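(* For $m=2$ and $N=1$, $$\mathrm{HH}^*(\Lambda_1)/\mathcal{N} \cong \mathbb{K}[\chi_{2,0}, \chi_{2,1}, \chi_{2,-1}]/(\chi_{2,0}^2 - \chi_{2,1}\chi_{2,-1})$$ with $\chi_{2,0}, \chi_{2,1}, \chi_{2,-1}$ all in degree $2$. Thus $\mathrm{HH}^*(\Lambda_1)/\mathcal{N}$ is a commutative finitely generated algebra of Krull dimension $2$.
   Context: Let $\mathbb{K}$ be a field. Let $\mathcal{Q}$ be the quiver with vertices $0,1,\ldots,m-1$ and, for each $i$ (indices modulo $m$), arrows $a_i:i\to i+1$ and $\bar a_i:i+1\to i$. Paths are written from left to right; $e_i$ is the trivial path at $i$. $\Lambda_N=\mathbb{K}\mathcal{Q}/I_N$ where $I_N$ is generated by $a_ia_{i+1}$, $\bar a_{i-1}\bar a_{i-2}$, $(a_i\bar a_i)^N-(\bar a_{i-1}a_{i-1})^N$ for all $i$. $\mathrm{HH}^*(\Lambda_N)=\mathrm{Ext}^*_{\Lambda_N^e}(\Lambda_N,\Lambda_N)$ with the Yoneda product; $\mathcal{N}$ is the ideal generated by all homogeneous nilpotent elements. Write $\otimes=\otimes_{\mathbb{K}}$. A minimal projective bimodule resolution of $\Lambda_N$ is $(P^*,\partial^* )$ with $P^n=\bigoplus_{i=0}^{m-1}\bigoplus_{r=0}^n\Lambda_Ne_i\otimes e_{i+n-2r}\Lambda_N$. Write $e_i\otimes_r e_{i+n-2r}$ for the generator of the $(i,r)$-summand of $P^n$ (first index modulo $m$; generators in $P^{n-1}$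 with tensor subscript $-1$ or $n$ are $0$). Unsubscripted $a,\bar a$ denote the arrows of that type making the expression composable. $\partial^0$ is multiplication, and for $n\geq1$, $\partial^n(e_i\otimes_r e_{i+n-2r})$ is: if $n-2r>0$: $e_i\otimes_r e_{i+n-1-2r}a+(-1)^{n+r}a e_{i+1}\otimes_r e_{i+n-2r}+(-1)^{n+r}\bar a(a\bar a)^{N-1}e_{i-1}\otimes_{r-1}e_{i+n-2r}+(-1)^n e_i\otimes_{r-1}e_{i+n+1-2r}\bar a(a\bar a)^{N-1}$; if $n-2r<0$: $e_i\otimes_r e_{i+n-1-2r}a(\bar aa)^{N-1}+(-1)^{n+r}a(\bar aa)^{N-1} e_{i+1}\otimes_r e_{i+n-2r}+(-1)^{n+r}\bar a e_{i-1}\otimes_{r-1}e_{i+n-2r}+(-1)^n e_i\otimes_{r-1}e_{i+n+1-2r}\bar a$; if $n=2r$: $\sum_{k=0}^{N-1}\big((\bar aa)^k[e_i\otimes_{r}e_{i-1}a+(-1)^{r}\bar a e_{i-1}\otimes_{r-1}e_i](\bar aa)^{N-k-1}+(a\bar a)^k[(-1)^{r}ae_{i+1}\otimes_{r}e_i+e_i\otimes_{r-1}e_{i+1}\bar a](a\bar a)^{N-k-1}\big)$. Classes in $\mathrm{HH}^n(\Lambda_N)$ are represented by cocycles in $\mathrm{Hom}_{\Lambda_N^e}(P^n,\Lambda_N)$; for a cocycle only the non-zero images of generators are listed. For $0\leq i\leq m-1$ and $k\in\mathbb{Z}$, $e_i\otimes e_{i+k}\in P^n$ means $e_i\otimes_r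 e_{i+n-2r}$ with $r=(n-k)/2$ ($k$ is not reduced modulo $m$). Here $m=2$ and the following classes lie in $\mathrm{HH}^2$, with $i=0,1$: $\chi_{2,0}$: $e_i\otimes e_i\mapsto(-1)^ie_i$; $\chi_{2,1}$: $e_i\otimes e_{i+2}\mapsto e_i$; $\chi_{2,-1}$: $e_i\otimes e_{i-2}\mapsto e_i$. In the quotient, these symbols denote the images of the classes. *)

theory Defs
  imports
    "HOL-Algebra.QuotRing"
    "HOL-Algebra.Module"
    "HOL-Algebra.Algebraic_Closure_Type"
    "HOL-Library.Poly_Mapping"
    "HOL-Library.Extended_Nat"
    "HOL-Library.FuncSet"
begin

text \<open>
  The field is a type of class \<open>field\<close>. A \<open>'k\<close>-algebra is a record of type \<open>module\<close>
  from HOL-Algebra: its ring operations together with a scalar multiplication by \<open>'k\<close>.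
\<close>

section \<open>Algebras\<close>

definition quotient_algebra :: "('k, 'a) module \<Rightarrow> 'a set \<Rightarrow> ('k, 'a set) module" where
  "quotient_algebra A I =
    \<lparr>carrier = carrier (A Quot I), monoid.mult = monoid.mult (A Quot I), one = one (A Quot I),
     zero = zero (A Quot I), add = add (A Quot I),
     module.smult = (\<lambda>c C. \<Union>x\<in>C. I +>\<^bsub>A\<^esub> (c \<odot>\<^bsub>A\<^esub> x))\<rparr>"

definition is_subalgebra :: "('k, 'a) module \<Rightarrow> 'a set \<Rightarrow> bool" where
  "is_subalgebra A V \<longleftrightarrow> V \<subseteq> carrier A \<and> \<one>\<^bsub>A\<^esub> \<in> V \<and>
     (\<forall>x\<in>V. \<forall>y\<in>V. x \<oplus>\<^bsub>A\<^esub> y \<in> V \<and> x \<otimes>\<^bsub>A\<^esub> y \<in> V) \<and> (\<forall>c. \<forall>x\<in>V. c \<odot>\<^bsub>A\<^esub> x \<in> V)"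

definition finitely_generated_algebra :: "('k, 'a) module \<Rightarrow> bool" where
  "finitely_generated_algebra A \<longleftrightarrow>
     (\<exists>S. finite S \<and> S \<subseteq> carrier A \<and> (\<forall>V. is_subalgebra A V \<and> S \<subseteq> V \<longrightarrow> V = carrier A))"

text \<open>The zero ring gets the value \<open>0\<close> here.\<close>

definition krull_dim :: "('a, 'm) ring_scheme \<Rightarrow> enat" where
  "krull_dim R = Sup (enat ` {n. \<exists>p :: nat \<Rightarrow> 'a set.
     (\<forall>i\<le>n. primeideal (p i) R) \<and> (\<forall>i<n. p i \<subset> p (Suc i))})"

definition algebra_iso :: "('k, 'a) module \<Rightarrow> ('k, 'b) module \<Rightarrow> ('a \<Rightarrow> 'b) set" where
  "algebra_iso A B = {h \<in> ring_iso A B. \<forall>c. \<forall>x\<in>carrier A. h (c \<odot>\<^bsub>A\<^esub> x) = c \<odot>\<^bsub>B\<^esub> h x}"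


section \<open>The algebra \<open>\<Lambda>\<^sub>N\<close>\<close>

text \<open>\<open>Arr i\<close> is \<open>a\<^sub>i : i \<rightarrow> i+1\<close> and \<open>Bar i\<close> is the arrow \<open>i+1 \<rightarrow> i\<close>, for \<open>0 \<le> i < m\<close>.\<close>

datatype arrow = Arr int | Bar int

definition arrows :: "int \<Rightarrow> arrow set" where
  "arrows m = Arr ` {0..<m} \<union> Bar ` {0..<m}"

fun arrow_src :: "int \<Rightarrow> arrow \<Rightarrow> int" where
  "arrow_src m (Arr i) = i"
| "arrow_src m (Bar i) = (i + 1) mod m"

fun arrow_tgt :: "int \<Rightarrow> arrow \<Rightarrow> int" where
  "arrow_tgt m (Arr i) = (i + 1) mod m"
| "arrow_tgt m (Bar i) = i"

text \<open>A path is its start vertex with its list of arrows, read from left to right.\<close>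

type_synonym path = "int \<times> arrow list"

fun walk :: "int \<Rightarrow> int \<Rightarrow> arrow list \<Rightarrow> bool" where
  "walk m i [] \<longleftrightarrow> True"
| "walk m i (x # w) \<longleftrightarrow> x \<in> arrows m \<and> arrow_src m x = i \<and> walk m (arrow_tgt m x) w"

definition paths :: "int \<Rightarrow> path set" where
  "paths m = {(i, w). i \<in> {0..<m} \<and> walk m i w}"

definition path_tgt :: "int \<Rightarrow> path \<Rightarrow> int" where
  "path_tgt m p = (if snd p = [] then fst p else arrow_tgt m (last (snd p)))"

definition path_vec :: "path \<Rightarrow> path \<Rightarrow> 'k::field" where
  "path_vec p = (\<lambda>q. if q = p then 1 else 0)"

definition path_algebra :: "int \<Rightarrow> ('k::field, path \<Rightarrow> 'k) module" where
  "path_algebra m =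
    \<lparr>carrier = {f. finite {p. f p \<noteq> 0} \<and> {p. f p \<noteq> 0} \<subseteq> paths m},
     monoid.mult = (\<lambda>f g (i, w). \<Sum>k\<le>length w.
        f (i, take k w) * g (path_tgt m (i, take k w), drop k w)),
     one = (\<lambda>p. \<Sum>i\<in>{0..<m}. path_vec (i, []) p),
     zero = (\<lambda>_. 0),
     add = (\<lambda>f g p. f p + g p),
     module.smult = (\<lambda>c f p. c * f p)\<rparr>"

definition path_e :: "int \<Rightarrow> int \<Rightarrow> path \<Rightarrow> 'k::field" where
  "path_e m i = path_vec (i mod m, [])"

definition path_a :: "int \<Rightarrow> int \<Rightarrow> path \<Rightarrow> 'k::field" where
  "path_a m i = path_vec (i mod m, [Arr (i mod m)])"

definition path_b :: "int \<Rightarrow> int \<Rightarrow> path \<Rightarrow> 'k::field" where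
  "path_b m i = path_vec ((i + 1) mod m, [Bar (i mod m)])"

definition relations :: "int \<Rightarrow> nat \<Rightarrow> (path \<Rightarrow> 'k::field) set" where
  "relations m N = (let A = path_algebra m; a = path_a m; b = path_b m in
     \<Union>i\<in>{0..<m}. {a i \<otimes>\<^bsub>A\<^esub> a (i + 1), b (i - 1) \<otimes>\<^bsub>A\<^esub> b (i - 2),
       ((a i \<otimes>\<^bsub>A\<^esub> b i) [^]\<^bsub>A\<^esub> N) \<ominus>\<^bsub>A\<^esub> ((b (i - 1) \<otimes>\<^bsub>A\<^esub> a (i - 1)) [^]\<^bsub>A\<^esub> N)})"

definition rel_ideal :: "int \<Rightarrow> nat \<Rightarrow> (path \<Rightarrow> 'k::field) set" where
  "rel_ideal m N = genideal (path_algebra m) (relations m N)"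

type_synonym 'k lam = "(path \<Rightarrow> 'k) set"

definition Lam :: "int \<Rightarrow> nat \<Rightarrow> ('k::field, 'k lam) module" where
  "Lam m N = quotient_algebra (path_algebra m) (rel_ideal m N)"

definition lam_e :: "int \<Rightarrow> nat \<Rightarrow> int \<Rightarrow> 'k::field lam" where
  "lam_e m N i = rel_ideal m N +>\<^bsub>path_algebra m\<^esub> path_e m i"

definition lam_a :: "int \<Rightarrow> nat \<Rightarrow> int \<Rightarrow> 'k::field lam" where
  "lam_a m N i = rel_ideal m N +>\<^bsub>path_algebra m\<^esub> path_a m i"

definition lam_b :: "int \<Rightarrow> nat \<Rightarrow> int \<Rightarrow> 'k::field lam" where
  "lam_b m N i = rel_ideal m N +>\<^bsub>path_algebra m\<^esub> path_b m i"


section \<open>Hochschild cohomology from a projective bimodule resolution\<close>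

text \<open>As for \<open>module\<close> in HOL-Algebra, the fields \<open>mult\<close> and \<open>one\<close> of the underlying ring
  record are irrelevant when the record is used only for its additive structure.\<close>

record ('a, 'b) bimodule = "'b ring" +
  lact :: "'a \<Rightarrow> 'b \<Rightarrow> 'b"
  ract :: "'b \<Rightarrow> 'a \<Rightarrow> 'b"

definition regular_bimodule :: "('k, 'a) module \<Rightarrow> ('a, 'a) bimodule" where
  "regular_bimodule A =
    \<lparr>carrier = carrier A, monoid.mult = monoid.mult A, one = one A, zero = zero A, add = add A,
     lact = monoid.mult A, ract = monoid.mult A\<rparr>"

definition bimodule_hom ::
  "('k, 'a) module \<Rightarrow> ('a, 'b) bimodule \<Rightarrow> ('a, 'c) bimodule \<Rightarrow> ('b \<Rightarrow> 'c) set" where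
  "bimodule_hom A M M' = {f \<in> carrier M \<rightarrow>\<^sub>E carrier M'.
     (\<forall>x\<in>carrier M. \<forall>y\<in>carrier M. f (x \<oplus>\<^bsub>M\<^esub> y) = f x \<oplus>\<^bsub>M'\<^esub> f y) \<and>
     (\<forall>l\<in>carrier A. \<forall>x\<in>carrier M. f (lact M l x) = lact M' l (f x) \<and>
                                      f (ract M x l) = ract M' (f x) l)}"

text \<open>In the following, \<open>P\<close>, \<open>d (Suc n) : P (Suc n) \<rightarrow> P n\<close> and \<open>aug : P 0 \<rightarrow> A\<close> form a
  projective bimodule resolution of the algebra \<open>A\<close>; \<open>d 0\<close> is not used.\<close>

definition cochains :: "('k, 'a) module \<Rightarrow> (nat \<Rightarrow> ('a, 'b) bimodule) \<Rightarrow> nat \<Rightarrow> ('k, 'b \<Rightarrow> 'a) module"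
  where
  "cochains A P n =
    \<lparr>carrier = bimodule_hom A (P n) (regular_bimodule A),
     monoid.mult = undefined, one = undefined,
     zero = (\<lambda>x\<in>carrier (P n). \<zero>\<^bsub>A\<^esub>),
     add = (\<lambda>f g. \<lambda>x\<in>carrier (P n). f x \<oplus>\<^bsub>A\<^esub> g x),
     module.smult = (\<lambda>c f. \<lambda>x\<in>carrier (P n). c \<odot>\<^bsub>A\<^esub> f x)\<rparr>"

definition coboundary ::
  "(nat \<Rightarrow> ('a, 'b) bimodule) \<Rightarrow> (nat \<Rightarrow> 'b \<Rightarrow> 'b) \<Rightarrow> nat \<Rightarrow> ('b \<Rightarrow> 'a) \<Rightarrow> 'b \<Rightarrow> 'a" where
  "coboundary P d n f = compose (carrier (P (Suc n))) f (d (Suc n))"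

definition cocycles ::
  "('k, 'a) module \<Rightarrow> (nat \<Rightarrow> ('a, 'b) bimodule) \<Rightarrow> (nat \<Rightarrow> 'b \<Rightarrow> 'b) \<Rightarrow> nat \<Rightarrow> ('b \<Rightarrow> 'a) set" where
  "cocycles A P d n =
     {f \<in> carrier (cochains A P n). coboundary P d n f = \<zero>\<^bsub>cochains A P (Suc n)\<^esub>}"

fun coboundaries ::
  "('k, 'a) module \<Rightarrow> (nat \<Rightarrow> ('a, 'b) bimodule) \<Rightarrow> (nat \<Rightarrow> 'b \<Rightarrow> 'b) \<Rightarrow> nat \<Rightarrow> ('b \<Rightarrow> 'a) set" where
  "coboundaries A P d 0 = {\<zero>\<^bsub>cochains A P 0\<^esub>}"
| "coboundaries A P d (Suc n) = coboundary P d n ` carrier (cochains A P n)"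

definition cohomology_class ::
  "('k, 'a) module \<Rightarrow> (nat \<Rightarrow> ('a, 'b) bimodule) \<Rightarrow> (nat \<Rightarrow> 'b \<Rightarrow> 'b) \<Rightarrow> nat \<Rightarrow> ('b \<Rightarrow> 'a)
    \<Rightarrow> ('b \<Rightarrow> 'a) set" where
  "cohomology_class A P d n f = coboundaries A P d n +>\<^bsub>cochains A P n\<^esub> f"

definition cohomology ::
  "('k, 'a) module \<Rightarrow> (nat \<Rightarrow> ('a, 'b) bimodule) \<Rightarrow> (nat \<Rightarrow> 'b \<Rightarrow> 'b) \<Rightarrow> nat
    \<Rightarrow> ('k, ('b \<Rightarrow> 'a) set) module" where
  "cohomology A P d n =
    \<lparr>carrier = cohomology_class A P d n ` cocycles A P d n,
     monoid.mult = undefined, one = undefined,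
     zero = coboundaries A P d n,
     add = set_add (cochains A P n),
     module.smult = (\<lambda>c F. \<Union>f\<in>F. cohomology_class A P d n (c \<odot>\<^bsub>cochains A P n\<^esub> f))\<rparr>"

text \<open>The chain maps \<open>L k : P (q + k) \<rightarrow> P k\<close> that lift \<open>g : P q \<rightarrow> A\<close>; they commute with the
  differentials without a sign.\<close>

definition liftings ::
  "('k, 'a) module \<Rightarrow> (nat \<Rightarrow> ('a, 'b) bimodule) \<Rightarrow> ('b \<Rightarrow> 'a) \<Rightarrow> (nat \<Rightarrow> 'b \<Rightarrow> 'b) \<Rightarrow> nat \<Rightarrow> ('b \<Rightarrow> 'a)
    \<Rightarrow> (nat \<Rightarrow> 'b \<Rightarrow> 'b) set" where
  "liftings A P aug d q g = {L.
     (\<forall>k. L k \<in> bimodule_hom A (P (q + k)) (P k)) \<and>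
     compose (carrier (P q)) aug (L 0) = g \<and>
     (\<forall>k. compose (carrier (P (q + Suc k))) (d (Suc k)) (L (Suc k)) =
          compose (carrier (P (q + Suc k))) (L k) (d (q + Suc k)))}"

text \<open>The Yoneda product of classes of degrees \<open>p\<close> and \<open>q\<close> is the class of \<open>f \<circ> L p\<close> for
  representatives \<open>f\<close>, \<open>g\<close> and any lifting \<open>L\<close> of \<open>g\<close>. This class does not depend on the
  choices, so the union below is a single coset.\<close>

definition yoneda ::
  "('k, 'a) module \<Rightarrow> (nat \<Rightarrow> ('a, 'b) bimodule) \<Rightarrow> ('b \<Rightarrow> 'a) \<Rightarrow> (nat \<Rightarrow> 'b \<Rightarrow> 'b) \<Rightarrow> nat \<Rightarrow> nat
    \<Rightarrow> ('b \<Rightarrow> 'a) set \<Rightarrow> ('b \<Rightarrow> 'a) set \<Rightarrow> ('b \<Rightarrow> 'a) set" where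
  "yoneda A P aug d p q F G = (\<Union>f\<in>F. \<Union>g\<in>G. \<Union>L\<in>liftings A P aug d q g.
     cohomology_class A P d (q + p) (compose (carrier (P (q + p))) f (L p)))"

text \<open>An element of the direct sum of all \<open>cohomology A P d n\<close> is the sequence of its components.\<close>

definition Ext_algebra ::
  "('k, 'a) module \<Rightarrow> (nat \<Rightarrow> ('a, 'b) bimodule) \<Rightarrow> ('b \<Rightarrow> 'a) \<Rightarrow> (nat \<Rightarrow> 'b \<Rightarrow> 'b)
    \<Rightarrow> ('k, nat \<Rightarrow> ('b \<Rightarrow> 'a) set) module" where
  "Ext_algebra A P aug d = (let H = cohomology A P d in
    \<lparr>carrier = {z. (\<forall>n. z n \<in> carrier (H n)) \<and> finite {n. z n \<noteq> \<zero>\<^bsub>H n\<^esub>}},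
     monoid.mult = (\<lambda>z w n. \<Oplus>\<^bsub>H n\<^esub>p\<in>{..n}. yoneda A P aug d p (n - p) (z p) (w (n - p))),
     one = (\<lambda>n. if n = 0 then cohomology_class A P d 0 aug else \<zero>\<^bsub>H n\<^esub>),
     zero = (\<lambda>n. \<zero>\<^bsub>H n\<^esub>),
     add = (\<lambda>z w n. z n \<oplus>\<^bsub>H n\<^esub> w n),
     module.smult = (\<lambda>c z n. c \<odot>\<^bsub>H n\<^esub> z n)\<rparr>)"


section \<open>The bimodule resolution of \<open>\<Lambda>\<^sub>N\<close>\<close>

definition bilinear_forms :: "('k::field, 'a) module \<Rightarrow> ('a \<Rightarrow> 'a \<Rightarrow> 'k) set" where
  "bilinear_forms A = {\<beta>.
     (\<forall>x\<in>carrier A. \<forall>y\<in>carrier A. \<forall>z\<in>carrier A.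
        \<beta> (x \<oplus>\<^bsub>A\<^esub> y) z = \<beta> x z + \<beta> y z \<and> \<beta> z (x \<oplus>\<^bsub>A\<^esub> y) = \<beta> z x + \<beta> z y) \<and>
     (\<forall>c. \<forall>x\<in>carrier A. \<forall>y\<in>carrier A.
        \<beta> (c \<odot>\<^bsub>A\<^esub> x) y = c * \<beta> x y \<and> \<beta> x (c \<odot>\<^bsub>A\<^esub> y) = c * \<beta> x y)}"

text \<open>Over a field, the canonical map from \<open>A \<otimes> A\<close> to the dual of the space of bilinear forms,
  \<open>x \<otimes> y \<mapsto> (\<beta> \<mapsto> \<beta> x y)\<close>, is injective. Elements of a tensor product over the field are
  represented by their images under it; since the tensor product over a field is exact,
  \<open>V \<otimes> W\<close> for subspaces \<open>V\<close> and \<open>W\<close> is the span of the \<open>x \<otimes> y\<close> with \<open>x \<in> V\<close>, \<open>y \<in> W\<close>.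
  All functionals are set to \<open>0\<close> off the bilinear forms.\<close>

type_synonym ('k, 'a) tensor = "('a \<Rightarrow> 'a \<Rightarrow> 'k) \<Rightarrow> 'k"

definition tensor :: "('k::field, 'a) module \<Rightarrow> 'a \<Rightarrow> 'a \<Rightarrow> ('k, 'a) tensor" where
  "tensor A x y = (\<lambda>\<beta>. if \<beta> \<in> bilinear_forms A then \<beta> x y else 0)"

definition tensor_space :: "('k::field, 'a) module \<Rightarrow> 'a set \<Rightarrow> 'a set \<Rightarrow> ('k, 'a) tensor set" where
  "tensor_space A V W = {t. \<exists>(n::nat) x y. (\<forall>k<n. x k \<in> V \<and> y k \<in> W) \<and>
     t = (\<lambda>\<beta>. \<Sum>k<n. tensor A (x k) (y k) \<beta>)}"

text \<open>The actions \<open>l (x \<otimes> y) = l x \<otimes> y\<close> and \<open>(x \<otimes> y) l = x \<otimes> y l\<close>.\<close>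

definition tensor_lact :: "('k::field, 'a) module \<Rightarrow> 'a \<Rightarrow> ('k, 'a) tensor \<Rightarrow> ('k, 'a) tensor" where
  "tensor_lact A l t =
     (\<lambda>\<beta>. if \<beta> \<in> bilinear_forms A then t (\<lambda>x y. \<beta> (l \<otimes>\<^bsub>A\<^esub> x) y) else 0)"

definition tensor_ract :: "('k::field, 'a) module \<Rightarrow> ('k, 'a) tensor \<Rightarrow> 'a \<Rightarrow> ('k, 'a) tensor" where
  "tensor_ract A t l =
     (\<lambda>\<beta>. if \<beta> \<in> bilinear_forms A then t (\<lambda>x y. \<beta> x (y \<otimes>\<^bsub>A\<^esub> l)) else 0)"

text \<open>An element of \<open>P\<^sup>n\<close> is the family of its components in the summands \<open>(i, r)\<close>.\<close>

type_synonym 'k res = "int \<times> int \<Rightarrow> ('k, 'k lam) tensor"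

definition Res :: "int \<Rightarrow> nat \<Rightarrow> nat \<Rightarrow> ('k::field lam, 'k res) bimodule" where
  "Res m N n = (let A = Lam m N in
    \<lparr>carrier = {u. \<forall>i r. if i \<in> {0..<m} \<and> r \<in> {0..int n}
        then u (i, r) \<in> tensor_space A {x \<otimes>\<^bsub>A\<^esub> lam_e m N i |x. x \<in> carrier A}
                                       {lam_e m N (i + int n - 2 * r) \<otimes>\<^bsub>A\<^esub> y |y. y \<in> carrier A}
        else u (i, r) = (\<lambda>_. 0)},
     monoid.mult = undefined, one = undefined,
     zero = (\<lambda>_ _. 0),
     add = (\<lambda>u v s \<beta>. u s \<beta> + v s \<beta>),
     lact = (\<lambda>l u s. tensor_lact A l (u s)),
     ract = (\<lambda>u l s. tensor_ract A (u s) l)\<rparr>)"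

definition res_scale :: "'k::field \<Rightarrow> 'k res \<Rightarrow> 'k res" where
  "res_scale c u = (\<lambda>s \<beta>. c * u s \<beta>)"

definition res_single :: "int \<Rightarrow> int \<Rightarrow> ('k::field, 'k lam) tensor \<Rightarrow> 'k res" where
  "res_single i r t = (\<lambda>s. if s = (i, r) then t else (\<lambda>_. 0))"

definition res_gen :: "int \<Rightarrow> nat \<Rightarrow> nat \<Rightarrow> int \<Rightarrow> int \<Rightarrow> 'k::field res" where
  "res_gen m N n i r =
     (if r \<in> {0..int n}
      then res_single (i mod m) r (tensor (Lam m N) (lam_e m N i) (lam_e m N (i + int n - 2 * r)))
      else (\<lambda>_ _. 0))"

text \<open>The image in \<open>P\<^sup>n\<^sup>-\<^sup>1\<close> of the \<open>(i, r)\<close>-generator of \<open>P\<^sup>n\<close>, for \<open>n \<ge> 1\<close>; \<open>j\<close> is its right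
  index. The arrows \<open>a k\<close> and \<open>b k\<close> are those which make the expressions composable.\<close>

definition res_bdry :: "int \<Rightarrow> nat \<Rightarrow> nat \<Rightarrow> int \<Rightarrow> nat \<Rightarrow> 'k::field res" where
  "res_bdry m N n i r = (let A = Lam m N; Q = Res m N (n - 1); g = res_gen m N (n - 1);
       a = lam_a m N; b = lam_b m N; s = int r; j = i + int n - 2 * s;
       ab = (\<lambda>k. a k \<otimes>\<^bsub>A\<^esub> b k); ba = (\<lambda>k. b k \<otimes>\<^bsub>A\<^esub> a k) in
     if int n - 2 * s > 0 then
       ract Q (g i s) (a (j - 1))
       \<oplus>\<^bsub>Q\<^esub> res_scale ((-1) ^ (n + r)) (lact Q (a i) (g (i + 1) s))
       \<oplus>\<^bsub>Q\<^esub> res_scale ((-1) ^ (n + r))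
             (lact Q (b (i - 1) \<otimes>\<^bsub>A\<^esub> (ab (i - 1) [^]\<^bsub>A\<^esub> (N - 1))) (g (i - 1) (s - 1)))
       \<oplus>\<^bsub>Q\<^esub> res_scale ((-1) ^ n)
             (ract Q (g i (s - 1)) (b j \<otimes>\<^bsub>A\<^esub> (ab j [^]\<^bsub>A\<^esub> (N - 1))))
     else if int n - 2 * s < 0 then
       ract Q (g i s) (a (j - 1) \<otimes>\<^bsub>A\<^esub> (ba (j - 1) [^]\<^bsub>A\<^esub> (N - 1)))
       \<oplus>\<^bsub>Q\<^esub> res_scale ((-1) ^ (n + r))
             (lact Q (a i \<otimes>\<^bsub>A\<^esub> (ba i [^]\<^bsub>A\<^esub> (N - 1))) (g (i + 1) s))
       \<oplus>\<^bsub>Q\<^esub> res_scale ((-1) ^ (n + r)) (lact Q (b (i - 1)) (g (i - 1) (s - 1)))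
       \<oplus>\<^bsub>Q\<^esub> res_scale ((-1) ^ n) (ract Q (g i (s - 1)) (b j))
     else
       (\<Oplus>\<^bsub>Q\<^esub>k\<in>{..<N}.
         lact Q (ba (i - 1) [^]\<^bsub>A\<^esub> k)
           (ract Q (ract Q (g i s) (a (i - 1))
                    \<oplus>\<^bsub>Q\<^esub> res_scale ((-1) ^ r) (lact Q (b (i - 1)) (g (i - 1) (s - 1))))
              (ba (i - 1) [^]\<^bsub>A\<^esub> (N - k - 1)))
         \<oplus>\<^bsub>Q\<^esub>
         lact Q (ab i [^]\<^bsub>A\<^esub> k)
           (ract Q (res_scale ((-1) ^ r) (lact Q (a i) (g (i + 1) s))
                    \<oplus>\<^bsub>Q\<^esub> ract Q (g i (s - 1)) (b i))
              (ab i [^]\<^bsub>A\<^esub> (N - k - 1)))))"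

definition res_diff :: "int \<Rightarrow> nat \<Rightarrow> nat \<Rightarrow> 'k::field res \<Rightarrow> 'k res" where
  "res_diff m N n = (THE f. f \<in> bimodule_hom (Lam m N) (Res m N n) (Res m N (n - 1)) \<and>
     (\<forall>i\<in>{0..<m}. \<forall>r\<le>n. f (res_gen m N n i (int r)) = res_bdry m N n i r))"

definition res_aug :: "int \<Rightarrow> nat \<Rightarrow> 'k::field res \<Rightarrow> 'k lam" where
  "res_aug m N = (let A = Lam m N in
     THE f. f \<in> bimodule_hom A (Res m N 0) (regular_bimodule A) \<and>
       (\<forall>i\<in>{0..<m}. \<forall>x\<in>carrier A. \<forall>y\<in>carrier A.
          f (res_single i 0 (tensor A (x \<otimes>\<^bsub>A\<^esub> lam_e m N i) (lam_e m N i \<otimes>\<^bsub>A\<^esub> y))) =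
            (x \<otimes>\<^bsub>A\<^esub> lam_e m N i) \<otimes>\<^bsub>A\<^esub> (lam_e m N i \<otimes>\<^bsub>A\<^esub> y)))"


section \<open>The Hochschild cohomology ring of \<open>\<Lambda>\<^sub>N\<close> modulo nilpotents\<close>

type_synonym 'k hh = "nat \<Rightarrow> ('k res \<Rightarrow> 'k lam) set"

definition HH :: "int \<Rightarrow> nat \<Rightarrow> ('k::field, 'k hh) module" where
  "HH m N = Ext_algebra (Lam m N) (Res m N) (res_aug m N) (res_diff m N)"

definition HH_homogeneous :: "int \<Rightarrow> nat \<Rightarrow> nat \<Rightarrow> 'k::field hh set" where
  "HH_homogeneous m N n = {z \<in> carrier (HH m N). \<forall>k. k \<noteq> n \<longrightarrow> z k = \<zero>\<^bsub>HH m N\<^esub> k}"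

definition HH_nil :: "int \<Rightarrow> nat \<Rightarrow> 'k::field hh set" where
  "HH_nil m N = genideal (HH m N)
     {z. (\<exists>n. z \<in> HH_homogeneous m N n) \<and> (\<exists>k::nat. z [^]\<^bsub>HH m N\<^esub> k = \<zero>\<^bsub>HH m N\<^esub>)}"

definition HH_red :: "int \<Rightarrow> nat \<Rightarrow> ('k::field, 'k hh set) module" where
  "HH_red m N = quotient_algebra (HH m N) (HH_nil m N)"

definition HH_red_degree :: "int \<Rightarrow> nat \<Rightarrow> nat \<Rightarrow> 'k::field hh set set" where
  "HH_red_degree m N n = (\<lambda>z. HH_nil m N +>\<^bsub>HH m N\<^esub> z) ` HH_homogeneous m N n"

text \<open>The image in the quotient of the class in degree \<open>n\<close> of the cocycle that maps
  \<open>e\<^sub>i \<otimes> e\<^sub>i\<^sub>+\<^sub>k\<close> (that is, the generator \<open>(i, r)\<close> with \<open>n - 2r = k\<close>) to \<open>c i e\<^sub>i\<close>,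
  and all other generators to \<open>0\<close>.\<close>

definition HH_red_class :: "int \<Rightarrow> nat \<Rightarrow> nat \<Rightarrow> int \<Rightarrow> (int \<Rightarrow> 'k::field) \<Rightarrow> 'k hh set" where
  "HH_red_class m N n k c = (let A = Lam m N;
      f = (THE f. f \<in> carrier (cochains A (Res m N) n) \<and>
        (\<forall>i\<in>{0..<m}. \<forall>r\<le>n. f (res_gen m N n i (int r)) =
           (if int n - 2 * int r = k then c i \<odot>\<^bsub>A\<^esub> lam_e m N i else \<zero>\<^bsub>A\<^esub>)))
    in HH_nil m N +>\<^bsub>HH m N\<^esub>
         (\<lambda>d. if d = n then cohomology_class A (Res m N) (res_diff m N) n f else \<zero>\<^bsub>HH m N\<^esub> d))"

definition chi_0 :: "'k::field hh set" where
  "chi_0 = HH_red_class 2 1 2 0 (\<lambda>i. (-1) ^ nat i)"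

definition chi_1 :: "'k::field hh set" where
  "chi_1 = HH_red_class 2 1 2 2 (\<lambda>_. 1)"

definition chi_m1 :: "'k::field hh set" where
  "chi_m1 = HH_red_class 2 1 2 (-2) (\<lambda>_. 1)"


section \<open>The polynomial side\<close>

datatype chi_var = X0 | X1 | Xm1

text \<open>Polynomials in the three variables, as finitely supported functions on monomials.\<close>

type_synonym 'k chi_poly = "(chi_var \<Rightarrow>\<^sub>0 nat) \<Rightarrow>\<^sub>0 'k"

definition Var :: "chi_var \<Rightarrow> 'k::field chi_poly" where
  "Var x = Poly_Mapping.single (Poly_Mapping.single x 1) 1"

definition poly_algebra :: "('k::field, 'k chi_poly) module" where
  "poly_algebra =
    \<lparr>carrier = UNIV, monoid.mult = (*), one = 1, zero = 0, add = (+),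
     module.smult = (\<lambda>c p. Poly_Mapping.single 0 c * p)\<rparr>"

definition chi_ideal :: "'k::field chi_poly set" where
  "chi_ideal = genideal poly_algebra {Var X0 ^ 2 - Var X1 * Var Xm1}"

definition chi_algebra :: "('k::field, 'k chi_poly set) module" where
  "chi_algebra = quotient_algebra poly_algebra chi_ideal"

definition chi_var_class :: "chi_var \<Rightarrow> 'k::field chi_poly set" where
  "chi_var_class x = chi_ideal +>\<^bsub>poly_algebra\<^esub> Var x"

text \<open>The grading with every variable in degree \<open>2\<close>.\<close>

definition chi_degree :: "nat \<Rightarrow> 'k::field chi_poly set set" where
  "chi_degree n = (\<lambda>p. chi_ideal +>\<^bsub>poly_algebra\<^esub> p) `
     {p. \<forall>t\<in>Poly_Mapping.keys p. 2 * (\<Sum>x\<in>Poly_Mapping.keys t. Poly_Mapping.lookup t x) = n}"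

end

theory Submission
  imports Defs "HOL-Computational_Algebra.Polynomial"
begin

text \<open>
  The resolution for \<open>N = 1\<close> is a tensor product of two periodic resolutions, so it has an explicit
  contracting homotopy. In the coordinates given by normal paths, a cocycle of degree \<open>n\<close> is determined
  modulo radical-valued cocycles by the coefficients \<open>c\<^sub>r\<close> of \<open>e\<^sub>0\<close> in its values on the generators
  \<open>(0, r)\<close>; they vanish for odd \<open>n\<close>, are arbitrary for even \<open>n\<close>, and vanish on coboundaries.
  Comparing radical parts in the equation of a chain map shows that the Yoneda product multiplies the
  polynomials \<open>\<Sum> c\<^sub>r U\<^sup>r\<close>. Hence \<open>HH\<^sup>*\<close> maps onto the ring spanned by the \<open>S\<^sup>n U\<^sup>r\<close> with \<open>n\<close> even and
  \<open>r \<le> n\<close>, which is a domain. A homogeneous class in the kernel has a radical-valued representative and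
  therefore cube zero, so the kernel is the ideal of nilpotents. The substitution
  \<open>\<chi>\<^sub>2\<^sub>,\<^sub>0 = S\<^sup>2 U\<close>, \<open>\<chi>\<^sub>2\<^sub>,\<^sub>1 = S\<^sup>2\<close>, \<open>\<chi>\<^sub>2\<^sub>,\<^sub>-\<^sub>1 = S\<^sup>2 U\<^sup>2\<close> identifies this ring with the polynomial quotient.
  Any three of its elements are algebraically dependent, and the lowest term of such a relation
  excludes a chain of four primes.
\<close>

section \<open>Graded rings\<close>

text \<open>For \<open>N = 1\<close> arrows of the two types commute and those of one type multiply
  to zero, so up to the bookkeeping of vertices \<open>Lam 2 1\<close> is K[x]/(x^2) tensored with
  K[y]/(y^2), with x for a and y for a-bar. The summand \<open>r\<close> of P^n is degree n - r for
  x tensored with degree r for y, and the three cases of the boundary formula become one. The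
  obstacle lies in the definitions: \<open>res_diff\<close>, \<open>res_aug\<close> and the chi
  classes are definite descriptions, and elements of P^n are functionals on bilinear forms. Each
  description needs a bimodule map with prescribed values on the generators. It is obtained by
  testing against linear functionals on the target; afterwards everything is computed in scalar
  coordinates. The ring \<open>HH 2 1\<close> itself is never computed. Only coefficients of trivial
  paths are followed: the boundary entries are single arrows, so these coefficients do not see
  coboundaries, and paths of length three vanish, so what they miss is nilpotent. Commutativity of
  the quotient is an outcome of the isomorphism with a subring of K[S, U], not an input.\<close>

lemma (in abelian_monoid) finsum_triangle:
  assumes "\<And>i j. i + j \<le> m \<Longrightarrow> G' i j \<in> carrier G"
  shows "(\<Oplus>j\<in>{..m::nat}. \<Oplus>i\<in>{..j}. G' i (j - i)) = (\<Oplus>i\<in>{..m}. \<Oplus>j\<in>{..m - i}. G' i j)"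
  using assms
proof (induction m)
  case 0
  then show ?case by simp
next
  case (Suc m)
  have c: "i + j \<le> Suc m \<Longrightarrow> G' i j \<in> carrier G" for i j
    using Suc.prems by blast
  have "(\<Oplus>j\<in>{..Suc m}. \<Oplus>i\<in>{..j}. G' i (j - i))
      = (\<Oplus>i\<in>{..Suc m}. G' i (Suc m - i)) \<oplus> (\<Oplus>j\<in>{..m}. \<Oplus>i\<in>{..j}. G' i (j - i))"
    by (subst finsum_Suc) (auto intro!: finsum_closed c)
  also have "(\<Oplus>i\<in>{..Suc m}. G' i (Suc m - i)) = G' (Suc m) 0 \<oplus> (\<Oplus>i\<in>{..m}. G' i (Suc m - i))"
    by (subst finsum_Suc) (auto intro!: c)
  also have "(\<Oplus>j\<in>{..m}. \<Oplus>i\<in>{..j}. G' i (j - i)) = (\<Oplus>i\<in>{..m}. \<Oplus>j\<in>{..m - i}. G' i j)"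
    using Suc.IH c by auto
  also have "(G' (Suc m) 0 \<oplus> (\<Oplus>i\<in>{..m}. G' i (Suc m - i))) \<oplus> (\<Oplus>i\<in>{..m}. \<Oplus>j\<in>{..m - i}. G' i j)
     = G' (Suc m) 0 \<oplus> ((\<Oplus>i\<in>{..m}. G' i (Suc m - i)) \<oplus> (\<Oplus>i\<in>{..m}. \<Oplus>j\<in>{..m - i}. G' i j))"
    by (rule a_assoc) (auto intro!: finsum_closed c)
  also have "(\<Oplus>i\<in>{..m}. G' i (Suc m - i)) \<oplus> (\<Oplus>i\<in>{..m}. \<Oplus>j\<in>{..m - i}. G' i j)
      = (\<Oplus>i\<in>{..m}. G' i (Suc m - i) \<oplus> (\<Oplus>j\<in>{..m - i}. G' i j))"
    by (subst finsum_addf) (auto intro!: finsum_closed c)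
  also have "\<dots> = (\<Oplus>i\<in>{..m}. \<Oplus>j\<in>{..Suc m - i}. G' i j)"
  proof (rule finsum_cong')
    show "(\<lambda>i. finsum G (G' i) {..Suc m - i}) \<in> {..m} \<rightarrow> carrier G"
      by (auto intro!: finsum_closed c)
    fix i assume "i \<in> {..m}"
    then show "G' i (Suc m - i) \<oplus> finsum G (G' i) {..m - i} = finsum G (G' i) {..Suc m - i}"
      by (simp add: Suc_diff_le, subst finsum_Suc) (auto intro!: finsum_closed c)
  qed simp
  also have "G' (Suc m) 0 \<oplus> \<dots> = (\<Oplus>i\<in>{..Suc m}. \<Oplus>j\<in>{..Suc m - i}. G' i j)"
    using c by (subst finsum_Suc) (auto intro!: finsum_closed c)
  finally show ?case .
qed

text \<open>The product is a family of biadditive maps between components of different degrees, so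
  that cohomology groups with the Yoneda product fit without a ring structure on their sum being
  presupposed; \<open>direct_sum_ring\<close> supplies that structure.\<close>

locale graded_ring =
  fixes H :: "nat \<Rightarrow> ('c, 'm) ring_scheme" and \<mu> :: "nat \<Rightarrow> nat \<Rightarrow> 'c \<Rightarrow> 'c \<Rightarrow> 'c" and u :: 'c
  assumes H: "abelian_group (H n)"
    and \<mu>_closed: "\<lbrakk>x \<in> carrier (H p); y \<in> carrier (H q)\<rbrakk> \<Longrightarrow> \<mu> p q x y \<in> carrier (H (p + q))"
    and \<mu>_add_left: "\<lbrakk>x \<in> carrier (H p); x' \<in> carrier (H p); y \<in> carrier (H q)\<rbrakk> \<Longrightarrow>
      \<mu> p q (x \<oplus>\<^bsub>H p\<^esub> x') y = \<mu> p q x y \<oplus>\<^bsub>H (p + q)\<^esub> \<mu> p q x' y"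
    and \<mu>_add_right: "\<lbrakk>x \<in> carrier (H p); y \<in> carrier (H q); y' \<in> carrier (H q)\<rbrakk> \<Longrightarrow>
      \<mu> p q x (y \<oplus>\<^bsub>H q\<^esub> y') = \<mu> p q x y \<oplus>\<^bsub>H (p + q)\<^esub> \<mu> p q x y'"
    and \<mu>_assoc: "\<lbrakk>x \<in> carrier (H p); y \<in> carrier (H q); z \<in> carrier (H r)\<rbrakk> \<Longrightarrow>
      \<mu> (p + q) r (\<mu> p q x y) z = \<mu> p (q + r) x (\<mu> q r y z)"
    and u_closed: "u \<in> carrier (H 0)"
    and \<mu>_u_left: "x \<in> carrier (H n) \<Longrightarrow> \<mu> 0 n u x = x"
    and \<mu>_u_right: "x \<in> carrier (H n) \<Longrightarrow> \<mu> n 0 x u = x"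
begin

sublocale H: abelian_group "H n" for n
  by (rule H)

lemma \<mu>_zero_left:
  assumes "y \<in> carrier (H q)"
  shows "\<mu> p q \<zero>\<^bsub>H p\<^esub> y = \<zero>\<^bsub>H (p + q)\<^esub>"
proof -
  have "\<mu> p q \<zero>\<^bsub>H p\<^esub> y \<oplus>\<^bsub>H (p + q)\<^esub> \<mu> p q \<zero>\<^bsub>H p\<^esub> y = \<mu> p q \<zero>\<^bsub>H p\<^esub> y"
    using \<mu>_add_left[of "\<zero>\<^bsub>H p\<^esub>" p "\<zero>\<^bsub>H p\<^esub>" y q] assms by simp
  then show ?thesis
    using \<mu>_closed[of "\<zero>\<^bsub>H p\<^esub>" p y q] assms by (simp add: H.add.r_cancel_one')
qed

lemma \<mu>_zero_right:
  assumes "x \<in> carrier (H p)"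
  shows "\<mu> p q x \<zero>\<^bsub>H q\<^esub> = \<zero>\<^bsub>H (p + q)\<^esub>"
proof -
  have "\<mu> p q x \<zero>\<^bsub>H q\<^esub> \<oplus>\<^bsub>H (p + q)\<^esub> \<mu> p q x \<zero>\<^bsub>H q\<^esub> = \<mu> p q x \<zero>\<^bsub>H q\<^esub>"
    using \<mu>_add_right[of x p "\<zero>\<^bsub>H q\<^esub>" q "\<zero>\<^bsub>H q\<^esub>"] assms by simp
  then show ?thesis
    using \<mu>_closed[of x p "\<zero>\<^bsub>H q\<^esub>" q] assms by (simp add: H.add.r_cancel_one')
qed

lemma \<mu>_finsum_left:
  assumes "finite S" "f \<in> S \<rightarrow> carrier (H p)" "y \<in> carrier (H q)"
  shows "\<mu> p q (\<Oplus>\<^bsub>H p\<^esub>i\<in>S. f i) y = (\<Oplus>\<^bsub>H (p + q)\<^esub>i\<in>S. \<mu> p q (f i) y)"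
  using assms(1,2)
proof (induction S rule: finite_induct)
  case (insert x S)
  then have "f x \<in> carrier (H p)" "f \<in> S \<rightarrow> carrier (H p)" by auto
  then show ?case
    using insert assms(3) by (simp add: \<mu>_add_left \<mu>_closed Pi_iff)
qed (simp add: \<mu>_zero_left assms)

lemma \<mu>_finsum_right:
  assumes "finite S" "f \<in> S \<rightarrow> carrier (H q)" "x \<in> carrier (H p)"
  shows "\<mu> p q x (\<Oplus>\<^bsub>H q\<^esub>i\<in>S. f i) = (\<Oplus>\<^bsub>H (p + q)\<^esub>i\<in>S. \<mu> p q x (f i))"
  using assms(1,2)
proof (induction S rule: finite_induct)
  case (insert y S)
  then have "f y \<in> carrier (H q)" "f \<in> S \<rightarrow> carrier (H q)" by auto
  then show ?case
    using insert assms(3) by (simp add: \<mu>_add_right \<mu>_closed Pi_iff)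
qed (simp add: \<mu>_zero_right assms)

text \<open>\<open>sum_carrier\<close>, \<open>conv\<close> and, further down, \<open>unit\<close>
  are the carrier, product and unit of \<open>Ext_algebra\<close> written for an arbitrary family,
  so that the two match by unfolding.\<close>

definition sum_carrier where
  "sum_carrier = {z. (\<forall>n. z n \<in> carrier (H n)) \<and> finite {n. z n \<noteq> \<zero>\<^bsub>H n\<^esub>}}"

definition conv where
  "conv z w = (\<lambda>n. \<Oplus>\<^bsub>H n\<^esub>p\<in>{..n}. \<mu> p (n - p) (z p) (w (n - p)))"

lemma term_closed:
  assumes "\<And>n. z n \<in> carrier (H n)" "\<And>n. w n \<in> carrier (H n)" "p \<le> n"
  shows "\<mu> p (n - p) (z p) (w (n - p)) \<in> carrier (H n)"
  using \<mu>_closed[OF assms(1)[of p] assms(2)[of "n - p"]] assms(3) by simp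

lemma conv_in:
  assumes "\<And>n. z n \<in> carrier (H n)" "\<And>n. w n \<in> carrier (H n)"
  shows "conv z w n \<in> carrier (H n)"
  unfolding conv_def by (rule H.finsum_closed) (auto intro!: term_closed assms)

lemma sum_carrierD: "z \<in> sum_carrier \<Longrightarrow> z n \<in> carrier (H n)"
  by (simp add: sum_carrier_def)

lemma sum_carrier_bound:
  assumes "z \<in> sum_carrier"
  obtains a where "\<And>n. n > a \<Longrightarrow> z n = \<zero>\<^bsub>H n\<^esub>"
proof -
  have "finite {n. z n \<noteq> \<zero>\<^bsub>H n\<^esub>}" using assms by (simp add: sum_carrier_def)
  then obtain a where "\<forall>n\<in>{n. z n \<noteq> \<zero>\<^bsub>H n\<^esub>}. n \<le> a"
    using finite_nat_set_iff_bounded_le by blast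
  then show thesis using that[of a] by fastforce
qed

lemma sum_carrierI:
  assumes "\<And>n. z n \<in> carrier (H n)" "\<And>n. n > a \<Longrightarrow> z n = \<zero>\<^bsub>H n\<^esub>"
  shows "z \<in> sum_carrier"
proof -
  have "{n. z n \<noteq> \<zero>\<^bsub>H n\<^esub>} \<subseteq> {..a}" using assms(2) not_less by blast
  then show ?thesis using assms(1) finite_subset by (fastforce simp: sum_carrier_def)
qed

lemma conv_closed:
  assumes "z \<in> sum_carrier" "w \<in> sum_carrier"
  shows "conv z w \<in> sum_carrier"
proof -
  note c = assms[THEN sum_carrierD]
  obtain a where a: "\<And>n. n > a \<Longrightarrow> z n = \<zero>\<^bsub>H n\<^esub>" using sum_carrier_bound assms by blast
  obtain b where b: "\<And>n. n > b \<Longrightarrow> w n = \<zero>\<^bsub>H n\<^esub>" using sum_carrier_bound assms by blast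
  show ?thesis
  proof (rule sum_carrierI[of _ "a + b"])
    show "conv z w n \<in> carrier (H n)" for n by (rule conv_in) (rule c)+
    fix n assume n: "n > a + b"
    have "\<mu> p (n - p) (z p) (w (n - p)) = \<zero>\<^bsub>H n\<^esub>" if "p \<le> n" for p
    proof (cases "p > a")
      case True
      then show ?thesis using a[of p] \<mu>_zero_left[OF c(2), of p "n - p"] that by simp
    next
      case False
      then have "n - p > b" using n by linarith
      then show ?thesis using b[of "n - p"] \<mu>_zero_right[OF c(1), of p "n - p"] that by simp
    qed
    then have "conv z w n = (\<Oplus>\<^bsub>H n\<^esub>p\<in>{..n}. \<zero>\<^bsub>H n\<^esub>)"
      unfolding conv_def by (intro H.finsum_cong') auto
    then show "conv z w n = \<zero>\<^bsub>H n\<^esub>" by simp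
  qed
qed

text \<open>Both bracketings are the sum of all products of three components of total degree n,
  indexed by the degrees i and j of the first two factors. One of them fixes i + j first, the other
  fixes i first, and \<open>finsum_triangle\<close> passes between them.\<close>

lemma conv_assoc:
  assumes c: "\<And>n. z n \<in> carrier (H n)" "\<And>n. w n \<in> carrier (H n)" "\<And>n. v n \<in> carrier (H n)"
  shows "conv (conv z w) v = conv z (conv w v)"
proof
  fix n
  define F where "F i j = \<mu> i (n - i) (z i) (\<mu> j (n - i - j) (w j) (v (n - i - j)))" for i j
  have F: "F i j \<in> carrier (H n)" if "i + j \<le> n" for i j
    using \<mu>_closed[OF c(1) term_closed[OF c(2,3), of j "n - i"], of i] that by (simp add: F_def)
  have "conv (conv z w) v n = (\<Oplus>\<^bsub>H n\<^esub>j\<in>{..n}. \<Oplus>\<^bsub>H n\<^esub>i\<in>{..j}. F i (j - i))"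
    unfolding conv_def
  proof (rule H.finsum_cong')
    fix j assume j: "j \<in> {..n}"
    have "\<mu> j (n - j) (\<Oplus>\<^bsub>H j\<^esub>i\<in>{..j}. \<mu> i (j - i) (z i) (w (j - i))) (v (n - j))
      = (\<Oplus>\<^bsub>H n\<^esub>i\<in>{..j}. \<mu> j (n - j) (\<mu> i (j - i) (z i) (w (j - i))) (v (n - j)))"
      using \<mu>_finsum_left[of "{..j}" "\<lambda>i. \<mu> i (j - i) (z i) (w (j - i))" j "v (n - j)" "n - j"]
        term_closed[OF c(1,2)] c(3) j by (simp add: Pi_iff)
    also have "\<dots> = (\<Oplus>\<^bsub>H n\<^esub>i\<in>{..j}. F i (j - i))"
    proof (rule H.finsum_cong')
      show "(\<lambda>i. F i (j - i)) \<in> {..j} \<rightarrow> carrier (H n)" using F j by auto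
      fix i assume i: "i \<in> {..j}"
      have [simp]: "n - i - (j - i) = n - j" "j - i + (n - j) = n - i" using i j by auto
      show "\<mu> j (n - j) (\<mu> i (j - i) (z i) (w (j - i))) (v (n - j)) = F i (j - i)"
        using \<mu>_assoc[OF c(1)[of i] c(2)[of "j - i"] c(3)[of "n - j"]] i j
        by (simp add: F_def)
    qed simp
    finally show "\<mu> j (n - j) (\<Oplus>\<^bsub>H j\<^esub>i\<in>{..j}. \<mu> i (j - i) (z i) (w (j - i))) (v (n - j))
      = (\<Oplus>\<^bsub>H n\<^esub>i\<in>{..j}. F i (j - i))" .
  qed (auto intro!: H.finsum_closed F)
  also have "\<dots> = (\<Oplus>\<^bsub>H n\<^esub>i\<in>{..n}. \<Oplus>\<^bsub>H n\<^esub>j\<in>{..n - i}. F i j)"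
    by (rule H.finsum_triangle) (rule F)
  also have "\<dots> = conv z (conv w v) n"
    unfolding conv_def
  proof (rule H.finsum_cong')
    show "(\<lambda>p. \<mu> p (n - p) (z p) (\<Oplus>\<^bsub>H (n - p)\<^esub>pa\<in>{..n - p}. \<mu> pa (n - p - pa) (w pa) (v (n - p - pa)))) \<in> {..n} \<rightarrow> carrier (H n)"
      using term_closed[OF c(1), of "conv w v"] conv_in[OF c(2,3)] by (simp add: conv_def Pi_iff)
    fix i assume "i \<in> {..n}"
    then show "(\<Oplus>\<^bsub>H n\<^esub>j\<in>{..n - i}. F i j) = \<mu> i (n - i) (z i) (\<Oplus>\<^bsub>H (n - i)\<^esub>j\<in>{..n - i}. \<mu> j (n - i - j) (w j) (v (n - i - j)))"
      using \<mu>_finsum_right[of "{..n - i}" "\<lambda>j. \<mu> j (n - i - j) (w j) (v (n - i - j))" "n - i" "z i" i]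
        term_closed[OF c(2,3)] c(1) by (simp add: Pi_iff F_def del: diff_diff_left)
  qed simp
  finally show "conv (conv z w) v n = conv z (conv w v) n" .
qed

definition unit where "unit = (\<lambda>n. if n = 0 then u else \<zero>\<^bsub>H n\<^esub>)"

lemma conv_unit_left:
  assumes c: "\<And>n. z n \<in> carrier (H n)"
  shows "conv unit z = z"
proof
  fix n
  have "conv unit z n = (\<Oplus>\<^bsub>H n\<^esub>p\<in>{..n}. if 0 = p then z n else \<zero>\<^bsub>H n\<^esub>)"
    unfolding conv_def
    by (rule H.finsum_cong')
       (use c in \<open>auto simp: unit_def \<mu>_u_left \<mu>_zero_left\<close>)
  also have "\<dots> = z n" using c by (subst H.finsum_singleton) auto
  finally show "conv unit z n = z n" .
qed

lemma conv_unit_right: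
  assumes c: "\<And>n. z n \<in> carrier (H n)"
  shows "conv z unit = z"
proof
  fix n
  have "conv z unit n = (\<Oplus>\<^bsub>H n\<^esub>p\<in>{..n}. if n = p then z n else \<zero>\<^bsub>H n\<^esub>)"
    unfolding conv_def
  proof (rule H.finsum_cong')
    fix p assume "p \<in> {..n}"
    then show "\<mu> p (n - p) (z p) (unit (n - p)) = (if n = p then z n else \<zero>\<^bsub>H n\<^esub>)"
      using \<mu>_zero_right[OF c, of p "n - p"] c by (auto simp: unit_def \<mu>_u_right)
  qed (use c in auto)
  also have "\<dots> = z n" using c by (subst H.finsum_singleton) auto
  finally show "conv z unit n = z n" .
qed

lemma conv_add_left:
  assumes c: "\<And>n. z n \<in> carrier (H n)" "\<And>n. z' n \<in> carrier (H n)" "\<And>n. w n \<in> carrier (H n)"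
  shows "conv (\<lambda>n. z n \<oplus>\<^bsub>H n\<^esub> z' n) w = (\<lambda>n. conv z w n \<oplus>\<^bsub>H n\<^esub> conv z' w n)"
proof
  fix n
  show "conv (\<lambda>n. z n \<oplus>\<^bsub>H n\<^esub> z' n) w n = conv z w n \<oplus>\<^bsub>H n\<^esub> conv z' w n"
    unfolding conv_def
    apply (subst H.finsum_addf[symmetric])
      apply (auto intro!: term_closed c)[2]
    apply (rule H.finsum_cong')
    subgoal by simp
    subgoal by (auto intro!: term_closed c H.a_closed)
    subgoal for p using \<mu>_add_left[OF c(1)[of p] c(2)[of p] c(3)[of "n - p"]] by simp
    done
qed

lemma conv_add_right:
  assumes c: "\<And>n. z n \<in> carrier (H n)" "\<And>n. z' n \<in> carrier (H n)" "\<And>n. w n \<in> carrier (H n)"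
  shows "conv w (\<lambda>n. z n \<oplus>\<^bsub>H n\<^esub> z' n) = (\<lambda>n. conv w z n \<oplus>\<^bsub>H n\<^esub> conv w z' n)"
proof
  fix n
  show "conv w (\<lambda>n. z n \<oplus>\<^bsub>H n\<^esub> z' n) n = conv w z n \<oplus>\<^bsub>H n\<^esub> conv w z' n"
    unfolding conv_def
    apply (subst H.finsum_addf[symmetric])
      apply (auto intro!: term_closed c)[2]
    apply (rule H.finsum_cong')
    subgoal by simp
    subgoal by (auto intro!: term_closed c H.a_closed)
    subgoal for p using \<mu>_add_right[OF c(3)[of p] c(1)[of "n - p"] c(2)[of "n - p"]] by simp
    done
qed

text \<open>The fields of R are prescribed one by one, so that R may be a record with further
  fields, such as the scalar multiplication of \<open>Ext_algebra\<close>.\<close>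

lemma direct_sum_ring:
  assumes "carrier R = sum_carrier" "monoid.mult R = conv" "\<one>\<^bsub>R\<^esub> = unit" "\<zero>\<^bsub>R\<^esub> = (\<lambda>n. \<zero>\<^bsub>H n\<^esub>)"
    "add R = (\<lambda>z w n. z n \<oplus>\<^bsub>H n\<^esub> w n)"
  shows "ring R"
proof (rule ringI)
  have add_closed: "(\<lambda>n. z n \<oplus>\<^bsub>H n\<^esub> w n) \<in> sum_carrier" if zw: "z \<in> sum_carrier" "w \<in> sum_carrier" for z w
  proof -
    obtain a where a: "\<And>n. n > a \<Longrightarrow> z n = \<zero>\<^bsub>H n\<^esub>" using sum_carrier_bound zw by blast
    obtain b where b: "\<And>n. n > b \<Longrightarrow> w n = \<zero>\<^bsub>H n\<^esub>" using sum_carrier_bound zw by blast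
    show ?thesis
      by (rule sum_carrierI[of _ "max a b"]) (use zw a b in \<open>auto intro: sum_carrierD\<close>)
  qed
  show "abelian_group R"
  proof (rule abelian_groupI)
    fix x assume x: "x \<in> carrier R"
    then obtain a where a: "\<And>n. n > a \<Longrightarrow> x n = \<zero>\<^bsub>H n\<^esub>" using sum_carrier_bound assms by metis
    have "(\<lambda>n. \<ominus>\<^bsub>H n\<^esub> x n) \<in> sum_carrier"
      by (rule sum_carrierI[of _ a]) (use x a assms in \<open>auto intro: sum_carrierD\<close>)
    moreover have "(\<lambda>n. \<ominus>\<^bsub>H n\<^esub> x n) \<oplus>\<^bsub>R\<^esub> x = \<zero>\<^bsub>R\<^esub>"
      using x by (simp add: assms fun_eq_iff sum_carrierD H.l_neg)
    ultimately show "\<exists>y\<in>carrier R. y \<oplus>\<^bsub>R\<^esub> x = \<zero>\<^bsub>R\<^esub>" using assms(1) by metis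
  next
    show "\<zero>\<^bsub>R\<^esub> \<in> carrier R" by (simp add: assms sum_carrierI)
  qed (auto simp: assms add_closed fun_eq_iff sum_carrierD H.a_ac)
  show "monoid R"
  proof (rule monoidI)
    show "\<one>\<^bsub>R\<^esub> \<in> carrier R"
      unfolding assms by (rule sum_carrierI[of _ 0]) (auto simp: unit_def u_closed)
  qed (auto simp: assms conv_closed conv_assoc conv_unit_left conv_unit_right sum_carrierD)
qed (auto simp: assms conv_add_left conv_add_right sum_carrierD)

end

section \<open>Yoneda products from a projective bimodule resolution\<close>

text \<open>Stated over a noncommutative \<open>ring\<close>, since path algebras and their
  quotients are meant; the last two axioms make the scalars central.\<close>

locale assoc_algebra = ring A for A :: "('k::field, 'a) module" (structure) +
  assumes smult_closed [simp, intro]: "x \<in> carrier A \<Longrightarrow> c \<odot> x \<in> carrier A"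
    and smult_r_distr: "\<lbrakk>x \<in> carrier A; y \<in> carrier A\<rbrakk> \<Longrightarrow> c \<odot> (x \<oplus> y) = c \<odot> x \<oplus> c \<odot> y"
    and smult_l_distr: "x \<in> carrier A \<Longrightarrow> (b + c) \<odot> x = b \<odot> x \<oplus> c \<odot> x"
    and smult_assoc1: "x \<in> carrier A \<Longrightarrow> (b * c) \<odot> x = b \<odot> (c \<odot> x)"
    and smult_one [simp]: "x \<in> carrier A \<Longrightarrow> 1 \<odot> x = x"
    and smult_mult_left: "\<lbrakk>x \<in> carrier A; y \<in> carrier A\<rbrakk> \<Longrightarrow> (c \<odot> x) \<otimes> y = c \<odot> (x \<otimes> y)"
    and smult_mult_right: "\<lbrakk>x \<in> carrier A; y \<in> carrier A\<rbrakk> \<Longrightarrow> x \<otimes> (c \<odot> y) = c \<odot> (x \<otimes> y)"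

text \<open>These are the modules over the enveloping algebra of A: \<open>scalar_central\<close>
  says that K acts in the same way from both sides. Scalar multiplication on M has no field of its
  own; it is the action of the multiples of the unit of A.\<close>

locale algebra_bimodule = A: assoc_algebra A + abelian_group M
  for A :: "('k::field, 'a) module" and M :: "('a, 'b) bimodule" +
  assumes lact_closed [simp, intro]: "\<lbrakk>l \<in> carrier A; x \<in> carrier M\<rbrakk> \<Longrightarrow> lact M l x \<in> carrier M"
    and ract_closed [simp, intro]: "\<lbrakk>l \<in> carrier A; x \<in> carrier M\<rbrakk> \<Longrightarrow> ract M x l \<in> carrier M"
    and lact_add: "\<lbrakk>l \<in> carrier A; x \<in> carrier M; y \<in> carrier M\<rbrakk> \<Longrightarrow>
      lact M l (x \<oplus>\<^bsub>M\<^esub> y) = lact M l x \<oplus>\<^bsub>M\<^esub> lact M l y"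
    and ract_add: "\<lbrakk>l \<in> carrier A; x \<in> carrier M; y \<in> carrier M\<rbrakk> \<Longrightarrow>
      ract M (x \<oplus>\<^bsub>M\<^esub> y) l = ract M x l \<oplus>\<^bsub>M\<^esub> ract M y l"
    and add_lact: "\<lbrakk>l \<in> carrier A; l' \<in> carrier A; x \<in> carrier M\<rbrakk> \<Longrightarrow>
      lact M (l \<oplus>\<^bsub>A\<^esub> l') x = lact M l x \<oplus>\<^bsub>M\<^esub> lact M l' x"
    and add_ract: "\<lbrakk>l \<in> carrier A; l' \<in> carrier A; x \<in> carrier M\<rbrakk> \<Longrightarrow>
      ract M x (l \<oplus>\<^bsub>A\<^esub> l') = ract M x l \<oplus>\<^bsub>M\<^esub> ract M x l'"
    and lact_mult: "\<lbrakk>l \<in> carrier A; l' \<in> carrier A; x \<in> carrier M\<rbrakk> \<Longrightarrow>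
      lact M (l \<otimes>\<^bsub>A\<^esub> l') x = lact M l (lact M l' x)"
    and ract_mult: "\<lbrakk>l \<in> carrier A; l' \<in> carrier A; x \<in> carrier M\<rbrakk> \<Longrightarrow>
      ract M x (l \<otimes>\<^bsub>A\<^esub> l') = ract M (ract M x l) l'"
    and lact_one [simp]: "x \<in> carrier M \<Longrightarrow> lact M \<one>\<^bsub>A\<^esub> x = x"
    and ract_one [simp]: "x \<in> carrier M \<Longrightarrow> ract M x \<one>\<^bsub>A\<^esub> = x"
    and lact_ract: "\<lbrakk>l \<in> carrier A; l' \<in> carrier A; x \<in> carrier M\<rbrakk> \<Longrightarrow>
      ract M (lact M l x) l' = lact M l (ract M x l')"
    and scalar_central: "x \<in> carrier M \<Longrightarrow> lact M (c \<odot>\<^bsub>A\<^esub> \<one>\<^bsub>A\<^esub>) x = ract M x (c \<odot>\<^bsub>A\<^esub> \<one>\<^bsub>A\<^esub>)"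
begin

lemma lact_zero [simp]: "l \<in> carrier A \<Longrightarrow> lact M l \<zero>\<^bsub>M\<^esub> = \<zero>\<^bsub>M\<^esub>"
  using lact_add[of l "\<zero>\<^bsub>M\<^esub>" "\<zero>\<^bsub>M\<^esub>"] by (simp add: add.l_cancel_one')

lemma ract_zero [simp]: "l \<in> carrier A \<Longrightarrow> ract M \<zero>\<^bsub>M\<^esub> l = \<zero>\<^bsub>M\<^esub>"
  using ract_add[of l "\<zero>\<^bsub>M\<^esub>" "\<zero>\<^bsub>M\<^esub>"] by (simp add: add.l_cancel_one')

lemma lact_minus: "\<lbrakk>l \<in> carrier A; x \<in> carrier M\<rbrakk> \<Longrightarrow> lact M l (\<ominus>\<^bsub>M\<^esub> x) = \<ominus>\<^bsub>M\<^esub> lact M l x"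
  using lact_add[of l "\<ominus>\<^bsub>M\<^esub> x" x] by (intro minus_equality[symmetric]) (simp_all add: l_neg)

lemma ract_minus: "\<lbrakk>l \<in> carrier A; x \<in> carrier M\<rbrakk> \<Longrightarrow> ract M (\<ominus>\<^bsub>M\<^esub> x) l = \<ominus>\<^bsub>M\<^esub> ract M x l"
  using ract_add[of l "\<ominus>\<^bsub>M\<^esub> x" x] by (intro minus_equality[symmetric]) (simp_all add: l_neg)

end

lemma (in assoc_algebra) regular_bimodule: "algebra_bimodule A (regular_bimodule A)"
proof -
  have "abelian_group (regular_bimodule A)"
  proof (rule abelian_groupI)
    fix x assume "x \<in> carrier (regular_bimodule A)"
    then show "\<exists>y\<in>carrier (regular_bimodule A). y \<oplus>\<^bsub>regular_bimodule A\<^esub> x = \<zero>\<^bsub>regular_bimodule A\<^esub>"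
      by (intro bexI[of _ "\<ominus> x"]) (simp_all add: regular_bimodule_def l_neg)
  qed (simp_all add: regular_bimodule_def a_ac)
  then show ?thesis
    by (simp add: algebra_bimodule_def assoc_algebra_axioms algebra_bimodule_axioms_def)
       (simp add: regular_bimodule_def l_distr r_distr m_assoc smult_mult_left smult_mult_right)
qed

section \<open>Bimodule homomorphisms and their sums\<close>

lemma bimodule_homD:
  assumes "f \<in> bimodule_hom A M N"
  shows "f \<in> extensional (carrier M)"
    and "x \<in> carrier M \<Longrightarrow> f x \<in> carrier N"
    and "x \<in> carrier M \<Longrightarrow> y \<in> carrier M \<Longrightarrow> f (x \<oplus>\<^bsub>M\<^esub> y) = f x \<oplus>\<^bsub>N\<^esub> f y"
    and "x \<in> carrier M \<Longrightarrow> l \<in> carrier A \<Longrightarrow> f (lact M l x) = lact N l (f x)"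
    and "x \<in> carrier M \<Longrightarrow> l \<in> carrier A \<Longrightarrow> f (ract M x l) = ract N (f x) l"
  using assms by (auto simp: bimodule_hom_def PiE_def)

lemma bimodule_homI:
  assumes "f \<in> extensional (carrier M)"
    and "\<And>x. x \<in> carrier M \<Longrightarrow> f x \<in> carrier N"
    and "\<And>x y. \<lbrakk>x \<in> carrier M; y \<in> carrier M\<rbrakk> \<Longrightarrow> f (x \<oplus>\<^bsub>M\<^esub> y) = f x \<oplus>\<^bsub>N\<^esub> f y"
    and "\<And>x l. \<lbrakk>x \<in> carrier M; l \<in> carrier A\<rbrakk> \<Longrightarrow> f (lact M l x) = lact N l (f x)"
    and "\<And>x l. \<lbrakk>x \<in> carrier M; l \<in> carrier A\<rbrakk> \<Longrightarrow> f (ract M x l) = ract N (f x) l"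
  shows "f \<in> bimodule_hom A M N"
  using assms by (auto simp: bimodule_hom_def PiE_def)

lemma bimodule_hom_eqI:
  assumes "f \<in> bimodule_hom A M N" "g \<in> bimodule_hom A M N'"
    and "\<And>x. x \<in> carrier M \<Longrightarrow> f x = g x"
  shows "f = g"
  by (rule extensionalityI[of _ "carrier M"]) (use assms bimodule_homD(1) in blast)+

lemma bimodule_hom_compose:
  assumes "f \<in> bimodule_hom A M N" "g \<in> bimodule_hom A N Q"
    and "algebra_bimodule A M"
  shows "compose (carrier M) g f \<in> bimodule_hom A M Q"
proof -
  interpret M: algebra_bimodule A M by fact
  show ?thesis
    using bimodule_homD(2-)[OF assms(1)] bimodule_homD(2-)[OF assms(2)]
    by (intro bimodule_homI) (simp_all add: compose_eq)
qed

lemma bimodule_hom_id: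
  assumes "algebra_bimodule A M"
  shows "(\<lambda>x\<in>carrier M. x) \<in> bimodule_hom A M M"
proof -
  interpret M: algebra_bimodule A M by fact
  show ?thesis by (intro bimodule_homI) simp_all
qed

lemma compose_eq_iff: "compose S f g = compose S f' g' \<longleftrightarrow> (\<forall>x\<in>S. f (g x) = f' (g' x))"
  by (auto simp: compose_def fun_eq_iff)

definition hom_add :: "('a, 'b) bimodule \<Rightarrow> ('a, 'c) bimodule \<Rightarrow> ('b \<Rightarrow> 'c) \<Rightarrow> ('b \<Rightarrow> 'c) \<Rightarrow> 'b \<Rightarrow> 'c" where
  "hom_add M N f g = (\<lambda>x\<in>carrier M. f x \<oplus>\<^bsub>N\<^esub> g x)"

definition hom_uminus :: "('a, 'b) bimodule \<Rightarrow> ('a, 'c) bimodule \<Rightarrow> ('b \<Rightarrow> 'c) \<Rightarrow> 'b \<Rightarrow> 'c" where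
  "hom_uminus M N f = (\<lambda>x\<in>carrier M. \<ominus>\<^bsub>N\<^esub> f x)"

definition hom_diff :: "('a, 'b) bimodule \<Rightarrow> ('a, 'c) bimodule \<Rightarrow> ('b \<Rightarrow> 'c) \<Rightarrow> ('b \<Rightarrow> 'c) \<Rightarrow> 'b \<Rightarrow> 'c" where
  "hom_diff M N f g = (\<lambda>x\<in>carrier M. f x \<ominus>\<^bsub>N\<^esub> g x)"

lemma bimodule_hom_zero:
  assumes "algebra_bimodule A M" "algebra_bimodule A N"
  shows "(\<lambda>x\<in>carrier M. \<zero>\<^bsub>N\<^esub>) \<in> bimodule_hom A M N"
proof -
  interpret M: algebra_bimodule A M by fact
  interpret N: algebra_bimodule A N by fact
  show ?thesis by (intro bimodule_homI) simp_all
qed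

lemma bimodule_hom_apply_zero:
  assumes "f \<in> bimodule_hom A M N" "algebra_bimodule A M" "algebra_bimodule A N"
  shows "f \<zero>\<^bsub>M\<^esub> = \<zero>\<^bsub>N\<^esub>"
proof -
  interpret M: algebra_bimodule A M by fact
  interpret N: algebra_bimodule A N by fact
  show ?thesis
    using bimodule_homD(2)[OF assms(1), of "\<zero>\<^bsub>M\<^esub>"] bimodule_homD(3)[OF assms(1), of "\<zero>\<^bsub>M\<^esub>" "\<zero>\<^bsub>M\<^esub>"]
    by (simp add: N.add.l_cancel_one')
qed

lemma bimodule_hom_apply_minus:
  assumes "f \<in> bimodule_hom A M N" "algebra_bimodule A M" "algebra_bimodule A N" "x \<in> carrier M"
  shows "f (\<ominus>\<^bsub>M\<^esub> x) = \<ominus>\<^bsub>N\<^esub> f x"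
proof -
  interpret M: algebra_bimodule A M by fact
  interpret N: algebra_bimodule A N by fact
  have "f (\<ominus>\<^bsub>M\<^esub> x) \<oplus>\<^bsub>N\<^esub> f x = \<zero>\<^bsub>N\<^esub>"
    using bimodule_homD(3)[OF assms(1), of "\<ominus>\<^bsub>M\<^esub> x" x] assms(4) bimodule_hom_apply_zero[OF assms(1-3)]
    by (simp add: M.l_neg)
  then show ?thesis
    using bimodule_homD(2)[OF assms(1)] assms(4) by (intro N.minus_equality[symmetric]) simp_all
qed

lemma bimodule_hom_add:
  assumes "f \<in> bimodule_hom A M N" "g \<in> bimodule_hom A M N"
    and "algebra_bimodule A M" "algebra_bimodule A N"
  shows "hom_add M N f g \<in> bimodule_hom A M N"
proof -
  interpret M: algebra_bimodule A M by fact
  interpret N: algebra_bimodule A N by fact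
  show ?thesis
    unfolding hom_add_def using bimodule_homD(2-)[OF assms(1)] bimodule_homD(2-)[OF assms(2)]
    by (intro bimodule_homI) (simp_all add: N.a_ac N.lact_add N.ract_add)
qed

lemma bimodule_hom_uminus:
  assumes "f \<in> bimodule_hom A M N"
    and "algebra_bimodule A M" "algebra_bimodule A N"
  shows "hom_uminus M N f \<in> bimodule_hom A M N"
proof -
  interpret M: algebra_bimodule A M by fact
  interpret N: algebra_bimodule A N by fact
  show ?thesis
    unfolding hom_uminus_def using bimodule_homD(2-)[OF assms(1)]
    by (intro bimodule_homI) (simp_all add: N.minus_add N.lact_minus N.ract_minus)
qed

lemma bimodule_hom_diff:
  assumes "f \<in> bimodule_hom A M N" "g \<in> bimodule_hom A M N"
    and "algebra_bimodule A M" "algebra_bimodule A N"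
  shows "hom_diff M N f g \<in> bimodule_hom A M N"
proof -
  have "hom_diff M N f g = hom_add M N f (hom_uminus M N g)"
    by (auto simp: hom_diff_def hom_add_def hom_uminus_def a_minus_def fun_eq_iff)
  then show ?thesis
    using assms by (simp add: bimodule_hom_add bimodule_hom_uminus)
qed

declare coboundaries.simps [simp del]

text \<open>Projectivity and exactness enter only in combination: each of the three
  \<open>lift\<close> axioms says that a homomorphism from some P n whose image dies under one map
  of the complex lifts through the map before it. This is exactly the form in which the comparison
  theorem uses them, and it avoids a separate notion of projective bimodule.\<close>

locale projective_resolution = A: assoc_algebra A
  for A :: "('k::field, 'a) module" and P :: "nat \<Rightarrow> ('a, 'b) bimodule"
    and aug :: "'b \<Rightarrow> 'a" and d :: "nat \<Rightarrow> 'b \<Rightarrow> 'b" +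
  assumes P: "algebra_bimodule A (P n)"
    and d_hom: "d (Suc n) \<in> bimodule_hom A (P (Suc n)) (P n)"
    and aug_hom: "aug \<in> bimodule_hom A (P 0) (regular_bimodule A)"
    and aug_d: "x \<in> carrier (P (Suc 0)) \<Longrightarrow> aug (d (Suc 0) x) = \<zero>\<^bsub>A\<^esub>"
    and d_d: "x \<in> carrier (P (Suc (Suc n))) \<Longrightarrow> d (Suc n) (d (Suc (Suc n)) x) = \<zero>\<^bsub>P n\<^esub>"
    and lift_aug: "g \<in> bimodule_hom A (P n) (regular_bimodule A) \<Longrightarrow>
      \<exists>h\<in>bimodule_hom A (P n) (P 0). \<forall>x\<in>carrier (P n). aug (h x) = g x"
    and lift_0: "\<lbrakk>f \<in> bimodule_hom A (P n) (P 0); \<forall>x\<in>carrier (P n). aug (f x) = \<zero>\<^bsub>A\<^esub>\<rbrakk> \<Longrightarrow>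
      \<exists>h\<in>bimodule_hom A (P n) (P (Suc 0)). \<forall>x\<in>carrier (P n). d (Suc 0) (h x) = f x"
    and lift_Suc: "\<lbrakk>f \<in> bimodule_hom A (P n) (P (Suc k)); \<forall>x\<in>carrier (P n). d (Suc k) (f x) = \<zero>\<^bsub>P k\<^esub>\<rbrakk> \<Longrightarrow>
      \<exists>h\<in>bimodule_hom A (P n) (P (Suc (Suc k))). \<forall>x\<in>carrier (P n). d (Suc (Suc k)) (h x) = f x"
begin

sublocale P: algebra_bimodule A "P n" for n by (rule P)

sublocale R: algebra_bimodule A "regular_bimodule A" by (rule A.regular_bimodule)

abbreviation "Hom n k \<equiv> bimodule_hom A (P n) (P k)"
abbreviation "HomA n \<equiv> bimodule_hom A (P n) (regular_bimodule A)"
abbreviation "C n \<equiv> cochains A P n"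
abbreviation "Z n \<equiv> cocycles A P d n"
abbreviation "B n \<equiv> coboundaries A P d n"
abbreviation "cls n \<equiv> cohomology_class A P d n"

lemma R_simps [simp]:
  "carrier (regular_bimodule A) = carrier A"
  "\<zero>\<^bsub>regular_bimodule A\<^esub> = \<zero>\<^bsub>A\<^esub>"
  "add (regular_bimodule A) = add A"
  "lact (regular_bimodule A) = monoid.mult A"
  "ract (regular_bimodule A) = monoid.mult A"
  by (simp_all add: regular_bimodule_def)

lemma d_closed [simp, intro]: "x \<in> carrier (P (Suc n)) \<Longrightarrow> d (Suc n) x \<in> carrier (P n)"
  by (rule bimodule_homD(2)[OF d_hom])

lemmas d_add = bimodule_homD(3)[OF d_hom]

lemma d_zero [simp]: "d (Suc n) \<zero>\<^bsub>P (Suc n)\<^esub> = \<zero>\<^bsub>P n\<^esub>"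
  by (rule bimodule_hom_apply_zero[OF d_hom P P])

section \<open>Cochains, cocycles and coboundaries\<close>

lemma C_simps [simp]:
  "carrier (C n) = HomA n"
  "\<zero>\<^bsub>C n\<^esub> = (\<lambda>x\<in>carrier (P n). \<zero>\<^bsub>A\<^esub>)"
  "add (C n) = hom_add (P n) (regular_bimodule A)"
  by (simp_all add: cochains_def hom_add_def fun_eq_iff)

lemmas homA_closed = bimodule_homD(2)[where N = "regular_bimodule A", simplified]

lemma C_abelian_group: "abelian_group (C n)"
proof (rule abelian_groupI)
  fix f assume f: "f \<in> carrier (C n)"
  then have "hom_add (P n) (regular_bimodule A) (hom_uminus (P n) (regular_bimodule A) f) f = (\<lambda>x\<in>carrier (P n). \<zero>\<^bsub>A\<^esub>)"
    using bimodule_homD(2)[of f A "P n" "regular_bimodule A"]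
    by (auto simp: hom_add_def hom_uminus_def fun_eq_iff R.l_neg simp del: R_simps(3))
  then show "\<exists>g\<in>carrier (C n). g \<oplus>\<^bsub>C n\<^esub> f = \<zero>\<^bsub>C n\<^esub>"
    using f bimodule_hom_uminus[OF _ P A.regular_bimodule] by fastforce
next
  fix f g h assume "f \<in> carrier (C n)" "g \<in> carrier (C n)" "h \<in> carrier (C n)"
  then show "f \<oplus>\<^bsub>C n\<^esub> g \<oplus>\<^bsub>C n\<^esub> h = f \<oplus>\<^bsub>C n\<^esub> (g \<oplus>\<^bsub>C n\<^esub> h)"
    by (simp add: hom_add_def fun_eq_iff homA_closed A.a_assoc)
next
  fix f g assume "f \<in> carrier (C n)" "g \<in> carrier (C n)"
  then show "f \<oplus>\<^bsub>C n\<^esub> g = g \<oplus>\<^bsub>C n\<^esub> f"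
    by (simp add: hom_add_def fun_eq_iff homA_closed A.a_comm)
next
  fix f assume f: "f \<in> carrier (C n)"
  then have "f \<in> extensional (carrier (P n))" by (simp add: bimodule_homD(1))
  then show "\<zero>\<^bsub>C n\<^esub> \<oplus>\<^bsub>C n\<^esub> f = f"
    using f by (auto simp: hom_add_def fun_eq_iff homA_closed extensional_def)
next
  show "\<zero>\<^bsub>C n\<^esub> \<in> carrier (C n)"
    using bimodule_hom_zero[OF P A.regular_bimodule] by simp
next
  fix f g assume "f \<in> carrier (C n)" "g \<in> carrier (C n)"
  then show "f \<oplus>\<^bsub>C n\<^esub> g \<in> carrier (C n)"
    using bimodule_hom_add[OF _ _ P A.regular_bimodule] by simp
qed

sublocale C: abelian_group "C n" for n by (rule C_abelian_group)

lemma cocycles_iff: "f \<in> Z n \<longleftrightarrow> f \<in> HomA n \<and> (\<forall>x\<in>carrier (P (Suc n)). f (d (Suc n) x) = \<zero>\<^bsub>A\<^esub>)"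
  by (auto simp: cocycles_def coboundary_def compose_def fun_eq_iff)

lemma coboundary_apply: "x \<in> carrier (P (Suc n)) \<Longrightarrow> coboundary P d n f x = f (d (Suc n) x)"
  by (simp add: coboundary_def compose_eq)

lemma coboundary_hom: "f \<in> HomA n \<Longrightarrow> coboundary P d n f \<in> HomA (Suc n)"
  unfolding coboundary_def by (rule bimodule_hom_compose[OF d_hom _ P])

lemma coboundaries_iff:
  "f \<in> B n \<longleftrightarrow> f \<in> HomA n \<and> (case n of 0 \<Rightarrow> (\<forall>x\<in>carrier (P 0). f x = \<zero>\<^bsub>A\<^esub>)
     | Suc m \<Rightarrow> \<exists>w\<in>HomA m. \<forall>x\<in>carrier (P (Suc m)). f x = w (d (Suc m) x))"
proof (cases n)
  case 0
  have "f = (\<lambda>x\<in>carrier (P 0). \<zero>\<^bsub>A\<^esub>)" if "f \<in> HomA 0" "\<forall>x\<in>carrier (P 0). f x = \<zero>\<^bsub>A\<^esub>"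
    using bimodule_hom_eqI[OF that(1) bimodule_hom_zero[OF P A.regular_bimodule]] that(2) by simp
  then show ?thesis
    using 0 bimodule_hom_zero[OF P A.regular_bimodule, of 0] by (auto simp: coboundaries.simps)
next
  case (Suc m)
  show ?thesis
  proof
    assume "f \<in> B n"
    then obtain w where "w \<in> HomA m" "f = coboundary P d m w"
      using Suc by (auto simp: coboundaries.simps)
    then show "f \<in> HomA n \<and> (case n of 0 \<Rightarrow> (\<forall>x\<in>carrier (P 0). f x = \<zero>\<^bsub>A\<^esub>)
     | Suc m \<Rightarrow> \<exists>w\<in>HomA m. \<forall>x\<in>carrier (P (Suc m)). f x = w (d (Suc m) x))"
      using Suc by (auto simp: coboundary_apply coboundary_hom)
  next
    assume "f \<in> HomA n \<and> (case n of 0 \<Rightarrow> (\<forall>x\<in>carrier (P 0). f x = \<zero>\<^bsub>A\<^esub>)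
     | Suc m \<Rightarrow> \<exists>w\<in>HomA m. \<forall>x\<in>carrier (P (Suc m)). f x = w (d (Suc m) x))"
    then obtain w where w: "f \<in> HomA (Suc m)" "w \<in> HomA m" "\<forall>x\<in>carrier (P (Suc m)). f x = w (d (Suc m) x)"
      using Suc by auto
    have "f = coboundary P d m w"
      by (rule bimodule_hom_eqI[OF w(1) coboundary_hom[OF w(2)]]) (simp add: coboundary_apply w(3))
    then show "f \<in> B n"
      using Suc w(2) by (simp add: coboundaries.simps)
  qed
qed

lemma B_sub_Z: "f \<in> B n \<Longrightarrow> f \<in> Z n"
proof (cases n)
  case 0
  then show "f \<in> B n \<Longrightarrow> f \<in> Z n" by (auto simp: coboundaries_iff cocycles_iff)
next
  case (Suc m)
  assume "f \<in> B n"
  then obtain w where "f \<in> HomA (Suc m)" "w \<in> HomA m" "\<forall>x\<in>carrier (P (Suc m)). f x = w (d (Suc m) x)"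
    using Suc by (auto simp: coboundaries_iff)
  moreover have "w \<zero>\<^bsub>P m\<^esub> = \<zero>\<^bsub>A\<^esub>"
    using bimodule_hom_apply_zero[OF _ P A.regular_bimodule] calculation(2) by simp
  ultimately show ?thesis
    using Suc by (auto simp: cocycles_iff d_d)
qed

lemma hom_add_apply [simp]: "x \<in> carrier M \<Longrightarrow> hom_add M N f g x = f x \<oplus>\<^bsub>N\<^esub> g x"
  by (simp add: hom_add_def)

lemma hom_diff_apply [simp]: "x \<in> carrier M \<Longrightarrow> hom_diff M N f g x = f x \<ominus>\<^bsub>N\<^esub> g x"
  by (simp add: hom_diff_def)

lemma hom_uminus_apply [simp]: "x \<in> carrier M \<Longrightarrow> hom_uminus M N f x = \<ominus>\<^bsub>N\<^esub> f x"
  by (simp add: hom_uminus_def)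

lemma homA_zero: "f \<in> HomA n \<Longrightarrow> f \<zero>\<^bsub>P n\<^esub> = \<zero>\<^bsub>A\<^esub>"
  using bimodule_hom_apply_zero[OF _ P A.regular_bimodule] by simp

lemma hom_zero: "f \<in> Hom n k \<Longrightarrow> f \<zero>\<^bsub>P n\<^esub> = \<zero>\<^bsub>P k\<^esub>"
  using bimodule_hom_apply_zero[OF _ P P] by simp

lemma R_minus [simp]: "x \<in> carrier A \<Longrightarrow> \<ominus>\<^bsub>regular_bimodule A\<^esub> x = \<ominus>\<^bsub>A\<^esub> x"
  using R.l_neg[of x] R.a_inv_closed[of x] by (intro A.minus_equality[symmetric]) simp_all

lemma R_diff [simp]: "y \<in> carrier A \<Longrightarrow> x \<ominus>\<^bsub>regular_bimodule A\<^esub> y = x \<ominus>\<^bsub>A\<^esub> y"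
  by (simp add: a_minus_def)

lemmas homA_add = bimodule_hom_add[OF _ _ P A.regular_bimodule]
lemmas homA_uminus = bimodule_hom_uminus[OF _ P A.regular_bimodule]
lemmas homA_diff = bimodule_hom_diff[OF _ _ P A.regular_bimodule]

lemma Z_add: "f \<in> Z n \<Longrightarrow> g \<in> Z n \<Longrightarrow> f \<oplus>\<^bsub>C n\<^esub> g \<in> Z n"
  by (auto simp: cocycles_iff homA_add)

lemma Z_uminus: "f \<in> Z n \<Longrightarrow> hom_uminus (P n) (regular_bimodule A) f \<in> Z n"
  by (auto simp: cocycles_iff homA_uminus)

lemma B_add:
  assumes "f \<in> B n" "g \<in> B n"
  shows "f \<oplus>\<^bsub>C n\<^esub> g \<in> B n"
proof (cases n)
  case 0
  then show ?thesis using assms by (auto simp: coboundaries_iff homA_add)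
next
  case (Suc m)
  then obtain v w where "f \<in> HomA (Suc m)" "w \<in> HomA m" "\<forall>x\<in>carrier (P (Suc m)). f x = w (d (Suc m) x)"
    "g \<in> HomA (Suc m)" "v \<in> HomA m" "\<forall>x\<in>carrier (P (Suc m)). g x = v (d (Suc m) x)"
    using assms by (auto simp: coboundaries_iff)
  then show ?thesis
    using Suc by (auto simp: coboundaries_iff homA_add intro!: bexI[of _ "hom_add (P m) (regular_bimodule A) w v"])
qed

lemma B_uminus:
  assumes "f \<in> B n"
  shows "hom_uminus (P n) (regular_bimodule A) f \<in> B n"
proof (cases n)
  case 0
  then show ?thesis using assms by (auto simp: coboundaries_iff homA_uminus)
next
  case (Suc m)
  then obtain w where "f \<in> HomA (Suc m)" "w \<in> HomA m" "\<forall>x\<in>carrier (P (Suc m)). f x = w (d (Suc m) x)"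
    using assms by (auto simp: coboundaries_iff)
  then show ?thesis
    using Suc by (auto simp: coboundaries_iff homA_uminus intro!: bexI[of _ "hom_uminus (P m) (regular_bimodule A) w"])
qed

lemma C_uminus: "f \<in> HomA n \<Longrightarrow> \<ominus>\<^bsub>C n\<^esub> f = hom_uminus (P n) (regular_bimodule A) f"
  by (rule C.minus_equality) (auto simp: homA_uminus hom_add_def fun_eq_iff homA_closed A.l_neg)

lemma B_zero: "\<zero>\<^bsub>C n\<^esub> \<in> B n"
proof (cases n)
  case 0
  then show ?thesis by (simp add: coboundaries.simps)
next
  case (Suc m)
  then show ?thesis
    using bimodule_hom_zero[OF P A.regular_bimodule, of "Suc m"] bimodule_hom_zero[OF P A.regular_bimodule, of m]
    by (auto simp: coboundaries_iff intro!: bexI[of _ "\<lambda>x\<in>carrier (P m). \<zero>\<^bsub>A\<^esub>"])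
qed

lemma B_subgroup: "abelian_subgroup (B n) (C n)"
proof (rule abelian_subgroupI3)
  show "additive_subgroup (B n) (C n)"
    unfolding additive_subgroup_def
  proof (rule C.add.subgroupI)
    fix f assume f: "f \<in> B n"
    then have "\<ominus>\<^bsub>C n\<^esub> f = hom_uminus (P n) (regular_bimodule A) f"
      by (simp add: C_uminus coboundaries_iff)
    then show "\<ominus>\<^bsub>C n\<^esub> f \<in> B n" using B_uminus f by simp
    next
    show "B n \<subseteq> carrier (C n)" by (auto simp: coboundaries_iff)
    show "B n \<noteq> {}" using B_zero[of n] by auto
    show "f \<in> B n \<Longrightarrow> g \<in> B n \<Longrightarrow> f \<oplus>\<^bsub>C n\<^esub> g \<in> B n" for f g by (rule B_add)
  qed
qed (rule C_abelian_group)

sublocale B: abelian_subgroup "B n" "C n" for n by (rule B_subgroup)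

lemma Z_hom: "f \<in> Z n \<Longrightarrow> f \<in> HomA n"
  by (simp add: cocycles_iff)

section \<open>Cohomology classes and their groups\<close>

lemma cls_eq_iff:
  assumes "f \<in> HomA n" "g \<in> HomA n"
  shows "cls n f = cls n g \<longleftrightarrow> hom_diff (P n) (regular_bimodule A) f g \<in> B n"
proof -
  have "hom_diff (P n) (regular_bimodule A) f g = f \<ominus>\<^bsub>C n\<^esub> g"
    using assms by (auto simp: a_minus_def C_uminus fun_eq_iff hom_diff_def hom_add_def hom_uminus_def)
  moreover have "cls n f = cls n g \<longleftrightarrow> f \<in> cls n g"
    unfolding cohomology_class_def
    using B.a_rcos_self B.a_repr_independence' assms by (metis C_simps(1))
  ultimately show ?thesis
    using B.a_rcos_module[of g n f] assms unfolding cohomology_class_def a_minus_def by simp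
qed


lemma cls_memD:
  assumes "f \<in> HomA n" "g \<in> cls n f"
  shows "g \<in> HomA n" "hom_diff (P n) (regular_bimodule A) g f \<in> B n"
proof -
  show g: "g \<in> HomA n"
    using B.a_elemrcos_carrier[of f n g] assms by (simp add: cohomology_class_def)
  have "cls n f = cls n g"
    using B.a_repr_independence'[of g n f] assms by (simp add: cohomology_class_def)
  then show "hom_diff (P n) (regular_bimodule A) g f \<in> B n"
    using cls_eq_iff[OF g assms(1)] by simp
qed

lemma cls_self: "f \<in> HomA n \<Longrightarrow> f \<in> cls n f"
  using B.a_rcos_self[of f n] by (simp add: cohomology_class_def)

lemma cls_zero: "cls n \<zero>\<^bsub>C n\<^esub> = B n"
  unfolding cohomology_class_def
  using C.a_coset_add_zero[of "B n" n] B.a_subset by simp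

lemma cls_add: "f \<in> HomA n \<Longrightarrow> g \<in> HomA n \<Longrightarrow> cls n f <+>\<^bsub>C n\<^esub> cls n g = cls n (f \<oplus>\<^bsub>C n\<^esub> g)"
  unfolding cohomology_class_def by (rule B.a_rcos_sum) simp_all

lemma H_simps:
  "carrier (cohomology A P d n) = cls n ` Z n"
  "\<zero>\<^bsub>cohomology A P d n\<^esub> = B n"
  "add (cohomology A P d n) = set_add (C n)"
  by (simp_all add: cohomology_def)

lemma H_abelian_group: "abelian_group (cohomology A P d n)"
proof (rule abelian_groupI, unfold H_simps)
  fix F assume "F \<in> cls n ` Z n"
  then obtain f where f: "f \<in> Z n" "F = cls n f" by blast
  have "\<ominus>\<^bsub>C n\<^esub> f \<in> Z n" "f \<in> HomA n"
    using Z_uminus[OF f(1)] f(1) by (simp_all add: C_uminus cocycles_iff)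
  moreover have "\<ominus>\<^bsub>C n\<^esub> f \<oplus>\<^bsub>C n\<^esub> f = \<zero>\<^bsub>C n\<^esub>"
    using calculation(2) by (intro C.l_neg) simp
  ultimately have "cls n (\<ominus>\<^bsub>C n\<^esub> f) <+>\<^bsub>C n\<^esub> F = B n"
    using f cls_zero by (simp add: cls_add Z_hom del: C_simps)
  then show "\<exists>G\<in>cls n ` Z n. G <+>\<^bsub>C n\<^esub> F = B n"
    using \<open>\<ominus>\<^bsub>C n\<^esub> f \<in> Z n\<close> by blast
next
  show "B n \<in> cls n ` Z n"
    using cls_zero[of n] B_sub_Z[OF B_zero] by (metis image_eqI)
next
  fix F assume "F \<in> cls n ` Z n"
  then obtain f where f: "f \<in> Z n" "F = cls n f" by blast
  have "B n <+>\<^bsub>C n\<^esub> F = cls n (\<zero>\<^bsub>C n\<^esub> \<oplus>\<^bsub>C n\<^esub> f)"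
    using cls_add[of "\<zero>\<^bsub>C n\<^esub>" n f] f Z_hom C.zero_closed[of n] cls_zero by (simp del: C_simps(2,3))
  also have "\<zero>\<^bsub>C n\<^esub> \<oplus>\<^bsub>C n\<^esub> f = f" using Z_hom[OF f(1)] by (intro C.l_zero) simp
  finally show "B n <+>\<^bsub>C n\<^esub> F = F" using f by simp
next
  fix F G assume "F \<in> cls n ` Z n" "G \<in> cls n ` Z n"
  then obtain f g where "f \<in> Z n" "F = cls n f" "g \<in> Z n" "G = cls n g" by blast
  then show "F <+>\<^bsub>C n\<^esub> G \<in> cls n ` Z n" "F <+>\<^bsub>C n\<^esub> G = G <+>\<^bsub>C n\<^esub> F"
    using Z_add[of f n g] C.a_comm[of f n g] Z_hom by (auto simp: cls_add simp del: C_simps(3))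
next
  fix F G K assume "F \<in> cls n ` Z n" "G \<in> cls n ` Z n" "K \<in> cls n ` Z n"
  then obtain f g k where fgk: "f \<in> Z n" "F = cls n f" "g \<in> Z n" "G = cls n g" "k \<in> Z n" "K = cls n k" by blast
  then have "F <+>\<^bsub>C n\<^esub> G <+>\<^bsub>C n\<^esub> K = cls n (f \<oplus>\<^bsub>C n\<^esub> g \<oplus>\<^bsub>C n\<^esub> k)"
      "F <+>\<^bsub>C n\<^esub> (G <+>\<^bsub>C n\<^esub> K) = cls n (f \<oplus>\<^bsub>C n\<^esub> (g \<oplus>\<^bsub>C n\<^esub> k))"
    using Z_add[of f n g] Z_add[of g n k] Z_hom by (auto simp: cls_add simp del: C_simps(3))
  moreover have "f \<oplus>\<^bsub>C n\<^esub> g \<oplus>\<^bsub>C n\<^esub> k = f \<oplus>\<^bsub>C n\<^esub> (g \<oplus>\<^bsub>C n\<^esub> k)"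
    using fgk Z_hom by (intro C.a_assoc) simp_all
  ultimately show "F <+>\<^bsub>C n\<^esub> G <+>\<^bsub>C n\<^esub> K = F <+>\<^bsub>C n\<^esub> (G <+>\<^bsub>C n\<^esub> K)" by simp
qed

section \<open>Liftings of cocycles and chain homotopies\<close>

lemma liftings_iff:
  assumes "g \<in> HomA q"
  shows "L \<in> liftings A P aug d q g \<longleftrightarrow> (\<forall>k. L k \<in> Hom (q + k) k) \<and>
    (\<forall>x\<in>carrier (P q). aug (L 0 x) = g x) \<and>
    (\<forall>k. \<forall>x\<in>carrier (P (Suc (q + k))). d (Suc k) (L (Suc k) x) = L k (d (Suc (q + k)) x))"
proof -
  have "compose (carrier (P q)) aug (L 0) = g \<longleftrightarrow> (\<forall>x\<in>carrier (P q). aug (L 0 x) = g x)"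
    using bimodule_homD(1)[OF assms] by (auto simp: compose_def fun_eq_iff extensional_def)
  then show ?thesis by (simp add: liftings_def compose_eq_iff)
qed

text \<open>One closure fact, stated for each of the forms in which the index q + k appears after
  simplification.\<close>

lemma chain_map_closed:
  assumes "\<forall>k. L k \<in> Hom (q + k) k"
  shows "x \<in> carrier (P (q + k)) \<Longrightarrow> L k x \<in> carrier (P k)"
    and "x \<in> carrier (P (Suc (q + k))) \<Longrightarrow> L (Suc k) x \<in> carrier (P (Suc k))"
    and "x \<in> carrier (P q) \<Longrightarrow> L 0 x \<in> carrier (P 0)"
  using assms bimodule_homD(2)[of "L k" A "P (q + k)" "P k" x]
    bimodule_homD(2)[of "L (Suc k)" A "P (q + Suc k)" "P (Suc k)" x]
    bimodule_homD(2)[of "L 0" A "P (q + 0)" "P 0" x]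
  by (metis add_Suc_right add_0_right)+

text \<open>The existence half of the comparison theorem, by dependent choice along k.\<close>

lemma lifting_exists:
  assumes "g \<in> Z q"
  shows "\<exists>L. L \<in> liftings A P aug d q g"
proof -
  have g: "g \<in> HomA q" and dg: "\<And>x. x \<in> carrier (P (Suc q)) \<Longrightarrow> g (d (Suc q) x) = \<zero>\<^bsub>A\<^esub>"
    using assms by (auto simp: cocycles_iff)
  \<comment> \<open>The middle conjunct is the invariant that keeps the recursion going:
    \<open>h\<close> after the differential of the source lands in the kernel of the map leaving P
    k, which is what \<open>lift_0\<close> and \<open>lift_Suc\<close> ask for in order to produce
    the next map.\<close>
  define Q where "Q k h \<longleftrightarrow> h \<in> Hom (q + k) k \<and>
    (\<forall>x\<in>carrier (P (Suc (q + k))). (case k of 0 \<Rightarrow> aug (h (d (Suc (q + k)) x)) = \<zero>\<^bsub>A\<^esub>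
       | Suc k' \<Rightarrow> d (Suc k') (h (d (Suc (q + k)) x)) = \<zero>\<^bsub>P k'\<^esub>))
     \<and> (k = 0 \<longrightarrow> (\<forall>x\<in>carrier (P q). aug (h x) = g x))" for k h
  define R where "R k h h' \<longleftrightarrow> (\<forall>x\<in>carrier (P (Suc (q + k))). d (Suc k) (h' x) = h (d (Suc (q + k)) x))"
    for k and h h' :: "'b \<Rightarrow> 'b"
  have "\<exists>L. \<forall>k. Q k (L k) \<and> R k (L k) (L (Suc k))"
  proof (rule dependent_nat_choice)
    show "\<exists>h. Q 0 h"
      using lift_aug[OF g] dg by (auto simp: Q_def)
  next
    fix h k assume h: "Q k h"
    then have hom: "h \<in> Hom (q + k) k" by (simp add: Q_def)
    let ?f = "compose (carrier (P (Suc (q + k)))) h (d (Suc (q + k)))"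
    have f: "?f \<in> Hom (Suc (q + k)) k" by (rule bimodule_hom_compose[OF d_hom hom P])
    have "\<exists>h'\<in>Hom (Suc (q + k)) (Suc k). \<forall>x\<in>carrier (P (Suc (q + k))). d (Suc k) (h' x) = ?f x"
    proof (cases k)
      case 0
      then show ?thesis
        using h f lift_0[of ?f "Suc (q + k)"] by (auto simp: Q_def compose_eq)
    next
      case (Suc k')
      then show ?thesis
        using h f lift_Suc[of ?f "Suc (q + k)" k'] by (auto simp: Q_def compose_eq)
    qed
    then obtain h' where h': "h' \<in> Hom (Suc (q + k)) (Suc k)"
      "\<And>x. x \<in> carrier (P (Suc (q + k))) \<Longrightarrow> d (Suc k) (h' x) = h (d (Suc (q + k)) x)"
      by (auto simp: compose_eq)
    then have "Q (Suc k) h'"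
      using hom by (simp add: Q_def d_d hom_zero)
    with h' show "\<exists>h'. Q (Suc k) h' \<and> R k h h'"
      by (auto simp: R_def)
  qed
  then obtain L where L: "\<And>k. Q k (L k)" "\<And>k. R k (L k) (L (Suc k))" by blast
  then have "L \<in> liftings A P aug d q g"
    unfolding liftings_iff[OF g] using L(1)[of 0] by (auto simp: Q_def R_def)
  then show ?thesis by blast
qed

text \<open>The part of a chain homotopy that is precomposed with a differential. No P sits below
  degree 0, so factoring there means vanishing; with this convention the homotopy statements need no
  separate version for q + k = 0.\<close>

definition factors_through_d where
  "factors_through_d n k t \<longleftrightarrow> (case n of 0 \<Rightarrow> \<forall>x\<in>carrier (P 0). t x = \<zero>\<^bsub>P k\<^esub>
     | Suc m \<Rightarrow> \<exists>w\<in>Hom m k. \<forall>x\<in>carrier (P (Suc m)). t x = w (d (Suc m) x))"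

lemma factors_through_dI:
  "\<lbrakk>w \<in> Hom m k; \<And>x. x \<in> carrier (P (Suc m)) \<Longrightarrow> t x = w (d (Suc m) x)\<rbrakk> \<Longrightarrow> factors_through_d (Suc m) k t"
  by (auto simp: factors_through_d_def)

lemma diff_diff: "x \<in> carrier (P n) \<Longrightarrow> y \<in> carrier (P n) \<Longrightarrow> x \<ominus>\<^bsub>P n\<^esub> (x \<ominus>\<^bsub>P n\<^esub> y) = y"
  by (simp add: P.minus_eq P.minus_add P.minus_minus P.a_assoc[symmetric] P.r_neg)

lemma hom_apply_diff: "f \<in> Hom n k \<Longrightarrow> x \<in> carrier (P n) \<Longrightarrow> y \<in> carrier (P n) \<Longrightarrow>
   f (x \<ominus>\<^bsub>P n\<^esub> y) = f x \<ominus>\<^bsub>P k\<^esub> f y"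
  using bimodule_homD(3)[of f A "P n" "P k" x "\<ominus>\<^bsub>P n\<^esub> y"] bimodule_hom_apply_minus[of f A "P n" "P k" y]
  by (simp add: P.minus_eq P)

lemma homA_apply_diff: "f \<in> HomA n \<Longrightarrow> x \<in> carrier (P n) \<Longrightarrow> y \<in> carrier (P n) \<Longrightarrow>
   f (x \<ominus>\<^bsub>P n\<^esub> y) = f x \<ominus>\<^bsub>A\<^esub> f y"
  using bimodule_homD(3)[of f A "P n" "regular_bimodule A" x "\<ominus>\<^bsub>P n\<^esub> y"]
    bimodule_hom_apply_minus[of f A "P n" "regular_bimodule A" y] bimodule_homD(2)[of f A "P n" "regular_bimodule A" y]
  by (simp add: P.minus_eq A.minus_eq P A.regular_bimodule)

text \<open>The uniqueness half of the comparison theorem, for a chain map that lifts a coboundary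
  instead of zero. The equation M = d s + s' d is kept for a single k, with s' hidden in
  \<open>factors_through_d\<close>; that is all the step to k + 1 uses, because there the current s
  takes over the role of s', and T = M - s d is killed by d and hence lifts.\<close>

lemma null_homotopic:
  assumes M: "\<And>k. M k \<in> Hom (q + k) k"
    and chain: "\<And>k x. x \<in> carrier (P (Suc (q + k))) \<Longrightarrow> d (Suc k) (M (Suc k) x) = M k (d (Suc (q + k)) x)"
    and b: "b \<in> B q" "\<And>x. x \<in> carrier (P q) \<Longrightarrow> aug (M 0 x) = b x"
  shows "\<exists>s\<in>Hom (q + k) (Suc k). factors_through_d (q + k) k (\<lambda>x. M k x \<ominus>\<^bsub>P k\<^esub> d (Suc k) (s x))"
proof (induction k)
  case 0
  have M0: "M 0 \<in> Hom q 0" using M[of 0] by simp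
  show ?case
  proof (cases q)
    case 0
    then obtain s where s: "s \<in> Hom 0 (Suc 0)" "\<forall>x\<in>carrier (P 0). d (Suc 0) (s x) = M 0 x"
      using lift_0[of "M 0" 0] b M0 by (auto simp: coboundaries_iff)
    then show ?thesis
      using 0 M0 by (auto simp: factors_through_d_def P.r_neg P.minus_eq bimodule_homD(2) intro!: bexI[of _ s])
  next
    case (Suc m)
    then obtain w where w: "w \<in> HomA m" "\<And>x. x \<in> carrier (P q) \<Longrightarrow> b x = w (d q x)"
      using b(1) by (auto simp: coboundaries_iff)
    obtain w0 where w0: "w0 \<in> Hom m 0" "\<forall>x\<in>carrier (P m). aug (w0 x) = w x"
      using lift_aug[OF w(1)] by blast
    \<comment> \<open>Here b = w d, so M 0 does not lift zero itself. Subtracting w0 d, where w0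
      lifts w through the augmentation, gives a map into the kernel of \<open>aug\<close>.\<close>
    let ?T = "hom_diff (P q) (P 0) (M 0) (compose (carrier (P q)) w0 (d q))"
    have T: "?T \<in> Hom q 0"
      using Suc bimodule_hom_diff[OF M0 bimodule_hom_compose[OF _ w0(1) P] P P] d_hom[of m] by simp
    have dq: "x \<in> carrier (P q) \<Longrightarrow> d q x \<in> carrier (P m)" for x using Suc by simp
    have "\<forall>x\<in>carrier (P q). aug (?T x) = \<zero>\<^bsub>A\<^esub>"
    proof
      fix x assume x: "x \<in> carrier (P q)"
      have "aug (?T x) = aug (M 0 x) \<ominus>\<^bsub>A\<^esub> aug (w0 (d q x))"
        using x dq M0 w0(1) by (simp add: compose_eq homA_apply_diff[OF aug_hom] bimodule_homD(2))
      also have "\<dots> = \<zero>\<^bsub>A\<^esub>"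
        using x w w0(2) dq b(2) homA_closed[OF w(1) dq[OF x]] by (simp add: A.r_neg A.minus_eq)
      finally show "aug (?T x) = \<zero>\<^bsub>A\<^esub>" .
    qed
    then obtain s where s: "s \<in> Hom q (Suc 0)" "\<forall>x\<in>carrier (P q). d (Suc 0) (s x) = ?T x"
      using lift_0[OF T] by blast
    have "M 0 x \<ominus>\<^bsub>P 0\<^esub> d (Suc 0) (s x) = w0 (d q x)" if "x \<in> carrier (P q)" for x
      using s(2) that dq M0 w0(1) by (simp add: compose_eq diff_diff bimodule_homD(2))
    then show ?thesis
      using Suc s(1) by (auto intro!: bexI[of _ s] factors_through_dI[OF w0(1)])
  qed
next
  case (Suc k)
  then obtain s where s: "s \<in> Hom (q + k) (Suc k)"
    "factors_through_d (q + k) k (\<lambda>x. M k x \<ominus>\<^bsub>P k\<^esub> d (Suc k) (s x))" by blast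
  let ?n = "Suc (q + k)"
  have M': "M (Suc k) \<in> Hom ?n (Suc k)" using M[of "Suc k"] by simp
  let ?T = "hom_diff (P ?n) (P (Suc k)) (M (Suc k)) (compose (carrier (P ?n)) s (d ?n))"
  have T: "?T \<in> Hom ?n (Suc k)"
    by (rule bimodule_hom_diff[OF M' bimodule_hom_compose[OF d_hom s(1) P] P P])
  have "\<forall>x\<in>carrier (P ?n). d (Suc k) (?T x) = \<zero>\<^bsub>P k\<^esub>"
  proof
    fix x assume x: "x \<in> carrier (P ?n)"
    have "d (Suc k) (?T x) = M k (d ?n x) \<ominus>\<^bsub>P k\<^esub> d (Suc k) (s (d ?n x))"
      using x s(1) M' by (simp add: compose_eq hom_apply_diff[OF d_hom] chain bimodule_homD(2))
    also have "\<dots> = \<zero>\<^bsub>P k\<^esub>"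
    proof (cases "q + k")
      case 0
      then show ?thesis using s(2) x d_closed[of x "q + k"] by (auto simp: factors_through_d_def)
    next
      case (Suc m)
      then obtain w where "w \<in> Hom m k"
          "\<forall>x\<in>carrier (P (q + k)). M k x \<ominus>\<^bsub>P k\<^esub> d (Suc k) (s x) = w (d (q + k) x)"
        using s(2) by (auto simp: factors_through_d_def)
      then show ?thesis using x d_closed[of x "q + k"] d_d[of x m] Suc by (simp add: hom_zero)
    qed
    finally show "d (Suc k) (?T x) = \<zero>\<^bsub>P k\<^esub>" .
  qed
  then obtain s' where s': "s' \<in> Hom ?n (Suc (Suc k))" "\<forall>x\<in>carrier (P ?n). d (Suc (Suc k)) (s' x) = ?T x"
    using lift_Suc[OF T] by blast
  have "M (Suc k) x \<ominus>\<^bsub>P (Suc k)\<^esub> d (Suc (Suc k)) (s' x) = s (d ?n x)" if "x \<in> carrier (P ?n)" for x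
    using s'(2) that M' s(1) by (simp add: compose_eq diff_diff bimodule_homD(2))
  then show ?case
    using s'(1) by (auto intro!: bexI[of _ s'] factors_through_dI[OF s(1)])
qed

text \<open>A cocycle f kills the image of d, so f M agrees with f applied to M - d s; that
  difference factors through the differential of the source, which makes the composite a
  coboundary.\<close>

lemma compose_null_homotopic:
  assumes "f \<in> Z p" and M: "\<And>k. M k \<in> Hom (q + k) k"
    and chain: "\<And>k x. x \<in> carrier (P (Suc (q + k))) \<Longrightarrow> d (Suc k) (M (Suc k) x) = M k (d (Suc (q + k)) x)"
    and b: "b \<in> B q" "\<And>x. x \<in> carrier (P q) \<Longrightarrow> aug (M 0 x) = b x"
  shows "compose (carrier (P (q + p))) f (M p) \<in> B (q + p)"
proof -
  have f: "f \<in> HomA p" "\<And>x. x \<in> carrier (P (Suc p)) \<Longrightarrow> f (d (Suc p) x) = \<zero>\<^bsub>A\<^esub>"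
    using assms(1) by (auto simp: cocycles_iff)
  obtain s where s: "s \<in> Hom (q + p) (Suc p)"
    "factors_through_d (q + p) p (\<lambda>x. M p x \<ominus>\<^bsub>P p\<^esub> d (Suc p) (s x))"
    using null_homotopic[OF M chain b] by blast
  have fM: "f (M p x) = f (M p x \<ominus>\<^bsub>P p\<^esub> d (Suc p) (s x))" if x: "x \<in> carrier (P (q + p))" for x
  proof -
    have "M p x \<in> carrier (P p)" "s x \<in> carrier (P (Suc p))"
      using bimodule_homD(2)[OF M x] bimodule_homD(2)[OF s(1) x] by simp_all
    then show ?thesis
      by (simp add: homA_apply_diff[OF f(1)] f(2) homA_closed[OF f(1)] A.minus_eq)
  qed
  have hom: "compose (carrier (P (q + p))) f (M p) \<in> HomA (q + p)"
    by (rule bimodule_hom_compose[OF M f(1) P])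
  show ?thesis
  proof (cases "q + p")
    case 0
    then show ?thesis
      using hom s(2) fM homA_zero[OF f(1)] by (auto simp: coboundaries_iff factors_through_d_def compose_eq)
  next
    case (Suc m)
    then obtain w where w: "w \<in> Hom m p"
        "\<forall>x\<in>carrier (P (q + p)). M p x \<ominus>\<^bsub>P p\<^esub> d (Suc p) (s x) = w (d (q + p) x)"
      using s(2) by (auto simp: factors_through_d_def)
    have "compose (carrier (P m)) f w \<in> HomA m" by (rule bimodule_hom_compose[OF w(1) f(1) P])
    moreover have "\<forall>x\<in>carrier (P (Suc m)). compose (carrier (P (Suc m))) f (M p) x
        = compose (carrier (P m)) f w (d (Suc m) x)"
      using Suc fM w(2) by (auto simp: compose_eq)
    ultimately show ?thesis
      using hom Suc by (auto simp: coboundaries_iff)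
  qed
qed

text \<open>If b = w d, then the chain map equation turns w d L into w L d.\<close>

lemma compose_coboundary:
  assumes "b \<in> B p" and L: "\<And>k. L k \<in> Hom (q + k) k"
    and chain: "\<And>k x. x \<in> carrier (P (Suc (q + k))) \<Longrightarrow> d (Suc k) (L (Suc k) x) = L k (d (Suc (q + k)) x)"
  shows "compose (carrier (P (q + p))) b (L p) \<in> B (q + p)"
proof (cases p)
  case 0
  then have "\<forall>x\<in>carrier (P 0). b x = \<zero>\<^bsub>A\<^esub>" using assms(1) by (auto simp: coboundaries_iff)
  then have "compose (carrier (P (q + p))) b (L p) = \<zero>\<^bsub>C (q + p)\<^esub>"
    using bimodule_homD(2)[OF L[of p]] 0 by (auto simp: compose_def fun_eq_iff)
  then show ?thesis using B_zero by (simp del: C_simps)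
next
  case (Suc m)
  then obtain w where w: "w \<in> HomA m" "\<forall>x\<in>carrier (P (Suc m)). b x = w (d (Suc m) x)" "b \<in> HomA p"
    using assms(1) by (auto simp: coboundaries_iff)
  have "compose (carrier (P (q + p))) b (L p) \<in> HomA (q + p)"
    by (rule bimodule_hom_compose[OF L w(3) P])
  moreover have "compose (carrier (P (q + m))) w (L m) \<in> HomA (q + m)"
    by (rule bimodule_hom_compose[OF L w(1) P])
  moreover have "\<forall>x\<in>carrier (P (Suc (q + m))). compose (carrier (P (Suc (q + m)))) b (L (Suc m)) x
      = compose (carrier (P (q + m))) w (L m) (d (Suc (q + m)) x)"
    using w(2) chain bimodule_homD(2)[OF L[of "Suc m"]] by (auto simp: compose_eq)
  ultimately show ?thesis using Suc by (auto simp: coboundaries_iff)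
qed

section \<open>The Yoneda product on classes and the ring it defines\<close>

lemma compose_lifting_cocycle:
  assumes "f \<in> Z p" "g \<in> Z q" "L \<in> liftings A P aug d q g"
  shows "compose (carrier (P (q + p))) f (L p) \<in> Z (q + p)"
proof -
  note L = assms(3)[unfolded liftings_iff[OF Z_hom[OF assms(2)]]]
  have "f (L p (d (Suc (q + p)) x)) = \<zero>\<^bsub>A\<^esub>" if "x \<in> carrier (P (Suc (q + p)))" for x
  proof -
    have "L (Suc p) x \<in> carrier (P (Suc p))"
      using chain_map_closed(2)[of L q x p] L that by simp
    then show ?thesis using L assms(1) that by (metis cocycles_iff)
  qed
  then show ?thesis
    using bimodule_hom_compose[OF _ Z_hom[OF assms(1)] P, of "L p" "q + p"] L
    by (simp add: cocycles_iff compose_eq)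
qed

text \<open>The union in the definition of \<open>yoneda\<close> collapses to one coset because of
  the splitting f' L' - f L = (f' - f) L' + f (L' - L). The first summand is a coboundary by
  \<open>compose_coboundary\<close>; in the second, L' - L is a chain map lifting the coboundary g'
  - g, so \<open>compose_null_homotopic\<close> applies.\<close>

lemma yoneda_cls:
  assumes "f \<in> Z p" "g \<in> Z q" "L \<in> liftings A P aug d q g"
  shows "yoneda A P aug d p q (cls p f) (cls q g) = cls (q + p) (compose (carrier (P (q + p))) f (L p))"
proof -
  note f = Z_hom[OF assms(1)] and g = Z_hom[OF assms(2)]
  have "cls (q + p) (compose (carrier (P (q + p))) f' (L' p))
      = cls (q + p) (compose (carrier (P (q + p))) f (L p))"
    if f': "f' \<in> cls p f" and g': "g' \<in> cls q g" and L': "L' \<in> liftings A P aug d q g'" for f' g' L'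
  proof -
    note fD = cls_memD[OF f f'] and gD = cls_memD[OF g g']
    note L1 = assms(3)[unfolded liftings_iff[OF g]] and L2 = L'[unfolded liftings_iff[OF gD(1)]]
    let ?X = "carrier (P (q + p))"
    let ?M = "\<lambda>k. hom_diff (P (q + k)) (P k) (L' k) (L k)"
    have M: "?M k \<in> Hom (q + k) k" for k using L1 L2 by (intro bimodule_hom_diff[OF _ _ P P]) auto
    have "compose ?X f (?M p) \<in> B (q + p)"
    proof (rule compose_null_homotopic[OF assms(1) M _ gD(2)])
      fix k x assume x: "x \<in> carrier (P (Suc (q + k)))"
      have "L (Suc k) x \<in> carrier (P (Suc k))" "L' (Suc k) x \<in> carrier (P (Suc k))"
        using L1 L2 chain_map_closed(2)[OF _ x] by simp_all
      then show "d (Suc k) (?M (Suc k) x) = ?M k (d (Suc (q + k)) x)"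
        using L1 L2 x by (simp add: hom_apply_diff[OF d_hom])
    next
      fix x assume x: "x \<in> carrier (P q)"
      have "L 0 x \<in> carrier (P 0)" "L' 0 x \<in> carrier (P 0)"
        using L1 L2 chain_map_closed(3)[OF _ x] by simp_all
      then show "aug (?M 0 x) = hom_diff (P q) (regular_bimodule A) g' g x"
        using L1 L2 x homA_closed[OF g x] by (simp add: homA_apply_diff[OF aug_hom] A.minus_eq)
    qed
    moreover have "compose ?X (hom_diff (P p) (regular_bimodule A) f' f) (L' p) \<in> B (q + p)"
      using L2 by (intro compose_coboundary[OF fD(2)]) auto
    ultimately have sum: "compose ?X (hom_diff (P p) (regular_bimodule A) f' f) (L' p)
       \<oplus>\<^bsub>C (q + p)\<^esub> compose ?X f (?M p) \<in> B (q + p)" by (intro B_add)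
    have hL: "compose ?X f (L p) \<in> HomA (q + p)" "compose ?X f' (L' p) \<in> HomA (q + p)"
      using L1 L2 by (auto intro!: bimodule_hom_compose[OF _ _ P] f fD)
    have "hom_diff (P (q + p)) (regular_bimodule A) (compose ?X f' (L' p)) (compose ?X f (L p))
      = compose ?X (hom_diff (P p) (regular_bimodule A) f' f) (L' p) \<oplus>\<^bsub>C (q + p)\<^esub> compose ?X f (?M p)"
    proof (rule bimodule_hom_eqI[OF homA_diff[OF hL(2,1)]])
      show "compose ?X (hom_diff (P p) (regular_bimodule A) f' f) (L' p) \<oplus>\<^bsub>C (q + p)\<^esub> compose ?X f (?M p) \<in> HomA (q + p)"
        using sum by (simp add: coboundaries_iff)
      fix x assume x: "x \<in> ?X"
      then have Lx: "L p x \<in> carrier (P p)" "L' p x \<in> carrier (P p)"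
        using L1 L2 chain_map_closed(1)[of _ q x p] by simp_all
      note c = homA_closed[OF f Lx(1)] homA_closed[OF f Lx(2)] homA_closed[OF fD(1) Lx(2)]
      have "(f' (L' p x) \<oplus>\<^bsub>A\<^esub> \<ominus>\<^bsub>A\<^esub> f (L' p x)) \<oplus>\<^bsub>A\<^esub> (f (L' p x) \<oplus>\<^bsub>A\<^esub> \<ominus>\<^bsub>A\<^esub> f (L p x))
         = f' (L' p x) \<oplus>\<^bsub>A\<^esub> \<ominus>\<^bsub>A\<^esub> f (L p x)"
        using c by (simp add: A.a_assoc A.r_neg1)
      then show "hom_diff (P (q + p)) (regular_bimodule A) (compose ?X f' (L' p)) (compose ?X f (L p)) x =
        (compose ?X (hom_diff (P p) (regular_bimodule A) f' f) (L' p) \<oplus>\<^bsub>C (q + p)\<^esub> compose ?X f (?M p)) x"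
        using x Lx c by (simp add: compose_eq homA_apply_diff[OF f] A.minus_eq)
    qed
    then show ?thesis
      using sum cls_eq_iff[OF hL(2,1)] by simp
  qed
  then have "yoneda A P aug d p q (cls p f) (cls q g)
     = (\<Union>f'\<in>cls p f. \<Union>g'\<in>cls q g. \<Union>L'\<in>liftings A P aug d q g'. cls (q + p) (compose (carrier (P (q + p))) f (L p)))"
    unfolding yoneda_def by (intro SUP_cong refl) auto
  also have "\<dots> = cls (q + p) (compose (carrier (P (q + p))) f (L p))"
    using cls_self[OF f] cls_self[OF g] assms(3) by blast
  finally show ?thesis .
qed

lemma aug_cocycle: "aug \<in> Z 0"
  by (auto simp: cocycles_iff aug_hom aug_d)

text \<open>All laws come from explicit liftings: the sum of two liftings lifts the sum, the
  composite of liftings of h and of g lifts the representative of the product of g and h, and the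
  identity maps lift the augmentation. By \<open>yoneda_cls\<close> any lifting may be used.\<close>

lemma Ext_graded_ring: "graded_ring (cohomology A P d) (yoneda A P aug d) (cls 0 aug)"
proof (rule graded_ring.intro)
  fix n p q r
  interpret H: abelian_group "cohomology A P d n" by (rule H_abelian_group)
  show "abelian_group (cohomology A P d n)" by (rule H_abelian_group)
  show "cls 0 aug \<in> carrier (cohomology A P d 0)"
    using aug_cocycle by (simp add: H_simps)
  {
    fix F G assume "F \<in> carrier (cohomology A P d p)" "G \<in> carrier (cohomology A P d q)"
    then obtain f g where fg: "f \<in> Z p" "F = cls p f" "g \<in> Z q" "G = cls q g" by (auto simp: H_simps)
    obtain L where L: "L \<in> liftings A P aug d q g" using lifting_exists fg by blast
    show "yoneda A P aug d p q F G \<in> carrier (cohomology A P d (p + q))"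
      using yoneda_cls[OF fg(1,3) L] compose_lifting_cocycle[OF fg(1,3) L] fg
      by (simp add: H_simps add.commute)
  next
    fix F F' G assume "F \<in> carrier (cohomology A P d p)" "F' \<in> carrier (cohomology A P d p)" "G \<in> carrier (cohomology A P d q)"
    then obtain f f' g where fg: "f \<in> Z p" "F = cls p f" "g \<in> Z q" "G = cls q g" "f' \<in> Z p" "F' = cls p f'" by (auto simp: H_simps)
    obtain L where L: "L \<in> liftings A P aug d q g" using lifting_exists fg by blast
    then have "L p \<in> Hom (q + p) p" using liftings_iff[OF Z_hom[OF fg(3)]] by blast
    note Lx = bimodule_homD(2)[OF this]
    let ?X = "carrier (P (q + p))"
    have "compose ?X (f \<oplus>\<^bsub>C p\<^esub> f') (L p) = compose ?X f (L p) \<oplus>\<^bsub>C (q + p)\<^esub> compose ?X f' (L p)"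
      using Lx by (auto simp: compose_def fun_eq_iff hom_add_def)
    then have "yoneda A P aug d p q (cls p (f \<oplus>\<^bsub>C p\<^esub> f')) G = cls (q + p) (compose ?X f (L p)) <+>\<^bsub>C (q + p)\<^esub> cls (q + p) (compose ?X f' (L p))"
      using yoneda_cls[OF Z_add[OF fg(1,5)] fg(3) L] fg
        compose_lifting_cocycle[OF fg(1,3) L] compose_lifting_cocycle[OF fg(5,3) L]
      by (simp add: cls_add Z_hom del: C_simps)
    then show "yoneda A P aug d p q (F \<oplus>\<^bsub>cohomology A P d p\<^esub> F') G
        = yoneda A P aug d p q F G \<oplus>\<^bsub>cohomology A P d (p + q)\<^esub> yoneda A P aug d p q F' G"
      using yoneda_cls[OF fg(1,3) L] yoneda_cls[OF fg(5,3) L] fg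
      by (simp add: H_simps cls_add Z_hom add.commute del: C_simps)
  next
    fix F G G' assume "F \<in> carrier (cohomology A P d p)" "G \<in> carrier (cohomology A P d q)" "G' \<in> carrier (cohomology A P d q)"
    then obtain f g g' where fg: "f \<in> Z p" "F = cls p f" "g \<in> Z q" "G = cls q g" "g' \<in> Z q" "G' = cls q g'" by (auto simp: H_simps)
    obtain L L' where L: "L \<in> liftings A P aug d q g" and L': "L' \<in> liftings A P aug d q g'" using lifting_exists fg by metis
    note L1 = L[unfolded liftings_iff[OF Z_hom[OF fg(3)]]] and L2 = L'[unfolded liftings_iff[OF Z_hom[OF fg(5)]]]
    let ?X = "carrier (P (q + p))"
    let ?M = "\<lambda>k. hom_add (P (q + k)) (P k) (L k) (L' k)"
    have M: "?M \<in> liftings A P aug d q (g \<oplus>\<^bsub>C q\<^esub> g')"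
      unfolding liftings_iff[OF Z_hom[OF Z_add[OF fg(3,5)]]]
    proof (intro conjI allI ballI)
      show "?M k \<in> Hom (q + k) k" for k using L1 L2 by (intro bimodule_hom_add[OF _ _ P P]) auto
      fix x assume x: "x \<in> carrier (P q)"
      have "L 0 x \<in> carrier (P 0)" "L' 0 x \<in> carrier (P 0)"
        using L1 L2 chain_map_closed(3)[OF _ x] by simp_all
      then show "aug (?M 0 x) = (g \<oplus>\<^bsub>C q\<^esub> g') x"
        using L1 L2 x bimodule_homD(3)[OF aug_hom] by simp
    next
      fix k x assume x: "x \<in> carrier (P (Suc (q + k)))"
      have "L (Suc k) x \<in> carrier (P (Suc k))" "L' (Suc k) x \<in> carrier (P (Suc k))"
        using L1 L2 chain_map_closed(2)[OF _ x] by simp_all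
      then show "d (Suc k) (?M (Suc k) x) = ?M k (d (Suc (q + k)) x)"
        using L1 L2 x by (simp add: d_add)
    qed
    have "L p x \<in> carrier (P p)" "L' p x \<in> carrier (P p)" if "x \<in> ?X" for x
      using L1 L2 chain_map_closed(1)[OF _ that] by simp_all
    then have "compose ?X f (?M p) = compose ?X f (L p) \<oplus>\<^bsub>C (q + p)\<^esub> compose ?X f (L' p)"
      using bimodule_homD(3)[OF Z_hom[OF fg(1)]] by (auto simp: compose_def fun_eq_iff hom_add_def)
    then have "yoneda A P aug d p q F (cls q (g \<oplus>\<^bsub>C q\<^esub> g')) = cls (q + p) (compose ?X f (L p)) <+>\<^bsub>C (q + p)\<^esub> cls (q + p) (compose ?X f (L' p))"
      using yoneda_cls[OF fg(1) Z_add[OF fg(3,5)] M] fg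
        compose_lifting_cocycle[OF fg(1,3) L] compose_lifting_cocycle[OF fg(1,5) L']
      by (simp add: cls_add Z_hom del: C_simps)
    then show "yoneda A P aug d p q F (G \<oplus>\<^bsub>cohomology A P d q\<^esub> G')
        = yoneda A P aug d p q F G \<oplus>\<^bsub>cohomology A P d (p + q)\<^esub> yoneda A P aug d p q F G'"
      using yoneda_cls[OF fg(1,3) L] yoneda_cls[OF fg(1,5) L'] fg
      by (simp add: H_simps cls_add Z_hom add.commute del: C_simps)
  next
    fix F G K assume "F \<in> carrier (cohomology A P d p)" "G \<in> carrier (cohomology A P d q)" "K \<in> carrier (cohomology A P d r)"
    then obtain f g h where fg: "f \<in> Z p" "F = cls p f" "g \<in> Z q" "G = cls q g" "h \<in> Z r" "K = cls r h" by (auto simp: H_simps)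
    obtain L L' where L: "L \<in> liftings A P aug d q g" and L': "L' \<in> liftings A P aug d r h" using lifting_exists fg by metis
    note L1 = L[unfolded liftings_iff[OF Z_hom[OF fg(3)]]] and L2 = L'[unfolded liftings_iff[OF Z_hom[OF fg(5)]]]
    let ?M = "\<lambda>k. compose (carrier (P (r + (q + k)))) (L k) (L' (q + k))"
    have c: "x \<in> carrier (P (r + k)) \<Longrightarrow> L' k x \<in> carrier (P k)" for x k
      using L2 chain_map_closed(1)[of L' r x k] by simp
    have M: "?M \<in> liftings A P aug d (r + q) (compose (carrier (P (r + q))) g (L' q))"
      unfolding liftings_iff[OF Z_hom[OF compose_lifting_cocycle[OF fg(3,5) L']]]
    proof (intro conjI allI ballI)
      show "?M k \<in> Hom (r + q + k) k" for k
        using L1 L2 bimodule_hom_compose[of "L' (q + k)" A "P (r + (q + k))" "P (q + k)" "L k" "P k"] P by (simp add: add.assoc)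
      fix x assume x: "x \<in> carrier (P (r + q))"
      then show "aug (?M 0 x) = compose (carrier (P (r + q))) g (L' q) x"
        using L1 c by (simp add: compose_eq)
    next
      fix k x assume "x \<in> carrier (P (Suc (r + q + k)))"
      then have x: "x \<in> carrier (P (Suc (r + (q + k))))" by (simp add: add.assoc)
      have "d (Suc k) (L (Suc k) (L' (Suc (q + k)) x)) = L k (d (Suc (q + k)) (L' (Suc (q + k)) x))"
        using L1 c[of x "Suc (q + k)"] x by simp
      also have "d (Suc (q + k)) (L' (Suc (q + k)) x) = L' (q + k) (d (Suc (r + (q + k))) x)"
        using L2 x by simp
      finally show "d (Suc k) (?M (Suc k) x) = ?M k (d (Suc (r + q + k)) x)"
        using x by (simp add: compose_eq add.assoc)
    qed
    have eq: "compose (carrier (P (r + (q + p)))) (compose (carrier (P (q + p))) f (L p)) (L' (q + p))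
      = compose (carrier (P (r + q + p))) f (?M p)"
      using c by (auto simp: compose_def fun_eq_iff add.assoc)
    have "yoneda A P aug d (q + p) r (yoneda A P aug d p q F G) K
        = cls (r + (q + p)) (compose (carrier (P (r + (q + p)))) (compose (carrier (P (q + p))) f (L p)) (L' (q + p)))"
      using yoneda_cls[OF fg(1,3) L] yoneda_cls[OF compose_lifting_cocycle[OF fg(1,3) L] fg(5) L'] fg by simp
    moreover have "yoneda A P aug d p (r + q) F (yoneda A P aug d q r G K)
        = cls (r + q + p) (compose (carrier (P (r + q + p))) f (?M p))"
      using yoneda_cls[OF fg(3,5) L'] yoneda_cls[OF fg(1) compose_lifting_cocycle[OF fg(3,5) L'] M] fg by simp
    ultimately show "yoneda A P aug d (p + q) r (yoneda A P aug d p q F G) K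
        = yoneda A P aug d p (q + r) F (yoneda A P aug d q r G K)"
      unfolding eq by (simp add: ac_simps)
  }
  {
    fix F assume "F \<in> carrier (cohomology A P d n)"
    then obtain f where f: "f \<in> Z n" "F = cls n f" by (auto simp: H_simps)
    obtain L where L: "L \<in> liftings A P aug d n f" using lifting_exists f by blast
    then have "compose (carrier (P n)) aug (L 0) = f" by (simp add: liftings_def)
    then show "yoneda A P aug d 0 n (cls 0 aug) F = F"
      using yoneda_cls[OF aug_cocycle f(1) L] f(2) by simp
    have I: "(\<lambda>k. \<lambda>x\<in>carrier (P k). x) \<in> liftings A P aug d 0 aug"
      unfolding liftings_iff[OF aug_hom] using bimodule_hom_id[OF P] by auto
    have "compose (carrier (P n)) f (\<lambda>x\<in>carrier (P n). x) = f"
      using bimodule_homD(1)[OF Z_hom[OF f(1)]] by (auto simp: compose_def fun_eq_iff extensional_def)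
    then show "yoneda A P aug d n 0 F (cls 0 aug) = F"
      using yoneda_cls[OF f(1) aug_cocycle I] f(2) by simp
  }
qed

sublocale H: graded_ring "cohomology A P d" "yoneda A P aug d" "cls 0 aug"
  by (rule Ext_graded_ring)

lemma Ext_algebra_simps:
  "carrier (Ext_algebra A P aug d) = H.sum_carrier"
  "monoid.mult (Ext_algebra A P aug d) = H.conv"
  "\<one>\<^bsub>Ext_algebra A P aug d\<^esub> = H.unit"
  "\<zero>\<^bsub>Ext_algebra A P aug d\<^esub> = (\<lambda>n. \<zero>\<^bsub>cohomology A P d n\<^esub>)"
  "add (Ext_algebra A P aug d) = (\<lambda>z w n. z n \<oplus>\<^bsub>cohomology A P d n\<^esub> w n)"
  by (simp_all add: Ext_algebra_def Let_def H.sum_carrier_def H.conv_def H.unit_def fun_eq_iff)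

lemma Ext_algebra_ring: "ring (Ext_algebra A P aug d)"
  by (rule H.direct_sum_ring) (simp_all add: Ext_algebra_simps)

end

section \<open>Quotient algebras and the path algebra\<close>

text \<open>\<open>Quot\<close> yields a plain ring record and \<open>quotient_algebra\<close> a
  record with scalars; this carries the ring axioms from one to the other.\<close>

lemma ring_cong:
  fixes R :: "('a, 'm) ring_scheme" and S :: "('a, 'n) ring_scheme"
  assumes "ring R" "carrier S = carrier R" "monoid.mult S = monoid.mult R" "\<one>\<^bsub>S\<^esub> = \<one>\<^bsub>R\<^esub>" "\<zero>\<^bsub>S\<^esub> = \<zero>\<^bsub>R\<^esub>" "add S = add R"
  shows "ring S"
proof -
  interpret R: ring R by fact
  show ?thesis
  proof (rule ringI)
    show "abelian_group S"
    proof (rule abelian_groupI)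
      fix x assume "x \<in> carrier S"
      then show "\<exists>y\<in>carrier S. y \<oplus>\<^bsub>S\<^esub> x = \<zero>\<^bsub>S\<^esub>"
        by (intro bexI[of _ "\<ominus>\<^bsub>R\<^esub> x"]) (simp_all add: assms R.l_neg)
    qed (simp_all add: assms R.a_ac)
    show "monoid S" by (rule monoidI) (simp_all add: assms R.m_assoc)
  qed (simp_all add: assms R.l_distr R.r_distr)
qed

lemma quotient_algebra_simps:
  "carrier (quotient_algebra A I) = carrier (A Quot I)"
  "monoid.mult (quotient_algebra A I) = monoid.mult (A Quot I)"
  "\<one>\<^bsub>quotient_algebra A I\<^esub> = \<one>\<^bsub>A Quot I\<^esub>"
  "\<zero>\<^bsub>quotient_algebra A I\<^esub> = \<zero>\<^bsub>A Quot I\<^esub>"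
  "add (quotient_algebra A I) = add (A Quot I)"
  "module.smult (quotient_algebra A I) = (\<lambda>c C. \<Union>x\<in>C. I +>\<^bsub>A\<^esub> (c \<odot>\<^bsub>A\<^esub> x))"
  by (simp_all add: quotient_algebra_def)

text \<open>Collects what makes scalar multiplication of cosets well defined. The locale serves the
  associative algebras as well as \<open>HH\<close> and the polynomial algebra, where the scalar
  laws are supplied by hand.\<close>

locale quotient_of_ring = ideal I A for I and A :: "('k, 'a) module" +
  assumes smult_closed': "x \<in> carrier A \<Longrightarrow> c \<odot>\<^bsub>A\<^esub> x \<in> carrier A"
    and smult_r_distr': "\<lbrakk>x \<in> carrier A; y \<in> carrier A\<rbrakk> \<Longrightarrow> c \<odot>\<^bsub>A\<^esub> (x \<oplus>\<^bsub>A\<^esub> y) = c \<odot>\<^bsub>A\<^esub> x \<oplus>\<^bsub>A\<^esub> c \<odot>\<^bsub>A\<^esub> y"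
    and smult_ideal: "x \<in> I \<Longrightarrow> c \<odot>\<^bsub>A\<^esub> x \<in> I"
begin

lemma carrier_quotient: "carrier (quotient_algebra A I) = (\<lambda>x. I +>\<^bsub>A\<^esub> x) ` carrier A"
  by (auto simp: quotient_algebra_simps FactRing_def A_RCOSETS_def')

lemma quotient_ring: "ring (quotient_algebra A I)"
  by (rule ring_cong[OF quotient_is_ring]) (simp_all add: quotient_algebra_simps)

lemma quotient_mult:
  "\<lbrakk>x \<in> carrier A; y \<in> carrier A\<rbrakk> \<Longrightarrow> (I +>\<^bsub>A\<^esub> x) \<otimes>\<^bsub>quotient_algebra A I\<^esub> (I +>\<^bsub>A\<^esub> y) = I +>\<^bsub>A\<^esub> (x \<otimes>\<^bsub>A\<^esub> y)"
  by (simp add: quotient_algebra_simps FactRing_def rcoset_mult_add)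

lemma quotient_add:
  "\<lbrakk>x \<in> carrier A; y \<in> carrier A\<rbrakk> \<Longrightarrow> (I +>\<^bsub>A\<^esub> x) \<oplus>\<^bsub>quotient_algebra A I\<^esub> (I +>\<^bsub>A\<^esub> y) = I +>\<^bsub>A\<^esub> (x \<oplus>\<^bsub>A\<^esub> y)"
  by (simp add: quotient_algebra_simps FactRing_def abelian_subgroup.a_rcos_sum[OF abelian_subgroupI3[OF is_additive_subgroup is_abelian_group]])

lemma quotient_one: "\<one>\<^bsub>quotient_algebra A I\<^esub> = I +>\<^bsub>A\<^esub> \<one>\<^bsub>A\<^esub>"
  by (simp add: quotient_algebra_simps FactRing_def)

lemma coset_eq_iff:
  assumes "x \<in> carrier A" "y \<in> carrier A"
  shows "I +>\<^bsub>A\<^esub> x = I +>\<^bsub>A\<^esub> y \<longleftrightarrow> x \<ominus>\<^bsub>A\<^esub> y \<in> I"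
  using quotient_eq_iff_same_a_r_cos[OF ideal_axioms assms] by simp

lemma coset_memD:
  assumes "x \<in> carrier A" "y \<in> I +>\<^bsub>A\<^esub> x"
  shows "\<exists>i\<in>I. y = i \<oplus>\<^bsub>A\<^esub> x"
  using assms by (auto simp: a_r_coset_def')

lemma quotient_smult:
  assumes x: "x \<in> carrier A"
  shows "c \<odot>\<^bsub>quotient_algebra A I\<^esub> (I +>\<^bsub>A\<^esub> x) = I +>\<^bsub>A\<^esub> (c \<odot>\<^bsub>A\<^esub> x)"
proof -
  have "I +>\<^bsub>A\<^esub> (c \<odot>\<^bsub>A\<^esub> y) = I +>\<^bsub>A\<^esub> (c \<odot>\<^bsub>A\<^esub> x)" if y: "y \<in> I +>\<^bsub>A\<^esub> x" for y
  proof -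
    obtain i where i: "i \<in> I" "y = i \<oplus>\<^bsub>A\<^esub> x" using coset_memD[OF x y] by blast
    have "c \<odot>\<^bsub>A\<^esub> y = c \<odot>\<^bsub>A\<^esub> i \<oplus>\<^bsub>A\<^esub> c \<odot>\<^bsub>A\<^esub> x" using i x by (simp add: smult_r_distr')
    then have "c \<odot>\<^bsub>A\<^esub> y \<ominus>\<^bsub>A\<^esub> c \<odot>\<^bsub>A\<^esub> x = c \<odot>\<^bsub>A\<^esub> i"
      using i x by (simp add: smult_closed' minus_eq a_assoc r_neg)
    then show ?thesis
      using i x smult_ideal[OF i(1)] by (simp add: coset_eq_iff smult_closed')
  qed
  then have "(\<Union>y\<in>I +>\<^bsub>A\<^esub> x. I +>\<^bsub>A\<^esub> (c \<odot>\<^bsub>A\<^esub> y)) = (\<Union>y\<in>I +>\<^bsub>A\<^esub> x. I +>\<^bsub>A\<^esub> (c \<odot>\<^bsub>A\<^esub> x))"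
    by (rule SUP_cong[OF refl])
  moreover have "x \<in> I +>\<^bsub>A\<^esub> x" using x by (auto simp: a_r_coset_def' intro!: bexI[of _ "\<zero>\<^bsub>A\<^esub>"])
  ultimately show ?thesis unfolding quotient_algebra_simps by auto
qed

end

text \<open>An ideal is closed under scalars because c x is the product of c 1 with x.\<close>

lemma (in assoc_algebra) quotient_of_ring:
  assumes "ideal I A"
  shows "quotient_of_ring I A"
proof -
  interpret I: ideal I A by fact
  have "c \<odot> x \<in> I" if "x \<in> I" for x c
  proof -
    have "(c \<odot> \<one>) \<otimes> x = c \<odot> x" using that by (simp add: smult_mult_left)
    moreover have "(c \<odot> \<one>) \<otimes> x \<in> I" using that by (intro I.I_l_closed) auto
    ultimately show ?thesis by simp
  qed
  then show ?thesis by unfold_locales (auto simp: smult_r_distr)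
qed

lemma (in assoc_algebra) quotient_assoc_algebra:
  assumes "ideal I A"
  shows "assoc_algebra (quotient_algebra A I)"
proof -
  interpret Q: quotient_of_ring I A by (rule quotient_of_ring[OF assms])
  show ?thesis
  proof (intro assoc_algebra.intro[OF Q.quotient_ring] assoc_algebra_axioms.intro, unfold Q.carrier_quotient)
    fix C D :: "'a set" and b c
    assume "C \<in> (+>) I ` carrier A"
    then obtain x where x: "x \<in> carrier A" "C = I +> x" by auto
    then show "c \<odot>\<^bsub>quotient_algebra A I\<^esub> C \<in> (+>) I ` carrier A"
      by (auto simp: Q.quotient_smult)
    show "1 \<odot>\<^bsub>quotient_algebra A I\<^esub> C = C"
      using x by (simp add: Q.quotient_smult)
    show "(b + c) \<odot>\<^bsub>quotient_algebra A I\<^esub> C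
        = b \<odot>\<^bsub>quotient_algebra A I\<^esub> C \<oplus>\<^bsub>quotient_algebra A I\<^esub> c \<odot>\<^bsub>quotient_algebra A I\<^esub> C"
      using x by (simp add: Q.quotient_smult Q.quotient_add smult_l_distr)
    show "(b * c) \<odot>\<^bsub>quotient_algebra A I\<^esub> C
        = b \<odot>\<^bsub>quotient_algebra A I\<^esub> (c \<odot>\<^bsub>quotient_algebra A I\<^esub> C)"
      using x by (simp add: Q.quotient_smult smult_assoc1)
    assume "D \<in> (+>) I ` carrier A"
    then obtain y where y: "y \<in> carrier A" "D = I +> y" by blast
    show "c \<odot>\<^bsub>quotient_algebra A I\<^esub> (C \<oplus>\<^bsub>quotient_algebra A I\<^esub> D)
        = c \<odot>\<^bsub>quotient_algebra A I\<^esub> C \<oplus>\<^bsub>quotient_algebra A I\<^esub> c \<odot>\<^bsub>quotient_algebra A I\<^esub> D"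
      using x y by (simp add: Q.quotient_smult Q.quotient_add smult_r_distr)
    show "c \<odot>\<^bsub>quotient_algebra A I\<^esub> C \<otimes>\<^bsub>quotient_algebra A I\<^esub> D
        = c \<odot>\<^bsub>quotient_algebra A I\<^esub> (C \<otimes>\<^bsub>quotient_algebra A I\<^esub> D)"
      "C \<otimes>\<^bsub>quotient_algebra A I\<^esub> (c \<odot>\<^bsub>quotient_algebra A I\<^esub> D)
        = c \<odot>\<^bsub>quotient_algebra A I\<^esub> (C \<otimes>\<^bsub>quotient_algebra A I\<^esub> D)"
      using x y by (simp_all add: Q.quotient_smult Q.quotient_mult smult_mult_left smult_mult_right)
  qed
qed

section \<open>The path algebra is an associative algebra\<close>

lemma path_algebra_simps:
  "carrier (path_algebra m) = {f. finite {p. f p \<noteq> 0} \<and> {p. f p \<noteq> 0} \<subseteq> paths m}"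
  "monoid.mult (path_algebra m) = (\<lambda>f g (i, w). \<Sum>k\<le>length w.
        f (i, take k w) * g (path_tgt m (i, take k w), drop k w))"
  "\<one>\<^bsub>path_algebra m\<^esub> = (\<lambda>p. \<Sum>i\<in>{0..<m}. path_vec (i, []) p)"
  "\<zero>\<^bsub>path_algebra m\<^esub> = (\<lambda>_. 0)"
  "add (path_algebra m) = (\<lambda>f g p. f p + g p)"
  "module.smult (path_algebra m) = (\<lambda>c f p. c * f p)"
  by (simp_all add: path_algebra_def fun_eq_iff)

lemma path_mult:
  "(f \<otimes>\<^bsub>path_algebra m\<^esub> g) (i, w) = (\<Sum>k\<le>length w. f (i, take k w) * g (path_tgt m (i, take k w), drop k w))"
  by (simp add: path_algebra_simps)

lemma path_one: "\<one>\<^bsub>path_algebra m\<^esub> (i, w) = of_bool (w = [] \<and> i \<in> {0..<m})"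
proof (cases "w = []")
  case True
  have "(\<Sum>j\<in>{0..<m}. path_vec (j, []) (i, w)) = (\<Sum>j\<in>{0..<m}. if i = j then 1 else 0)"
    using True by (intro sum.cong) (auto simp: path_vec_def)
  then show ?thesis using True by (auto simp: path_algebra_simps)
qed (simp add: path_algebra_simps path_vec_def)

lemma path_tgt_append: "path_tgt m (path_tgt m (i, u), v) = path_tgt m (i, u @ v)"
  by (simp add: path_tgt_def)

lemma path_tgt_Cons: "path_tgt m (i, x # w) = path_tgt m (arrow_tgt m x, w)"
  by (simp add: path_tgt_def)

lemma walk_append: "walk m i (u @ v) \<longleftrightarrow> walk m i u \<and> walk m (path_tgt m (i, u)) v"
  by (induction u arbitrary: i) (auto simp: path_tgt_Cons, auto simp: path_tgt_def)

lemma arrow_tgt_range: "x \<in> arrows m \<Longrightarrow> arrow_tgt m x \<in> {0..<m}"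
  by (auto simp: arrows_def)

lemma walk_tgt_range: "walk m i w \<Longrightarrow> i \<in> {0..<m} \<Longrightarrow> path_tgt m (i, w) \<in> {0..<m}"
  by (induction w arbitrary: i) (use arrow_tgt_range in \<open>auto simp: path_tgt_Cons, auto simp: path_tgt_def\<close>)

lemma path_mult_closed:
  assumes "f \<in> carrier (path_algebra m)" "g \<in> carrier (path_algebra m)"
  shows "f \<otimes>\<^bsub>path_algebra m\<^esub> g \<in> carrier (path_algebra m)"
proof -
  let ?h = "f \<otimes>\<^bsub>path_algebra m\<^esub> g"
  have ex: "\<exists>k\<le>length w. f (i, take k w) \<noteq> 0 \<and> g (path_tgt m (i, take k w), drop k w) \<noteq> 0"
    if "?h (i, w) \<noteq> 0" for i w
  proof (rule ccontr)
    assume "\<not> ?thesis"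
    then have "?h (i, w) = 0" unfolding path_mult by (intro sum.neutral) auto
    then show False using that by simp
  qed
  have "{p. ?h p \<noteq> 0} \<subseteq> (\<lambda>(p, q). (fst p, snd p @ snd q)) ` ({p. f p \<noteq> 0} \<times> {p. g p \<noteq> 0})"
  proof
    fix p assume "p \<in> {p. ?h p \<noteq> 0}"
    moreover obtain i w where "p = (i, w)" by (cases p)
    ultimately obtain k where "p = (i, w)" "f (i, take k w) \<noteq> 0" "g (path_tgt m (i, take k w), drop k w) \<noteq> 0"
      using ex[of i w] by auto
    then show "p \<in> (\<lambda>(p, q). (fst p, snd p @ snd q)) ` ({p. f p \<noteq> 0} \<times> {p. g p \<noteq> 0})"
      by (intro image_eqI[of _ _ "((i, take k w), (path_tgt m (i, take k w), drop k w))"]) auto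
  qed
  then have "finite {p. ?h p \<noteq> 0}"
    by (rule finite_subset) (use assms in \<open>simp add: path_algebra_simps(1)\<close>)
  moreover have "{p. ?h p \<noteq> 0} \<subseteq> paths m"
  proof
    fix p assume "p \<in> {p. ?h p \<noteq> 0}"
    moreover obtain i w where "p = (i, w)" by (cases p)
    ultimately obtain k where p: "p = (i, w)" "f (i, take k w) \<noteq> 0" "g (path_tgt m (i, take k w), drop k w) \<noteq> 0"
      using ex[of i w] by auto
    then have "(i, take k w) \<in> paths m" "(path_tgt m (i, take k w), drop k w) \<in> paths m"
      using assms by (auto simp: path_algebra_simps(1))
    then show "p \<in> paths m"
      using walk_append[of m i "take k w" "drop k w"] p(1) by (simp add: paths_def)
  qed
  ultimately show ?thesis by (simp only: path_algebra_simps(1) mem_Collect_eq)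
qed

lemma sum_triangle:
  fixes F :: "nat \<Rightarrow> nat \<Rightarrow> 'a::comm_monoid_add"
  shows "(\<Sum>k\<le>n. \<Sum>j\<le>k. F j k) = (\<Sum>j\<le>n. \<Sum>l\<le>n - j. F j (j + l))"
proof -
  have "(\<Sum>k\<le>n. \<Sum>j\<le>k. F j k) = (\<Sum>k\<le>n. \<Sum>j\<le>k. F j (j + (k - j)))"
    by (intro sum.cong refl) simp
  also have "\<dots> = (\<Sum>(j, l)\<in>{(j, l). j + l \<le> n}. F j (j + l))"
    by (rule sum.triangle_reindex_eq[symmetric])
  also have "{(j, l). j + l \<le> n} = Sigma {..n} (\<lambda>j. {..n - j})" by auto
  also have "(\<Sum>(j, l)\<in>Sigma {..n} (\<lambda>j. {..n - j}). F j (j + l)) = (\<Sum>j\<le>n. \<Sum>l\<le>n - j. F j (j + l))"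
    by (rule sum.Sigma[symmetric]) auto
  finally show ?thesis .
qed

text \<open>Both sides sum over the ways to cut a path twice. \<open>sum_triangle\<close> replaces
  the position of the second cut by the length of the middle piece.\<close>

lemma path_mult_assoc:
  "(f \<otimes>\<^bsub>path_algebra m\<^esub> g) \<otimes>\<^bsub>path_algebra m\<^esub> h = f \<otimes>\<^bsub>path_algebra m\<^esub> (g \<otimes>\<^bsub>path_algebra m\<^esub> h)"
proof
  fix p :: path
  obtain i w where p: "p = (i, w)" by (cases p)
  let ?t = "\<lambda>k. path_tgt m (i, take k w)"
  have "((f \<otimes>\<^bsub>path_algebra m\<^esub> g) \<otimes>\<^bsub>path_algebra m\<^esub> h) (i, w)
     = (\<Sum>k\<le>length w. \<Sum>j\<le>k. f (i, take j w) * g (?t j, drop j (take k w)) * h (?t k, drop k w))"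
    unfolding path_mult sum_distrib_right by (intro sum.cong refl) (auto simp: min_def)
  also have "\<dots> = (\<Sum>j\<le>length w. \<Sum>l\<le>length w - j. f (i, take j w) * g (?t j, drop j (take (j + l) w)) * h (?t (j + l), drop (j + l) w))"
    by (rule sum_triangle)
  also have "\<dots> = (f \<otimes>\<^bsub>path_algebra m\<^esub> (g \<otimes>\<^bsub>path_algebra m\<^esub> h)) (i, w)"
    unfolding path_mult sum_distrib_left length_drop
  proof (intro sum.cong refl)
    fix j l
    have "drop j (take (j + l) w) = take l (drop j w)" by (simp add: take_drop add.commute)
    moreover have "?t (j + l) = path_tgt m (path_tgt m (i, take j w), take l (drop j w))"
      by (simp only: path_tgt_append take_add)
    ultimately show "f (i, take j w) * g (?t j, drop j (take (j + l) w)) * h (?t (j + l), drop (j + l) w)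
      = f (i, take j w) * (g (?t j, take l (drop j w)) * h (path_tgt m (?t j, take l (drop j w)), drop l (drop j w)))"
      by (simp add: mult.assoc add.commute)
  qed
  finally show "((f \<otimes>\<^bsub>path_algebra m\<^esub> g) \<otimes>\<^bsub>path_algebra m\<^esub> h) p = (f \<otimes>\<^bsub>path_algebra m\<^esub> (g \<otimes>\<^bsub>path_algebra m\<^esub> h)) p"
    using p by simp
qed

lemma path_one_mult:
  assumes "f \<in> carrier (path_algebra m)"
  shows "\<one>\<^bsub>path_algebra m\<^esub> \<otimes>\<^bsub>path_algebra m\<^esub> f = f"
proof
  fix p :: path
  obtain i w where p: "p = (i, w)" by (cases p)
  have "(\<one>\<^bsub>path_algebra m\<^esub> \<otimes>\<^bsub>path_algebra m\<^esub> f) (i, w) = (\<Sum>k\<le>length w. if 0 = k then of_bool (i \<in> {0..<m}) * f (i, w) else 0)"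
    unfolding path_mult by (intro sum.cong refl) (auto simp: path_one path_tgt_def)
  also have "\<dots> = f (i, w)"
    using assms by (auto simp: path_algebra_simps paths_def)
  finally show "(\<one>\<^bsub>path_algebra m\<^esub> \<otimes>\<^bsub>path_algebra m\<^esub> f) p = f p" using p by simp
qed

lemma path_mult_one:
  assumes "f \<in> carrier (path_algebra m)"
  shows "f \<otimes>\<^bsub>path_algebra m\<^esub> \<one>\<^bsub>path_algebra m\<^esub> = f"
proof
  fix p :: path
  obtain i w where p: "p = (i, w)" by (cases p)
  have "f (i, w) \<noteq> 0 \<Longrightarrow> (i, w) \<in> paths m"
    using assms by (auto simp: path_algebra_simps)
  then have r: "f (i, w) \<noteq> 0 \<Longrightarrow> path_tgt m (i, w) \<in> {0..<m}"
    using walk_tgt_range by (simp add: paths_def)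
  have "(f \<otimes>\<^bsub>path_algebra m\<^esub> \<one>\<^bsub>path_algebra m\<^esub>) (i, w) = (\<Sum>k\<le>length w. if length w = k then f (i, w) else 0)"
    unfolding path_mult using r by (intro sum.cong refl) (auto simp: path_one)
  also have "\<dots> = f (i, w)" by simp
  finally show "(f \<otimes>\<^bsub>path_algebra m\<^esub> \<one>\<^bsub>path_algebra m\<^esub>) p = f p" using p by simp
qed

lemma path_add_closed:
  assumes "f \<in> carrier (path_algebra m)" "g \<in> carrier (path_algebra m)"
  shows "(\<lambda>p. f p + g p) \<in> carrier (path_algebra m)"
proof -
  have "{p. f p + g p \<noteq> 0} \<subseteq> {p. f p \<noteq> 0} \<union> {p. g p \<noteq> 0}" by auto
  then show ?thesis
    using assms finite_subset[of "{p. f p + g p \<noteq> 0}" "{p. f p \<noteq> 0} \<union> {p. g p \<noteq> 0}"]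
    by (auto simp: path_algebra_simps)
qed

lemma path_smult_closed:
  assumes "f \<in> carrier (path_algebra m)"
  shows "(\<lambda>p. c * f p) \<in> carrier (path_algebra m)"
proof -
  have "{p. c * f p \<noteq> 0} \<subseteq> {p. f p \<noteq> 0}" by auto
  then show ?thesis
    using assms finite_subset[of "{p. c * f p \<noteq> 0}" "{p. f p \<noteq> 0}"]
    by (auto simp: path_algebra_simps)
qed

lemma path_vec_closed: "p \<in> paths m \<Longrightarrow> path_vec p \<in> carrier (path_algebra m)"
  by (auto simp: path_algebra_simps path_vec_def)

lemma path_one_closed: "\<one>\<^bsub>path_algebra m\<^esub> \<in> (carrier (path_algebra m) :: (path \<Rightarrow> 'k::field) set)"
proof -
  have "{p. \<one>\<^bsub>path_algebra m\<^esub> p \<noteq> (0::'k)} \<subseteq> (\<lambda>i. (i, [])) ` {0..<m}"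
    by (auto simp: path_one)
  then show ?thesis
    using finite_subset[of "{p. \<one>\<^bsub>path_algebra m\<^esub> p \<noteq> (0::'k)}" "(\<lambda>i. (i, [])) ` {0..<m}"]
    by (auto simp: path_algebra_simps(1) paths_def)
qed

lemma path_algebra_ring: "ring (path_algebra m :: ('k::field, path \<Rightarrow> 'k) module)"
proof (rule ringI)
  show "abelian_group (path_algebra m :: ('k, path \<Rightarrow> 'k) module)"
  proof (rule abelian_groupI)
    fix f :: "path \<Rightarrow> 'k" assume f: "f \<in> carrier (path_algebra m)"
    show "\<exists>g\<in>carrier (path_algebra m). g \<oplus>\<^bsub>path_algebra m\<^esub> f = \<zero>\<^bsub>path_algebra m\<^esub>"
      by (rule bexI[OF _ path_smult_closed[OF f, of "-1"]]) (simp add: path_algebra_simps)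
  qed (auto intro: path_add_closed simp: path_algebra_simps(4-), simp_all add: path_algebra_simps(1) add_ac)
  show "monoid (path_algebra m :: ('k, path \<Rightarrow> 'k) module)"
    by (rule monoidI) (simp_all add: path_mult_closed path_one_closed path_mult_assoc path_one_mult path_mult_one)
qed (auto simp: fun_eq_iff path_mult path_algebra_simps(5) algebra_simps sum.distrib)

lemma path_assoc_algebra: "assoc_algebra (path_algebra m :: ('k::field, path \<Rightarrow> 'k) module)"
proof (rule assoc_algebra.intro[OF path_algebra_ring], unfold_locales)
  fix f g :: "path \<Rightarrow> 'k" and c
  show "c \<odot>\<^bsub>path_algebra m\<^esub> f \<otimes>\<^bsub>path_algebra m\<^esub> g = c \<odot>\<^bsub>path_algebra m\<^esub> (f \<otimes>\<^bsub>path_algebra m\<^esub> g)"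
    "f \<otimes>\<^bsub>path_algebra m\<^esub> (c \<odot>\<^bsub>path_algebra m\<^esub> g) = c \<odot>\<^bsub>path_algebra m\<^esub> (f \<otimes>\<^bsub>path_algebra m\<^esub> g)"
    by (auto simp: path_algebra_simps(6) path_mult sum_distrib_left algebra_simps)
qed (auto simp: path_algebra_simps(5,6) path_smult_closed algebra_simps)

lemma path_vec_mult:
  "path_vec (i, u) \<otimes>\<^bsub>path_algebra m\<^esub> path_vec (j, v)
    = (if path_tgt m (i, u) = j then path_vec (i, u @ v) else \<zero>\<^bsub>path_algebra m\<^esub>)"
proof
  fix p :: path
  obtain i' w where p: "p = (i', w)" by (cases p)
  have "(path_vec (i, u) \<otimes>\<^bsub>path_algebra m\<^esub> path_vec (j, v)) (i', w)
    = (\<Sum>k\<le>length w. if length u = k then of_bool (path_tgt m (i, u) = j \<and> i' = i \<and> w = u @ v) else 0)"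
    unfolding path_mult
  proof (intro sum.cong refl)
    fix k assume "k \<in> {..length w}"
    then have k: "k \<le> length w" by simp
    show "path_vec (i, u) (i', take k w) * path_vec (j, v) (path_tgt m (i', take k w), drop k w)
      = (if length u = k then of_bool (path_tgt m (i, u) = j \<and> i' = i \<and> w = u @ v) else 0)"
    proof (cases "length u = k")
      case True
      have "w = u @ v \<longleftrightarrow> take k w = u \<and> drop k w = v"
        using append_take_drop_id[of k w] True by (metis append_eq_conv_conj)
      then show ?thesis using True by (auto simp: path_vec_def)
    next
      case False
      then have "take k w \<noteq> u" using k by (metis length_take min.absorb2)
      then show ?thesis using False by (simp add: path_vec_def)
    qed
  qed
  then show "(path_vec (i, u) \<otimes>\<^bsub>path_algebra m\<^esub> path_vec (j, v)) p
    = (if path_tgt m (i, u) = j then path_vec (i, u @ v) else \<zero>\<^bsub>path_algebra m\<^esub>) p"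
    using p by (auto simp: path_vec_def path_algebra_simps(4))
qed

lemma path_e_closed: "0 < m \<Longrightarrow> path_e m i \<in> carrier (path_algebra m)"
  unfolding path_e_def by (rule path_vec_closed) (simp add: paths_def)

lemma path_a_closed: "0 < m \<Longrightarrow> path_a m i \<in> carrier (path_algebra m)"
  unfolding path_a_def by (rule path_vec_closed) (simp add: paths_def arrows_def)

lemma path_b_closed: "0 < m \<Longrightarrow> path_b m i \<in> carrier (path_algebra m)"
  unfolding path_b_def by (rule path_vec_closed) (simp add: paths_def arrows_def mod_add_left_eq)

lemma relations_closed:
  assumes "0 < m"
  shows "relations m N \<subseteq> (carrier (path_algebra m) :: (path \<Rightarrow> 'k::field) set)"
proof -
  interpret A: ring "path_algebra m :: ('k, path \<Rightarrow> 'k) module" by (rule path_algebra_ring)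
  show ?thesis
    using assms by (auto simp: relations_def Let_def path_a_closed path_b_closed)
qed

lemma rel_ideal: "0 < m \<Longrightarrow> ideal (rel_ideal m N) (path_algebra m)"
  unfolding rel_ideal_def by (rule ring.genideal_ideal[OF path_algebra_ring relations_closed])

lemma Lam_assoc_algebra: "0 < m \<Longrightarrow> assoc_algebra (Lam m N)"
  unfolding Lam_def by (rule assoc_algebra.quotient_assoc_algebra[OF path_assoc_algebra rel_ideal])

section \<open>Coordinates on \<open>\<Lambda>\<^sub>1\<close>\<close>

text \<open>Otherwise \<open>Lam 2 1\<close> would be rewritten to \<open>Lam 2 (Suc 0)\<close>.\<close>

declare One_nat_def [simp del]

abbreviation "PA \<equiv> path_algebra 2"

text \<open>With m = 2 a vertex is a parity, and negation is both i + 1 and i - 1. Either type of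
  arrow flips the vertex, which is why the end points of a path depend only on its start and on the
  parity of its length.\<close>

definition vert :: "bool \<Rightarrow> int" where
  "vert v = (if v then 1 else 0)"

text \<open>The eight coefficients of a path algebra element in the basis that its class has in
  \<open>Lam 2 1\<close>. The two paths of length two that change type become equal there, so their
  coefficients are added; a a, its barred counterpart and all longer paths become zero and are
  ignored.\<close>

definition path_coord :: "(path \<Rightarrow> 'k::field) \<Rightarrow> bool \<Rightarrow> bool \<Rightarrow> bool \<Rightarrow> 'k" where
  "path_coord f v \<alpha> \<beta> =
     (if \<alpha> then if \<beta> then f (vert v, [Arr (vert v), Bar (vert v)]) + f (vert v, [Bar (vert (\<not> v)), Arr (vert (\<not> v))])
               else f (vert v, [Arr (vert v)])
      else if \<beta> then f (vert v, [Bar (vert (\<not> v))]) else f (vert v, []))"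

text \<open>The product of \<open>Lam 2 1\<close> in this basis: a sum over the ways to distribute
  the arrows of the result over the two factors. The second factor starts at \<open>\<not> v\<close>
  when the first one has exactly one arrow. Apart from the vertex this is multiplication in
  K[x, y]/(x^2, y^2).\<close>

definition coord_mult :: "(bool \<Rightarrow> bool \<Rightarrow> bool \<Rightarrow> 'k::field) \<Rightarrow> (bool \<Rightarrow> bool \<Rightarrow> bool \<Rightarrow> 'k) \<Rightarrow> bool \<Rightarrow> bool \<Rightarrow> bool \<Rightarrow> 'k" where
  "coord_mult a b v \<alpha> \<beta> =
     (if \<alpha> then if \<beta> then a v False False * b v True True + a v True False * b (\<not> v) False True
                        + a v False True * b (\<not> v) True False + a v True True * b v False False
               else a v False False * b v True False + a v True False * b (\<not> v) False False
      else if \<beta> then a v False False * b v False True + a v False True * b (\<not> v) False False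
      else a v False False * b v False False)"

lemma (in ideal) diff_mem_iff:
  assumes "a \<ominus> b \<in> I" "a \<in> carrier R" "b \<in> carrier R"
  shows "a \<in> I \<longleftrightarrow> b \<in> I"
proof
  assume "b \<in> I"
  moreover have "a = (a \<ominus> b) \<oplus> b" using assms by (simp add: minus_eq a_assoc l_neg)
  ultimately show "a \<in> I" using assms(1) additive_subgroup.a_closed[OF is_additive_subgroup] by metis
next
  assume "a \<in> I"
  moreover have "b = \<ominus> (a \<ominus> b) \<oplus> a"
    using assms by (simp add: minus_eq minus_add a_comm[of "\<ominus> a" b] a_assoc l_neg)
  ultimately show "b \<in> I"
    using assms(1) additive_subgroup.a_closed[OF is_additive_subgroup] additive_subgroup.a_inv_closed[OF is_additive_subgroup] by metis
qed

lemma vert_cases: "i \<in> {0..<2} \<Longrightarrow> \<exists>v. i = vert v"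
  by (rule exI[of _ "i = 1"]) (auto simp: vert_def)

lemma path_coord_mult: "path_coord (f \<otimes>\<^bsub>PA\<^esub> g) = coord_mult (path_coord f) (path_coord g)"
  by (auto simp: fun_eq_iff path_coord_def coord_mult_def path_mult vert_def path_tgt_def numeral_2_eq_2 algebra_simps)

lemma path_coord_add: "path_coord (f \<oplus>\<^bsub>PA\<^esub> g) v \<alpha> \<beta> = path_coord f v \<alpha> \<beta> + path_coord g v \<alpha> \<beta>"
  by (simp add: path_coord_def path_algebra_simps(5))

lemma path_coord_smult: "path_coord (c \<odot>\<^bsub>PA\<^esub> f) v \<alpha> \<beta> = c * path_coord f v \<alpha> \<beta>"
  by (simp add: path_coord_def path_algebra_simps(6) algebra_simps)

lemma path_coord_zero: "path_coord \<zero>\<^bsub>PA\<^esub> v \<alpha> \<beta> = 0"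
  by (simp add: path_coord_def path_algebra_simps(4))

lemma path_minus: "f \<in> carrier (path_algebra m) \<Longrightarrow> \<ominus>\<^bsub>path_algebra m\<^esub> f = (\<lambda>p. - f p)"
  by (rule abelian_group.minus_equality[OF ring.is_abelian_group[OF path_algebra_ring]])
     (use path_smult_closed[of f m "-1"] in \<open>auto simp: path_algebra_simps(4,5)\<close>)

lemma path_coord_diff: "g \<in> carrier PA \<Longrightarrow> path_coord (f \<ominus>\<^bsub>PA\<^esub> g) v \<alpha> \<beta> = path_coord f v \<alpha> \<beta> - path_coord g v \<alpha> \<beta>"
  by (simp add: a_minus_def path_minus path_coord_add) (simp add: path_coord_def)

lemma path_coord_gens:
  "path_coord (path_e 2 i) v \<alpha> \<beta> = of_bool (v = odd i \<and> \<not> \<alpha> \<and> \<not> \<beta>)"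
  "path_coord (path_a 2 i) v \<alpha> \<beta> = of_bool (v = odd i \<and> \<alpha> \<and> \<not> \<beta>)"
  "path_coord (path_b 2 i) v \<alpha> \<beta> = of_bool (v = even i \<and> \<not> \<alpha> \<and> \<beta>)"
proof -
  have "i mod 2 = vert (odd i)" "(i + 1) mod 2 = vert (even i)"
    by (simp_all add: vert_def) presburger+
  then show "path_coord (path_e 2 i) v \<alpha> \<beta> = of_bool (v = odd i \<and> \<not> \<alpha> \<and> \<not> \<beta>)"
    "path_coord (path_a 2 i) v \<alpha> \<beta> = of_bool (v = odd i \<and> \<alpha> \<and> \<not> \<beta>)"
    "path_coord (path_b 2 i) v \<alpha> \<beta> = of_bool (v = even i \<and> \<not> \<alpha> \<and> \<beta>)"
    by (auto simp: path_coord_def path_e_def path_a_def path_b_def path_vec_def vert_def)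
qed

lemma path_coord_one: "path_coord \<one>\<^bsub>PA\<^esub> v \<alpha> \<beta> = of_bool (\<not> \<alpha> \<and> \<not> \<beta>)"
  by (simp add: path_coord_def path_one vert_def)

section \<open>The relation ideal is the common kernel of the coordinates\<close>

definition path_kernel :: "(path \<Rightarrow> 'k::field) set" where
  "path_kernel = {f \<in> carrier PA. \<forall>v \<alpha> \<beta>. path_coord f v \<alpha> \<beta> = 0}"

lemma path_kernel_ideal: "ideal path_kernel (PA :: ('k::field, path \<Rightarrow> 'k) module)"
proof -
  interpret A: ring "PA :: ('k, path \<Rightarrow> 'k) module" by (rule path_algebra_ring)
  show ?thesis
  proof (rule idealI[OF path_algebra_ring])
    show "subgroup path_kernel (add_monoid (PA :: ('k, path \<Rightarrow> 'k) module))"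
    proof (rule A.add.subgroupI)
      have "\<zero>\<^bsub>PA\<^esub> \<in> (path_kernel :: (path \<Rightarrow> 'k) set)"
        using A.zero_closed by (simp add: path_kernel_def path_coord_zero)
      then show "path_kernel \<noteq> ({} :: (path \<Rightarrow> 'k) set)" by blast
      show "\<ominus>\<^bsub>PA\<^esub> f \<in> path_kernel" if f: "f \<in> path_kernel" for f :: "path \<Rightarrow> 'k"
      proof -
        have fc: "f \<in> carrier PA" using f by (simp add: path_kernel_def)
        have "path_coord (\<ominus>\<^bsub>PA\<^esub> f) v \<alpha> \<beta> = - path_coord f v \<alpha> \<beta>" for v \<alpha> \<beta>
          unfolding path_minus[OF fc] by (simp add: path_coord_def)
        then show ?thesis using f A.a_inv_closed[OF fc] by (simp add: path_kernel_def)
      qed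
    qed (auto simp: path_kernel_def path_coord_add)
    fix f g :: "path \<Rightarrow> 'k" assume "f \<in> path_kernel" "g \<in> carrier PA"
    then show "g \<otimes>\<^bsub>PA\<^esub> f \<in> path_kernel" "f \<otimes>\<^bsub>PA\<^esub> g \<in> path_kernel"
      by (simp_all add: path_kernel_def path_coord_mult coord_mult_def)
  qed
qed

lemma relations_kernel: "relations 2 1 \<subseteq> (path_kernel :: (path \<Rightarrow> 'k::field) set)"
proof -
  interpret A: ring "PA :: ('k, path \<Rightarrow> 'k) module" by (rule path_algebra_ring)
  show ?thesis
    by (auto simp: relations_def Let_def path_kernel_def path_a_closed path_b_closed path_coord_mult
        coord_mult_def path_coord_gens path_coord_diff)
qed

lemma rel_ideal_sub_kernel: "rel_ideal 2 1 \<subseteq> (path_kernel :: (path \<Rightarrow> 'k::field) set)"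
  unfolding rel_ideal_def by (rule ring.genideal_minimal[OF path_algebra_ring path_kernel_ideal relations_kernel])

definition normal_path :: "bool \<Rightarrow> bool \<Rightarrow> bool \<Rightarrow> path" where
  "normal_path v \<alpha> \<beta> = (vert v, (if \<alpha> then if \<beta> then [Arr (vert v), Bar (vert v)] else [Arr (vert v)]
      else if \<beta> then [Bar (vert (\<not> v))] else []))"

lemma normal_path_in: "normal_path v \<alpha> \<beta> \<in> paths 2"
  by (auto simp: normal_path_def paths_def vert_def arrows_def)

lemma rel_ideal_contains:
  fixes v :: bool
  defines "I \<equiv> (rel_ideal 2 1 :: (path \<Rightarrow> 'k::field) set)"
  shows "path_vec (vert v, [Arr (vert v), Arr (vert (\<not> v))]) \<in> I"
    and "path_vec (vert v, [Bar (vert (\<not> v)), Bar (vert v)]) \<in> I"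
    and "path_vec (vert v, [Arr (vert v), Bar (vert v)]) \<ominus>\<^bsub>PA\<^esub> path_vec (vert v, [Bar (vert (\<not> v)), Arr (vert (\<not> v))]) \<in> I"
proof -
  interpret A: ring "PA :: ('k, path \<Rightarrow> 'k) module" by (rule path_algebra_ring)
  have v: "vert v \<in> {0..<2}" by (simp add: vert_def)
  have sub: "relations 2 1 \<subseteq> I"
    unfolding I_def rel_ideal_def by (rule A.genideal_self[OF relations_closed]) simp
  let ?A = "PA :: ('k, path \<Rightarrow> 'k) module"
  have "path_a 2 (vert v) \<otimes>\<^bsub>?A\<^esub> path_a 2 (vert v + 1) \<in> relations 2 1"
    "path_b 2 (vert v - 1) \<otimes>\<^bsub>?A\<^esub> path_b 2 (vert v - 2) \<in> relations 2 1"
    "(path_a 2 (vert v) \<otimes>\<^bsub>?A\<^esub> path_b 2 (vert v)) [^]\<^bsub>?A\<^esub> (1::nat) \<ominus>\<^bsub>?A\<^esub> (path_b 2 (vert v - 1) \<otimes>\<^bsub>?A\<^esub> path_a 2 (vert v - 1)) [^]\<^bsub>?A\<^esub> (1::nat) \<in> relations 2 1"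
    unfolding relations_def Let_def using v by blast+
  moreover have "path_a 2 (vert v) \<otimes>\<^bsub>?A\<^esub> path_a 2 (vert v + 1) = path_vec (vert v, [Arr (vert v), Arr (vert (\<not> v))])"
    "path_b 2 (vert v - 1) \<otimes>\<^bsub>?A\<^esub> path_b 2 (vert v - 2) = path_vec (vert v, [Bar (vert (\<not> v)), Bar (vert v)])"
    "path_a 2 (vert v) \<otimes>\<^bsub>?A\<^esub> path_b 2 (vert v) = path_vec (vert v, [Arr (vert v), Bar (vert v)])"
    "path_b 2 (vert v - 1) \<otimes>\<^bsub>?A\<^esub> path_a 2 (vert v - 1) = path_vec (vert v, [Bar (vert (\<not> v)), Arr (vert (\<not> v))])"
    by (simp_all add: path_a_def path_b_def path_vec_mult path_tgt_def vert_def)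
  moreover have "path_vec (vert v, [Arr (vert v), Bar (vert v)]) \<in> carrier ?A"
    "path_vec (vert v, [Bar (vert (\<not> v)), Arr (vert (\<not> v))]) \<in> carrier ?A"
    by (auto intro!: path_vec_closed simp: paths_def arrows_def vert_def)
  ultimately show "path_vec (vert v, [Arr (vert v), Arr (vert (\<not> v))]) \<in> I"
    and "path_vec (vert v, [Bar (vert (\<not> v)), Bar (vert v)]) \<in> I"
    and "path_vec (vert v, [Arr (vert v), Bar (vert v)]) \<ominus>\<^bsub>PA\<^esub> path_vec (vert v, [Bar (vert (\<not> v)), Arr (vert (\<not> v))]) \<in> I"
    using sub by (simp_all only: A.nat_pow_eone subset_eq)
qed

text \<open>Only the first three arrows matter, since the rest multiplies from the right. If two
  neighbours among them have the same type, a zero relation applies directly. The alternating words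
  aba and bab are exchanged, by the commutation relation on their first two arrows, for baa and abb,
  which contain a repeated type.\<close>

lemma long_path_in_rel_ideal:
  assumes "(i, w) \<in> paths 2" "length w \<ge> 3"
  shows "path_vec (i, w) \<in> (rel_ideal 2 1 :: (path \<Rightarrow> 'k::field) set)"
proof -
  interpret A: ring "PA :: ('k, path \<Rightarrow> 'k) module" by (rule path_algebra_ring)
  interpret I: ideal "rel_ideal 2 1" "PA :: ('k, path \<Rightarrow> 'k) module" by (rule rel_ideal) simp
  let ?I = "rel_ideal 2 1 :: (path \<Rightarrow> 'k) set"
  have left: "path_vec (i, u @ w) \<in> ?I" if "path_vec (j, w) \<in> ?I" "(i, u) \<in> paths 2" "path_tgt 2 (i, u) = j" for i j u w
    using I.I_l_closed[OF that(1) path_vec_closed[OF that(2)]] that(3) by (simp add: path_vec_mult)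
  have right: "path_vec (i, u @ w) \<in> ?I" if "path_vec (i, u) \<in> ?I" "(j, w) \<in> paths 2" "path_tgt 2 (i, u) = j" for i j u w
    using I.I_r_closed[OF that(1) path_vec_closed[OF that(2)]] that(3) by (simp add: path_vec_mult)
  let ?A = "PA :: ('k, path \<Rightarrow> 'k) module"
  have swap: "path_vec (i, u @ w) \<in> ?I \<longleftrightarrow> path_vec (i, u' @ w) \<in> ?I"
    if d: "path_vec (i, u) \<ominus>\<^bsub>PA\<^esub> path_vec (i, u') \<in> ?I" and "(i, u) \<in> paths 2" "(i, u') \<in> paths 2" "(j, w) \<in> paths 2"
      "path_tgt 2 (i, u) = j" "path_tgt 2 (i, u') = j" for i j u u' w
  proof -
    have c: "path_vec (i, u) \<in> carrier ?A" "path_vec (i, u') \<in> carrier ?A" "path_vec (j, w) \<in> carrier ?A"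
      using that path_vec_closed by blast+
    have "(path_vec (i, u) \<ominus>\<^bsub>PA\<^esub> path_vec (i, u')) \<otimes>\<^bsub>PA\<^esub> path_vec (j, w) \<in> ?I"
      by (rule I.I_r_closed[OF d c(3)])
    then have "path_vec (i, u) \<otimes>\<^bsub>PA\<^esub> path_vec (j, w) \<ominus>\<^bsub>PA\<^esub> path_vec (i, u') \<otimes>\<^bsub>PA\<^esub> path_vec (j, w) \<in> ?I"
      using c by (simp add: A.minus_eq A.l_distr A.l_minus)
    moreover have c': "path_vec (i, u) \<otimes>\<^bsub>PA\<^esub> path_vec (j, w) \<in> carrier ?A" "path_vec (i, u') \<otimes>\<^bsub>PA\<^esub> path_vec (j, w) \<in> carrier ?A"
      using c by simp_all
    ultimately have "path_vec (i, u) \<otimes>\<^bsub>PA\<^esub> path_vec (j, w) \<in> ?I \<longleftrightarrow> path_vec (i, u') \<otimes>\<^bsub>PA\<^esub> path_vec (j, w) \<in> ?I"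
      by (intro I.diff_mem_iff)
    then show ?thesis using that by (simp add: path_vec_mult)
  qed
  obtain x y z w' where w: "w = [x, y, z] @ w'"
    using assms(2) by (auto simp: numeral_3_eq_3 Suc_le_length_iff)
  obtain v where v: "i = vert v" using assms(1) vert_cases by (auto simp: paths_def)
  have walk3: "walk 2 i [x, y, z]" and rest: "(path_tgt 2 (i, [x, y, z]), w') \<in> paths 2"
    using assms(1) walk_append[of 2 i "[x, y, z]" w'] walk_tgt_range[of 2 i "[x, y, z]"]
    unfolding w by (auto simp: paths_def)
  have "path_vec (i, [x, y, z]) \<in> ?I"
  proof -
    note r1 = rel_ideal_contains(1) and r2 = rel_ideal_contains(2)
    have p: "(vert v, [Arr (vert v)]) \<in> paths 2" "(vert v, [Bar (vert (\<not> v))]) \<in> paths 2"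
      "(vert v, [Arr (vert v), Bar (vert v)]) \<in> paths 2" "(vert v, [Bar (vert (\<not> v)), Arr (vert (\<not> v))]) \<in> paths 2" for v
      by (auto simp: paths_def arrows_def vert_def)
    have t: "path_tgt 2 (vert v, [Arr (vert v)]) = vert (\<not> v)" "path_tgt 2 (vert v, [Bar (vert (\<not> v))]) = vert (\<not> v)"
      "path_tgt 2 (vert v, [Arr (vert v), Bar (vert v)]) = vert v" "path_tgt 2 (vert v, [Bar (vert (\<not> v)), Arr (vert (\<not> v))]) = vert v"
      "path_tgt 2 (vert v, [Arr (vert v), Arr (vert (\<not> v))]) = vert v"
      "path_tgt 2 (vert v, [Bar (vert (\<not> v)), Bar (vert v)]) = vert v" for v
      by (auto simp: path_tgt_def vert_def)
    have aaa: "path_vec (vert v, [Arr (vert v), Arr (vert (\<not> v)), y]) \<in> ?I" if "(vert v, [y]) \<in> paths 2" for v y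
      using right[OF r1 that] t by simp
    have bbb: "path_vec (vert v, [Bar (vert (\<not> v)), Bar (vert v), y]) \<in> ?I" if "(vert v, [y]) \<in> paths 2" for v y
      using right[OF r2 that] t by simp
    have abb: "path_vec (vert v, [Arr (vert v), Bar (vert v), Bar (vert (\<not> v))]) \<in> ?I" for v
      using left[OF r2[of "\<not> v"] p(1)[of v]] t by simp
    have baa: "path_vec (vert v, [Bar (vert (\<not> v)), Arr (vert (\<not> v)), Arr (vert v)]) \<in> ?I" for v
      using left[OF r1[of "\<not> v"] p(2)[of v]] t by simp
    have aba: "path_vec (vert v, [Arr (vert v), Bar (vert v), Arr (vert v)]) \<in> ?I" for v
      using swap[OF rel_ideal_contains(3) p(3,4) p(1) t(3,4), of v] baa[of v] by simp
    have bab: "path_vec (vert v, [Bar (vert (\<not> v)), Arr (vert (\<not> v)), Bar (vert (\<not> v))]) \<in> ?I" for v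
      using swap[OF rel_ideal_contains(3) p(3,4) p(2) t(3,4), of v] abb[of v] by simp
    show ?thesis
    proof -
      have step: "x \<in> arrows 2 \<Longrightarrow> arrow_src 2 x = vert v \<Longrightarrow>
          (x = Arr (vert v) \<or> x = Bar (vert (\<not> v))) \<and> arrow_tgt 2 x = vert (\<not> v)" for x v
      proof -
        have "{0..<2::int} = {0, 1}" by auto
        then show "x \<in> arrows 2 \<Longrightarrow> arrow_src 2 x = vert v \<Longrightarrow>
          (x = Arr (vert v) \<or> x = Bar (vert (\<not> v))) \<and> arrow_tgt 2 x = vert (\<not> v)"
          by (cases v) (auto simp: arrows_def vert_def)
      qed
      have x: "(x = Arr (vert v) \<or> x = Bar (vert (\<not> v))) \<and> arrow_tgt 2 x = vert (\<not> v)"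
        using walk3 v by (intro step) auto
      then have y: "(y = Arr (vert (\<not> v)) \<or> y = Bar (vert v)) \<and> arrow_tgt 2 y = vert v"
        using walk3 step[of y "\<not> v"] by auto
      then have z: "z = Arr (vert v) \<or> z = Bar (vert (\<not> v))"
        using walk3 step[of z v] by auto
      have "(vert v, [z]) \<in> paths 2" using z p by blast
      with x y z show ?thesis
        unfolding v using aaa[of v z] bbb[of v z] abb[of v] baa[of v] aba[of v] bab[of v] by metis
    qed
  qed
  then show ?thesis
    unfolding w using right[OF _ rest refl] by simp
qed


lemma path_coord_vec:
  "path_coord (path_vec (normal_path v' \<gamma> \<delta>)) v \<alpha> \<beta> = of_bool (v = v' \<and> \<alpha> = \<gamma> \<and> \<beta> = \<delta>)"
  by (auto simp: path_coord_def path_vec_def normal_path_def vert_def)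

lemma path_coord_lin: "path_coord (\<lambda>p. c * u p + w p) v \<alpha> \<beta> = c * path_coord u v \<alpha> \<beta> + path_coord w v \<alpha> \<beta>"
  by (simp add: path_coord_def algebra_simps)

lemma long_path_coord: "length w \<ge> 3 \<Longrightarrow> path_coord (path_vec (i, w)) v \<alpha> \<beta> = 0"
  by (auto simp: path_coord_def path_vec_def)

definition normal_form :: "(path \<Rightarrow> 'k::field) \<Rightarrow> path \<Rightarrow> 'k" where
  "normal_form f p = (\<Sum>(v, \<alpha>, \<beta>)\<in>UNIV. path_coord f v \<alpha> \<beta> * path_vec (normal_path v \<alpha> \<beta>) p)"

lemma sum_bool3:
  fixes F :: "bool \<Rightarrow> bool \<Rightarrow> bool \<Rightarrow> 'c::comm_monoid_add"
  shows "(\<Sum>(v, \<alpha>, \<beta>)\<in>UNIV. F v \<alpha> \<beta>) = (\<Sum>v\<in>UNIV. \<Sum>\<alpha>\<in>UNIV. \<Sum>\<beta>\<in>UNIV. F v \<alpha> \<beta>)"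
  by (simp add: UNIV_Times_UNIV[symmetric] sum.cartesian_product del: UNIV_Times_UNIV UNIV_bool)

text \<open>By linearity, with induction on a finite set containing the support, it suffices to
  treat one path. A normal path equals its normal form; paths of length at least three and the two
  of length two with a repeated type have normal form zero and lie in the ideal. The only other one
  is the path b a, which the commutation relation makes congruent to the normal path a b.\<close>

lemma normal_form_diff_in_rel_ideal:
  assumes "f \<in> carrier PA"
  shows "(\<lambda>p. f p - normal_form f p) \<in> (rel_ideal 2 1 :: (path \<Rightarrow> 'k::field) set)"
proof -
  let ?A = "PA :: ('k, path \<Rightarrow> 'k) module"
  let ?I = "rel_ideal 2 1 :: (path \<Rightarrow> 'k) set"
  interpret A: ring ?A by (rule path_algebra_ring)
  interpret I: ideal ?I ?A by (rule rel_ideal) simp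
  interpret Q: quotient_of_ring ?I ?A
    by (rule assoc_algebra.quotient_of_ring[OF path_assoc_algebra I.ideal_axioms])
  have vec: "(\<lambda>q. path_vec p q - normal_form (path_vec p) q :: 'k) \<in> ?I" if p: "p \<in> paths 2" for p
  proof (cases "\<exists>v \<alpha> \<beta>. p = normal_path v \<alpha> \<beta>")
    case True
    then obtain v \<alpha> \<beta> where v: "p = normal_path v \<alpha> \<beta>" by blast
    have "(\<lambda>q. path_vec p q - normal_form (path_vec p) q :: 'k) = \<zero>\<^bsub>?A\<^esub>"
      unfolding v normal_form_def sum_bool3 UNIV_bool path_coord_vec
      by (cases v; cases \<alpha>; cases \<beta>) (simp_all add: path_algebra_simps(4))
    then show ?thesis using additive_subgroup.zero_closed[OF I.is_additive_subgroup] by simp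
  next
    case False
    obtain i w where iw: "p = (i, w)" by (cases p)
    obtain v where v: "i = vert v" using p vert_cases iw by (auto simp: paths_def)
    show ?thesis
    proof (cases "length w \<ge> 3")
      case True
      then have "(\<lambda>q. path_vec p q - normal_form (path_vec p) q :: 'k) = path_vec p"
        by (simp add: iw normal_form_def long_path_coord case_prod_unfold)
      then show ?thesis using long_path_in_rel_ideal[of i w] True p iw by simp
    next
      case short: False
      have two: "{0..<2::int} = {0, 1}" by auto
      have "w = [Arr (vert v), Arr (vert (\<not> v))] \<or> w = [Bar (vert (\<not> v)), Bar (vert v)]
          \<or> w = [Bar (vert (\<not> v)), Arr (vert (\<not> v))]"
      proof -
        consider "w = []" | x where "w = [x]" | x y where "w = [x, y]"
          using short by (cases w; cases "tl w"; cases "tl (tl w)") auto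
        then show ?thesis
        proof cases
          case 1
          moreover have "p \<noteq> normal_path v False False" using False by blast
          ultimately show ?thesis using iw v by (auto simp: normal_path_def)
        next
          case (2 x)
          then have "w = [Arr (vert v)] \<or> w = [Bar (vert (\<not> v))]"
            using p iw v by (cases v) (auto simp: paths_def arrows_def two vert_def)
          moreover have "p \<noteq> normal_path v True False" "p \<noteq> normal_path v False True" using False by blast+
          ultimately show ?thesis using iw v by (auto simp: normal_path_def)
        next
          case (3 x y)
          then have "w = [Arr (vert v), Bar (vert v)] \<or> w = [Arr (vert v), Arr (vert (\<not> v))] \<or> w = [Bar (vert (\<not> v)), Bar (vert v)]
             \<or> w = [Bar (vert (\<not> v)), Arr (vert (\<not> v))]"
            using p iw v by (cases v) (auto simp: paths_def arrows_def two vert_def)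
          moreover have "p \<noteq> normal_path v True True" using False by blast
          ultimately show ?thesis using iw v by (auto simp: normal_path_def)
        qed
      qed
      then show ?thesis
      proof (elim disjE)
        assume w: "w = [Arr (vert v), Arr (vert (\<not> v))]"
        have "(\<lambda>q. path_vec p q - normal_form (path_vec p) q :: 'k) = path_vec p"
          by (auto simp: iw v w normal_form_def path_coord_def path_vec_def vert_def case_prod_unfold intro!: ext sum.neutral)
        then show ?thesis using rel_ideal_contains(1)[of v] iw v w by simp
      next
        assume w: "w = [Bar (vert (\<not> v)), Bar (vert v)]"
        have "(\<lambda>q. path_vec p q - normal_form (path_vec p) q :: 'k) = path_vec p"
          by (auto simp: iw v w normal_form_def path_coord_def path_vec_def vert_def case_prod_unfold intro!: ext sum.neutral)
        then show ?thesis using rel_ideal_contains(2)[of v] iw v w by simp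
      next
        assume w: "w = [Bar (vert (\<not> v)), Arr (vert (\<not> v))]"
        let ?n = "path_vec (vert v, [Arr (vert v), Bar (vert v)]) :: path \<Rightarrow> 'k"
        have c: "?n \<in> carrier ?A" "path_vec p \<in> carrier ?A"
          using path_vec_closed[OF normal_path_in[of v True True]] path_vec_closed[OF p] by (simp_all add: normal_path_def)
        have pc: "path_coord (path_vec p) v' \<alpha> \<beta> = (of_bool (v' = v \<and> \<alpha> \<and> \<beta>) :: 'k)" for v' \<alpha> \<beta>
          by (auto simp: iw v w path_coord_def path_vec_def vert_def)
        have "normal_form (path_vec p) = ?n"
          unfolding normal_form_def sum_bool3 UNIV_bool pc
          by (cases v) (simp_all add: normal_path_def fun_eq_iff)
        moreover have e: "?n \<ominus>\<^bsub>?A\<^esub> path_vec p = (\<lambda>q. ?n q - path_vec p q)"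
          using c by (simp add: a_minus_def path_minus path_algebra_simps(5))
        have m: "?n \<ominus>\<^bsub>?A\<^esub> path_vec p \<in> ?I"
          using rel_ideal_contains(3)[of v] by (simp add: iw v w)
        have "\<ominus>\<^bsub>?A\<^esub> (?n \<ominus>\<^bsub>?A\<^esub> path_vec p) = (\<lambda>q. path_vec p q - ?n q)"
          using path_minus[OF A.minus_closed[OF c]] by (simp add: e)
        ultimately show ?thesis
          using additive_subgroup.a_inv_closed[OF I.is_additive_subgroup m] by simp
      qed
    qed
  qed
  have "finite {p. f p \<noteq> 0}" "{p. f p \<noteq> 0} \<subseteq> paths 2"
    using assms by (simp_all add: path_algebra_simps(1))
  moreover have "(\<lambda>p. h p - normal_form h p) \<in> ?I" if "finite S" "S \<subseteq> paths 2" "{p. h p \<noteq> 0} \<subseteq> S"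
    for S :: "path set" and h :: "path \<Rightarrow> 'k"
    using that
  proof (induction S arbitrary: h rule: finite_induct)
    case empty
    then have "h = \<zero>\<^bsub>?A\<^esub>" by (auto simp: path_algebra_simps(4))
    then have "(\<lambda>p. h p - normal_form h p) = \<zero>\<^bsub>?A\<^esub>"
      by (simp add: path_algebra_simps(4) normal_form_def path_coord_def sum_bool3 UNIV_bool)
    then show ?case using additive_subgroup.zero_closed[OF I.is_additive_subgroup] by simp
  next
    case (insert s S)
    let ?v = "\<lambda>q. path_vec s q - normal_form (path_vec s) q"
    define c g where "c = h s" and "g = h(s := 0)"
    have IH: "(\<lambda>p. g p - normal_form g p) \<in> ?I"
      by (rule insert.IH) (use insert.prems in \<open>auto simp: g_def\<close>)
    have h: "h = (\<lambda>p. c * path_vec s p + g p)" by (auto simp: path_vec_def c_def g_def)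
    have "normal_form h = (\<lambda>p. c * normal_form (path_vec s) p + normal_form g p)"
    proof
      fix p
      show "normal_form h p = c * normal_form (path_vec s) p + normal_form g p"
        unfolding h normal_form_def sum_bool3 UNIV_bool path_coord_lin by (simp add: algebra_simps)
    qed
    then have "(\<lambda>p. h p - normal_form h p) = (c \<odot>\<^bsub>?A\<^esub> ?v) \<oplus>\<^bsub>?A\<^esub> (\<lambda>p. g p - normal_form g p)"
      unfolding h by (simp add: path_algebra_simps(5,6) algebra_simps)
    moreover have "c \<odot>\<^bsub>?A\<^esub> ?v \<in> ?I"
      by (rule Q.smult_ideal[OF vec]) (use insert.prems in auto)
    then have "(c \<odot>\<^bsub>?A\<^esub> ?v) \<oplus>\<^bsub>?A\<^esub> (\<lambda>p. g p - normal_form g p) \<in> ?I"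
      by (rule additive_subgroup.a_closed[OF I.is_additive_subgroup _ IH])
    ultimately show ?case by (simp only:)
  qed
  ultimately show ?thesis by blast
qed

lemma path_kernel_eq: "path_kernel = (rel_ideal 2 1 :: (path \<Rightarrow> 'k::field) set)"
proof
  show "path_kernel \<subseteq> (rel_ideal 2 1 :: (path \<Rightarrow> 'k) set)"
  proof
    fix f :: "path \<Rightarrow> 'k" assume f: "f \<in> path_kernel"
    then have "(\<lambda>p. f p - normal_form f p) = f"
      by (simp add: path_kernel_def normal_form_def case_prod_unfold)
    then show "f \<in> rel_ideal 2 1"
      using normal_form_diff_in_rel_ideal[of f] f by (simp add: path_kernel_def)
  qed
qed (rule rel_ideal_sub_kernel)

text \<open>\<open>lam_coord x v \<alpha> \<beta>\<close> is the coefficient in \<open>x\<close> of the path from the vertex \<open>v\<close> (a parity) with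
  \<open>\<alpha>\<close> arrows of type \<open>a\<close> and \<open>\<beta>\<close> arrows of type \<open>\<open>a\<close>-bar\<close>.\<close>

definition lam_coord :: "'k::field lam \<Rightarrow> bool \<Rightarrow> bool \<Rightarrow> bool \<Rightarrow> 'k" where
  "lam_coord x = path_coord (SOME f. f \<in> x)"

abbreviation "LA \<equiv> Lam 2 1"

section \<open>The normal paths as a basis of the quotient algebra\<close>

lemma lam_coord_coset:
  fixes f :: "path \<Rightarrow> 'k::field"
  assumes "f \<in> carrier PA"
  shows "lam_coord (rel_ideal 2 1 +>\<^bsub>PA\<^esub> f) = path_coord f"
proof -
  interpret I: ideal "rel_ideal 2 1" "PA :: ('k, path \<Rightarrow> 'k) module" by (rule rel_ideal) simp
  interpret Q: quotient_of_ring "rel_ideal 2 1" "PA :: ('k, path \<Rightarrow> 'k) module"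
    by (rule assoc_algebra.quotient_of_ring[OF path_assoc_algebra I.ideal_axioms])
  have ex: "f \<in> rel_ideal 2 1 +>\<^bsub>PA\<^esub> f"
    using assms additive_subgroup.zero_closed[OF I.is_additive_subgroup] 
    by (auto simp: a_r_coset_def' path_algebra_simps(4,5) intro!: bexI[of _ "\<zero>\<^bsub>PA\<^esub>"])
  have "path_coord g = path_coord f" if g: "g \<in> rel_ideal 2 1 +>\<^bsub>PA\<^esub> f" for g
  proof -
    obtain h where h: "h \<in> rel_ideal 2 1" "g = h \<oplus>\<^bsub>PA\<^esub> f" using Q.coset_memD[OF assms g] by auto
    have "h \<in> path_kernel" using h(1) by (simp only: path_kernel_eq)
    then have "path_coord h v \<alpha> \<beta> = 0" for v \<alpha> \<beta> unfolding path_kernel_def by blast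
    then have "path_coord (h \<oplus>\<^bsub>PA\<^esub> f) v \<alpha> \<beta> = path_coord f v \<alpha> \<beta>" for v \<alpha> \<beta>
      by (simp only: path_coord_add add_0)
    then show ?thesis unfolding h(2) by blast
  qed
  from this[OF someI[of "\<lambda>g. g \<in> rel_ideal 2 1 +>\<^bsub>PA\<^esub> f", OF ex]] show ?thesis
    unfolding lam_coord_def .
qed

lemma Lam_quotient: "quotient_of_ring (rel_ideal 2 1) PA"
  by (rule assoc_algebra.quotient_of_ring[OF path_assoc_algebra rel_ideal]) simp

lemma Lam_carrierE:
  assumes "x \<in> carrier LA"
  obtains f where "f \<in> carrier PA" "x = rel_ideal 2 1 +>\<^bsub>PA\<^esub> f"
  using assms by (auto simp: Lam_def quotient_of_ring.carrier_quotient[OF Lam_quotient])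

lemma Lam_assoc: "assoc_algebra LA"
  by (rule Lam_assoc_algebra) simp

lemma lam_coord_mult:
  assumes "x \<in> carrier LA" "y \<in> carrier LA"
  shows "lam_coord (x \<otimes>\<^bsub>LA\<^esub> y) = coord_mult (lam_coord x) (lam_coord y)"
  using assms by (elim Lam_carrierE)
    (simp add: Lam_def quotient_of_ring.quotient_mult[OF Lam_quotient] lam_coord_coset path_mult_closed path_coord_mult)

lemma lam_coord_add:
  assumes "x \<in> carrier LA" "y \<in> carrier LA"
  shows "lam_coord (x \<oplus>\<^bsub>LA\<^esub> y) v \<alpha> \<beta> = lam_coord x v \<alpha> \<beta> + lam_coord y v \<alpha> \<beta>"
  using assms by (elim Lam_carrierE)
    (simp add: ring.ring_simprules(1)[OF path_algebra_ring] Lam_def quotient_of_ring.quotient_add[OF Lam_quotient] lam_coord_coset path_coord_add)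

lemma lam_coord_smult:
  assumes "x \<in> carrier LA"
  shows "lam_coord (c \<odot>\<^bsub>LA\<^esub> x) v \<alpha> \<beta> = c * lam_coord x v \<alpha> \<beta>"
  using assms by (elim Lam_carrierE)
    (simp add: assoc_algebra.smult_closed[OF path_assoc_algebra] Lam_def quotient_of_ring.quotient_smult[OF Lam_quotient] lam_coord_coset path_coord_smult)

lemma lam_coord_one: "lam_coord \<one>\<^bsub>LA\<^esub> v \<alpha> \<beta> = of_bool (\<not> \<alpha> \<and> \<not> \<beta>)"
  by (simp add: Lam_def quotient_of_ring.quotient_one[OF Lam_quotient] lam_coord_coset path_one_closed path_coord_one)

lemma lam_coord_zero: "lam_coord \<zero>\<^bsub>LA\<^esub> v \<alpha> \<beta> = (0 :: 'k::field)"
proof -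
  interpret L: assoc_algebra "LA :: ('k, 'k lam) module" by (rule Lam_assoc)
  show ?thesis
    using lam_coord_add[OF L.zero_closed L.zero_closed, of v \<alpha> \<beta>] L.l_zero[OF L.zero_closed]
      add_cancel_right_right by metis
qed

lemma lam_gens_closed:
  "lam_e 2 1 i \<in> carrier LA" "lam_a 2 1 i \<in> carrier LA" "lam_b 2 1 i \<in> carrier LA"
  by (auto simp: Lam_def lam_e_def lam_a_def lam_b_def quotient_of_ring.carrier_quotient[OF Lam_quotient]
      path_e_closed path_a_closed path_b_closed)

lemma lam_coord_gens:
  "lam_coord (lam_e 2 1 i) v \<alpha> \<beta> = of_bool (v = odd i \<and> \<not> \<alpha> \<and> \<not> \<beta>)"
  "lam_coord (lam_a 2 1 i) v \<alpha> \<beta> = of_bool (v = odd i \<and> \<alpha> \<and> \<not> \<beta>)"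
  "lam_coord (lam_b 2 1 i) v \<alpha> \<beta> = of_bool (v = even i \<and> \<not> \<alpha> \<and> \<beta>)"
  by (simp_all add: lam_e_def lam_a_def lam_b_def lam_coord_coset path_e_closed path_a_closed path_b_closed path_coord_gens)

lemma lam_coord_inj:
  assumes "x \<in> carrier LA" "y \<in> carrier LA" "\<And>v \<alpha> \<beta>. lam_coord x v \<alpha> \<beta> = lam_coord y v \<alpha> \<beta>"
  shows "x = y"
proof -
  obtain f where f: "f \<in> carrier PA" "x = rel_ideal 2 1 +>\<^bsub>PA\<^esub> f" by (rule Lam_carrierE[OF assms(1)])
  obtain g where g: "g \<in> carrier PA" "y = rel_ideal 2 1 +>\<^bsub>PA\<^esub> g" by (rule Lam_carrierE[OF assms(2)])
  have "f \<ominus>\<^bsub>PA\<^esub> g \<in> path_kernel"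
    using assms(3) f g ring.ring_simprules(4)[OF path_algebra_ring f(1) g(1)]
    by (simp add: path_kernel_def path_coord_diff lam_coord_coset)
  then show ?thesis
    using f g by (simp add: path_kernel_eq quotient_of_ring.coset_eq_iff[OF Lam_quotient])
qed

text \<open>With \<open>lam_coord_inj\<close> this identifies the algebra with the functions on the
  eight normal paths. It is the source of existence wherever an element, such as
  \<open>lam_mon\<close> or a value of \<open>aug_map\<close>, is specified by its
  coordinates.\<close>

lemma lam_coord_surj: "\<exists>x\<in>carrier LA. \<forall>v \<alpha> \<beta>. lam_coord x v \<alpha> \<beta> = c v \<alpha> \<beta>"
proof -
  define f where "f p = (\<Sum>(v, \<alpha>, \<beta>)\<in>UNIV. c v \<alpha> \<beta> * path_vec (normal_path v \<alpha> \<beta>) p)" for p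
  have f: "f \<in> carrier PA"
  proof -
    have "(\<lambda>p. c v \<alpha> \<beta> * path_vec (normal_path v \<alpha> \<beta>) p) \<in> carrier PA" for v \<alpha> \<beta>
      by (rule path_smult_closed[OF path_vec_closed[OF normal_path_in]])
    then show ?thesis
      unfolding f_def[abs_def] sum_bool3 UNIV_bool by (simp add: path_add_closed)
  qed
  have "path_coord f v \<alpha> \<beta> = c v \<alpha> \<beta>" for v \<alpha> \<beta>
    by (cases v; cases \<alpha>; cases \<beta>)
       (simp_all add: path_coord_def f_def[abs_def] sum_bool3 UNIV_bool path_vec_def normal_path_def vert_def)
  then show ?thesis
    using f by (intro bexI[of _ "rel_ideal 2 1 +>\<^bsub>PA\<^esub> f"])
      (auto simp: lam_coord_coset Lam_def quotient_of_ring.carrier_quotient[OF Lam_quotient])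
qed

section \<open>The terms of the resolution\<close>

lemma tensor_spaceE:
  assumes "t \<in> tensor_space A V W"
  obtains n x y where "\<And>k::nat. k < n \<Longrightarrow> x k \<in> V \<and> y k \<in> W"
    "t = (\<lambda>\<beta>. \<Sum>k<n. tensor A (x k) (y k) \<beta>)"
proof -
  from assms obtain n :: nat and x y where "\<forall>k<n. x k \<in> V \<and> y k \<in> W"
    and "t = (\<lambda>\<beta>. \<Sum>k<n. tensor A (x k) (y k) \<beta>)"
    unfolding tensor_space_def by blast
  then show thesis by (intro that[of n x y]) simp_all
qed

lemma tensor_space_evalE:
  assumes "t \<in> tensor_space A V W"
  obtains n x y where "\<And>k::nat. k < n \<Longrightarrow> x k \<in> V \<and> y k \<in> W"
    "\<And>\<beta>. \<beta> \<in> bilinear_forms A \<Longrightarrow> t \<beta> = (\<Sum>k<n. \<beta> (x k) (y k))"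
proof -
  obtain n x y where "\<And>k::nat. k < n \<Longrightarrow> x k \<in> V \<and> y k \<in> W"
    "t = (\<lambda>\<beta>. \<Sum>k<n. tensor A (x k) (y k) \<beta>)"
    by (rule tensor_spaceE[OF assms]) (rule that)
  then show thesis by (intro that[of n x y]) (simp_all add: tensor_def)
qed

lemma tensor_spaceI:
  assumes "\<And>k::nat. k < n \<Longrightarrow> x k \<in> V" "\<And>k. k < n \<Longrightarrow> y k \<in> W"
    and "\<And>\<beta>. t \<beta> = (\<Sum>k<n. tensor A (x k) (y k) \<beta>)"
  shows "t \<in> tensor_space A V W"
  unfolding tensor_space_def using assms
  by (intro CollectI exI[of _ n] exI[of _ x] exI[of _ y]) (simp add: fun_eq_iff)

lemma tensor_space_outside:
  assumes "t \<in> tensor_space A V W" "\<beta> \<notin> bilinear_forms A"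
  shows "t \<beta> = 0"
  using assms by (elim tensor_spaceE) (simp add: tensor_def)

lemma tensor_in_space: "x \<in> V \<Longrightarrow> y \<in> W \<Longrightarrow> tensor A x y \<in> tensor_space A V W"
  unfolding tensor_space_def by (rule CollectI, rule exI[of _ 1], rule exI[of _ "\<lambda>_. x"], rule exI[of _ "\<lambda>_. y"]) auto

lemma tensor_space_zero: "(\<lambda>_. 0) \<in> tensor_space A V W"
  unfolding tensor_space_def by (rule CollectI, rule exI[of _ 0]) auto

lemma tensor_space_add:
  assumes "t \<in> tensor_space A V W" "u \<in> tensor_space A V W"
  shows "(\<lambda>\<beta>. t \<beta> + u \<beta>) \<in> tensor_space A V W"
proof -
  obtain n x y where t: "\<And>k::nat. k < n \<Longrightarrow> x k \<in> V \<and> y k \<in> W" "t = (\<lambda>\<beta>. \<Sum>k<n. tensor A (x k) (y k) \<beta>)"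
    by (rule tensor_spaceE[OF assms(1)]) (rule that)
  obtain m x' y' where u: "\<And>k::nat. k < m \<Longrightarrow> x' k \<in> V \<and> y' k \<in> W" "u = (\<lambda>\<beta>. \<Sum>k<m. tensor A (x' k) (y' k) \<beta>)"
    by (rule tensor_spaceE[OF assms(2)]) (rule that)
  let ?x = "\<lambda>k. if k < n then x k else x' (k - n)" and ?y = "\<lambda>k. if k < n then y k else y' (k - n)"
  have "t \<beta> + u \<beta> = (\<Sum>k<n + m. tensor A (?x k) (?y k) \<beta>)" for \<beta>
  proof -
    have "{..<n + m} = {..<n} \<union> (\<lambda>k. n + k) ` {..<m}"
      by (auto simp: image_iff intro: bexI[of _ "_ - n"]) (metis add_diff_inverse_nat lessThan_iff nat_add_left_cancel_less)
    moreover have "(\<Sum>k\<in>(\<lambda>k. n + k) ` {..<m}. tensor A (?x k) (?y k) \<beta>) = (\<Sum>k<m. tensor A (x' k) (y' k) \<beta>)"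
      by (subst sum.reindex) auto
    moreover have "(\<Sum>k<n. tensor A (?x k) (?y k) \<beta>) = (\<Sum>k<n. tensor A (x k) (y k) \<beta>)"
      by (intro sum.cong) auto
    ultimately show ?thesis
      by (simp only: t(2) u(2)) (subst sum.union_disjoint, auto)
  qed
  then show ?thesis
    by (rule tensor_spaceI[where x = ?x and y = ?y, rotated 2]) (use t(1) u(1) in auto)
qed

lemma tensor_space_sum:
  assumes "finite S" "\<And>s. s \<in> S \<Longrightarrow> t s \<in> tensor_space A V W"
  shows "(\<lambda>\<beta>. \<Sum>s\<in>S. t s \<beta>) \<in> tensor_space A V W"
  using assms by (induction S rule: finite_induct) (auto simp: tensor_space_zero tensor_space_add)

text \<open>Evaluating a tensor at the pullback of a form along p and q is the action of p tensor q
  in this representation. Both bimodule actions are instances, with the identity on the other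
  side.\<close>

lemma tensor_space_map:
  assumes "t \<in> tensor_space A V W" "\<And>x. x \<in> V \<Longrightarrow> p x \<in> V'" "\<And>y. y \<in> W \<Longrightarrow> q y \<in> W'"
    and "\<And>\<beta>. \<beta> \<in> bilinear_forms A \<Longrightarrow> (\<lambda>x y. \<beta> (p x) (q y)) \<in> bilinear_forms A"
  shows "(\<lambda>\<beta>. if \<beta> \<in> bilinear_forms A then t (\<lambda>x y. \<beta> (p x) (q y)) else 0) \<in> tensor_space A V' W'"
proof -
  obtain n x y where t: "\<And>k::nat. k < n \<Longrightarrow> x k \<in> V \<and> y k \<in> W"
    "\<And>\<beta>. \<beta> \<in> bilinear_forms A \<Longrightarrow> t \<beta> = (\<Sum>k<n. \<beta> (x k) (y k))"
    by (rule tensor_space_evalE[OF assms(1)]) (rule that)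
  have "(\<lambda>\<beta>. if \<beta> \<in> bilinear_forms A then t (\<lambda>x y. \<beta> (p x) (q y)) else 0)
     = (\<lambda>\<beta>. \<Sum>k<n. tensor A (p (x k)) (q (y k)) \<beta>)"
    using t(2) assms(4) by (auto simp: tensor_def)
  then show ?thesis
    unfolding tensor_space_def using t(1) assms(2,3) by (intro CollectI exI conjI) auto
qed

lemma tensor_space_eqI:
  assumes "t \<in> tensor_space A V W" "u \<in> tensor_space A V W"
    and "\<And>\<beta>. \<beta> \<in> bilinear_forms A \<Longrightarrow> t \<beta> = u \<beta>"
  shows "t = u"
proof
  fix \<beta>
  show "t \<beta> = u \<beta>"
    using tensor_space_outside[OF assms(1)] tensor_space_outside[OF assms(2)] assms(3)
    by (cases "\<beta> \<in> bilinear_forms A") auto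
qed

lemma tensor_space_cong:
  assumes "t \<in> tensor_space A V W" "\<beta> \<in> bilinear_forms A" "\<beta>' \<in> bilinear_forms A"
    and "\<And>x y. x \<in> V \<Longrightarrow> y \<in> W \<Longrightarrow> \<beta> x y = \<beta>' x y"
  shows "t \<beta> = t \<beta>'"
proof -
  obtain n x y where t: "\<And>k::nat. k < n \<Longrightarrow> x k \<in> V \<and> y k \<in> W"
    "\<And>\<beta>. \<beta> \<in> bilinear_forms A \<Longrightarrow> t \<beta> = (\<Sum>k<n. \<beta> (x k) (y k))"
    by (rule tensor_space_evalE[OF assms(1)]) (rule that)
  then show ?thesis using assms by (auto intro!: sum.cong)
qed

text \<open>A functional on forms need not be linear or depend only on values on V and W; one that
  is a sum of pure tensors does both. This is how identities between forms on the algebra become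
  identities between elements of the resolution.\<close>

lemma tensor_space_lin:
  assumes "t \<in> tensor_space A V W" "\<beta> \<in> bilinear_forms A" "\<beta>' \<in> bilinear_forms A" "\<beta>'' \<in> bilinear_forms A"
    and "\<And>x y. x \<in> V \<Longrightarrow> y \<in> W \<Longrightarrow> \<beta> x y = c * \<beta>' x y + c' * \<beta>'' x y"
  shows "t \<beta> = c * t \<beta>' + c' * t \<beta>''"
proof -
  obtain n x y where t: "\<And>k::nat. k < n \<Longrightarrow> x k \<in> V \<and> y k \<in> W"
    "\<And>\<beta>. \<beta> \<in> bilinear_forms A \<Longrightarrow> t \<beta> = (\<Sum>k<n. \<beta> (x k) (y k))"
    by (rule tensor_space_evalE[OF assms(1)]) (rule that)
  then have "t \<beta> = (\<Sum>k<n. c * \<beta>' (x k) (y k) + c' * \<beta>'' (x k) (y k))"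
    using assms by (auto intro!: sum.cong)
  then show ?thesis
    using t(2) assms(3,4) by (simp add: sum.distrib sum_distrib_left)
qed

context assoc_algebra
begin

lemma bilinear_formI:
  assumes "\<And>x y z. \<lbrakk>x \<in> carrier A; y \<in> carrier A; z \<in> carrier A\<rbrakk> \<Longrightarrow> \<beta> (x \<oplus> y) z = \<beta> x z + \<beta> y z"
    and "\<And>x y z. \<lbrakk>x \<in> carrier A; y \<in> carrier A; z \<in> carrier A\<rbrakk> \<Longrightarrow> \<beta> z (x \<oplus> y) = \<beta> z x + \<beta> z y"
    and "\<And>c x y. \<lbrakk>x \<in> carrier A; y \<in> carrier A\<rbrakk> \<Longrightarrow> \<beta> (c \<odot> x) y = c * \<beta> x y"
    and "\<And>c x y. \<lbrakk>x \<in> carrier A; y \<in> carrier A\<rbrakk> \<Longrightarrow> \<beta> x (c \<odot> y) = c * \<beta> x y"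
  shows "\<beta> \<in> bilinear_forms A"
  using assms by (simp add: bilinear_forms_def)

lemma bilinear_formD:
  assumes "\<beta> \<in> bilinear_forms A" "x \<in> carrier A" "y \<in> carrier A"
  shows "z \<in> carrier A \<Longrightarrow> \<beta> (x \<oplus> y) z = \<beta> x z + \<beta> y z"
    and "z \<in> carrier A \<Longrightarrow> \<beta> z (x \<oplus> y) = \<beta> z x + \<beta> z y"
    and "\<beta> (c \<odot> x) y = c * \<beta> x y" and "\<beta> x (c \<odot> y) = c * \<beta> x y"
  using assms by (simp_all add: bilinear_forms_def)

lemma bilinear_form_lmult: "\<beta> \<in> bilinear_forms A \<Longrightarrow> l \<in> carrier A \<Longrightarrow> (\<lambda>x y. \<beta> (l \<otimes> x) y) \<in> bilinear_forms A"
  by (rule bilinear_formI) (simp_all add: bilinear_formD r_distr smult_mult_right)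

lemma bilinear_form_rmult: "\<beta> \<in> bilinear_forms A \<Longrightarrow> l \<in> carrier A \<Longrightarrow> (\<lambda>x y. \<beta> x (y \<otimes> l)) \<in> bilinear_forms A"
  by (rule bilinear_formI) (simp_all add: bilinear_formD l_distr smult_mult_left)

lemma tensor_lact_closed:
  "\<lbrakk>t \<in> tensor_space A V W; l \<in> carrier A; \<And>x. x \<in> V \<Longrightarrow> l \<otimes> x \<in> V\<rbrakk> \<Longrightarrow> tensor_lact A l t \<in> tensor_space A V W"
  unfolding tensor_lact_def
  by (rule tensor_space_map[where p = "\<lambda>x. l \<otimes> x" and q = "\<lambda>y. y"]) (auto simp: bilinear_form_lmult)

lemma tensor_ract_closed:
  "\<lbrakk>t \<in> tensor_space A V W; l \<in> carrier A; \<And>y. y \<in> W \<Longrightarrow> y \<otimes> l \<in> W\<rbrakk> \<Longrightarrow> tensor_ract A t l \<in> tensor_space A V W"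
  unfolding tensor_ract_def
  by (rule tensor_space_map[where p = "\<lambda>x. x" and q = "\<lambda>y. y \<otimes> l"]) (auto simp: bilinear_form_rmult)

lemma tensor_space_scale:
  assumes "t \<in> tensor_space A V W" "V \<subseteq> carrier A" "W \<subseteq> carrier A" "\<And>x. x \<in> V \<Longrightarrow> c \<odot> x \<in> V"
  shows "(\<lambda>\<beta>. c * t \<beta>) \<in> tensor_space A V W"
proof -
  obtain n x y where t: "\<And>k::nat. k < n \<Longrightarrow> x k \<in> V \<and> y k \<in> W" "t = (\<lambda>\<beta>. \<Sum>k<n. tensor A (x k) (y k) \<beta>)"
    by (rule tensor_spaceE[OF assms(1)]) (rule that)
  have "c * t \<beta> = (\<Sum>k<n. tensor A (c \<odot> x k) (y k) \<beta>)" for \<beta>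
  proof -
    have "c * tensor A (x k) (y k) \<beta> = tensor A (c \<odot> x k) (y k) \<beta>" if "k < n" for k
    proof -
      have "x k \<in> carrier A" "y k \<in> carrier A" using t(1)[OF that] assms(2,3) by blast+
      then show ?thesis by (simp add: tensor_def bilinear_formD(3))
    qed
    then show ?thesis by (simp add: t(2) sum_distrib_left)
  qed
  then show ?thesis
    by (rule tensor_spaceI[where x = "\<lambda>k. c \<odot> x k" and y = y, rotated 2]) (use t(1) assms(4) in auto)
qed

end

interpretation LA: assoc_algebra "Lam 2 1 :: ('k::field, 'k lam) module"
  by (rule Lam_assoc)

abbreviation "RP n \<equiv> Res 2 1 n"
abbreviation "eL i \<equiv> lam_e 2 1 i"

section \<open>The terms of the resolution as bimodules\<close>

definition left_part :: "int \<Rightarrow> 'k::field lam set" where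
  "left_part i = {x \<otimes>\<^bsub>LA\<^esub> eL i |x. x \<in> carrier LA}"

definition right_part :: "int \<Rightarrow> 'k::field lam set" where
  "right_part j = {eL j \<otimes>\<^bsub>LA\<^esub> y |y. y \<in> carrier LA}"

definition Res_index :: "nat \<Rightarrow> (int \<times> int) set" where
  "Res_index n = {0..<2} \<times> {0..int n}"

abbreviation "Res_part n s \<equiv> tensor_space LA (left_part (fst s)) (right_part (fst s + int n - 2 * snd s))"

lemma Res_carrier: "u \<in> carrier (RP n) \<longleftrightarrow>
   (\<forall>s. if s \<in> Res_index n then u s \<in> Res_part n s else u s = (\<lambda>_. 0))"
  by (auto simp: Res_def Let_def left_part_def right_part_def Res_index_def split: if_splits)

lemma Res_simps:
  "\<zero>\<^bsub>RP n\<^esub> = (\<lambda>_ _. 0)"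
  "u \<oplus>\<^bsub>RP n\<^esub> w = (\<lambda>s \<beta>. u s \<beta> + w s \<beta>)"
  "lact (RP n) l u = (\<lambda>s. tensor_lact LA l (u s))"
  "ract (RP n) u l = (\<lambda>s. tensor_ract LA (u s) l)"
  by (simp_all add: Res_def Let_def)

lemma left_part_sub: "x \<in> left_part i \<Longrightarrow> x \<in> carrier LA"
  by (auto simp: left_part_def lam_gens_closed)

lemma right_part_sub: "x \<in> right_part i \<Longrightarrow> x \<in> carrier LA"
  by (auto simp: right_part_def lam_gens_closed)

lemma left_part_subset: "left_part i \<subseteq> carrier LA" and right_part_subset: "right_part i \<subseteq> carrier LA"
  by (rule subsetI, erule left_part_sub) (rule subsetI, erule right_part_sub)

lemma left_part_mult: "x \<in> left_part i \<Longrightarrow> l \<in> carrier LA \<Longrightarrow> l \<otimes>\<^bsub>LA\<^esub> x \<in> left_part i"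
  by (auto simp: left_part_def lam_gens_closed LA.m_assoc[symmetric])

lemma right_part_mult: "x \<in> right_part i \<Longrightarrow> l \<in> carrier LA \<Longrightarrow> x \<otimes>\<^bsub>LA\<^esub> l \<in> right_part i"
  by (auto simp: right_part_def lam_gens_closed LA.m_assoc)

lemma left_part_smult: "x \<in> left_part i \<Longrightarrow> c \<odot>\<^bsub>LA\<^esub> x \<in> left_part i"
  by (auto simp: left_part_def lam_gens_closed LA.smult_mult_left[symmetric])

lemma Res_part_of:
  assumes "u \<in> carrier (RP n)"
  shows "u s \<in> Res_part n s"
  using assms[unfolded Res_carrier, THEN spec, of s] tensor_space_zero by (simp split: if_splits)

lemma Res_outside: "u \<in> carrier (RP n) \<Longrightarrow> s \<notin> Res_index n \<Longrightarrow> u s = (\<lambda>_. 0)"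
  unfolding Res_carrier by (drule spec[of _ s]) simp

lemma Res_carrierI:
  assumes "\<And>s. s \<in> Res_index n \<Longrightarrow> u s \<in> Res_part n s" "\<And>s. s \<notin> Res_index n \<Longrightarrow> u s = (\<lambda>_. 0)"
  shows "u \<in> carrier (RP n)"
  unfolding Res_carrier using assms by (intro allI) simp

lemma Res_eqI:
  assumes "u \<in> carrier (RP n)" "w \<in> carrier (RP n)"
    and "\<And>s \<beta>. s \<in> Res_index n \<Longrightarrow> \<beta> \<in> bilinear_forms LA \<Longrightarrow> u s \<beta> = w s \<beta>"
  shows "u = w"
proof
  fix s
  show "u s = w s"
  proof (cases "s \<in> Res_index n")
    case True
    then show ?thesis
      using assms(3) by (intro tensor_space_eqI[OF Res_part_of[OF assms(1)] Res_part_of[OF assms(2)]])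
  qed (simp add: Res_outside[OF assms(1)] Res_outside[OF assms(2)])
qed

lemma Res_scale_closed:
  assumes u: "u \<in> carrier (RP n)"
  shows "res_scale c u \<in> carrier (RP n)"
proof (rule Res_carrierI)
  fix s
  show "res_scale c u s \<in> Res_part n s"
    unfolding res_scale_def
    by (rule LA.tensor_space_scale[OF Res_part_of[OF u] left_part_subset right_part_subset left_part_smult])
  show "s \<notin> Res_index n \<Longrightarrow> res_scale c u s = (\<lambda>_. 0)"
    by (simp add: res_scale_def Res_outside[OF u])
qed

text \<open>The laws in which algebra elements are added, multiplied or equal to the unit need the
  linear or local behaviour of tensors: the forms on the two sides agree only on the carrier of the
  algebra. Outside the bilinear forms every functional is zero by convention, and this case is split
  off each time.\<close>

lemma Res_bimodule: "algebra_bimodule (LA :: ('k::field, 'k lam) module) (RP n)"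
proof (intro algebra_bimodule.intro Lam_assoc algebra_bimodule_axioms.intro)
  show "abelian_group (RP n :: ('k lam, 'k res) bimodule)"
  proof (rule abelian_groupI)
    fix u :: "'k res" assume u: "u \<in> carrier (RP n)"
    show "\<exists>w\<in>carrier (RP n). w \<oplus>\<^bsub>RP n\<^esub> u = \<zero>\<^bsub>RP n\<^esub>"
      by (rule bexI[OF _ Res_scale_closed[OF u, of "-1"]]) (simp add: Res_simps res_scale_def)
  next
    fix u w :: "'k res" assume "u \<in> carrier (RP n)" "w \<in> carrier (RP n)"
    then show "u \<oplus>\<^bsub>RP n\<^esub> w \<in> carrier (RP n)"
      by (intro Res_carrierI) (simp_all add: Res_simps Res_part_of Res_outside tensor_space_add)
  next
    show "\<zero>\<^bsub>RP n\<^esub> \<in> carrier (RP n)"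
      by (rule Res_carrierI) (simp_all add: Res_simps tensor_space_zero)
  qed (auto simp: Res_simps add_ac)
next
  fix l :: "'k lam" and u :: "'k res" assume lu: "l \<in> carrier LA" "u \<in> carrier (RP n)"
  have 0: "tensor_lact LA l (\<lambda>_. 0) = (\<lambda>_. 0)" "tensor_ract LA (\<lambda>_. 0) l = (\<lambda>_. 0)"
    by (auto simp: tensor_lact_def tensor_ract_def)
  show l: "lact (RP n) l u \<in> carrier (RP n)"
    using lu by (intro Res_carrierI) (simp_all add: Res_simps 0 Res_outside LA.tensor_lact_closed Res_part_of left_part_mult)
  show r: "ract (RP n) u l \<in> carrier (RP n)"
    using lu by (intro Res_carrierI) (simp_all add: Res_simps 0 Res_outside LA.tensor_ract_closed Res_part_of right_part_mult)
next
  fix l :: "'k lam" and u w :: "'k res" assume "l \<in> carrier LA" "u \<in> carrier (RP n)" "w \<in> carrier (RP n)"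
  show "lact (RP n) l (u \<oplus>\<^bsub>RP n\<^esub> w) = lact (RP n) l u \<oplus>\<^bsub>RP n\<^esub> lact (RP n) l w"
    "ract (RP n) (u \<oplus>\<^bsub>RP n\<^esub> w) l = ract (RP n) u l \<oplus>\<^bsub>RP n\<^esub> ract (RP n) w l"
    by (auto simp: Res_simps tensor_lact_def tensor_ract_def fun_eq_iff)
next
  fix l l' :: "'k lam" and u :: "'k res" assume lu: "l \<in> carrier LA" "l' \<in> carrier LA" "u \<in> carrier (RP n)"
  have part: "u s \<in> Res_part n s" for s using Res_part_of[OF lu(3)] .
  have lin: "u s \<beta> = u s \<beta>' + u s \<beta>''"
    if "\<beta> \<in> bilinear_forms LA" "\<beta>' \<in> bilinear_forms LA" "\<beta>'' \<in> bilinear_forms LA"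
     "\<And>x y. x \<in> carrier LA \<Longrightarrow> y \<in> carrier LA \<Longrightarrow> \<beta> x y = \<beta>' x y + \<beta>'' x y" for s \<beta> \<beta>' \<beta>''
    using tensor_space_lin[OF part[of s] that(1-3), where c = 1 and c' = 1] that(4)[OF left_part_sub right_part_sub] by simp
  have cong: "u s \<beta> = u s \<beta>'"
    if "\<beta> \<in> bilinear_forms LA" "\<beta>' \<in> bilinear_forms LA"
     "\<And>x y. x \<in> carrier LA \<Longrightarrow> y \<in> carrier LA \<Longrightarrow> \<beta> x y = \<beta>' x y" for s \<beta> \<beta>'
    using tensor_space_cong[OF part[of s] that(1,2)] that(3)[OF left_part_sub right_part_sub] by simp
  note bf = LA.bilinear_form_lmult LA.bilinear_form_rmult
  show "lact (RP n) (l \<oplus>\<^bsub>LA\<^esub> l') u = lact (RP n) l u \<oplus>\<^bsub>RP n\<^esub> lact (RP n) l' u"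
  proof (intro ext)
    fix s and \<beta> :: "'k lam \<Rightarrow> 'k lam \<Rightarrow> 'k"
    show "(lact (RP n) (l \<oplus>\<^bsub>LA\<^esub> l') u) s \<beta> = (lact (RP n) l u \<oplus>\<^bsub>RP n\<^esub> lact (RP n) l' u) s \<beta>"
    proof (cases "\<beta> \<in> bilinear_forms LA")
      case True
      then show ?thesis
        unfolding Res_simps tensor_lact_def if_P[OF True]
        by (intro lin[OF bf(1)[OF True] bf(1)[OF True lu(1)] bf(1)[OF True lu(2)]])
           (use lu in \<open>simp_all add: LA.bilinear_formD LA.l_distr LA.r_distr\<close>)
    qed (simp add: Res_simps tensor_lact_def)
  qed
  show "ract (RP n) u (l \<oplus>\<^bsub>LA\<^esub> l') = ract (RP n) u l \<oplus>\<^bsub>RP n\<^esub> ract (RP n) u l'"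
  proof (intro ext)
    fix s and \<beta> :: "'k lam \<Rightarrow> 'k lam \<Rightarrow> 'k"
    show "(ract (RP n) u (l \<oplus>\<^bsub>LA\<^esub> l')) s \<beta> = (ract (RP n) u l \<oplus>\<^bsub>RP n\<^esub> ract (RP n) u l') s \<beta>"
    proof (cases "\<beta> \<in> bilinear_forms LA")
      case True
      then show ?thesis
        unfolding Res_simps tensor_ract_def if_P[OF True]
        by (intro lin[OF bf(2)[OF True] bf(2)[OF True lu(1)] bf(2)[OF True lu(2)]])
           (use lu in \<open>simp_all add: LA.bilinear_formD LA.l_distr LA.r_distr\<close>)
    qed (simp add: Res_simps tensor_ract_def)
  qed
  show "lact (RP n) (l \<otimes>\<^bsub>LA\<^esub> l') u = lact (RP n) l (lact (RP n) l' u)"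
  proof (intro ext)
    fix s and \<beta> :: "'k lam \<Rightarrow> 'k lam \<Rightarrow> 'k"
    show "lact (RP n) (l \<otimes>\<^bsub>LA\<^esub> l') u s \<beta> = lact (RP n) l (lact (RP n) l' u) s \<beta>"
    proof (cases "\<beta> \<in> bilinear_forms LA")
      case True
      note b = bf(1)[OF True lu(1)]
      have "u s (\<lambda>x y. \<beta> (l \<otimes>\<^bsub>LA\<^esub> l' \<otimes>\<^bsub>LA\<^esub> x) y) = u s (\<lambda>x y. \<beta> (l \<otimes>\<^bsub>LA\<^esub> (l' \<otimes>\<^bsub>LA\<^esub> x)) y)"
        by (rule cong[OF bf(1)[OF True] bf(1)[OF b lu(2)]]) (use lu in \<open>simp_all add: LA.m_assoc\<close>)
      then show ?thesis using True b by (simp add: Res_simps tensor_lact_def)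
    qed (simp add: Res_simps tensor_lact_def)
  qed
  show "ract (RP n) u (l \<otimes>\<^bsub>LA\<^esub> l') = ract (RP n) (ract (RP n) u l) l'"
  proof (intro ext)
    fix s and \<beta> :: "'k lam \<Rightarrow> 'k lam \<Rightarrow> 'k"
    show "ract (RP n) u (l \<otimes>\<^bsub>LA\<^esub> l') s \<beta> = ract (RP n) (ract (RP n) u l) l' s \<beta>"
    proof (cases "\<beta> \<in> bilinear_forms LA")
      case True
      note b = bf(2)[OF True lu(2)]
      have "u s (\<lambda>x y. \<beta> x (y \<otimes>\<^bsub>LA\<^esub> (l \<otimes>\<^bsub>LA\<^esub> l'))) = u s (\<lambda>x y. \<beta> x (y \<otimes>\<^bsub>LA\<^esub> l \<otimes>\<^bsub>LA\<^esub> l'))"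
        by (rule cong[OF bf(2)[OF True] bf(2)[OF b lu(1)]]) (use lu in \<open>simp_all add: LA.m_assoc\<close>)
      then show ?thesis using True b by (simp add: Res_simps tensor_ract_def)
    qed (simp add: Res_simps tensor_ract_def)
  qed
  show "ract (RP n) (lact (RP n) l u) l' = lact (RP n) l (ract (RP n) u l')"
    using lu by (auto simp: Res_simps tensor_ract_def tensor_lact_def fun_eq_iff bf)
next
  fix c :: 'k and u :: "'k res" assume u: "u \<in> carrier (RP n)"
  have part: "u s \<in> Res_part n s" for s using Res_part_of[OF u] .
  have cong: "u s \<beta> = u s \<beta>'"
    if "\<beta> \<in> bilinear_forms LA" "\<beta>' \<in> bilinear_forms LA"
     "\<And>x y. x \<in> carrier LA \<Longrightarrow> y \<in> carrier LA \<Longrightarrow> \<beta> x y = \<beta>' x y" for s \<beta> \<beta>'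
    using tensor_space_cong[OF part[of s] that(1,2)] that(3)[OF left_part_sub right_part_sub] by simp
  note bf = LA.bilinear_form_lmult LA.bilinear_form_rmult
  have out: "u s \<beta> = 0" if "\<beta> \<notin> bilinear_forms LA" for s \<beta>
    using tensor_space_outside[OF part that] .
  show "lact (RP n) \<one>\<^bsub>LA\<^esub> u = u"
    by (auto simp: Res_simps tensor_lact_def fun_eq_iff bf out intro!: cong)
  show "ract (RP n) u \<one>\<^bsub>LA\<^esub> = u"
    by (auto simp: Res_simps tensor_ract_def fun_eq_iff bf out intro!: cong)
  show "lact (RP n) (c \<odot>\<^bsub>LA\<^esub> \<one>\<^bsub>LA\<^esub>) u = ract (RP n) u (c \<odot>\<^bsub>LA\<^esub> \<one>\<^bsub>LA\<^esub>)"
    by (auto simp: Res_simps tensor_ract_def tensor_lact_def fun_eq_iff bf LA.bilinear_formD LA.smult_mult_left LA.smult_mult_right intro!: cong)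
qed

interpretation RP: algebra_bimodule "Lam 2 1 :: ('k::field, 'k lam) module" "Res 2 1 n" for n
  by (rule Res_bimodule)

text \<open>The bimodule record carries no scalar multiplication; this identifies
  \<open>res_scale\<close> with the action of the multiples of the unit, the form in which
  \<open>functionals\<close> expresses linearity.\<close>

lemma Res_scale:
  fixes u :: "'k::field res"
  assumes u: "u \<in> carrier (RP n)"
  shows "res_scale c u = lact (RP n) (c \<odot>\<^bsub>LA\<^esub> \<one>\<^bsub>LA\<^esub>) u"
proof (rule Res_eqI)
  show "res_scale c u \<in> carrier (RP n)" "lact (RP n) (c \<odot>\<^bsub>LA\<^esub> \<one>\<^bsub>LA\<^esub>) u \<in> carrier (RP n)"
    using u by (auto simp: Res_scale_closed)
  fix s and \<beta> :: "'k lam \<Rightarrow> 'k lam \<Rightarrow> 'k" assume b: "\<beta> \<in> bilinear_forms LA"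
  have "u s (\<lambda>x y. \<beta> (c \<odot>\<^bsub>LA\<^esub> \<one>\<^bsub>LA\<^esub> \<otimes>\<^bsub>LA\<^esub> x) y) = c * u s \<beta> + 0 * u s \<beta>"
  proof (rule tensor_space_lin[OF Res_part_of[OF u] LA.bilinear_form_lmult[OF b] b b])
    fix x y :: "'k lam" assume "x \<in> left_part (fst s)" "y \<in> right_part (fst s + int n - 2 * snd s)"
    then have "x \<in> carrier LA" "y \<in> carrier LA" using left_part_sub right_part_sub by blast+
    then show "\<beta> (c \<odot>\<^bsub>LA\<^esub> \<one>\<^bsub>LA\<^esub> \<otimes>\<^bsub>LA\<^esub> x) y = c * \<beta> x y + 0 * \<beta> x y"
      using b by (simp add: LA.bilinear_formD LA.smult_mult_left)
  qed simp
  then show "res_scale c u s \<beta> = lact (RP n) (c \<odot>\<^bsub>LA\<^esub> \<one>\<^bsub>LA\<^esub>) u s \<beta>"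
    using b by (simp add: res_scale_def Res_simps tensor_lact_def)
qed

section \<open>Generators and homomorphisms determined by their values on them\<close>

definition single_gen :: "nat \<Rightarrow> int \<times> int \<Rightarrow> 'k::field res" where
  "single_gen n s = res_single (fst s) (snd s) (tensor LA (eL (fst s)) (eL (fst s + int n - 2 * snd s)))"

lemma eL_idem: "eL i \<otimes>\<^bsub>LA\<^esub> eL i = eL i"
  by (rule lam_coord_inj) (auto simp: lam_gens_closed lam_coord_mult lam_coord_gens coord_mult_def)

lemma eL_left: "eL i \<in> left_part i" and eL_right: "eL i \<in> right_part i"
  unfolding left_part_def right_part_def using lam_gens_closed(1) eL_idem by (metis (mono_tags, lifting) mem_Collect_eq)+

lemma single_gen_closed: "s \<in> Res_index n \<Longrightarrow> single_gen n s \<in> carrier (RP n)"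
  by (rule Res_carrierI) (auto simp: single_gen_def res_single_def intro!: tensor_in_space eL_left eL_right tensor_space_zero)

lemma tensor_lact_ract:
  fixes x y :: "'k::field lam"
  assumes "x \<in> carrier LA" "y \<in> carrier LA"
  shows "tensor_lact LA x (tensor_ract LA (tensor LA z w) y) = tensor LA (x \<otimes>\<^bsub>LA\<^esub> z) (w \<otimes>\<^bsub>LA\<^esub> y)"
proof
  fix \<beta> :: "'k lam \<Rightarrow> 'k lam \<Rightarrow> 'k"
  show "tensor_lact LA x (tensor_ract LA (tensor LA z w) y) \<beta> = tensor LA (x \<otimes>\<^bsub>LA\<^esub> z) (w \<otimes>\<^bsub>LA\<^esub> y) \<beta>"
    using LA.bilinear_form_lmult[OF _ assms(1)] LA.bilinear_form_rmult[OF LA.bilinear_form_lmult[OF _ assms(1)] assms(2)]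
    by (simp add: tensor_lact_def tensor_ract_def tensor_def)
qed

lemma lact_ract_single_gen:
  assumes "x \<in> carrier LA" "y \<in> carrier LA"
  shows "lact (RP n) x (ract (RP n) (single_gen n s) y)
    = res_single (fst s) (snd s) (tensor LA (x \<otimes>\<^bsub>LA\<^esub> eL (fst s)) (eL (fst s + int n - 2 * snd s) \<otimes>\<^bsub>LA\<^esub> y))"
proof
  fix s'
  have "tensor_lact LA x (tensor_ract LA (\<lambda>_. 0) y) = (\<lambda>_. 0)"
    by (auto simp: tensor_lact_def tensor_ract_def)
  then show "lact (RP n) x (ract (RP n) (single_gen n s) y) s'
    = res_single (fst s) (snd s) (tensor LA (x \<otimes>\<^bsub>LA\<^esub> eL (fst s)) (eL (fst s + int n - 2 * snd s) \<otimes>\<^bsub>LA\<^esub> y)) s'"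
    by (simp add: Res_simps single_gen_def res_single_def tensor_lact_ract[OF assms])
qed

text \<open>The generators generate: an element is the sum of its components, a component is a
  finite sum of pure tensors, and a pure tensor in the (i, r)-summand has the form x e_i tensor e_j
  y, which is x times the generator times y.\<close>

lemma Res_induct [consumes 1, case_names zero add gen]:
  assumes u: "u \<in> carrier (RP n)"
    and zero: "Q \<zero>\<^bsub>RP n\<^esub>"
    and add: "\<And>u w. \<lbrakk>u \<in> carrier (RP n); w \<in> carrier (RP n); Q u; Q w\<rbrakk> \<Longrightarrow> Q (u \<oplus>\<^bsub>RP n\<^esub> w)"
    and gen: "\<And>s x y. \<lbrakk>s \<in> Res_index n; x \<in> carrier LA; y \<in> carrier LA\<rbrakk> \<Longrightarrow>
      Q (lact (RP n) x (ract (RP n) (single_gen n s) y))"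
  shows "Q u"
proof -
  have single: "res_single (fst s) (snd s) t \<in> carrier (RP n) \<and> Q (res_single (fst s) (snd s) t)"
    if s: "s \<in> Res_index n" and t: "t \<in> Res_part n s" for s t
  proof -
    obtain N x y where xy: "\<And>k::nat. k < N \<Longrightarrow> x k \<in> left_part (fst s) \<and> y k \<in> right_part (fst s + int n - 2 * snd s)"
        "t = (\<lambda>\<beta>. \<Sum>k<N. tensor LA (x k) (y k) \<beta>)"
      by (rule tensor_spaceE[OF t]) (rule that)
    let ?t = "\<lambda>N \<beta>. \<Sum>k<N. tensor LA (x k) (y k) \<beta>"
    have "M \<le> N \<Longrightarrow> res_single (fst s) (snd s) (?t M) \<in> carrier (RP n) \<and> Q (res_single (fst s) (snd s) (?t M))" for M
    proof (induction M)
      case 0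
      have "res_single (fst s) (snd s) (?t 0) = \<zero>\<^bsub>RP n\<^esub>" by (auto simp: res_single_def Res_simps)
      then show ?case using zero by simp
    next
      case (Suc M)
      then obtain x' y' where x': "x' \<in> carrier LA" "x M = x' \<otimes>\<^bsub>LA\<^esub> eL (fst s)"
          and y': "y' \<in> carrier LA" "y M = eL (fst s + int n - 2 * snd s) \<otimes>\<^bsub>LA\<^esub> y'"
        using xy(1)[of M] by (auto simp: left_part_def right_part_def)
      let ?g = "lact (RP n) x' (ract (RP n) (single_gen n s) y')"
      have "?g = res_single (fst s) (snd s) (tensor LA (x M) (y M))"
        unfolding lact_ract_single_gen[OF x'(1) y'(1)] x'(2) y'(2) ..
      then have "res_single (fst s) (snd s) (?t (Suc M)) = res_single (fst s) (snd s) (?t M) \<oplus>\<^bsub>RP n\<^esub> ?g"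
        by (auto simp: res_single_def Res_simps(2))
      moreover have "?g \<in> carrier (RP n)" using x'(1) y'(1) by (simp add: single_gen_closed[OF s])
      moreover have "res_single (fst s) (snd s) (?t M) \<in> carrier (RP n)" "Q (res_single (fst s) (snd s) (?t M))"
        using Suc by auto
      ultimately show ?case
        using add[of "res_single (fst s) (snd s) (?t M)" ?g] gen[OF s x'(1) y'(1)]
        by (simp only: RP.a_closed simp_thms)
    qed
    then show ?thesis unfolding xy(2) by blast
  qed
  have "(\<lambda>s. if s \<in> S then u s else (\<lambda>_. 0)) \<in> carrier (RP n) \<and> Q (\<lambda>s. if s \<in> S then u s else (\<lambda>_. 0))"
    if "finite S" "S \<subseteq> Res_index n" for S
    using that
  proof (induction S rule: finite_induct)
    case empty
    have "(\<lambda>s. if s \<in> {} then u s else (\<lambda>_. 0)) = \<zero>\<^bsub>RP n\<^esub>" by (simp add: Res_simps)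
    then show ?case using zero by (simp only: RP.zero_closed simp_thms)
  next
    case (insert s S)
    let ?u = "\<lambda>s'. if s' \<in> S then u s' else (\<lambda>_. 0)" and ?w = "res_single (fst s) (snd s) (u s)"
    have "(\<lambda>s'. if s' \<in> insert s S then u s' else (\<lambda>_. 0)) = ?u \<oplus>\<^bsub>RP n\<^esub> ?w"
      using insert.hyps by (auto simp: Res_simps res_single_def fun_eq_iff)
    moreover have "?u \<in> carrier (RP n)" "Q ?u" using insert by auto
    moreover have "?w \<in> carrier (RP n)" "Q ?w" using single[of s "u s"] Res_part_of[OF u] insert.prems by auto
    ultimately show ?case
      using add[of ?u ?w] by (simp only: RP.a_closed simp_thms)
  qed
  from this[of "Res_index n"] have "Q (\<lambda>s. if s \<in> Res_index n then u s else (\<lambda>_. 0))"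
    by (simp add: Res_index_def)
  also have "(\<lambda>s. if s \<in> Res_index n then u s else (\<lambda>_. 0)) = u"
    using Res_outside[OF u] by auto
  finally show ?thesis .
qed

text \<open>The uniqueness half of the definite descriptions \<open>res_diff\<close>,
  \<open>res_aug\<close> and those of the cochains behind the chi classes.\<close>

lemma Res_hom_ext:
  fixes f g :: "'k::field res \<Rightarrow> 'b"
  assumes f: "f \<in> bimodule_hom LA (RP n) M" and g: "g \<in> bimodule_hom LA (RP n) M"
    and "algebra_bimodule LA M" "\<And>s. s \<in> Res_index n \<Longrightarrow> f (single_gen n s) = g (single_gen n s)"
  shows "f = g"
proof (rule bimodule_hom_eqI[OF f g])
  fix u :: "'k res" assume "u \<in> carrier (RP n)"
  then show "f u = g u"
  proof (induction rule: Res_induct)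
    case zero
    then show ?case using bimodule_hom_apply_zero[OF _ Res_bimodule assms(3)] f g by metis
  next
    case (add u w)
    then show ?case by (simp add: bimodule_homD(3)[OF f] bimodule_homD(3)[OF g])
  next
    case (gen s x y)
    then show ?case
      using assms(4)
      by (simp add: single_gen_closed[OF gen(1)] bimodule_homD(4,5)[OF f] bimodule_homD(4,5)[OF g])
  qed
qed

definition functionals :: "('k::field, 'a) module \<Rightarrow> ('a, 'b) bimodule \<Rightarrow> ('b \<Rightarrow> 'k) set" where
  "functionals A M = {\<phi>. (\<forall>x\<in>carrier M. \<forall>y\<in>carrier M. \<phi> (x \<oplus>\<^bsub>M\<^esub> y) = \<phi> x + \<phi> y) \<and>
     (\<forall>c. \<forall>x\<in>carrier M. \<phi> (lact M (c \<odot>\<^bsub>A\<^esub> \<one>\<^bsub>A\<^esub>) x) = c * \<phi> x)}"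

text \<open>A tensor here can be evaluated only at scalar-valued forms, while the natural recipe for
  a homomorphism into M uses the M-valued map sending x, y to x h y. Composing that map with a
  linear functional on M yields a scalar form, and separation of points recovers the element of M
  from the results.\<close>

locale separated_bimodule = algebra_bimodule A M
  for A :: "('k::field, 'a) module" and M :: "('a, 'b) bimodule" +
  assumes separated: "\<lbrakk>x \<in> carrier M; \<And>\<phi>. \<phi> \<in> functionals A M \<Longrightarrow> \<phi> x = 0\<rbrakk> \<Longrightarrow> x = \<zero>\<^bsub>M\<^esub>"
begin

lemma functional_add: "\<phi> \<in> functionals A M \<Longrightarrow> x \<in> carrier M \<Longrightarrow> y \<in> carrier M \<Longrightarrow> \<phi> (x \<oplus>\<^bsub>M\<^esub> y) = \<phi> x + \<phi> y"
  by (simp add: functionals_def)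

lemma functional_scale: "\<phi> \<in> functionals A M \<Longrightarrow> x \<in> carrier M \<Longrightarrow> \<phi> (lact M (c \<odot>\<^bsub>A\<^esub> \<one>\<^bsub>A\<^esub>) x) = c * \<phi> x"
  by (simp add: functionals_def)

lemma smult_eq: "x \<in> carrier A \<Longrightarrow> c \<odot>\<^bsub>A\<^esub> x = (c \<odot>\<^bsub>A\<^esub> \<one>\<^bsub>A\<^esub>) \<otimes>\<^bsub>A\<^esub> x" "x \<in> carrier A \<Longrightarrow> c \<odot>\<^bsub>A\<^esub> x = x \<otimes>\<^bsub>A\<^esub> (c \<odot>\<^bsub>A\<^esub> \<one>\<^bsub>A\<^esub>)"
  by (simp_all add: A.smult_mult_left A.smult_mult_right)

lemma functional_zero: "\<phi> \<in> functionals A M \<Longrightarrow> \<phi> \<zero>\<^bsub>M\<^esub> = 0"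
  using functional_add[of \<phi> "\<zero>\<^bsub>M\<^esub>" "\<zero>\<^bsub>M\<^esub>"] by (metis add_cancel_right_right l_zero zero_closed)

lemma functional_eqI:
  assumes "x \<in> carrier M" "y \<in> carrier M" "\<And>\<phi>. \<phi> \<in> functionals A M \<Longrightarrow> \<phi> x = \<phi> y"
  shows "x = y"
proof -
  have xy: "(x \<ominus>\<^bsub>M\<^esub> y) \<oplus>\<^bsub>M\<^esub> y = x" using assms(1,2) by (simp add: minus_eq a_assoc l_neg)
  have "\<phi> (x \<ominus>\<^bsub>M\<^esub> y) = 0" if \<phi>: "\<phi> \<in> functionals A M" for \<phi>
    using functional_add[OF \<phi> _ assms(2), of "x \<ominus>\<^bsub>M\<^esub> y"] assms(1,2) assms(3)[OF \<phi>] by (simp add: xy)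
  then have "x \<ominus>\<^bsub>M\<^esub> y = \<zero>\<^bsub>M\<^esub>" by (intro separated) (use assms(1,2) in simp_all)
  then show ?thesis using xy assms(2) by simp
qed

lemma functional_lact:
  assumes "\<phi> \<in> functionals A M" "l \<in> carrier A"
  shows "(\<lambda>x. \<phi> (lact M l x)) \<in> functionals A M"
proof -
  have "lact M l (lact M (c \<odot>\<^bsub>A\<^esub> \<one>\<^bsub>A\<^esub>) x) = lact M (c \<odot>\<^bsub>A\<^esub> \<one>\<^bsub>A\<^esub>) (lact M l x)" if "x \<in> carrier M" for c x
    using assms(2) that smult_eq[OF assms(2), of c] by (simp add: lact_mult[symmetric])
  then show ?thesis
    using assms by (simp add: functionals_def lact_add)
qed

lemma functional_ract:
  assumes "\<phi> \<in> functionals A M" "l \<in> carrier A"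
  shows "(\<lambda>x. \<phi> (ract M x l)) \<in> functionals A M"
  using assms by (simp add: functionals_def ract_add lact_ract)

lemma functional_form:
  assumes "\<phi> \<in> functionals A M" "h \<in> carrier M"
  shows "(\<lambda>x y. \<phi> (lact M x (ract M h y))) \<in> bilinear_forms A"
proof (rule A.bilinear_formI)
  fix c x y assume xy: "x \<in> carrier A" "y \<in> carrier A"
  show "\<phi> (lact M (c \<odot>\<^bsub>A\<^esub> x) (ract M h y)) = c * \<phi> (lact M x (ract M h y))"
    using xy assms smult_eq(1)[OF xy(1), of c] by (simp add: lact_mult functional_scale)
  have "ract M h (c \<odot>\<^bsub>A\<^esub> y) = lact M (c \<odot>\<^bsub>A\<^esub> \<one>\<^bsub>A\<^esub>) (ract M h y)"
    using xy assms smult_eq(2)[OF xy(2), of c] by (simp add: ract_mult scalar_central)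
  then show "\<phi> (lact M x (ract M h (c \<odot>\<^bsub>A\<^esub> y))) = c * \<phi> (lact M x (ract M h y))"
    using functional_scale[OF functional_lact[OF assms(1) xy(1)]] xy assms by simp
qed (use assms in \<open>simp_all add: functional_add add_lact add_ract lact_add\<close>)

end

text \<open>The universal property of the sum of the bimodules generated by e_i tensor e_j: a
  homomorphism is a free choice of elements h s with e_i h s e_j = h s. The value at u is the unique
  z on which every functional takes the value that u predicts; existence of z spreads from the
  generators by \<open>Res_induct\<close>, uniqueness is separation.\<close>

lemma Res_hom_exists:
  fixes M :: "('k::field lam, 'b) bimodule"
  assumes "separated_bimodule LA M"
    and h: "\<And>s. s \<in> Res_index n \<Longrightarrow> h s \<in> carrier M"
      "\<And>s. s \<in> Res_index n \<Longrightarrow> lact M (eL (fst s)) (h s) = h s"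
      "\<And>s. s \<in> Res_index n \<Longrightarrow> ract M (h s) (eL (fst s + int n - 2 * snd s)) = h s"
  shows "\<exists>f\<in>bimodule_hom LA (RP n) M. \<forall>s\<in>Res_index n. f (single_gen n s) = h s"
proof -
  interpret M: separated_bimodule LA M by fact
  define ev where "ev u \<phi> = (\<Sum>s\<in>Res_index n. u s (\<lambda>x y. \<phi> (lact M x (ract M (h s) y))))" for u :: "'k res" and \<phi>
  \<comment> \<open>A relation first, because the existence of z is known only after the induction;
    \<open>f\<close> then picks the unique related element.\<close>
  define rl where "rl u z \<longleftrightarrow> z \<in> carrier M \<and> (\<forall>\<phi>\<in>functionals LA M. \<phi> z = ev u \<phi>)" for u z
  have unique: "z = z'" if "rl u z" "rl u z'" for u z z'
    using that by (intro M.functional_eqI) (auto simp: rl_def)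
  have rl_add: "rl (u \<oplus>\<^bsub>RP n\<^esub> w) (z \<oplus>\<^bsub>M\<^esub> z')" if "rl u z" "rl w z'" for u w z z'
    using that by (auto simp: rl_def ev_def Res_simps sum.distrib M.functional_add)
  have rl_gen: "rl (lact (RP n) x (ract (RP n) (single_gen n s) y)) (lact M x (ract M (h s) y))"
    if s: "s \<in> Res_index n" and xy: "x \<in> carrier LA" "y \<in> carrier LA" for s x y
    unfolding rl_def
  proof (intro conjI ballI)
    show "lact M x (ract M (h s) y) \<in> carrier M" using h s xy by simp
    fix \<phi> assume \<phi>: "\<phi> \<in> functionals LA M"
    let ?e = "eL (fst s)" and ?e' = "eL (fst s + int n - 2 * snd s)"
    let ?\<beta> = "\<lambda>x y. \<phi> (lact M x (ract M (h s) y))"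
    have "ev (lact (RP n) x (ract (RP n) (single_gen n s) y)) \<phi>
        = (\<Sum>s'\<in>Res_index n. if s = s' then ?\<beta> (x \<otimes>\<^bsub>LA\<^esub> ?e) (?e' \<otimes>\<^bsub>LA\<^esub> y) else 0)"
      unfolding ev_def lact_ract_single_gen[OF xy]
    proof (intro sum.cong refl)
      fix s'
      show "res_single (fst s) (snd s) (tensor LA (x \<otimes>\<^bsub>LA\<^esub> ?e) (?e' \<otimes>\<^bsub>LA\<^esub> y)) s' (\<lambda>x y. \<phi> (lact M x (ract M (h s') y)))
        = (if s = s' then ?\<beta> (x \<otimes>\<^bsub>LA\<^esub> ?e) (?e' \<otimes>\<^bsub>LA\<^esub> y) else 0)"
        by (cases "s' = s") (simp_all add: res_single_def tensor_def M.functional_form[OF \<phi> h(1)[OF s]])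
    qed
    also have "\<dots> = ?\<beta> (x \<otimes>\<^bsub>LA\<^esub> ?e) (?e' \<otimes>\<^bsub>LA\<^esub> y)"
      using s by (simp add: Res_index_def)
    also have "ract M (h s) (?e' \<otimes>\<^bsub>LA\<^esub> y) = ract M (h s) y"
      using h s xy by (simp add: M.ract_mult lam_gens_closed)
    also have "lact M (x \<otimes>\<^bsub>LA\<^esub> ?e) (ract M (h s) y) = lact M x (ract M (lact M ?e (h s)) y)"
      using h(1) s xy by (simp add: M.lact_mult M.lact_ract lam_gens_closed)
    also have "\<dots> = lact M x (ract M (h s) y)" using h(2)[OF s] by simp
    finally show "\<phi> (lact M x (ract M (h s) y)) = ev (lact (RP n) x (ract (RP n) (single_gen n s) y)) \<phi>" by simp
  qed
  have ex: "\<exists>z. rl u z" if "u \<in> carrier (RP n)" for u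
    using that
  proof (induction rule: Res_induct)
    case zero
    have "rl \<zero>\<^bsub>RP n\<^esub> \<zero>\<^bsub>M\<^esub>" by (simp add: rl_def ev_def Res_simps M.functional_zero)
    then show ?case by (rule exI)
  next
    case (add u w)
    then obtain z z' where "rl u z" "rl w z'" by auto
    then show ?case by (intro exI) (rule rl_add)
  next
    case (gen s x y)
    then show ?case by (intro exI) (rule rl_gen)
  qed
  define f where "f = (\<lambda>u\<in>carrier (RP n). THE z. rl u z)"
  have f: "f u = z" if "rl u z" "u \<in> carrier (RP n)" for u z
    using that unique by (auto simp: f_def)
  have rlf: "rl u (f u)" if "u \<in> carrier (RP n)" for u
    using ex[OF that] f[OF _ that] by auto
  have "f \<in> bimodule_hom LA (RP n) M"
  proof (rule bimodule_homI)
    show "f \<in> extensional (carrier (RP n))" by (simp add: f_def)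
    show "f u \<in> carrier M" if "u \<in> carrier (RP n)" for u using rlf[OF that] by (simp add: rl_def)
    show "f (u \<oplus>\<^bsub>RP n\<^esub> w) = f u \<oplus>\<^bsub>M\<^esub> f w" if "u \<in> carrier (RP n)" "w \<in> carrier (RP n)" for u w
      using f[OF rl_add[OF rlf rlf]] that by simp
  next
    fix u :: "'k res" and l :: "'k lam" assume u: "u \<in> carrier (RP n)" and l: "l \<in> carrier LA"
    have part: "u s \<in> Res_part n s" for s using Res_part_of[OF u] .
    have z: "f u \<in> carrier M" "\<And>\<phi>. \<phi> \<in> functionals LA M \<Longrightarrow> \<phi> (f u) = ev u \<phi>"
      using rlf[OF u] by (auto simp: rl_def)
    have "rl (lact (RP n) l u) (lact M l (f u))"
      unfolding rl_def
    proof (intro conjI ballI)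
      fix \<phi> assume \<phi>: "\<phi> \<in> functionals LA M"
      have "\<phi> (lact M l (f u)) = ev u (\<lambda>x. \<phi> (lact M l x))"
        using z(2)[OF M.functional_lact[OF \<phi> l]] by simp
      also have "\<dots> = ev (lact (RP n) l u) \<phi>"
        unfolding ev_def
      proof (intro sum.cong refl)
        fix s assume s: "s \<in> Res_index n"
        note \<beta> = M.functional_form[OF \<phi> h(1)[OF s]]
        have "u s (\<lambda>x y. \<phi> (lact M l (lact M x (ract M (h s) y)))) = u s (\<lambda>x y. \<phi> (lact M (l \<otimes>\<^bsub>LA\<^esub> x) (ract M (h s) y)))"
        proof (rule tensor_space_cong[OF part M.functional_form[OF M.functional_lact[OF \<phi> l] h(1)[OF s]] LA.bilinear_form_lmult[OF \<beta> l]])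
          fix x y :: "'k lam" assume "x \<in> left_part (fst s)" "y \<in> right_part (fst s + int n - 2 * snd s)"
          then have "x \<in> carrier LA" "y \<in> carrier LA" by (auto intro: left_part_sub right_part_sub)
          then show "\<phi> (lact M l (lact M x (ract M (h s) y))) = \<phi> (lact M (l \<otimes>\<^bsub>LA\<^esub> x) (ract M (h s) y))"
            using l h(1)[OF s] by (simp add: M.lact_mult)
        qed
        then show "u s (\<lambda>x y. \<phi> (lact M l (lact M x (ract M (h s) y)))) = lact (RP n) l u s (\<lambda>x y. \<phi> (lact M x (ract M (h s) y)))"
          using \<beta> by (simp add: Res_simps tensor_lact_def)
      qed
      finally show "\<phi> (lact M l (f u)) = ev (lact (RP n) l u) \<phi>" .
    qed (use z l in simp)
    then show "f (lact (RP n) l u) = lact M l (f u)"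
      using f u l by simp
    have "rl (ract (RP n) u l) (ract M (f u) l)"
      unfolding rl_def
    proof (intro conjI ballI)
      fix \<phi> assume \<phi>: "\<phi> \<in> functionals LA M"
      have "\<phi> (ract M (f u) l) = ev u (\<lambda>x. \<phi> (ract M x l))"
        using z(2)[OF M.functional_ract[OF \<phi> l]] by simp
      also have "\<dots> = ev (ract (RP n) u l) \<phi>"
        unfolding ev_def
      proof (intro sum.cong refl)
        fix s assume s: "s \<in> Res_index n"
        note \<beta> = M.functional_form[OF \<phi> h(1)[OF s]]
        have "u s (\<lambda>x y. \<phi> (ract M (lact M x (ract M (h s) y)) l)) = u s (\<lambda>x y. \<phi> (lact M x (ract M (h s) (y \<otimes>\<^bsub>LA\<^esub> l))))"
        proof (rule tensor_space_cong[OF part M.functional_form[OF M.functional_ract[OF \<phi> l] h(1)[OF s]] LA.bilinear_form_rmult[OF \<beta> l]])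
          fix x y :: "'k lam" assume "x \<in> left_part (fst s)" "y \<in> right_part (fst s + int n - 2 * snd s)"
          then have "x \<in> carrier LA" "y \<in> carrier LA" by (auto intro: left_part_sub right_part_sub)
          then show "\<phi> (ract M (lact M x (ract M (h s) y)) l) = \<phi> (lact M x (ract M (h s) (y \<otimes>\<^bsub>LA\<^esub> l)))"
            using l h(1)[OF s] by (simp add: M.ract_mult M.lact_ract)
        qed
        then show "u s (\<lambda>x y. \<phi> (ract M (lact M x (ract M (h s) y)) l)) = ract (RP n) u l s (\<lambda>x y. \<phi> (lact M x (ract M (h s) y)))"
          using \<beta> by (simp add: Res_simps tensor_ract_def)
      qed
      finally show "\<phi> (ract M (f u) l) = ev (ract (RP n) u l) \<phi>" .
    qed (use z l in simp)
    then show "f (ract (RP n) u l) = ract M (f u) l"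
      using f u l by simp
  qed
  moreover have "f (single_gen n s) = h s" if s: "s \<in> Res_index n" for s
    using f[OF rl_gen[OF s LA.one_closed LA.one_closed]] h(1)[OF s] by (simp add: single_gen_closed[OF s])
  ultimately show ?thesis by blast
qed

lemma regular_separated: "separated_bimodule (LA :: ('k::field, 'k lam) module) (regular_bimodule LA)"
proof (intro separated_bimodule.intro LA.regular_bimodule separated_bimodule_axioms.intro)
  fix x :: "'k lam" assume x: "x \<in> carrier (regular_bimodule LA)"
    and \<phi>: "\<And>\<phi>. \<phi> \<in> functionals LA (regular_bimodule LA) \<Longrightarrow> \<phi> x = 0"
  have fn: "(\<lambda>x. lam_coord x v \<alpha> \<beta>) \<in> functionals (LA :: ('k, 'k lam) module) (regular_bimodule LA)" for v \<alpha> \<beta>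
    by (simp add: functionals_def regular_bimodule_def lam_coord_add LA.smult_mult_left lam_coord_smult)
  show "x = \<zero>\<^bsub>regular_bimodule LA\<^esub>"
    using x \<phi>[OF fn] by (intro lam_coord_inj) (simp_all add: regular_bimodule_def lam_coord_zero)
qed

lemma Res_separated: "separated_bimodule (LA :: ('k::field, 'k lam) module) (RP n)"
proof (intro separated_bimodule.intro Res_bimodule separated_bimodule_axioms.intro)
  fix u :: "'k res" assume u: "u \<in> carrier (RP n)"
    and \<phi>: "\<And>\<phi>. \<phi> \<in> functionals LA (RP n) \<Longrightarrow> \<phi> u = 0"
  have fn: "(\<lambda>u. u s \<beta>) \<in> functionals (LA :: ('k, 'k lam) module) (RP n)" for s \<beta>
    unfolding functionals_def by (simp add: Res_simps(2) Res_scale[symmetric]) (simp add: res_scale_def)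
  show "u = \<zero>\<^bsub>RP n\<^esub>"
    unfolding Res_simps using \<phi>[OF fn] by (intro ext)
qed

section \<open>The resolution in coordinates\<close>

text \<open>In degree \<open>n\<close>, the coordinate of the \<open>(i, r)\<close>-summand at \<open>p \<otimes> q\<close>, where \<open>p\<close> is the normal path with arrow
  counts \<open>(\<alpha>, \<beta>)\<close> that ends at \<open>i\<close> and \<open>q\<close> is the one with counts \<open>(\<gamma>, \<delta>)\<close> that starts at \<open>i + n\<close>.\<close>

definition res_coord :: "nat \<Rightarrow> 'k::field res \<Rightarrow> bool \<Rightarrow> nat \<Rightarrow> bool \<Rightarrow> bool \<Rightarrow> bool \<Rightarrow> bool \<Rightarrow> 'k" where
  "res_coord n u i r \<alpha> \<beta> \<gamma> \<delta> =
     u (vert i, int r) (\<lambda>x y. lam_coord x (i \<noteq> (\<alpha> \<noteq> \<beta>)) \<alpha> \<beta> * lam_coord y (i \<noteq> odd n) \<gamma> \<delta>)"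

lemma coord_form: "(\<lambda>x y. lam_coord x v \<alpha> \<beta> * lam_coord y w \<gamma> \<delta>) \<in> bilinear_forms (LA :: ('k::field, 'k lam) module)"
  by (rule LA.bilinear_formI) (simp_all add: lam_coord_add lam_coord_smult algebra_simps)

lemma vert_simps [simp]: "even (vert i) \<longleftrightarrow> \<not> i" "vert i = vert j \<longleftrightarrow> i = j" "vert i \<in> {0..<2}" "0 \<le> vert i" "vert i < 2"
  by (auto simp: vert_def)

lemma Res_indexE:
  assumes "s \<in> Res_index n"
  obtains i r where "s = (vert i, int r)" "r \<le> n"
proof -
  from assms have "fst s \<in> {0..<2}" "0 \<le> snd s" "snd s \<le> int n" by (auto simp: Res_index_def)
  moreover then obtain i where "fst s = vert i" using vert_cases by blast
  ultimately show thesis by (intro that[of i "nat (snd s)"]) (auto simp: prod_eq_iff)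
qed

lemma Res_indexI: "r \<le> n \<Longrightarrow> (vert i, int r) \<in> Res_index n"
  by (simp add: Res_index_def)

lemma res_coord_add: "res_coord n (u \<oplus>\<^bsub>RP n\<^esub> w) i r \<alpha> \<beta> \<gamma> \<delta> = res_coord n u i r \<alpha> \<beta> \<gamma> \<delta> + res_coord n w i r \<alpha> \<beta> \<gamma> \<delta>"
  by (simp add: res_coord_def Res_simps(2))

lemma res_coord_zero: "res_coord n \<zero>\<^bsub>RP n\<^esub> i r \<alpha> \<beta> \<gamma> \<delta> = 0"
  by (simp add: res_coord_def Res_simps(1))

lemma res_coord_scale: "res_coord n (res_scale c u) i r \<alpha> \<beta> \<gamma> \<delta> = c * res_coord n u i r \<alpha> \<beta> \<gamma> \<delta>"
  by (simp add: res_coord_def res_scale_def)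

lemma res_coord_lact_ract_gen:
  fixes x y :: "'k::field lam"
  assumes "x \<in> carrier LA" "y \<in> carrier LA"
  shows "res_coord n (lact (RP n) x (ract (RP n) (single_gen n s) y)) i r \<alpha> \<beta> \<gamma> \<delta>
    = of_bool (s = (vert i, int r)) * lam_coord x (i \<noteq> (\<alpha> \<noteq> \<beta>)) \<alpha> \<beta> * lam_coord y (i \<noteq> odd n) \<gamma> \<delta>"
proof (cases "s = (vert i, int r)")
  case True
  have "lam_coord (x \<otimes>\<^bsub>LA\<^esub> eL (vert i)) (i \<noteq> (\<alpha> \<noteq> \<beta>)) \<alpha> \<beta> = lam_coord x (i \<noteq> (\<alpha> \<noteq> \<beta>)) \<alpha> \<beta>"
    using assms by (cases \<alpha>; cases \<beta>) (simp_all add: lam_coord_mult lam_gens_closed coord_mult_def lam_coord_gens)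
  moreover have "lam_coord (eL (vert i + int n - 2 * int r) \<otimes>\<^bsub>LA\<^esub> y) (i \<noteq> odd n) \<gamma> \<delta> = lam_coord y (i \<noteq> odd n) \<gamma> \<delta>"
    using assms by (cases \<gamma>; cases \<delta>) (auto simp: lam_coord_mult lam_gens_closed coord_mult_def lam_coord_gens)
  ultimately show ?thesis
    unfolding lact_ract_single_gen[OF assms] res_coord_def by (simp add: True res_single_def tensor_def coord_form)
next
  case False
  then show ?thesis
    unfolding lact_ract_single_gen[OF assms] res_coord_def by (auto simp: res_single_def prod_eq_iff)
qed

text \<open>Left multiplication acts on the pair for the left factor alone. That factor ends at i,
  so its start is \<open>i \<noteq> (\<alpha> \<noteq> \<beta>)\<close>, which is the vertex handed
  to \<open>coord_mult\<close>; the vertex of the second factor is forced by its arrows and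
  therefore ignored. The rule for \<open>ract\<close> is the mirror image, with the start of the
  right factor fixed.\<close>

lemma res_coord_lact:
  fixes u :: "'k::field res"
  assumes "u \<in> carrier (RP n)" and l: "l \<in> carrier LA"
  shows "res_coord n (lact (RP n) l u) i r \<alpha> \<beta> \<gamma> \<delta>
    = coord_mult (lam_coord l) (\<lambda>_ a b. res_coord n u i r a b \<gamma> \<delta>) (i \<noteq> (\<alpha> \<noteq> \<beta>)) \<alpha> \<beta>"
  using assms(1)
proof (induction rule: Res_induct)
  case zero
  show ?case by (simp add: RP.lact_zero[OF l] res_coord_zero coord_mult_def)
next
  case (add u w)
  then show ?case by (simp add: RP.lact_add[OF l] res_coord_add coord_mult_def algebra_simps)
next
  case (gen s x y)
  have "lact (RP n) l (lact (RP n) x (ract (RP n) (single_gen n s) y)) = lact (RP n) (l \<otimes>\<^bsub>LA\<^esub> x) (ract (RP n) (single_gen n s) y)"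
    using l gen by (simp add: RP.lact_mult single_gen_closed)
  then show ?case
    using gen l by (simp only: res_coord_lact_ract_gen LA.m_closed lam_coord_mult)
      (cases \<alpha>; cases \<beta>; simp add: coord_mult_def algebra_simps)
qed

lemma res_coord_ract:
  fixes u :: "'k::field res"
  assumes "u \<in> carrier (RP n)" and l: "l \<in> carrier LA"
  shows "res_coord n (ract (RP n) u l) i r \<alpha> \<beta> \<gamma> \<delta>
    = coord_mult (\<lambda>_ c d. res_coord n u i r \<alpha> \<beta> c d) (lam_coord l) (i \<noteq> odd n) \<gamma> \<delta>"
  using assms(1)
proof (induction rule: Res_induct)
  case zero
  show ?case by (simp add: RP.ract_zero[OF l] res_coord_zero coord_mult_def)
next
  case (add u w)
  then show ?case by (simp add: RP.ract_add[OF l] res_coord_add coord_mult_def algebra_simps)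
next
  case (gen s x y)
  have "ract (RP n) (lact (RP n) x (ract (RP n) (single_gen n s) y)) l = lact (RP n) x (ract (RP n) (single_gen n s) (y \<otimes>\<^bsub>LA\<^esub> l))"
    using l gen by (simp add: RP.lact_ract RP.ract_mult single_gen_closed)
  then show ?case
    using gen l by (simp only: res_coord_lact_ract_gen LA.m_closed lam_coord_mult)
      (cases \<gamma>; cases \<delta>; simp add: coord_mult_def algebra_simps)
qed

definition lam_mon :: "bool \<Rightarrow> bool \<Rightarrow> bool \<Rightarrow> 'k::field lam" where
  "lam_mon v \<alpha> \<beta> = (SOME x. x \<in> carrier LA \<and> (\<forall>v' a b. lam_coord x v' a b = of_bool (v' = v \<and> a = \<alpha> \<and> b = \<beta>)))"

lemma lam_mon:
  "lam_mon v \<alpha> \<beta> \<in> carrier (LA :: ('k::field, 'k lam) module)"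
  "lam_coord (lam_mon v \<alpha> \<beta> :: 'k lam) v' a b = of_bool (v' = v \<and> a = \<alpha> \<and> b = \<beta>)"
proof -
  have "\<exists>x. x \<in> carrier LA \<and> (\<forall>v' a b. lam_coord x v' a b = (of_bool (v' = v \<and> a = \<alpha> \<and> b = \<beta>) :: 'k))"
    using lam_coord_surj[of "\<lambda>v' a b. of_bool (v' = v \<and> a = \<alpha> \<and> b = \<beta>) :: 'k"] by blast
  from someI_ex[OF this] show "lam_mon v \<alpha> \<beta> \<in> carrier (LA :: ('k, 'k lam) module)"
    "lam_coord (lam_mon v \<alpha> \<beta> :: 'k lam) v' a b = of_bool (v' = v \<and> a = \<alpha> \<and> b = \<beta>)"
    unfolding lam_mon_def by blast+
qed

lemma lam_expand:
  fixes x :: "'k::field lam"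
  assumes x: "x \<in> carrier LA"
    and add: "\<And>x y. x \<in> carrier LA \<Longrightarrow> y \<in> carrier LA \<Longrightarrow> \<phi> (x \<oplus>\<^bsub>LA\<^esub> y) = \<phi> x + \<phi> y"
    and smult: "\<And>c x. x \<in> carrier LA \<Longrightarrow> \<phi> (c \<odot>\<^bsub>LA\<^esub> x) = c * \<phi> x"
  shows "\<phi> x = (\<Sum>(v, \<alpha>, \<beta>)\<in>UNIV. lam_coord x v \<alpha> \<beta> * \<phi> (lam_mon v \<alpha> \<beta>))"
proof -
  define T where "T v a b = lam_coord x v a b \<odot>\<^bsub>LA\<^esub> lam_mon v a b" for v a b
  have T: "T v a b \<in> carrier LA" for v a b by (simp add: T_def lam_mon)
  have cT: "lam_coord (T v a b) v' a' b' = (if v' = v \<and> a' = a \<and> b' = b then lam_coord x v a b else 0)" for v a b v' a' b'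
    by (simp add: T_def lam_coord_smult lam_mon)
  define S where "S v = (T v False False \<oplus>\<^bsub>LA\<^esub> T v False True) \<oplus>\<^bsub>LA\<^esub> (T v True False \<oplus>\<^bsub>LA\<^esub> T v True True)" for v
  have "x = S False \<oplus>\<^bsub>LA\<^esub> S True"
  proof (rule lam_coord_inj[OF x])
    show "S False \<oplus>\<^bsub>LA\<^esub> S True \<in> carrier LA" using T by (simp add: S_def)
    show "lam_coord x v a b = lam_coord (S False \<oplus>\<^bsub>LA\<^esub> S True) v a b" for v a b
      using T by (cases v; cases a; cases b) (simp_all add: S_def lam_coord_add cT)
  qed
  then have "\<phi> x = \<phi> (S False \<oplus>\<^bsub>LA\<^esub> S True)" by simp
  also have "\<dots> = (\<Sum>(v, \<alpha>, \<beta>)\<in>UNIV. lam_coord x v \<alpha> \<beta> * \<phi> (lam_mon v \<alpha> \<beta>))"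
    using T by (simp add: sum_bool3 UNIV_bool S_def add) (simp add: T_def smult lam_mon algebra_simps)
  finally show ?thesis .
qed

lemma bilinear_expand:
  fixes x y :: "'k::field lam"
  assumes \<beta>: "\<beta> \<in> bilinear_forms LA" and xy: "x \<in> carrier LA" "y \<in> carrier LA"
  shows "\<beta> x y = (\<Sum>(v, a, b)\<in>UNIV. \<Sum>(w, c, d)\<in>UNIV.
     (lam_coord x v a b * lam_coord y w c d) * \<beta> (lam_mon v a b) (lam_mon w c d))"
proof -
  have "\<beta> x y = (\<Sum>(v, a, b)\<in>UNIV. lam_coord x v a b * \<beta> (lam_mon v a b) y)"
    by (rule lam_expand[OF xy(1)]) (use \<beta> xy in \<open>simp_all add: LA.bilinear_formD\<close>)
  also have "\<dots> = (\<Sum>(v, a, b)\<in>UNIV. lam_coord x v a b * (\<Sum>(w, c, d)\<in>UNIV. lam_coord y w c d * \<beta> (lam_mon v a b) (lam_mon w c d)))"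
  proof (intro sum.cong refl)
    fix p :: "bool \<times> bool \<times> bool"
    obtain v a b where p: "p = (v, a, b)" by (cases p) auto
    have "\<beta> (lam_mon v a b) y = (\<Sum>(w, c, d)\<in>UNIV. lam_coord y w c d * \<beta> (lam_mon v a b) (lam_mon w c d))"
      by (rule lam_expand[OF xy(2)]) (use \<beta> in \<open>simp_all add: LA.bilinear_formD lam_mon\<close>)
    then show "(case p of (v, a, b) \<Rightarrow> lam_coord x v a b * \<beta> (lam_mon v a b) y) = (case p of (v, a, b) \<Rightarrow>
       lam_coord x v a b * (\<Sum>(w, c, d)\<in>UNIV. lam_coord y w c d * \<beta> (lam_mon v a b) (lam_mon w c d)))"
      by (simp add: p)
  qed
  finally show ?thesis
    by (simp add: sum_distrib_left case_prod_unfold mult.assoc)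
qed

text \<open>The products of two coordinate functions form a basis of the bilinear forms on the
  carrier, so a tensor is determined by its values at these finitely many forms.\<close>

lemma tensor_expand:
  fixes t :: "('k::field, 'k lam) tensor"
  assumes t: "t \<in> tensor_space LA V W" and VW: "V \<subseteq> carrier LA" "W \<subseteq> carrier LA" and \<beta>: "\<beta> \<in> bilinear_forms LA"
  shows "t \<beta> = (\<Sum>(v, a, b)\<in>UNIV. \<Sum>(w, c, d)\<in>UNIV.
     t (\<lambda>x y. lam_coord x v a b * lam_coord y w c d) * \<beta> (lam_mon v a b) (lam_mon w c d))"
proof -
  obtain n x y where xy: "\<And>k::nat. k < n \<Longrightarrow> x k \<in> V \<and> y k \<in> W"
    "\<And>\<beta>. \<beta> \<in> bilinear_forms LA \<Longrightarrow> t \<beta> = (\<Sum>k<n. \<beta> (x k) (y k))"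
    by (rule tensor_space_evalE[OF t]) (rule that)
  have "t \<beta> = (\<Sum>k<n. \<Sum>p\<in>UNIV. \<Sum>q\<in>UNIV. (case p of (v, a, b) \<Rightarrow> case q of (w, c, d) \<Rightarrow>
     (lam_coord (x k) v a b * lam_coord (y k) w c d) * \<beta> (lam_mon v a b) (lam_mon w c d)))"
    unfolding xy(2)[OF \<beta>]
  proof (intro sum.cong refl)
    fix k assume "k \<in> {..<n}"
    then have "x k \<in> carrier LA" "y k \<in> carrier LA" using xy(1)[of k] VW by auto
    from bilinear_expand[OF \<beta> this]
    show "\<beta> (x k) (y k) = (\<Sum>p\<in>UNIV. \<Sum>q\<in>UNIV. (case p of (v, a, b) \<Rightarrow> case q of (w, c, d) \<Rightarrow>
     (lam_coord (x k) v a b * lam_coord (y k) w c d) * \<beta> (lam_mon v a b) (lam_mon w c d)))"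
      by (simp add: case_prod_unfold)
  qed
  also have "\<dots> = (\<Sum>p\<in>UNIV. \<Sum>q\<in>UNIV. \<Sum>k<n. (case p of (v, a, b) \<Rightarrow> case q of (w, c, d) \<Rightarrow>
     (lam_coord (x k) v a b * lam_coord (y k) w c d) * \<beta> (lam_mon v a b) (lam_mon w c d)))"
    by (subst sum.swap, intro sum.cong refl, rule sum.swap)
  also have "\<dots> = (\<Sum>(v, a, b)\<in>UNIV. \<Sum>(w, c, d)\<in>UNIV.
     t (\<lambda>x y. lam_coord x v a b * lam_coord y w c d) * \<beta> (lam_mon v a b) (lam_mon w c d))"
    by (simp add: case_prod_unfold xy(2)[OF coord_form] sum_distrib_right)
  finally show ?thesis .
qed

lemma left_part_coord: "x \<in> left_part i \<Longrightarrow> v \<noteq> (odd i \<noteq> (\<alpha> \<noteq> \<beta>)) \<Longrightarrow> lam_coord x v \<alpha> \<beta> = 0"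
  by (cases \<alpha>; cases \<beta>) (auto simp: left_part_def lam_coord_mult lam_gens_closed coord_mult_def lam_coord_gens)

lemma right_part_coord: "y \<in> right_part j \<Longrightarrow> w \<noteq> odd j \<Longrightarrow> lam_coord y w \<gamma> \<delta> = 0"
  by (cases \<gamma>; cases \<delta>) (auto simp: right_part_def lam_coord_mult lam_gens_closed coord_mult_def lam_coord_gens)

text \<open>\<open>tensor_expand\<close> also mentions coordinate forms whose left path does not end
  at i or whose right path does not start at the right index. They vanish on the (i, r)-summand, and
  the remaining ones are the values recorded by \<open>res_coord\<close>.\<close>

lemma res_coord_inj:
  fixes u w :: "'k::field res"
  assumes u: "u \<in> carrier (RP n)" and w: "w \<in> carrier (RP n)"
    and eq: "\<And>i r \<alpha> \<beta> \<gamma> \<delta>. r \<le> n \<Longrightarrow> res_coord n u i r \<alpha> \<beta> \<gamma> \<delta> = res_coord n w i r \<alpha> \<beta> \<gamma> \<delta>"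
  shows "u = w"
proof (rule Res_eqI[OF u w])
  fix s and \<beta> :: "'k lam \<Rightarrow> 'k lam \<Rightarrow> 'k" assume s: "s \<in> Res_index n" and \<beta>: "\<beta> \<in> bilinear_forms LA"
  obtain i r where ir: "s = (vert i, int r)" "r \<le> n" by (rule Res_indexE[OF s])
  have zero: "t s (\<lambda>x y. lam_coord x v a b * lam_coord y v' c d) = 0"
    if t: "t \<in> carrier (RP n)" and ne: "v \<noteq> (i \<noteq> (a \<noteq> b)) \<or> v' \<noteq> (i \<noteq> odd n)" for t :: "'k res" and v a b v' c d
  proof -
    have "t s (\<lambda>x y. lam_coord x v a b * lam_coord y v' c d)
      = 0 * t s (\<lambda>x y. lam_coord x v a b * lam_coord y v' c d) + 0 * t s (\<lambda>x y. lam_coord x v a b * lam_coord y v' c d)"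
    proof (rule tensor_space_lin[OF Res_part_of[OF t] coord_form coord_form coord_form])
      fix x y :: "'k lam" assume "x \<in> left_part (fst s)" "y \<in> right_part (fst s + int n - 2 * snd s)"
      then show "lam_coord x v a b * lam_coord y v' c d = 0 * (lam_coord x v a b * lam_coord y v' c d) + 0 * (lam_coord x v a b * lam_coord y v' c d)"
        using ne left_part_coord[of x "fst s" v a b] right_part_coord[of y "fst s + int n - 2 * snd s" v' c d]
        by (auto simp: ir)
    qed
    then show ?thesis by simp
  qed
  have "u s (\<lambda>x y. lam_coord x v a b * lam_coord y v' c d) = w s (\<lambda>x y. lam_coord x v a b * lam_coord y v' c d)" for v a b v' c d
  proof (cases "v = (i \<noteq> (a \<noteq> b)) \<and> v' = (i \<noteq> odd n)")
    case True
    then show ?thesis using eq[OF ir(2), of i a b c d] by (simp add: res_coord_def ir(1))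
  next
    case False
    then have ne: "v \<noteq> (i \<noteq> (a \<noteq> b)) \<or> v' \<noteq> (i \<noteq> odd n)" by simp
    show ?thesis by (simp only: zero[OF u ne] zero[OF w ne])
  qed
  then show "u s \<beta> = w s \<beta>"
    using tensor_expand[OF Res_part_of[OF u] left_part_subset right_part_subset \<beta>, of s]
      tensor_expand[OF Res_part_of[OF w] left_part_subset right_part_subset \<beta>, of s] by (simp only:)
qed

lemma res_coord_surj:
  fixes c :: "bool \<Rightarrow> nat \<Rightarrow> bool \<Rightarrow> bool \<Rightarrow> bool \<Rightarrow> bool \<Rightarrow> 'k::field"
  shows "\<exists>u\<in>carrier (RP n). \<forall>i r \<alpha> \<beta> \<gamma> \<delta>. r \<le> n \<longrightarrow> res_coord n u i r \<alpha> \<beta> \<gamma> \<delta> = c i r \<alpha> \<beta> \<gamma> \<delta>"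
proof -
  define l where "l i r p = (case p of (a, b, g, d) \<Rightarrow> c i r a b g d \<odot>\<^bsub>LA\<^esub> lam_mon (i \<noteq> (a \<noteq> b)) a b)" for i r p
  define m where "m i p = (case p of (a :: bool, b :: bool, g, d) \<Rightarrow> (lam_mon (i \<noteq> odd n) g d :: 'k lam))" for i p
  define u where "u s = (if s \<in> Res_index n then (\<lambda>\<beta>. \<Sum>p\<in>UNIV. tensor LA (l (odd (fst s)) (nat (snd s)) p) (m (odd (fst s)) p) \<beta>) else (\<lambda>_. 0))" for s
  have lm: "l i r p \<in> left_part (vert i)" "m i p \<in> right_part (vert i + int n - 2 * int r)" for i r p
  proof -
    obtain a b g d where p: "p = (a, b, g, d)" by (cases p) auto
    have lc: "l i r p \<in> carrier LA" and mc: "m i p \<in> carrier LA" by (simp_all add: l_def m_def p lam_mon)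
    have "l i r p \<otimes>\<^bsub>LA\<^esub> eL (vert i) = l i r p"
      by (rule lam_coord_inj)
        (use lc in \<open>auto simp: lam_gens_closed lam_coord_mult coord_mult_def lam_coord_gens l_def p lam_coord_smult lam_mon\<close>)
    then show "l i r p \<in> left_part (vert i)" unfolding left_part_def using lc by (metis (mono_tags, lifting) mem_Collect_eq)
    have "eL (vert i + int n - 2 * int r) \<otimes>\<^bsub>LA\<^esub> m i p = m i p"
      by (rule lam_coord_inj)
        (use mc in \<open>auto simp: lam_gens_closed lam_coord_mult coord_mult_def lam_coord_gens m_def p lam_coord_smult lam_mon\<close>)
    then show "m i p \<in> right_part (vert i + int n - 2 * int r)" unfolding right_part_def using mc by (metis (mono_tags, lifting) mem_Collect_eq)
  qed
  have "u \<in> carrier (RP n)"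
  proof (rule Res_carrierI)
    fix s assume s: "s \<in> Res_index n"
    obtain i r where ir: "s = (vert i, int r)" "r \<le> n" by (rule Res_indexE[OF s])
    show "u s \<in> Res_part n s"
      unfolding u_def if_P[OF s] using lm[of i] by (intro tensor_space_sum tensor_in_space) (simp_all add: ir)
  qed (simp add: u_def)
  moreover have "res_coord n u i r \<alpha> \<beta> \<gamma> \<delta> = c i r \<alpha> \<beta> \<gamma> \<delta>" if "r \<le> n" for i r \<alpha> \<beta> \<gamma> \<delta>
  proof -
    have "res_coord n u i r \<alpha> \<beta> \<gamma> \<delta> = (\<Sum>p\<in>UNIV. if p = (\<alpha>, \<beta>, \<gamma>, \<delta>) then c i r \<alpha> \<beta> \<gamma> \<delta> else 0)"
      unfolding res_coord_def u_def if_P[OF Res_indexI[OF that]]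
    proof (intro sum.cong refl)
      fix p :: "bool \<times> bool \<times> bool \<times> bool"
      obtain a b g d where p: "p = (a, b, g, d)" by (cases p) auto
      show "tensor LA (l (odd (fst (vert i, int r))) (nat (snd (vert i, int r))) p) (m (odd (fst (vert i, int r))) p)
         (\<lambda>x y. lam_coord x (i \<noteq> (\<alpha> \<noteq> \<beta>)) \<alpha> \<beta> * lam_coord y (i \<noteq> odd n) \<gamma> \<delta>) = (if p = (\<alpha>, \<beta>, \<gamma>, \<delta>) then c i r \<alpha> \<beta> \<gamma> \<delta> else 0)"
        by (auto simp: tensor_def coord_form p l_def m_def lam_coord_smult lam_mon)
    qed
    also have "\<dots> = c i r \<alpha> \<beta> \<gamma> \<delta>" by (subst sum.delta) auto
    finally show ?thesis .
  qed
  ultimately show ?thesis by blast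
qed

text \<open>The differential from degree n to n - 1, sorted by target. The coordinate at a summand
  collects what the four boundary terms bring there: right and left multiplication by a from the
  same r, left and right multiplication by a-bar from r + 1. The shift of r explains the exponent
  \<open>Suc (n + r)\<close> in the third term. Since N = 1, no longer path occurs in any
  term.\<close>

definition diff_coord :: "nat \<Rightarrow> (bool \<Rightarrow> nat \<Rightarrow> bool \<Rightarrow> bool \<Rightarrow> bool \<Rightarrow> bool \<Rightarrow> 'k::field) \<Rightarrow> bool \<Rightarrow> nat \<Rightarrow> bool \<Rightarrow> bool \<Rightarrow> bool \<Rightarrow> bool \<Rightarrow> 'k" where
  "diff_coord n u i r \<alpha> \<beta> \<gamma> \<delta> =
     (if \<gamma> then u i r \<alpha> \<beta> False \<delta> else 0) + (if \<alpha> then (-1) ^ (n + r) * u (\<not> i) r False \<beta> \<gamma> \<delta> else 0)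
     + (if \<beta> then (-1) ^ Suc (n + r) * u (\<not> i) (Suc r) \<alpha> False \<gamma> \<delta> else 0)
     + (if \<delta> then (-1) ^ n * u i (Suc r) \<alpha> \<beta> \<gamma> False else 0)"

text \<open>Multiplication of the two tensor factors: one term for each way to cut the normal path
  (for two arrows, in either order), taken from the summand of the vertex at which the cut is
  made.\<close>

definition aug_coord :: "(bool \<Rightarrow> nat \<Rightarrow> bool \<Rightarrow> bool \<Rightarrow> bool \<Rightarrow> bool \<Rightarrow> 'k::field) \<Rightarrow> bool \<Rightarrow> bool \<Rightarrow> bool \<Rightarrow> 'k" where
  "aug_coord u v \<alpha> \<beta> =
     (if \<alpha> then if \<beta> then u v 0 False False True True + u (\<not> v) 0 True False False True
                       + u (\<not> v) 0 False True True False + u v 0 True True False False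
               else u v 0 False False True False + u (\<not> v) 0 True False False False
      else if \<beta> then u v 0 False False False True + u (\<not> v) 0 False True False False
      else u v 0 False False False False)"

text \<open>The contracting homotopy of the tensor product of the periodic resolutions of
  \<open>K[x]/(x\<^sup>2)\<close> and \<open>K[y]/(y\<^sup>2)\<close>, in coordinates.\<close>

definition homotopy_coord :: "nat \<Rightarrow> (bool \<Rightarrow> nat \<Rightarrow> bool \<Rightarrow> bool \<Rightarrow> bool \<Rightarrow> bool \<Rightarrow> 'k::field) \<Rightarrow> bool \<Rightarrow> nat \<Rightarrow> bool \<Rightarrow> bool \<Rightarrow> bool \<Rightarrow> bool \<Rightarrow> 'k" where
  "homotopy_coord n u i r \<alpha> \<beta> \<gamma> \<delta> =
     (if \<gamma> then 0 else if r \<le> n then u i r \<alpha> \<beta> True \<delta>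
      else if \<delta> then 0
      else (-1) ^ Suc n * (u i n \<alpha> \<beta> False True + (if \<alpha> then u (\<not> i) n False \<beta> True True else 0)))"

lemma diff_diff_coord: "diff_coord n (diff_coord (Suc n) u) i r \<alpha> \<beta> \<gamma> \<delta> = 0"
  by (cases "even n"; cases "even r"; cases \<alpha>; cases \<beta>; cases \<gamma>; cases \<delta>) (simp_all add: diff_coord_def)

lemma aug_diff_coord: "aug_coord (diff_coord 1 u) v \<alpha> \<beta> = 0"
  by (cases \<alpha>; cases \<beta>) (simp_all add: aug_coord_def diff_coord_def)

text \<open>The identity verified is d h + h d = 1. The homotopy has the shape of h_x tensor 1 plus
  (s e)_x tensor h_y, with e the augmentation and s its section in the x-direction. Thus it strips
  an a off the right factor and keeps r; in the summand of x-degree 0 it moves a remaining a to the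
  left and strips an a-bar into the new last summand. The second case of the proof is that last
  summand.\<close>

lemma exact_coord:
  fixes u :: "bool \<Rightarrow> nat \<Rightarrow> bool \<Rightarrow> bool \<Rightarrow> bool \<Rightarrow> bool \<Rightarrow> 'k::field"
  assumes "\<And>i r \<alpha> \<beta> \<gamma> \<delta>. r \<le> n \<Longrightarrow> diff_coord (Suc n) u i r \<alpha> \<beta> \<gamma> \<delta> = 0" and r: "r \<le> Suc n"
  shows "diff_coord (Suc (Suc n)) (homotopy_coord (Suc n) u) i r \<alpha> \<beta> \<gamma> \<delta> = u i r \<alpha> \<beta> \<gamma> \<delta>"
proof (cases \<gamma>)
  case True
  then show ?thesis using r by (simp add: diff_coord_def homotopy_coord_def)
next
  case False
  show ?thesis
  proof (cases "r \<le> n")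
    case True
    have "diff_coord (Suc (Suc n)) (homotopy_coord (Suc n) u) i r \<alpha> \<beta> False \<delta>
        = u i r \<alpha> \<beta> False \<delta> - diff_coord (Suc n) u i r \<alpha> \<beta> True \<delta>"
      using True by (cases "even n"; cases "even r"; cases \<alpha>; cases \<beta>; cases \<delta>)
        (simp_all add: diff_coord_def homotopy_coord_def)
    then show ?thesis using False assms(1)[OF True] by simp
  next
    case r': False
    then have r: "r = Suc n" using r by simp
    have "diff_coord (Suc (Suc n)) (homotopy_coord (Suc n) u) i (Suc n) \<alpha> \<beta> False \<delta>
        = u i (Suc n) \<alpha> \<beta> False \<delta> - (if \<delta> then 0 else (-1) ^ Suc n * (diff_coord (Suc n) u i n \<alpha> \<beta> False True
          + (if \<alpha> then diff_coord (Suc n) u (\<not> i) n False \<beta> True True else 0)))"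
      by (cases "even n"; cases \<alpha>; cases \<beta>; cases \<delta>)
        (simp_all add: diff_coord_def homotopy_coord_def)
    then show ?thesis using False assms(1) r by simp
  qed
qed

text \<open>At the bottom the identity is d h = 1 - s e, where s sends a path to the tensor with
  trivial right factor; hence the correction occurs only if there is no arrow on the right.\<close>

lemma exact_coord_0:
  fixes u :: "bool \<Rightarrow> nat \<Rightarrow> bool \<Rightarrow> bool \<Rightarrow> bool \<Rightarrow> bool \<Rightarrow> 'k::field"
  assumes "\<And>v \<alpha> \<beta>. aug_coord u v \<alpha> \<beta> = 0"
  shows "diff_coord 1 (homotopy_coord 0 u) i 0 \<alpha> \<beta> \<gamma> \<delta> = u i 0 \<alpha> \<beta> \<gamma> \<delta>"
proof -
  have "diff_coord 1 (homotopy_coord 0 u) i 0 \<alpha> \<beta> \<gamma> \<delta>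
    = u i 0 \<alpha> \<beta> \<gamma> \<delta> - (if \<gamma> \<or> \<delta> then 0 else aug_coord u (i \<noteq> (\<alpha> \<noteq> \<beta>)) \<alpha> \<beta>)"
    by (cases \<alpha>; cases \<beta>; cases \<gamma>; cases \<delta>) (simp_all add: diff_coord_def homotopy_coord_def aug_coord_def)
  then show ?thesis by (simp add: assms)
qed

section \<open>The differential and the augmentation agree with their coordinate formulas\<close>

lemma eL_cong: "even i = even j \<Longrightarrow> eL i = eL j"
  by (simp add: lam_e_def path_e_def even_iff_mod_2_eq_zero odd_iff_mod_2_eq_one) (metis mod2_eq_if)

lemma res_gen_single:
  fixes n :: nat
  assumes r: "0 \<le> r" "r \<le> int n"
  shows "(res_gen 2 1 n j r :: 'k::field res) = single_gen n (vert (odd j), r)"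
proof -
  have "j mod 2 = vert (odd j)" by (simp add: vert_def) presburger
  then show ?thesis
    using r
    by (simp add: res_gen_def single_gen_def eL_cong[of j "vert (odd j)"]
        eL_cong[of "j + int n - 2 * r" "vert (odd j) + int n - 2 * r"])
qed

lemma res_gen_zero: "\<not> (0 \<le> r \<and> r \<le> int n) \<Longrightarrow> (res_gen 2 1 n j r :: 'k::field res) = \<zero>\<^bsub>RP n\<^esub>"
  by (auto simp: res_gen_def Res_simps)

lemma res_gen_closed: "(res_gen 2 1 n j r :: 'k::field res) \<in> carrier (RP n)"
proof (cases "0 \<le> r \<and> r \<le> int n")
  case True
  then have "(vert (odd j), r) \<in> Res_index n" by (simp add: Res_index_def)
  then show ?thesis using True by (simp add: res_gen_single single_gen_closed)
next
  case False
  show ?thesis unfolding res_gen_zero[OF False] by (rule RP.zero_closed)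
qed

lemma res_coord_single_gen:
  assumes "r0 \<le> n"
  shows "res_coord n (single_gen n (vert i0, int r0) :: 'k::field res) i r \<alpha> \<beta> \<gamma> \<delta>
    = of_bool (i = i0 \<and> r = r0 \<and> \<not> \<alpha> \<and> \<not> \<beta> \<and> \<not> \<gamma> \<and> \<not> \<delta>)"
proof -
  let ?g = "single_gen n (vert i0, int r0) :: 'k res"
  have "?g = lact (RP n) \<one>\<^bsub>LA\<^esub> (ract (RP n) ?g \<one>\<^bsub>LA\<^esub>)"
    by (simp add: single_gen_closed[OF Res_indexI[OF assms]])
  then have "res_coord n ?g i r \<alpha> \<beta> \<gamma> \<delta> = res_coord n (lact (RP n) \<one>\<^bsub>LA\<^esub> (ract (RP n) ?g \<one>\<^bsub>LA\<^esub>)) i r \<alpha> \<beta> \<gamma> \<delta>"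
    by simp
  then show ?thesis
    by (simp only: res_coord_lact_ract_gen LA.one_closed lam_coord_one) auto
qed

lemma res_coord_gen:
  "res_coord n (res_gen 2 1 n j r :: 'k::field res) i r' \<alpha> \<beta> \<gamma> \<delta>
    = of_bool (0 \<le> r \<and> r \<le> int n \<and> r = int r' \<and> i = odd j \<and> \<not> \<alpha> \<and> \<not> \<beta> \<and> \<not> \<gamma> \<and> \<not> \<delta>)"
proof (cases "0 \<le> r \<and> r \<le> int n")
  case True
  then obtain r0 where r0: "r = int r0" "r0 \<le> n" by (metis nonneg_int_cases of_nat_le_iff)
  show ?thesis
    using r0(2) by (simp add: r0(1) res_gen_single res_coord_single_gen[OF r0(2)])
next
  case False
  then show ?thesis by (auto simp: res_gen_zero[OF False] res_coord_zero)
qed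

lemma lessThan_one: "{..<1::nat} = {0}"
  by auto

text \<open>With N = 1 all powers of a a-bar and a-bar a in the boundary formula are the unit, and
  its three cases consist of the same four terms t1 to t4.\<close>

lemma res_bdry_coord:
  assumes r0: "r0 \<le> Suc n"
  shows "res_bdry 2 1 (Suc n) (vert i0) r0 \<in> carrier (RP n :: ('k::field lam, 'k res) bimodule)"
    and "r \<le> n \<Longrightarrow> res_coord n (res_bdry 2 1 (Suc n) (vert i0) r0 :: 'k res) i r \<alpha> \<beta> \<gamma> \<delta>
      = diff_coord (Suc n) (res_coord (Suc n) (single_gen (Suc n) (vert i0, int r0))) i r \<alpha> \<beta> \<gamma> \<delta>"
proof -
  let ?i = "vert i0" and ?N = "Suc n"
  let ?j = "?i + int ?N - 2 * int r0"
  let ?g = "\<lambda>i r. res_gen 2 1 n i r :: 'k res"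
  let ?a = "\<lambda>i. lam_a 2 1 i :: 'k lam" and ?b = "\<lambda>i. lam_b 2 1 i :: 'k lam"
  define t1 where "t1 = ract (RP n) (?g ?i (int r0)) (?a (?j - 1))"
  define t2 where "t2 = lact (RP n) (?a ?i) (?g (?i + 1) (int r0))"
  define t3 where "t3 = lact (RP n) (?b (?i - 1)) (?g (?i - 1) (int r0 - 1))"
  define t4 where "t4 = ract (RP n) (?g ?i (int r0 - 1)) (?b ?j)"
  let ?w = "res_bdry 2 1 (Suc n) (vert i0) r0 :: 'k res"
  note gc = res_gen_closed lam_gens_closed
  note td = t1_def t2_def t3_def t4_def
  have t: "t1 \<in> carrier (RP n)" "t2 \<in> carrier (RP n)" "t3 \<in> carrier (RP n)" "t4 \<in> carrier (RP n)"
    by (simp_all add: gc td)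
  have coords: "res_coord n t1 i r \<alpha> \<beta> \<gamma> \<delta> = of_bool (r \<le> n \<and> r = r0 \<and> i = i0 \<and> \<not> \<alpha> \<and> \<not> \<beta> \<and> \<gamma> \<and> \<not> \<delta>)"
    "res_coord n t2 i r \<alpha> \<beta> \<gamma> \<delta> = of_bool (r \<le> n \<and> r = r0 \<and> i = (\<not> i0) \<and> \<alpha> \<and> \<not> \<beta> \<and> \<not> \<gamma> \<and> \<not> \<delta>)"
    "res_coord n t3 i r \<alpha> \<beta> \<gamma> \<delta> = of_bool (r \<le> n \<and> Suc r = r0 \<and> i = (\<not> i0) \<and> \<not> \<alpha> \<and> \<beta> \<and> \<not> \<gamma> \<and> \<not> \<delta>)"
    "res_coord n t4 i r \<alpha> \<beta> \<gamma> \<delta> = of_bool (r \<le> n \<and> Suc r = r0 \<and> i = i0 \<and> \<not> \<alpha> \<and> \<not> \<beta> \<and> \<not> \<gamma> \<and> \<delta>)" for i r \<alpha> \<beta> \<gamma> \<delta>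
  proof -
    have 1: "int r0 \<le> int n \<and> int r0 = int r \<longleftrightarrow> r \<le> n \<and> r = r0" by auto
    have 2: "0 \<le> int r0 - 1 \<and> int r0 - 1 \<le> int n \<and> int r0 - 1 = int r \<longleftrightarrow> r \<le> n \<and> Suc r = r0" by auto
    show "res_coord n t1 i r \<alpha> \<beta> \<gamma> \<delta> = of_bool (r \<le> n \<and> r = r0 \<and> i = i0 \<and> \<not> \<alpha> \<and> \<not> \<beta> \<and> \<gamma> \<and> \<not> \<delta>)"
      using 1 by (cases \<gamma>; cases \<delta>) (auto simp: td res_coord_ract gc coord_mult_def lam_coord_gens res_coord_gen)
    show "res_coord n t2 i r \<alpha> \<beta> \<gamma> \<delta> = of_bool (r \<le> n \<and> r = r0 \<and> i = (\<not> i0) \<and> \<alpha> \<and> \<not> \<beta> \<and> \<not> \<gamma> \<and> \<not> \<delta>)"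
      using 1 by (cases \<alpha>; cases \<beta>) (auto simp: td res_coord_lact gc coord_mult_def lam_coord_gens res_coord_gen)
    show "res_coord n t3 i r \<alpha> \<beta> \<gamma> \<delta> = of_bool (r \<le> n \<and> Suc r = r0 \<and> i = (\<not> i0) \<and> \<not> \<alpha> \<and> \<beta> \<and> \<not> \<gamma> \<and> \<not> \<delta>)"
      using 2 by (cases \<alpha>; cases \<beta>) (auto simp: td res_coord_lact gc coord_mult_def lam_coord_gens res_coord_gen)
    show "res_coord n t4 i r \<alpha> \<beta> \<gamma> \<delta> = of_bool (r \<le> n \<and> Suc r = r0 \<and> i = i0 \<and> \<not> \<alpha> \<and> \<not> \<beta> \<and> \<not> \<gamma> \<and> \<delta>)"
      using 2 by (cases \<gamma>; cases \<delta>) (auto simp: td res_coord_ract gc coord_mult_def lam_coord_gens res_coord_gen)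
  qed
  have w: "?w \<in> carrier (RP n) \<and> (\<forall>i r \<alpha> \<beta> \<gamma> \<delta>. res_coord n ?w i r \<alpha> \<beta> \<gamma> \<delta> = res_coord n t1 i r \<alpha> \<beta> \<gamma> \<delta>
       + (-1) ^ (?N + r0) * res_coord n t2 i r \<alpha> \<beta> \<gamma> \<delta> + (-1) ^ (?N + r0) * res_coord n t3 i r \<alpha> \<beta> \<gamma> \<delta>
       + (-1) ^ ?N * res_coord n t4 i r \<alpha> \<beta> \<gamma> \<delta>)"
  proof (cases "int ?N = 2 * int r0")
    case False
    have "?w = t1 \<oplus>\<^bsub>RP n\<^esub> res_scale ((-1) ^ (?N + r0)) t2 \<oplus>\<^bsub>RP n\<^esub> res_scale ((-1) ^ (?N + r0)) t3 \<oplus>\<^bsub>RP n\<^esub> res_scale ((-1) ^ ?N) t4"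
      using False by (auto simp: res_bdry_def Let_def gc LA.r_one td)
    then show ?thesis by (simp only:) (simp add: t Res_scale_closed res_coord_add res_coord_scale del: power_Suc)
  next
    \<comment> \<open>In the middle case the degree is 2 r0, so its signs (-1)^r0 and 1 are the
      (-1)^(n + r0) and (-1)^n of the other cases, for the degree n of the generator. The sum over k
      has the single index 0.\<close>
    case True
    then have N: "?N = 2 * r0" by linarith
    have j: "?j = ?i" using True by linarith
    let ?k = "ract (RP n) (t1 \<oplus>\<^bsub>RP n\<^esub> res_scale ((-1) ^ r0) t3) \<one>\<^bsub>LA\<^esub>"
    let ?k' = "ract (RP n) (res_scale ((-1) ^ r0) t2 \<oplus>\<^bsub>RP n\<^esub> t4) \<one>\<^bsub>LA\<^esub>"
    have kc: "lact (RP n) \<one>\<^bsub>LA\<^esub> ?k \<oplus>\<^bsub>RP n\<^esub> lact (RP n) \<one>\<^bsub>LA\<^esub> ?k' \<in> carrier (RP n)"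
      by (simp add: t Res_scale_closed)
    have "?w = finsum (RP n) (\<lambda>k. lact (RP n) ((?b (?i - 1) \<otimes>\<^bsub>LA\<^esub> ?a (?i - 1)) [^]\<^bsub>LA\<^esub> k)
           (ract (RP n) (ract (RP n) (?g ?i (int r0)) (?a (?i - 1))
                    \<oplus>\<^bsub>RP n\<^esub> res_scale ((-1) ^ r0) t3)
              ((?b (?i - 1) \<otimes>\<^bsub>LA\<^esub> ?a (?i - 1)) [^]\<^bsub>LA\<^esub> (1 - k - 1)))
         \<oplus>\<^bsub>RP n\<^esub>
         lact (RP n) ((?a ?i \<otimes>\<^bsub>LA\<^esub> ?b ?i) [^]\<^bsub>LA\<^esub> k)
           (ract (RP n) (res_scale ((-1) ^ r0) t2
                    \<oplus>\<^bsub>RP n\<^esub> ract (RP n) (?g ?i (int r0 - 1)) (?b ?i))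
              ((?a ?i \<otimes>\<^bsub>LA\<^esub> ?b ?i) [^]\<^bsub>LA\<^esub> (1 - k - 1)))) {0::nat}"
      using True by (simp add: res_bdry_def Let_def lessThan_one td)
    also have "\<dots> = lact (RP n) \<one>\<^bsub>LA\<^esub> ?k \<oplus>\<^bsub>RP n\<^esub> lact (RP n) \<one>\<^bsub>LA\<^esub> ?k'"
      using kc unfolding j td by (subst RP.finsum_insert) simp_all
    also have "\<dots> = t1 \<oplus>\<^bsub>RP n\<^esub> res_scale ((-1) ^ r0) t3 \<oplus>\<^bsub>RP n\<^esub> (res_scale ((-1) ^ r0) t2 \<oplus>\<^bsub>RP n\<^esub> t4)"
      by (simp add: t Res_scale_closed)
    finally have w: "?w = t1 \<oplus>\<^bsub>RP n\<^esub> res_scale ((-1) ^ r0) t3 \<oplus>\<^bsub>RP n\<^esub> (res_scale ((-1) ^ r0) t2 \<oplus>\<^bsub>RP n\<^esub> t4)" .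
    have "?w \<in> carrier (RP n)" unfolding w by (simp add: t Res_scale_closed)
    moreover have "(-1 :: 'k) ^ ?N = 1" unfolding N by simp
    moreover from this have "(-1 :: 'k) ^ (?N + r0) = (-1) ^ r0" by (simp only: power_add mult_1)
    ultimately show ?thesis
      by (simp only: w) (simp add: t Res_scale_closed res_coord_add res_coord_scale del: power_Suc)
  qed
  then show "?w \<in> carrier (RP n)" by blast
  fix i r \<alpha> \<beta> \<gamma> \<delta> assume r: "r \<le> n"
  note wc = conjunct2[OF w, THEN spec[of _ i], THEN spec[of _ r], THEN spec[of _ \<alpha>], THEN spec[of _ \<beta>],
      THEN spec[of _ \<gamma>], THEN spec[of _ \<delta>]]
  show "res_coord n ?w i r \<alpha> \<beta> \<gamma> \<delta>
      = diff_coord (Suc n) (res_coord (Suc n) (single_gen (Suc n) (vert i0, int r0))) i r \<alpha> \<beta> \<gamma> \<delta>"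
    unfolding diff_coord_def res_coord_single_gen[OF r0] wc coords
    using r by (cases \<alpha>; cases \<beta>; cases \<gamma>; cases \<delta>; cases i; cases i0; cases "r0 = r"; cases "r0 = Suc r"; simp)
qed

text \<open>The differential is built from its coordinates, so that it is a homomorphism and squares
  to zero by finite coordinate checks. \<open>res_diff_eq\<close> shows that it is the map singled
  out by the definite description.\<close>

definition diff_map :: "nat \<Rightarrow> 'k::field res \<Rightarrow> 'k res" where
  "diff_map n = (\<lambda>u\<in>carrier (RP (Suc n)). SOME w. w \<in> carrier (RP n) \<and>
     (\<forall>i r \<alpha> \<beta> \<gamma> \<delta>. r \<le> n \<longrightarrow> res_coord n w i r \<alpha> \<beta> \<gamma> \<delta> = diff_coord (Suc n) (res_coord (Suc n) u) i r \<alpha> \<beta> \<gamma> \<delta>))"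

lemma diff_map:
  fixes u :: "'k::field res"
  assumes "u \<in> carrier (RP (Suc n))"
  shows "diff_map n u \<in> carrier (RP n)"
    and "r \<le> n \<Longrightarrow> res_coord n (diff_map n u) i r \<alpha> \<beta> \<gamma> \<delta> = diff_coord (Suc n) (res_coord (Suc n) u) i r \<alpha> \<beta> \<gamma> \<delta>"
proof -
  have "\<exists>w. w \<in> carrier (RP n) \<and>
     (\<forall>i r \<alpha> \<beta> \<gamma> \<delta>. r \<le> n \<longrightarrow> res_coord n w i r \<alpha> \<beta> \<gamma> \<delta> = diff_coord (Suc n) (res_coord (Suc n) u) i r \<alpha> \<beta> \<gamma> \<delta>)"
    using res_coord_surj[of n "diff_coord (Suc n) (res_coord (Suc n) u)"] by blast
  from someI_ex[OF this] assms show "diff_map n u \<in> carrier (RP n)"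
    and "r \<le> n \<Longrightarrow> res_coord n (diff_map n u) i r \<alpha> \<beta> \<gamma> \<delta> = diff_coord (Suc n) (res_coord (Suc n) u) i r \<alpha> \<beta> \<gamma> \<delta>"
    unfolding diff_map_def by simp_all
qed

lemma diff_coord_eqI:
  fixes u w :: "'k::field res"
  assumes "u \<in> carrier (RP (Suc n))" "w \<in> carrier (RP n)"
    "\<And>i r \<alpha> \<beta> \<gamma> \<delta>. r \<le> n \<Longrightarrow> res_coord n w i r \<alpha> \<beta> \<gamma> \<delta> = diff_coord (Suc n) (res_coord (Suc n) u) i r \<alpha> \<beta> \<gamma> \<delta>"
  shows "diff_map n u = w"
  by (rule res_coord_inj[OF diff_map(1)[OF assms(1)] assms(2)]) (simp add: diff_map(2)[OF assms(1)] assms(3))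

lemma diff_map_hom: "diff_map n \<in> bimodule_hom (LA :: ('k::field, 'k lam) module) (RP (Suc n)) (RP n)"
proof (rule bimodule_homI)
  show "diff_map n \<in> extensional (carrier (RP (Suc n)))" by (simp add: diff_map_def)
next
  fix u :: "'k res" assume u: "u \<in> carrier (RP (Suc n))"
  show "diff_map n u \<in> carrier (RP n)" by (rule diff_map(1)[OF u])
next
  fix u w :: "'k res" assume uw: "u \<in> carrier (RP (Suc n))" "w \<in> carrier (RP (Suc n))"
  show "diff_map n (u \<oplus>\<^bsub>RP (Suc n)\<^esub> w) = diff_map n u \<oplus>\<^bsub>RP n\<^esub> diff_map n w"
    by (rule diff_coord_eqI)
       (use uw in \<open>simp_all add: diff_map res_coord_add diff_coord_def algebra_simps\<close>)
next
  fix u :: "'k res" and l :: "'k lam" assume u: "u \<in> carrier (RP (Suc n))" and l: "l \<in> carrier LA"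
  note c = diff_map[OF u] res_coord_lact[OF diff_map(1)[OF u] l] res_coord_ract[OF diff_map(1)[OF u] l]
    res_coord_lact[OF u l] res_coord_ract[OF u l]
  show "diff_map n (lact (RP (Suc n)) l u) = lact (RP n) l (diff_map n u)"
  proof (rule diff_coord_eqI)
    fix i r \<alpha> \<beta> \<gamma> \<delta> assume "r \<le> n"
    then show "res_coord n (lact (RP n) l (diff_map n u)) i r \<alpha> \<beta> \<gamma> \<delta>
       = diff_coord (Suc n) (res_coord (Suc n) (lact (RP (Suc n)) l u)) i r \<alpha> \<beta> \<gamma> \<delta>"
      by (cases \<alpha>; cases \<beta>; cases \<gamma>; cases \<delta>) (simp_all add: c diff_coord_def coord_mult_def algebra_simps)
  qed (use u l in \<open>simp_all add: diff_map(1)\<close>)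
  show "diff_map n (ract (RP (Suc n)) u l) = ract (RP n) (diff_map n u) l"
  proof (rule diff_coord_eqI)
    fix i r \<alpha> \<beta> \<gamma> \<delta> assume "r \<le> n"
    then show "res_coord n (ract (RP n) (diff_map n u) l) i r \<alpha> \<beta> \<gamma> \<delta>
       = diff_coord (Suc n) (res_coord (Suc n) (ract (RP (Suc n)) u l)) i r \<alpha> \<beta> \<gamma> \<delta>"
      by (cases \<alpha>; cases \<beta>; cases \<gamma>; cases \<delta>) (simp_all add: c diff_coord_def coord_mult_def algebra_simps)
  qed (use u l in \<open>simp_all add: diff_map(1)\<close>)
qed

lemma diff_map_gen:
  assumes "r0 \<le> Suc n"
  shows "diff_map n (single_gen (Suc n) (vert i0, int r0)) = res_bdry 2 1 (Suc n) (vert i0) r0"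
  by (rule diff_coord_eqI[OF single_gen_closed[OF Res_indexI[OF assms]] res_bdry_coord[OF assms]])

lemma Res_gens_iff: "(\<forall>i\<in>{0..<2}. \<forall>r\<le>n. Q i r) \<longleftrightarrow> (\<forall>i. \<forall>r\<le>n. Q (vert i) r)"
  using vert_cases by (metis vert_simps(3))

lemma res_gen_vert: "r \<le> n \<Longrightarrow> res_gen 2 1 n (vert i) (int r) = single_gen n (vert i, int r)"
  by (simp add: res_gen_single)

lemma res_diff_eq: "res_diff 2 1 (Suc n) = (diff_map n :: 'k::field res \<Rightarrow> 'k res)"
  unfolding res_diff_def
proof (rule the_equality)
  show "diff_map n \<in> bimodule_hom LA (RP (Suc n)) (RP (Suc n - 1)) \<and>
    (\<forall>i\<in>{0..<2}. \<forall>r\<le>Suc n. diff_map n (res_gen 2 1 (Suc n) i (int r)) = (res_bdry 2 1 (Suc n) i r :: 'k res))"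
    unfolding Res_gens_iff by (simp add: diff_map_hom res_gen_vert diff_map_gen)
next
  fix f :: "'k res \<Rightarrow> 'k res"
  assume f: "f \<in> bimodule_hom LA (RP (Suc n)) (RP (Suc n - 1)) \<and>
    (\<forall>i\<in>{0..<2}. \<forall>r\<le>Suc n. f (res_gen 2 1 (Suc n) i (int r)) = res_bdry 2 1 (Suc n) i r)"
  show "f = diff_map n"
  proof (rule Res_hom_ext[OF _ diff_map_hom Res_bimodule])
    show "f \<in> bimodule_hom LA (RP (Suc n)) (RP n)" using f by simp
    fix s assume "s \<in> Res_index (Suc n)"
    then obtain i r where ir: "s = (vert i, int r)" "r \<le> Suc n" by (rule Res_indexE)
    have "f (res_gen 2 1 (Suc n) (vert i) (int r)) = res_bdry 2 1 (Suc n) (vert i) r"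
      using f ir(2) unfolding Res_gens_iff by blast
    then show "f (single_gen (Suc n) s) = diff_map n (single_gen (Suc n) s)"
      using ir by (simp add: res_gen_vert diff_map_gen)
  qed
qed

definition aug_map :: "'k::field res \<Rightarrow> 'k lam" where
  "aug_map = (\<lambda>u\<in>carrier (RP 0). SOME x. x \<in> carrier LA \<and> (\<forall>v \<alpha> \<beta>. lam_coord x v \<alpha> \<beta> = aug_coord (res_coord 0 u) v \<alpha> \<beta>))"

lemma aug_map:
  fixes u :: "'k::field res"
  assumes "u \<in> carrier (RP 0)"
  shows "aug_map u \<in> carrier LA" and "lam_coord (aug_map u) v \<alpha> \<beta> = aug_coord (res_coord 0 u) v \<alpha> \<beta>"
proof -
  have "\<exists>x. x \<in> carrier LA \<and> (\<forall>v \<alpha> \<beta>. lam_coord x v \<alpha> \<beta> = aug_coord (res_coord 0 u) v \<alpha> \<beta>)"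
    using lam_coord_surj[of "aug_coord (res_coord 0 u)"] by blast
  from someI_ex[OF this] assms show "aug_map u \<in> carrier LA" and "lam_coord (aug_map u) v \<alpha> \<beta> = aug_coord (res_coord 0 u) v \<alpha> \<beta>"
    unfolding aug_map_def by simp_all
qed

lemma regular_bimodule_simps [simp]:
  "carrier (regular_bimodule A) = carrier A" "\<zero>\<^bsub>regular_bimodule A\<^esub> = \<zero>\<^bsub>A\<^esub>" "add (regular_bimodule A) = add A"
  "lact (regular_bimodule A) = monoid.mult A" "ract (regular_bimodule A) = monoid.mult A"
  by (simp_all add: regular_bimodule_def)

lemma aug_map_hom: "aug_map \<in> bimodule_hom (LA :: ('k::field, 'k lam) module) (RP 0) (regular_bimodule LA)"
proof (rule bimodule_homI)
  show "aug_map \<in> extensional (carrier (RP 0))" by (simp add: aug_map_def)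
next
  fix u :: "'k res" assume u: "u \<in> carrier (RP 0)"
  show "aug_map u \<in> carrier (regular_bimodule LA)" using aug_map(1)[OF u] by simp
next
  fix u w :: "'k res" assume uw: "u \<in> carrier (RP 0)" "w \<in> carrier (RP 0)"
  have "aug_map (u \<oplus>\<^bsub>RP 0\<^esub> w) = aug_map u \<oplus>\<^bsub>LA\<^esub> aug_map w"
    by (rule lam_coord_inj)
       (use uw in \<open>simp_all add: aug_map res_coord_add aug_coord_def lam_coord_add algebra_simps\<close>)
  then show "aug_map (u \<oplus>\<^bsub>RP 0\<^esub> w) = aug_map u \<oplus>\<^bsub>regular_bimodule LA\<^esub> aug_map w" by simp
next
  fix u :: "'k res" and l :: "'k lam" assume u: "u \<in> carrier (RP 0)" and l: "l \<in> carrier LA"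
  note c = aug_map[OF u] res_coord_lact[OF u l] res_coord_ract[OF u l] lam_coord_mult[OF l aug_map(1)[OF u]]
    lam_coord_mult[OF aug_map(1)[OF u] l]
  have "aug_map (lact (RP 0) l u) = l \<otimes>\<^bsub>LA\<^esub> aug_map u"
  proof (rule lam_coord_inj)
    fix v \<alpha> \<beta>
    show "lam_coord (aug_map (lact (RP 0) l u)) v \<alpha> \<beta> = lam_coord (l \<otimes>\<^bsub>LA\<^esub> aug_map u) v \<alpha> \<beta>"
      using u l by (cases \<alpha>; cases \<beta>) (simp_all add: aug_map(2) c aug_coord_def coord_mult_def algebra_simps)
  qed (use u l in \<open>simp_all add: aug_map(1)\<close>)
  then show "aug_map (lact (RP 0) l u) = lact (regular_bimodule LA) l (aug_map u)" by simp
  have "aug_map (ract (RP 0) u l) = aug_map u \<otimes>\<^bsub>LA\<^esub> l"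
  proof (rule lam_coord_inj)
    fix v \<alpha> \<beta>
    show "lam_coord (aug_map (ract (RP 0) u l)) v \<alpha> \<beta> = lam_coord (aug_map u \<otimes>\<^bsub>LA\<^esub> l) v \<alpha> \<beta>"
      using u l by (cases \<alpha>; cases \<beta>) (simp_all add: aug_map(2) c aug_coord_def coord_mult_def algebra_simps)
  qed (use u l in \<open>simp_all add: aug_map(1)\<close>)
  then show "aug_map (ract (RP 0) u l) = ract (regular_bimodule LA) (aug_map u) l" by simp
qed

lemma aug_map_gen: "aug_map (single_gen 0 (vert i, 0)) = (eL (vert i) :: 'k::field lam)"
proof (rule lam_coord_inj)
  let ?g = "single_gen 0 (vert i, 0) :: 'k res"
  have c: "?g \<in> carrier (RP 0)" using single_gen_closed[OF Res_indexI[of 0 0 i]] by simp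
  show "aug_map ?g \<in> carrier LA" by (rule aug_map(1)[OF c])
  have r: "res_coord 0 ?g j 0 a b c d = of_bool (j = i \<and> \<not> a \<and> \<not> b \<and> \<not> c \<and> \<not> d)" for j a b c d
    using res_coord_single_gen[of 0 0 i, where 'k='k] by simp
  show "lam_coord (aug_map ?g) v \<alpha> \<beta> = lam_coord (eL (vert i)) v \<alpha> \<beta>" for v \<alpha> \<beta>
    unfolding aug_map(2)[OF c] aug_coord_def r lam_coord_gens by (cases v; cases i; simp)
qed (rule lam_gens_closed)

lemma aug_map_single:
  fixes x y :: "'k::field lam"
  assumes xy: "x \<in> carrier LA" "y \<in> carrier LA"
  shows "aug_map (res_single (vert i) 0 (tensor LA (x \<otimes>\<^bsub>LA\<^esub> eL (vert i)) (eL (vert i) \<otimes>\<^bsub>LA\<^esub> y)))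
    = (x \<otimes>\<^bsub>LA\<^esub> eL (vert i)) \<otimes>\<^bsub>LA\<^esub> (eL (vert i) \<otimes>\<^bsub>LA\<^esub> y)"
proof -
  let ?g = "single_gen 0 (vert i, 0) :: 'k res"
  have c: "?g \<in> carrier (RP 0)" using single_gen_closed[OF Res_indexI[of 0 0 i]] by simp
  have "res_single (vert i) 0 (tensor LA (x \<otimes>\<^bsub>LA\<^esub> eL (vert i)) (eL (vert i) \<otimes>\<^bsub>LA\<^esub> y)) = lact (RP 0) x (ract (RP 0) ?g y)"
    by (simp add: lact_ract_single_gen[OF xy])
  then have "aug_map (res_single (vert i) 0 (tensor LA (x \<otimes>\<^bsub>LA\<^esub> eL (vert i)) (eL (vert i) \<otimes>\<^bsub>LA\<^esub> y))) = x \<otimes>\<^bsub>LA\<^esub> (eL (vert i) \<otimes>\<^bsub>LA\<^esub> y)"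
    using xy c by (simp add: bimodule_homD(4,5)[OF aug_map_hom] aug_map_gen)
  also have "\<dots> = x \<otimes>\<^bsub>LA\<^esub> (eL (vert i) \<otimes>\<^bsub>LA\<^esub> eL (vert i) \<otimes>\<^bsub>LA\<^esub> y)" by (simp add: eL_idem)
  also have "\<dots> = (x \<otimes>\<^bsub>LA\<^esub> eL (vert i)) \<otimes>\<^bsub>LA\<^esub> (eL (vert i) \<otimes>\<^bsub>LA\<^esub> y)" using xy by (simp add: LA.m_assoc lam_gens_closed)
  finally show ?thesis .
qed

lemma res_aug_eq: "res_aug 2 1 = (aug_map :: 'k::field res \<Rightarrow> 'k lam)"
  unfolding res_aug_def Let_def
proof (rule the_equality)
  show "aug_map \<in> bimodule_hom LA (RP 0) (regular_bimodule LA) \<and>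
       (\<forall>i\<in>{0..<2}. \<forall>x\<in>carrier LA. \<forall>y\<in>carrier (LA :: ('k, 'k lam) module).
          aug_map (res_single i 0 (tensor LA (x \<otimes>\<^bsub>LA\<^esub> eL i) (eL i \<otimes>\<^bsub>LA\<^esub> y))) =
            (x \<otimes>\<^bsub>LA\<^esub> eL i) \<otimes>\<^bsub>LA\<^esub> (eL i \<otimes>\<^bsub>LA\<^esub> y))"
    using aug_map_hom aug_map_single vert_cases by (metis (no_types, lifting))
next
  fix f :: "'k res \<Rightarrow> 'k lam"
  assume f: "f \<in> bimodule_hom LA (RP 0) (regular_bimodule LA) \<and>
       (\<forall>i\<in>{0..<2}. \<forall>x\<in>carrier LA. \<forall>y\<in>carrier LA.
          f (res_single i 0 (tensor LA (x \<otimes>\<^bsub>LA\<^esub> eL i) (eL i \<otimes>\<^bsub>LA\<^esub> y))) =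
            (x \<otimes>\<^bsub>LA\<^esub> eL i) \<otimes>\<^bsub>LA\<^esub> (eL i \<otimes>\<^bsub>LA\<^esub> y))"
  show "f = aug_map"
  proof (rule Res_hom_ext[OF _ aug_map_hom LA.regular_bimodule])
    show "f \<in> bimodule_hom LA (RP 0) (regular_bimodule LA)" using f by simp
    fix s assume "s \<in> Res_index 0"
    then obtain i where s: "s = (vert i, 0)" by (auto elim: Res_indexE)
    have "f (res_single (vert i) 0 (tensor LA (\<one>\<^bsub>LA\<^esub> \<otimes>\<^bsub>LA\<^esub> eL (vert i)) (eL (vert i) \<otimes>\<^bsub>LA\<^esub> \<one>\<^bsub>LA\<^esub>)))
      = (\<one>\<^bsub>LA\<^esub> \<otimes>\<^bsub>LA\<^esub> eL (vert i)) \<otimes>\<^bsub>LA\<^esub> (eL (vert i) \<otimes>\<^bsub>LA\<^esub> \<one>\<^bsub>LA\<^esub>)"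
      using f LA.one_closed vert_simps(3) by blast
    then show "f (single_gen 0 s) = aug_map (single_gen 0 s)"
      unfolding s aug_map_gen by (simp add: single_gen_def lam_gens_closed eL_idem)
  qed
qed

text \<open>Projectivity of P^n. Preimages of the images of the generators are chosen arbitrarily
  and need not respect the idempotents, so each is replaced by e_i w e_j. This does not change its
  image, because the image of a generator is fixed by the same idempotents.\<close>

lemma Res_lift:
  fixes M :: "('k::field lam, 'b) bimodule" and N :: "('k lam, 'c) bimodule"
  assumes M: "separated_bimodule LA M" and N: "algebra_bimodule LA N"
    and \<delta>: "\<delta> \<in> bimodule_hom LA M N" and f: "f \<in> bimodule_hom LA (RP n) N"
    and im: "\<And>s. s \<in> Res_index n \<Longrightarrow> \<exists>w\<in>carrier M. \<delta> w = f (single_gen n s)"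
  shows "\<exists>h\<in>bimodule_hom LA (RP n) M. \<forall>x\<in>carrier (RP n). \<delta> (h x) = f x"
proof -
  interpret M: separated_bimodule LA M by fact
  obtain w where w: "\<And>s. s \<in> Res_index n \<Longrightarrow> w s \<in> carrier M \<and> \<delta> (w s) = f (single_gen n s)"
    using im by metis
  let ?e = "\<lambda>s. eL (fst s)" and ?e' = "\<lambda>s. eL (fst s + int n - 2 * snd s)"
  let ?h = "\<lambda>s. lact M (?e s) (ract M (w s) (?e' s))"
  have "\<exists>h\<in>bimodule_hom LA (RP n) M. \<forall>s\<in>Res_index n. h (single_gen n s) = ?h s"
  proof (rule Res_hom_exists[OF M])
    fix s assume "s \<in> Res_index n"
    then have ws: "w s \<in> carrier M" using w by blast
    show "?h s \<in> carrier M" using ws by (simp add: lam_gens_closed)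
    show "lact M (?e s) (?h s) = ?h s"
      using ws by (simp add: M.lact_mult[symmetric] lam_gens_closed eL_idem)
    show "ract M (?h s) (?e' s) = ?h s"
      using ws by (simp add: M.lact_ract M.ract_mult[symmetric] lam_gens_closed eL_idem)
  qed
  then obtain h where h: "h \<in> bimodule_hom LA (RP n) M" "\<And>s. s \<in> Res_index n \<Longrightarrow> h (single_gen n s) = ?h s"
    by blast
  have "compose (carrier (RP n)) \<delta> h = f"
  proof (rule Res_hom_ext[OF bimodule_hom_compose[OF h(1) \<delta> Res_bimodule] f N])
    fix s assume s: "s \<in> Res_index n"
    have g: "single_gen n s = lact (RP n) (?e s) (ract (RP n) (single_gen n s) (?e' s) :: 'k res)"
      by (subst lact_ract_single_gen) (simp_all add: lam_gens_closed eL_idem single_gen_def)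
    have "\<delta> (?h s) = lact N (?e s) (ract N (f (single_gen n s)) (?e' s))"
      using w[OF s] by (simp add: bimodule_homD(4,5)[OF \<delta>] lam_gens_closed)
    also have "\<dots> = f (lact (RP n) (?e s) (ract (RP n) (single_gen n s) (?e' s)))"
      by (simp add: bimodule_homD(4,5)[OF f] lam_gens_closed single_gen_closed[OF s])
    finally show "compose (carrier (RP n)) \<delta> h (single_gen n s) = f (single_gen n s)"
      using h(2)[OF s] by (simp add: compose_eq single_gen_closed[OF s] g[symmetric])
  qed
  then have "\<delta> (h x) = f x" if "x \<in> carrier (RP n)" for x
    using that by (drule_tac fun_cong[of _ _ x]) (simp add: compose_eq)
  then show ?thesis using h(1) by blast
qed

text \<open>The contracting homotopy need not be a bimodule map: it is applied only to the
  coordinates of the image of one generator, \<open>res_coord_surj\<close> turns the result into an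
  element, and \<open>Res_lift\<close> extends the choice to a homomorphism.\<close>

lemma Res_projective_resolution:
  "projective_resolution (LA :: ('k::field, 'k lam) module) (Res 2 1) (res_aug 2 1) (res_diff 2 1)"
proof (intro projective_resolution.intro Lam_assoc projective_resolution_axioms.intro, unfold res_diff_eq res_aug_eq)
  fix n k
  show "algebra_bimodule (LA :: ('k, 'k lam) module) (RP n)" by (rule Res_bimodule)
  show "diff_map n \<in> bimodule_hom (LA :: ('k, 'k lam) module) (RP (Suc n)) (RP n)" by (rule diff_map_hom)
  show "aug_map \<in> bimodule_hom (LA :: ('k, 'k lam) module) (RP 0) (regular_bimodule LA)" by (rule aug_map_hom)
  {
    fix u :: "'k res" assume u: "u \<in> carrier (RP (Suc 0))"
    show "aug_map (diff_map 0 u) = \<zero>\<^bsub>LA\<^esub>"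
    proof (rule lam_coord_inj)
      fix v \<alpha> \<beta>
      have "aug_coord (res_coord 0 (diff_map 0 u)) v \<alpha> \<beta> = aug_coord (diff_coord 1 (res_coord (Suc 0) u)) v \<alpha> \<beta>"
        by (simp add: aug_coord_def diff_map(2)[OF u] One_nat_def)
      then show "lam_coord (aug_map (diff_map 0 u)) v \<alpha> \<beta> = lam_coord \<zero>\<^bsub>LA\<^esub> v \<alpha> \<beta>"
        by (simp add: aug_map(2)[OF diff_map(1)[OF u]] aug_diff_coord lam_coord_zero)
    qed (simp_all add: aug_map(1)[OF diff_map(1)[OF u]])
  next
    fix u :: "'k res" assume u: "u \<in> carrier (RP (Suc (Suc n)))"
    show "diff_map n (diff_map (Suc n) u) = \<zero>\<^bsub>RP n\<^esub>"
    proof (rule diff_coord_eqI[OF diff_map(1)[OF u]])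
      fix i r \<alpha> \<beta> \<gamma> \<delta> assume r: "r \<le> n"
      have "diff_coord (Suc n) (res_coord (Suc n) (diff_map (Suc n) u)) i r \<alpha> \<beta> \<gamma> \<delta>
         = diff_coord (Suc n) (diff_coord (Suc (Suc n)) (res_coord (Suc (Suc n)) u)) i r \<alpha> \<beta> \<gamma> \<delta>"
        using r by (simp add: diff_coord_def[of "Suc n"] diff_map(2)[OF u])
      then show "res_coord n \<zero>\<^bsub>RP n\<^esub> i r \<alpha> \<beta> \<gamma> \<delta> = diff_coord (Suc n) (res_coord (Suc n) (diff_map (Suc n) u)) i r \<alpha> \<beta> \<gamma> \<delta>"
        by (simp add: diff_diff_coord res_coord_zero)
    qed simp
  next
    fix g :: "'k res \<Rightarrow> 'k lam" assume g: "g \<in> bimodule_hom LA (RP n) (regular_bimodule LA)"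
    show "\<exists>h\<in>bimodule_hom LA (RP n) (RP 0). \<forall>x\<in>carrier (RP n). aug_map (h x) = g x"
    proof (rule Res_lift[OF Res_separated LA.regular_bimodule aug_map_hom g])
      fix s assume s: "s \<in> Res_index n"
      let ?z = "g (single_gen n s)"
      have z: "?z \<in> carrier LA" using bimodule_homD(2)[OF g single_gen_closed[OF s]] by simp
      \<comment> \<open>The two generators of P^0 map to e_0 and e_1, whose sum is the unit, so z
        times ?u is a preimage of z.\<close>
      let ?u = "single_gen 0 (vert False, 0) \<oplus>\<^bsub>RP 0\<^esub> single_gen 0 (vert True, 0) :: 'k res"
      have c: "single_gen 0 (vert i, 0) \<in> carrier (RP 0 :: ('k lam, 'k res) bimodule)" for i
        using single_gen_closed[OF Res_indexI[of 0 0 i]] by simp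
      have "aug_map ?u = eL (vert False) \<oplus>\<^bsub>LA\<^esub> eL (vert True)"
        using c bimodule_homD(3)[OF aug_map_hom c c, of False True] by (simp add: aug_map_gen)
      also have "\<dots> = \<one>\<^bsub>LA\<^esub>"
        by (rule lam_coord_inj) (auto simp: lam_gens_closed lam_coord_add lam_coord_gens lam_coord_one)
      finally have "aug_map (lact (RP 0) ?z ?u) = ?z"
        using bimodule_homD(4)[OF aug_map_hom, of ?u ?z] z c by simp
      then show "\<exists>w\<in>carrier (RP 0). aug_map w = ?z" using z c by (intro bexI[of _ "lact (RP 0) ?z ?u"]) simp_all
    qed
  next
    fix f :: "'k res \<Rightarrow> 'k res" assume f: "f \<in> bimodule_hom LA (RP n) (RP 0)" "\<forall>x\<in>carrier (RP n). aug_map (f x) = \<zero>\<^bsub>LA\<^esub>"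
    show "\<exists>h\<in>bimodule_hom LA (RP n) (RP (Suc 0)). \<forall>x\<in>carrier (RP n). diff_map 0 (h x) = f x"
    proof (rule Res_lift[OF Res_separated Res_bimodule diff_map_hom f(1)])
      fix s assume s: "s \<in> Res_index n"
      let ?z = "f (single_gen n s)"
      have z: "?z \<in> carrier (RP 0)" using bimodule_homD(2)[OF f(1) single_gen_closed[OF s]] .
      have a: "aug_coord (res_coord 0 ?z) v \<alpha> \<beta> = 0" for v \<alpha> \<beta>
      proof -
        have "aug_map ?z = \<zero>\<^bsub>LA\<^esub>" using f(2) single_gen_closed[OF s] by blast
        then show ?thesis using aug_map(2)[OF z, of v \<alpha> \<beta>] by (simp only: lam_coord_zero)
      qed
      obtain w :: "'k res" where w: "w \<in> carrier (RP (Suc 0))"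
        "\<And>i r \<alpha> \<beta> \<gamma> \<delta>. r \<le> Suc 0 \<Longrightarrow> res_coord (Suc 0) w i r \<alpha> \<beta> \<gamma> \<delta> = homotopy_coord 0 (res_coord 0 ?z) i r \<alpha> \<beta> \<gamma> \<delta>"
        using res_coord_surj[of "Suc 0" "homotopy_coord 0 (res_coord 0 ?z)"] by (metis (no_types))
      have "diff_map 0 w = ?z"
      proof (rule diff_coord_eqI[OF w(1) z])
        fix i r \<alpha> \<beta> \<gamma> \<delta> assume "r \<le> (0::nat)"
        moreover have "diff_coord (Suc 0) (res_coord (Suc 0) w) i 0 \<alpha> \<beta> \<gamma> \<delta>
           = diff_coord (Suc 0) (homotopy_coord 0 (res_coord 0 ?z)) i 0 \<alpha> \<beta> \<gamma> \<delta>"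
          by (simp add: diff_coord_def w(2))
        ultimately show "res_coord 0 ?z i r \<alpha> \<beta> \<gamma> \<delta> = diff_coord (Suc 0) (res_coord (Suc 0) w) i r \<alpha> \<beta> \<gamma> \<delta>"
          using exact_coord_0[OF a, of i \<alpha> \<beta> \<gamma> \<delta>] by (simp add: One_nat_def)
      qed
      then show "\<exists>w\<in>carrier (RP (Suc 0)). diff_map 0 w = ?z" using w(1) by blast
    qed
  next
    fix f :: "'k res \<Rightarrow> 'k res" assume f: "f \<in> bimodule_hom LA (RP n) (RP (Suc k))" "\<forall>x\<in>carrier (RP n). diff_map k (f x) = \<zero>\<^bsub>RP k\<^esub>"
    show "\<exists>h\<in>bimodule_hom LA (RP n) (RP (Suc (Suc k))). \<forall>x\<in>carrier (RP n). diff_map (Suc k) (h x) = f x"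
    proof (rule Res_lift[OF Res_separated Res_bimodule diff_map_hom f(1)])
      fix s assume s: "s \<in> Res_index n"
      let ?z = "f (single_gen n s)"
      have z: "?z \<in> carrier (RP (Suc k))" using bimodule_homD(2)[OF f(1) single_gen_closed[OF s]] .
      have a: "diff_coord (Suc k) (res_coord (Suc k) ?z) i r \<alpha> \<beta> \<gamma> \<delta> = 0" if "r \<le> k" for i r \<alpha> \<beta> \<gamma> \<delta>
      proof -
        have "diff_map k ?z = \<zero>\<^bsub>RP k\<^esub>" using f(2) single_gen_closed[OF s] by blast
        then show ?thesis using diff_map(2)[OF z that, of i \<alpha> \<beta> \<gamma> \<delta>] by (simp only: res_coord_zero)
      qed
      obtain w :: "'k res" where w: "w \<in> carrier (RP (Suc (Suc k)))"
        "\<And>i r \<alpha> \<beta> \<gamma> \<delta>. r \<le> Suc (Suc k) \<Longrightarrow> res_coord (Suc (Suc k)) w i r \<alpha> \<beta> \<gamma> \<delta> = homotopy_coord (Suc k) (res_coord (Suc k) ?z) i r \<alpha> \<beta> \<gamma> \<delta>"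
        using res_coord_surj[of "Suc (Suc k)" "homotopy_coord (Suc k) (res_coord (Suc k) ?z)"] by (metis (no_types))
      have "diff_map (Suc k) w = ?z"
      proof (rule diff_coord_eqI[OF w(1) z])
        fix i r \<alpha> \<beta> \<gamma> \<delta> assume r: "r \<le> Suc k"
        then have "diff_coord (Suc (Suc k)) (res_coord (Suc (Suc k)) w) i r \<alpha> \<beta> \<gamma> \<delta>
           = diff_coord (Suc (Suc k)) (homotopy_coord (Suc k) (res_coord (Suc k) ?z)) i r \<alpha> \<beta> \<gamma> \<delta>"
          by (simp add: diff_coord_def w(2))
        then show "res_coord (Suc k) ?z i r \<alpha> \<beta> \<gamma> \<delta> = diff_coord (Suc (Suc k)) (res_coord (Suc (Suc k)) w) i r \<alpha> \<beta> \<gamma> \<delta>"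
          using exact_coord[OF a r, of i \<alpha> \<beta> \<gamma> \<delta>] by simp
      qed
      then show "\<exists>w\<in>carrier (RP (Suc (Suc k))). diff_map (Suc k) w = ?z" using w(1) by blast
    qed
  }
qed

section \<open>Values of cocycles on the generators\<close>

interpretation E: projective_resolution "Lam 2 1" "Res 2 1" "res_aug 2 1" "res_diff 2 1"
  by (rule Res_projective_resolution)

abbreviation d_res :: "nat \<Rightarrow> 'k::field res \<Rightarrow> 'k res" where
  "d_res \<equiv> res_diff 2 1"

abbreviation gen :: "nat \<Rightarrow> bool \<Rightarrow> nat \<Rightarrow> 'k::field res" where
  "gen n i r \<equiv> single_gen n (vert i, int r)"

lemma gen_closed: "r \<le> n \<Longrightarrow> (gen n i r :: 'k::field res) \<in> carrier (RP n)"
  by (simp add: single_gen_closed Res_indexI)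

text \<open>Only paths from i are recorded, since by \<open>hom_gen_val\<close> the other
  coordinates of this value are zero.\<close>

definition gen_val :: "nat \<Rightarrow> ('k::field res \<Rightarrow> 'k lam) \<Rightarrow> nat \<Rightarrow> bool \<Rightarrow> bool \<Rightarrow> bool \<Rightarrow> 'k" where
  "gen_val n f r i \<alpha> \<beta> = lam_coord (f (gen n i r)) i \<alpha> \<beta>"

text \<open>The coordinate of \<open>f u\<close> at a normal path is the sum, over all ways to split that path into three
  factors, of the coordinates of \<open>u\<close> at the outer factors times those of the value of \<open>f\<close> at the
  middle one.\<close>

definition hom_term ::
  "(bool \<Rightarrow> bool \<Rightarrow> bool \<Rightarrow> 'k::field) \<Rightarrow> (bool \<Rightarrow> bool \<Rightarrow> bool \<Rightarrow> bool \<Rightarrow> bool \<Rightarrow> 'k) \<Rightarrow> bool \<Rightarrow> bool \<Rightarrow> bool \<Rightarrow> 'k" where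
  "hom_term m u v \<alpha> \<beta> =
     (if \<alpha> then if \<beta> then
          u v False False True True * m v False False + u (\<not> v) True False False True * m (\<not> v) False False
        + u (\<not> v) False True True False * m (\<not> v) False False + u v True True False False * m v False False
        + u (\<not> v) False True False False * m (\<not> v) True False + u v False False False True * m v True False
        + u (\<not> v) True False False False * m (\<not> v) False True + u v False False True False * m v False True
        + u v False False False False * m v True True
      else u v False False True False * m v False False + u (\<not> v) True False False False * m (\<not> v) False False
        + u v False False False False * m v True False
      else if \<beta> then u v False False False True * m v False False + u (\<not> v) False True False False * m (\<not> v) False False
        + u v False False False False * m v False True
      else u v False False False False * m v False False)"

lemma hom_term_add: "hom_term m (\<lambda>i a b c d. u i a b c d + w i a b c d) v \<alpha> \<beta> = hom_term m u v \<alpha> \<beta> + hom_term m w v \<alpha> \<beta>"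
  by (simp add: hom_term_def algebra_simps)

lemma hom_term_zero: "hom_term m (\<lambda>i a b c d. 0) v \<alpha> \<beta> = 0"
  by (simp add: hom_term_def)

text \<open>The value at the generator is fixed by e_i on the left and by the idempotent at i + n on
  the right, which restricts it to paths from i whose length has the parity of n.\<close>

lemma hom_gen_val:
  fixes f :: "'k::field res \<Rightarrow> 'k lam"
  assumes f: "f \<in> E.HomA n" and r: "r \<le> n"
  shows "lam_coord (f (gen n i r)) v \<alpha> \<beta> = (if v = i \<and> (\<alpha> \<noteq> \<beta>) = odd n then gen_val n f r i \<alpha> \<beta> else 0)"
proof -
  let ?j = "vert i + int n - 2 * int r"
  let ?g = "gen n i r :: 'k res"
  note g = gen_closed[OF r]
  have eq: "?g = lact (RP n) (eL (vert i)) (ract (RP n) ?g (eL ?j))"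
    by (subst lact_ract_single_gen) (simp_all add: lam_gens_closed eL_idem single_gen_def)
  have fg: "f ?g \<in> carrier LA" by (rule E.homA_closed[OF f g])
  have "f ?g = f (lact (RP n) (eL (vert i)) (ract (RP n) ?g (eL ?j)))" using eq by simp
  also have "\<dots> = eL (vert i) \<otimes>\<^bsub>LA\<^esub> (f ?g \<otimes>\<^bsub>LA\<^esub> eL ?j)"
    by (simp add: bimodule_homD(4,5)[OF f] lam_gens_closed g)
  finally have "lam_coord (f ?g) v \<alpha> \<beta> = lam_coord (eL (vert i) \<otimes>\<^bsub>LA\<^esub> (f ?g \<otimes>\<^bsub>LA\<^esub> eL ?j)) v \<alpha> \<beta>"
    by (rule arg_cong)
  also have "\<dots> = coord_mult (lam_coord (eL (vert i))) (coord_mult (lam_coord (f ?g)) (lam_coord (eL ?j))) v \<alpha> \<beta>"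
    by (simp add: lam_coord_mult fg lam_gens_closed)
  also have "\<dots> = (if v = i \<and> (\<alpha> \<noteq> \<beta>) = odd n then gen_val n f r i \<alpha> \<beta> else 0)"
    by (cases \<alpha>; cases \<beta>; cases i; cases v) (auto simp: coord_mult_def lam_coord_gens gen_val_def)
  finally show ?thesis .
qed

lemma hom_coord:
  fixes f :: "'k::field res \<Rightarrow> 'k lam"
  assumes f: "f \<in> E.HomA n" and u: "u \<in> carrier (RP n)"
  shows "lam_coord (f u) v \<alpha> \<beta> = (\<Sum>r\<le>n. hom_term (gen_val n f r) (\<lambda>i. res_coord n u i r) v \<alpha> \<beta>)"
  using u
proof (induction rule: Res_induct)
  case zero
  have "f \<zero>\<^bsub>RP n\<^esub> = \<zero>\<^bsub>LA\<^esub>" by (rule E.homA_zero[OF f])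
  then show ?case by (simp add: res_coord_zero[abs_def] lam_coord_zero hom_term_zero)
next
  case (add u w)
  then have "f (u \<oplus>\<^bsub>RP n\<^esub> w) = f u \<oplus>\<^bsub>LA\<^esub> f w" using bimodule_homD(3)[OF f] by simp
  then show ?case
    using add E.homA_closed[OF f] by (simp add: res_coord_add[abs_def] lam_coord_add hom_term_add sum.distrib)
next
  case (gen s x y)
  obtain i0 r0 where s: "s = (vert i0, int r0)" "r0 \<le> n" using gen(1) by (rule Res_indexE)
  let ?u = "lact (RP n) x (ract (RP n) (gen n i0 r0) y)"
  let ?U = "\<lambda>i a b c d. of_bool (i = i0) * (lam_coord x (i \<noteq> (a \<noteq> b)) a b * lam_coord y (i \<noteq> odd n) c d)"
  note g = gen_closed[OF s(2)]
  have fg: "f (gen n i0 r0) \<in> carrier LA" by (rule E.homA_closed[OF f g])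
  have U: "(\<lambda>i. res_coord n ?u i r) = (if r = r0 then ?U else (\<lambda>i a b c d. 0))" for r
    using gen by (auto simp: fun_eq_iff res_coord_lact_ract_gen)
  have "f ?u = x \<otimes>\<^bsub>LA\<^esub> (f (gen n i0 r0) \<otimes>\<^bsub>LA\<^esub> y)"
    using gen by (simp add: bimodule_homD(4,5)[OF f] g)
  then have "lam_coord (f ?u) v \<alpha> \<beta> = coord_mult (lam_coord x) (coord_mult (lam_coord (f (gen n i0 r0))) (lam_coord y)) v \<alpha> \<beta>"
    using gen fg by (simp add: lam_coord_mult)
  also have "\<dots> = hom_term (gen_val n f r0) ?U v \<alpha> \<beta>"
  proof -
    define m where "m a b = gen_val n f r0 i0 a b" for a b
    have K: "lam_coord (f (gen n i0 r0)) = (\<lambda>v a b. if v = i0 \<and> (a \<noteq> b) = odd n then m a b else 0)"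
      using hom_gen_val[OF f s(2)] by (simp add: m_def fun_eq_iff)
    have G: "gen_val n f r0 i0 a b = (if (a \<noteq> b) = odd n then m a b else 0)" for a b
      using K by (simp add: gen_val_def)
    consider "v = i0" | "v = (\<not> i0)" by auto
    then show ?thesis
      unfolding hom_term_def coord_mult_def K
      by cases (cases \<alpha>; cases \<beta>; cases "odd n"; simp add: G algebra_simps)+
  qed
  also have "\<dots> = (\<Sum>r\<le>n. if r = r0 then hom_term (gen_val n f r0) ?U v \<alpha> \<beta> else 0)"
    using s(2) by simp
  also have "\<dots> = (\<Sum>r\<le>n. hom_term (gen_val n f r) (\<lambda>i. res_coord n ?u i r) v \<alpha> \<beta>)"
    unfolding U by (intro sum.cong refl) (simp add: hom_term_zero)
  finally show ?case by (simp add: s)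
qed

section \<open>Trivial-path coefficients of cocycles and coboundaries\<close>

lemma boundary_coord:
  assumes r: "r \<le> n" and r0: "r0 \<le> Suc n"
  shows "res_coord n (d_res (Suc n) (gen (Suc n) i0 r0) :: 'k::field res) i r \<alpha> \<beta> \<gamma> \<delta>
    = (if \<alpha> \<and> \<not> \<beta> \<and> \<not> \<gamma> \<and> \<not> \<delta> then of_bool (r = r0 \<and> i = (\<not> i0)) * (-1) ^ (Suc n + r)
       else if \<not> \<alpha> \<and> \<beta> \<and> \<not> \<gamma> \<and> \<not> \<delta> then of_bool (r0 = Suc r \<and> i = (\<not> i0)) * (-1) ^ (n + r)
       else if \<not> \<alpha> \<and> \<not> \<beta> \<and> \<gamma> \<and> \<not> \<delta> then of_bool (r = r0 \<and> i = i0)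
       else if \<not> \<alpha> \<and> \<not> \<beta> \<and> \<not> \<gamma> \<and> \<delta> then of_bool (r0 = Suc r \<and> i = i0) * (-1) ^ Suc n else 0)"
proof -
  have "res_coord n (d_res (Suc n) (gen (Suc n) i0 r0) :: 'k res) i r \<alpha> \<beta> \<gamma> \<delta>
    = diff_coord (Suc n) (res_coord (Suc n) (gen (Suc n) i0 r0)) i r \<alpha> \<beta> \<gamma> \<delta>"
    unfolding res_diff_eq by (rule diff_map(2)[OF gen_closed[OF r0] r])
  also have "\<dots> = (if \<alpha> \<and> \<not> \<beta> \<and> \<not> \<gamma> \<and> \<not> \<delta> then of_bool (r = r0 \<and> i = (\<not> i0)) * (-1) ^ (Suc n + r)
       else if \<not> \<alpha> \<and> \<beta> \<and> \<not> \<gamma> \<and> \<not> \<delta> then of_bool (r0 = Suc r \<and> i = (\<not> i0)) * (-1) ^ (n + r)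
       else if \<not> \<alpha> \<and> \<not> \<beta> \<and> \<gamma> \<and> \<not> \<delta> then of_bool (r = r0 \<and> i = i0)
       else if \<not> \<alpha> \<and> \<not> \<beta> \<and> \<not> \<gamma> \<and> \<delta> then of_bool (r0 = Suc r \<and> i = i0) * (-1) ^ Suc n else 0)"
    unfolding diff_coord_def res_coord_single_gen[OF r0]
    by (cases \<alpha>; cases \<beta>; cases \<gamma>; cases \<delta>; cases i; cases i0; simp)
  finally show ?thesis .
qed

text \<open>The composite with the differential is a bimodule map, so it vanishes as soon as it does
  on generators.\<close>

lemma cocycle_gens_iff:
  fixes f :: "'k::field res \<Rightarrow> 'k lam"
  assumes f: "f \<in> E.HomA n"
  shows "f \<in> E.Z n \<longleftrightarrow> (\<forall>i. \<forall>r\<le>Suc n. f (d_res (Suc n) (gen (Suc n) i r)) = \<zero>\<^bsub>LA\<^esub>)"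
proof
  assume "f \<in> E.Z n"
  then show "\<forall>i. \<forall>r\<le>Suc n. f (d_res (Suc n) (gen (Suc n) i r)) = \<zero>\<^bsub>LA\<^esub>"
    by (simp add: E.cocycles_iff gen_closed)
next
  assume a: "\<forall>i. \<forall>r\<le>Suc n. f (d_res (Suc n) (gen (Suc n) i r)) = \<zero>\<^bsub>LA\<^esub>"
  have "compose (carrier (RP (Suc n))) f (d_res (Suc n)) = (\<lambda>x\<in>carrier (RP (Suc n)). \<zero>\<^bsub>LA\<^esub>)"
  proof (rule Res_hom_ext[OF bimodule_hom_compose[OF E.d_hom f Res_bimodule] _ LA.regular_bimodule])
    show "(\<lambda>x\<in>carrier (RP (Suc n)). \<zero>\<^bsub>LA\<^esub>) \<in> E.HomA (Suc n)"
      using bimodule_hom_zero[OF Res_bimodule LA.regular_bimodule, of "Suc n"] by simp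
    fix s assume "s \<in> Res_index (Suc n)"
    then obtain i r where s: "s = (vert i, int r)" "r \<le> Suc n" by (rule Res_indexE)
    then show "compose (carrier (RP (Suc n))) f (d_res (Suc n)) (single_gen (Suc n) s)
      = (\<lambda>x\<in>carrier (RP (Suc n)). \<zero>\<^bsub>LA\<^esub>) (single_gen (Suc n) s)"
      using a by (simp add: compose_eq gen_closed)
  qed
  then have "f (d_res (Suc n) x) = \<zero>\<^bsub>LA\<^esub>" if "x \<in> carrier (RP (Suc n))" for x
    using that by (drule_tac fun_cong[of _ _ x]) (simp add: compose_eq)
  then show "f \<in> E.Z n" using f by (simp add: E.cocycles_iff)
qed

lemma odd_val:
  fixes f :: "'k::field res \<Rightarrow> 'k lam"
  assumes "f \<in> E.HomA n" "r \<le> n" "odd n"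
  shows "gen_val n f r i False False = 0"
  unfolding gen_val_def by (subst hom_gen_val[OF assms(1,2)]) (use assms(3) in simp)

text \<open>For even n, read off the coefficient of the arrow a from vertex 0 in the image of the
  boundary of the (0, r)-generator. Right multiplication by a contributes the trivial coefficient at
  vertex 0, left multiplication the one at vertex 1 with sign -(-1)^r. For odd n both coefficients
  are zero.\<close>

lemma cocycle_val:
  fixes f :: "'k::field res \<Rightarrow> 'k lam"
  assumes f: "f \<in> E.Z n" and r: "r \<le> n"
  shows "gen_val n f r True False False = (-1) ^ r * gen_val n f r False False False"
proof (cases "even n")
  case True
  let ?u = "d_res (Suc n) (gen (Suc n) False r) :: 'k res"
  have r': "r \<le> Suc n" using r by simp
  have "(0 :: 'k) = lam_coord (f ?u) False True False"
    using f r' by (simp add: E.cocycles_iff gen_closed lam_coord_zero)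
  also have "\<dots> = (\<Sum>s\<le>n. hom_term (gen_val n f s) (\<lambda>i. res_coord n ?u i s) False True False)"
    by (rule hom_coord[OF E.Z_hom[OF f]]) (simp add: gen_closed[OF r'])
  also have "\<dots> = (\<Sum>s\<le>n. if s = r then gen_val n f r False False False - (-1) ^ r * gen_val n f r True False False else 0)"
    by (intro sum.cong refl) (use True in \<open>simp add: hom_term_def boundary_coord[OF _ r'] power_add\<close>)
  also have "\<dots> = gen_val n f r False False False - (-1) ^ r * gen_val n f r True False False" using r by simp
  finally show ?thesis by (cases "even r") (simp_all add: add_eq_0_iff)
next
  case False
  then show ?thesis by (simp only: odd_val[OF E.Z_hom[OF f] r False] mult_zero_right)
qed

text \<open>Every entry of the differential is an arrow, so a map composed with it takes values in
  the radical. This is minimality of the resolution at work.\<close>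

lemma coboundary_val:
  fixes f :: "'k::field res \<Rightarrow> 'k lam"
  assumes f: "f \<in> E.B n" and r: "r \<le> n"
  shows "gen_val n f r i False False = 0"
proof (cases n)
  case 0
  then have "\<forall>x\<in>carrier (RP n). f x = \<zero>\<^bsub>LA\<^esub>" using f by (simp add: E.coboundaries_iff)
  from bspec[OF this gen_closed[OF r]] show ?thesis by (simp only: gen_val_def lam_coord_zero)
next
  case (Suc m)
  then obtain w :: "'k res \<Rightarrow> 'k lam" where w: "w \<in> E.HomA m" "\<And>x. x \<in> carrier (RP (Suc m)) \<Longrightarrow> f x = w (d_res (Suc m) x)"
    using f by (auto simp: E.coboundaries_iff)
  have r': "r \<le> Suc m" using r Suc by simp
  have "lam_coord (f (gen n i r)) i False False
    = (\<Sum>s\<le>m. hom_term (gen_val m w s) (\<lambda>j. res_coord m (d_res (Suc m) (gen (Suc m) i r)) j s) i False False)"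
    unfolding Suc w(2)[OF gen_closed[OF r']] by (rule hom_coord[OF w(1)]) (simp add: gen_closed[OF r'])
  also have "\<dots> = 0"
    by (intro sum.neutral ballI) (simp add: hom_term_def boundary_coord[OF _ r'])
  finally show ?thesis by (simp add: gen_val_def)
qed

text \<open>The sign at vertex 1 is the one that \<open>cocycle_val\<close> forces, and it is also
  sufficient: the boundary of a generator has two a-terms with the same r and two a-bar-terms with
  the same r, and for even n each pair cancels. Even n is also what allows a multiple of e_i as a
  value at the (i, r)-generator.\<close>

lemma cocycle_exists:
  fixes c :: "nat \<Rightarrow> 'k::field"
  assumes n: "even n"
  shows "\<exists>f\<in>E.Z n. \<forall>i. \<forall>r\<le>n. f (gen n i r) = ((if i then (-1) ^ r else 1) * c r) \<odot>\<^bsub>LA\<^esub> eL (vert i)"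
proof -
  let ?c = "\<lambda>i r. (if i then (-1) ^ r else 1) * c r"
  let ?h = "\<lambda>s. ?c (fst s = 1) (nat (snd s)) \<odot>\<^bsub>LA\<^esub> eL (fst s)"
  have v1: "vert i = 1 \<longleftrightarrow> i" for i by (simp add: vert_def)
  have "\<exists>f\<in>E.HomA n. \<forall>s\<in>Res_index n. f (single_gen n s) = ?h s"
  proof (rule Res_hom_exists[OF regular_separated])
    fix s assume "s \<in> Res_index n"
    have e: "eL (fst s + int n - 2 * snd s) = (eL (fst s) :: 'k lam)" using n by (intro eL_cong) simp
    show "?h s \<in> carrier (regular_bimodule LA)" by (simp add: lam_gens_closed)
    show "lact (regular_bimodule LA) (eL (fst s)) (?h s) = ?h s"
      by (rule lam_coord_inj) (auto simp: lam_gens_closed lam_coord_mult lam_coord_smult coord_mult_def lam_coord_gens)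
    show "ract (regular_bimodule LA) (?h s) (eL (fst s + int n - 2 * snd s)) = ?h s"
      unfolding e by (rule lam_coord_inj) (auto simp: lam_gens_closed lam_coord_mult lam_coord_smult coord_mult_def lam_coord_gens)
  qed
  then obtain f where f: "f \<in> E.HomA n" "\<And>s. s \<in> Res_index n \<Longrightarrow> f (single_gen n s) = ?h s" by blast
  have v: "f (gen n i r) = ?c i r \<odot>\<^bsub>LA\<^esub> eL (vert i)" if "r \<le> n" for i r
    using f(2)[OF Res_indexI[OF that]] by (simp add: v1)
  have val: "gen_val n f r i \<alpha> \<beta> = (if \<not> \<alpha> \<and> \<not> \<beta> then ?c i r else 0)" if "r \<le> n" for i r \<alpha> \<beta>
    by (simp add: gen_val_def v[OF that] lam_coord_smult lam_gens_closed lam_coord_gens)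
  have "f \<in> E.Z n"
    unfolding cocycle_gens_iff[OF f(1)]
  proof (intro allI impI)
    fix i r0 assume r0: "r0 \<le> Suc n"
    let ?u = "d_res (Suc n) (gen (Suc n) i r0) :: 'k res"
    have u: "?u \<in> carrier (RP n)" by (simp add: gen_closed r0)
    show "f ?u = \<zero>\<^bsub>LA\<^esub>"
    proof (rule lam_coord_inj)
      fix v \<alpha> \<beta>
      have "lam_coord (f ?u) v \<alpha> \<beta> = (\<Sum>r\<le>n. hom_term (gen_val n f r) (\<lambda>i. res_coord n ?u i r) v \<alpha> \<beta>)"
        by (rule hom_coord[OF f(1) u])
      also have "\<dots> = 0"
      proof (intro sum.neutral ballI)
        fix r assume "r \<in> {..n}"
        then have r: "r \<le> n" by simp
        show "hom_term (gen_val n f r) (\<lambda>i. res_coord n ?u i r) v \<alpha> \<beta> = 0"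
          unfolding hom_term_def boundary_coord[OF r r0] val[OF r]
          using n by (cases \<alpha>; cases \<beta>; cases i; cases v; simp add: power_add)
      qed
      finally show "lam_coord (f ?u) v \<alpha> \<beta> = lam_coord \<zero>\<^bsub>LA\<^esub> v \<alpha> \<beta>" by (simp add: lam_coord_zero)
    qed (simp_all add: E.homA_closed[OF f(1) u])
  qed
  then show ?thesis using v by blast
qed

section \<open>Scalar multiples of cochains and classes\<close>

context projective_resolution
begin

lemma homA_smult:
  assumes f: "f \<in> HomA n"
  shows "c \<odot>\<^bsub>C n\<^esub> f \<in> HomA n" "x \<in> carrier (P n) \<Longrightarrow> (c \<odot>\<^bsub>C n\<^esub> f) x = c \<odot>\<^bsub>A\<^esub> f x"
proof -
  show x: "x \<in> carrier (P n) \<Longrightarrow> (c \<odot>\<^bsub>C n\<^esub> f) x = c \<odot>\<^bsub>A\<^esub> f x" for x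
    by (simp add: cochains_def)
  show "c \<odot>\<^bsub>C n\<^esub> f \<in> HomA n"
  proof (rule bimodule_homI)
    show "c \<odot>\<^bsub>C n\<^esub> f \<in> extensional (carrier (P n))" by (simp add: cochains_def)
  qed (simp_all add: x homA_closed[OF f] bimodule_homD(3,4,5)[OF f] A.smult_r_distr A.smult_mult_left A.smult_mult_right)
qed

lemma smult_zero [simp]: "c \<odot>\<^bsub>A\<^esub> \<zero>\<^bsub>A\<^esub> = \<zero>\<^bsub>A\<^esub>"
proof -
  have "c \<odot>\<^bsub>A\<^esub> \<zero>\<^bsub>A\<^esub> \<oplus>\<^bsub>A\<^esub> c \<odot>\<^bsub>A\<^esub> \<zero>\<^bsub>A\<^esub> = c \<odot>\<^bsub>A\<^esub> \<zero>\<^bsub>A\<^esub> \<oplus>\<^bsub>A\<^esub> \<zero>\<^bsub>A\<^esub>"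
    by (subst A.smult_r_distr[symmetric]) simp_all
  then show ?thesis using A.add.l_cancel[of "c \<odot>\<^bsub>A\<^esub> \<zero>\<^bsub>A\<^esub>" "c \<odot>\<^bsub>A\<^esub> \<zero>\<^bsub>A\<^esub>" "\<zero>\<^bsub>A\<^esub>"] by blast
qed

lemma smult_minus: "x \<in> carrier A \<Longrightarrow> c \<odot>\<^bsub>A\<^esub> (\<ominus>\<^bsub>A\<^esub> x) = \<ominus>\<^bsub>A\<^esub> (c \<odot>\<^bsub>A\<^esub> x)"
  by (rule A.minus_equality[symmetric]) (simp_all add: A.smult_r_distr[symmetric] A.l_neg)

lemma smult_diff: "x \<in> carrier A \<Longrightarrow> y \<in> carrier A \<Longrightarrow> c \<odot>\<^bsub>A\<^esub> (x \<ominus>\<^bsub>A\<^esub> y) = c \<odot>\<^bsub>A\<^esub> x \<ominus>\<^bsub>A\<^esub> c \<odot>\<^bsub>A\<^esub> y"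
  by (simp add: a_minus_def A.smult_r_distr smult_minus)

lemma Z_smult: "f \<in> Z n \<Longrightarrow> c \<odot>\<^bsub>C n\<^esub> f \<in> Z n"
  by (simp add: cocycles_iff homA_smult)

lemma B_smult:
  assumes f: "f \<in> B n"
  shows "c \<odot>\<^bsub>C n\<^esub> f \<in> B n"
proof (cases n)
  case 0
  then show ?thesis using f by (simp add: coboundaries_iff homA_smult)
next
  case (Suc m)
  then obtain w where w: "w \<in> HomA m" "\<And>x. x \<in> carrier (P (Suc m)) \<Longrightarrow> f x = w (d (Suc m) x)" and f': "f \<in> HomA (Suc m)"
    using f by (auto simp: coboundaries_iff)
  then show ?thesis
    unfolding Suc coboundaries_iff by (auto simp: homA_smult intro!: bexI[of _ "c \<odot>\<^bsub>C m\<^esub> w"])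
qed

lemma cls_smult:
  assumes f: "f \<in> Z n"
  shows "c \<odot>\<^bsub>cohomology A P d n\<^esub> cls n f = cls n (c \<odot>\<^bsub>C n\<^esub> f)"
proof -
  have "cls n (c \<odot>\<^bsub>C n\<^esub> g) = cls n (c \<odot>\<^bsub>C n\<^esub> f)" if g: "g \<in> cls n f" for g
  proof -
    note g' = cls_memD[OF Z_hom[OF f] g]
    have "hom_diff (P n) (regular_bimodule A) (c \<odot>\<^bsub>C n\<^esub> g) (c \<odot>\<^bsub>C n\<^esub> f) = c \<odot>\<^bsub>C n\<^esub> hom_diff (P n) (regular_bimodule A) g f"
      by (rule bimodule_hom_eqI[OF homA_diff[OF homA_smult(1)[OF g'(1)] homA_smult(1)[OF Z_hom[OF f]]]
            homA_smult(1)[OF homA_diff[OF g'(1) Z_hom[OF f]]]])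
         (simp add: homA_smult Z_hom[OF f] g'(1) homA_diff homA_closed[OF Z_hom[OF f]] homA_closed[OF g'(1)] smult_diff)
    then show ?thesis
      unfolding cls_eq_iff[OF homA_smult(1)[OF g'(1)] homA_smult(1)[OF Z_hom[OF f]]]
      using B_smult[OF g'(2)] by (simp only:)
  qed
  then have "(\<Union>g\<in>cls n f. cls n (c \<odot>\<^bsub>C n\<^esub> g)) = cls n (c \<odot>\<^bsub>C n\<^esub> f)"
    by (rule UN_constant_eq[OF cls_self[OF Z_hom[OF f]] ballI])
  then show ?thesis by (simp only: cohomology_def module.simps)
qed

end

section \<open>Trivial coordinates of chain maps, and the product of classes\<close>

lemma hom_gen_coord:
  fixes h :: "'k::field res \<Rightarrow> 'k res"
  assumes h: "h \<in> E.Hom n k" and r: "r \<le> n"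
    and ne: "(i \<noteq> (\<alpha> \<noteq> \<beta>)) \<noteq> i0 \<or> ((i \<noteq> odd k) \<noteq> (\<gamma> \<noteq> \<delta>)) \<noteq> (i0 \<noteq> odd n)"
  shows "res_coord k (h (gen n i0 r)) i r' \<alpha> \<beta> \<gamma> \<delta> = 0"
proof -
  let ?j = "vert i0 + int n - 2 * int r"
  let ?g = "gen n i0 r :: 'k res"
  note g = gen_closed[OF r]
  have eq: "?g = lact (RP n) (eL (vert i0)) (ract (RP n) ?g (eL ?j))"
    by (subst lact_ract_single_gen) (simp_all add: lam_gens_closed eL_idem single_gen_def)
  have hg: "h ?g \<in> carrier (RP k)" by (rule bimodule_homD(2)[OF h g])
  have "h ?g = h (lact (RP n) (eL (vert i0)) (ract (RP n) ?g (eL ?j)))" using eq by simp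
  also have "\<dots> = lact (RP k) (eL (vert i0)) (ract (RP k) (h ?g) (eL ?j))"
    by (simp add: bimodule_homD(4,5)[OF h] lam_gens_closed g)
  finally have "res_coord k (h ?g) i r' \<alpha> \<beta> \<gamma> \<delta>
    = res_coord k (lact (RP k) (eL (vert i0)) (ract (RP k) (h ?g) (eL ?j))) i r' \<alpha> \<beta> \<gamma> \<delta>"
    by (rule arg_cong)
  also have "\<dots> = 0"
    unfolding res_coord_lact[OF RP.ract_closed[OF lam_gens_closed(1) hg] lam_gens_closed(1)] res_coord_ract[OF hg lam_gens_closed(1)]
    using ne by (cases \<alpha>; cases \<beta>; cases \<gamma>; cases \<delta>) (auto simp: coord_mult_def lam_coord_gens)
  finally show ?thesis .
qed

text \<open>Write u as a sum of terms x gen y. With a trivial left factor and at most one arrow on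
  the right, that arrow comes from y or from the image of the generator. The latter is excluded by
  the end points, since n and k have the same parity. With both arrows on the right, the coordinate
  of the image at a path of length two could enter as well.\<close>

lemma res_hom_coord:
  fixes h :: "'k::field res \<Rightarrow> 'k res"
  assumes h: "h \<in> E.Hom n k" and u: "u \<in> carrier (RP n)" and nk: "even n \<longleftrightarrow> even k" and cd: "\<not> (\<gamma> \<and> \<delta>)"
  shows "res_coord k (h u) i r' False False \<gamma> \<delta>
    = (\<Sum>r\<le>n. res_coord n u i r False False \<gamma> \<delta> * res_coord k (h (gen n i r)) i r' False False False False)"
  using u
proof (induction rule: Res_induct)
  case zero
  have "h \<zero>\<^bsub>RP n\<^esub> = \<zero>\<^bsub>RP k\<^esub>" by (rule E.hom_zero[OF h])
  then show ?case by (simp add: res_coord_zero)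
next
  case (add u w)
  then have "h (u \<oplus>\<^bsub>RP n\<^esub> w) = h u \<oplus>\<^bsub>RP k\<^esub> h w" using bimodule_homD(3)[OF h] by simp
  then show ?case using add by (simp add: res_coord_add sum.distrib algebra_simps)
next
  case (gen s x y)
  obtain i0 r0 where s: "s = (vert i0, int r0)" "r0 \<le> n" using gen(1) by (rule Res_indexE)
  let ?u = "lact (RP n) x (ract (RP n) (gen n i0 r0) y)"
  let ?U = "of_bool (i = i0) * (lam_coord x i False False * lam_coord y (i \<noteq> odd n) \<gamma> \<delta>)"
  note g = gen_closed[OF s(2)]
  have hg: "h (gen n i0 r0) \<in> carrier (RP k)" by (rule bimodule_homD(2)[OF h g])
  have U: "res_coord n ?u i r False False \<gamma> \<delta> = (if r = r0 then ?U else 0)" for r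
    using gen by (auto simp: res_coord_lact_ract_gen)
  have "h ?u = lact (RP k) x (ract (RP k) (h (gen n i0 r0)) y)"
    using gen by (simp add: bimodule_homD(4,5)[OF h] g)
  then have "res_coord k (h ?u) i r' False False \<gamma> \<delta> = lam_coord x i False False *
     coord_mult (\<lambda>_ c d. res_coord k (h (gen n i0 r0)) i r' False False c d) (lam_coord y) (i \<noteq> odd k) \<gamma> \<delta>"
    using gen by (simp add: res_coord_lact res_coord_ract hg coord_mult_def)
  also have "\<dots> = ?U * res_coord k (h (gen n i r0)) i r' False False False False"
  proof (cases "i = i0")
    case True
    have "res_coord k (h (gen n i0 r0)) i r' False False \<gamma> \<delta> = 0" if "\<gamma> \<noteq> \<delta>"
      by (rule hom_gen_coord[OF h s(2)]) (use nk that True in simp)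
    then show ?thesis
      using cd nk True by (cases \<gamma>; cases \<delta>) (simp_all add: coord_mult_def)
  next
    case False
    have "res_coord k (h (gen n i0 r0)) i r' False False c d = 0" for c d
      by (rule hom_gen_coord[OF h s(2)]) (use False in simp)
    then show ?thesis using False by (simp add: coord_mult_def)
  qed
  also have "\<dots> = (\<Sum>r\<le>n. if r = r0 then ?U * res_coord k (h (gen n i r0)) i r' False False False False else 0)"
    using s(2) by simp
  also have "\<dots> = (\<Sum>r\<le>n. res_coord n ?u i r False False \<gamma> \<delta> * res_coord k (h (gen n i r)) i r' False False False False)"
    unfolding U by (intro sum.cong refl) simp
  finally show ?case by (simp add: s)
qed

text \<open>Induction on \<open>k\<close>: the coefficients at \<open>(\<gamma>, \<delta>) = (1, 0)\<close> and \<open>(0, 1)\<close> of the chain map equation reduce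
  the top coefficients of \<open>L (Suc k)\<close> to those of \<open>L k\<close>.\<close>

lemma lifting_coord:
  fixes g :: "'k::field res \<Rightarrow> 'k lam"
  assumes g: "g \<in> E.Z q" and L: "L \<in> liftings (Lam 2 1) (Res 2 1) (res_aug 2 1) d_res q g"
    and "r \<le> q + k" "r' \<le> k"
  shows "res_coord k (L k (gen (q + k) i r)) i r' False False False False
    = (if r' \<le> r \<and> r - r' \<le> q then gen_val q g (r - r') i False False else 0)"
proof (cases "even q")
  case False
  have L': "L k \<in> E.Hom (q + k) k" using L by (simp add: E.liftings_iff[OF E.Z_hom[OF g]])
  have "res_coord k (L k (gen (q + k) i r)) i r' False False False False = 0"
    by (rule hom_gen_coord[OF L' assms(3)]) (use False in simp)
  then show ?thesis using odd_val[OF E.Z_hom[OF g] _ False] by simp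
next
  case True
  note L' = L[unfolded E.liftings_iff[OF E.Z_hom[OF g]]]
  have Lh: "L k \<in> E.Hom (q + k) k" for k using L' by blast
  show ?thesis
    using assms(3,4)
  proof (induction k arbitrary: r r')
    case 0
    then have r: "r \<le> q" and r': "r' = 0" by simp_all
    have x: "L 0 (gen (q + 0) i r) \<in> carrier (RP 0)"
      by (rule bimodule_homD(2)[OF Lh]) (use r in \<open>simp add: gen_closed\<close>)
    have "res_aug 2 1 (L 0 (gen (q + 0) i r)) = g (gen q i r)"
      using L' r by (simp add: gen_closed)
    then have "gen_val q g r i False False = lam_coord (aug_map (L 0 (gen (q + 0) i r))) i False False"
      by (simp add: gen_val_def res_aug_eq)
    also have "\<dots> = res_coord 0 (L 0 (gen (q + 0) i r)) i 0 False False False False"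
      unfolding aug_map(2)[OF x] by (simp add: aug_coord_def)
    finally show ?case using r r' by simp
  next
    case (Suc k)
    let ?x = "gen (q + Suc k) i r :: 'k res"
    have r: "r \<le> Suc (q + k)" using Suc.prems by simp
    have x: "?x \<in> carrier (RP (q + Suc k))" using gen_closed[OF Suc.prems(1)] .
    have Lx: "L (Suc k) ?x \<in> carrier (RP (Suc k))" by (rule bimodule_homD(2)[OF Lh x])
    have eq: "d_res (Suc k) (L (Suc k) ?x) = L k (d_res (Suc (q + k)) (gen (Suc (q + k)) i r))"
      using L' x by simp
    have step: "diff_coord (Suc k) (res_coord (Suc k) (L (Suc k) ?x)) i s False False \<gamma> \<delta>
      = (\<Sum>t\<le>q + k. res_coord (q + k) (d_res (Suc (q + k)) (gen (Suc (q + k)) i r)) i t False False \<gamma> \<delta>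
           * res_coord k (L k (gen (q + k) i t)) i s False False False False)"
      if "s \<le> k" "\<not> (\<gamma> \<and> \<delta>)" for s \<gamma> \<delta>
    proof -
      have "diff_coord (Suc k) (res_coord (Suc k) (L (Suc k) ?x)) i s False False \<gamma> \<delta>
        = res_coord k (d_res (Suc k) (L (Suc k) ?x)) i s False False \<gamma> \<delta>"
        unfolding res_diff_eq by (rule diff_map(2)[OF Lx that(1), symmetric])
      also have "\<dots> = res_coord k (L k (d_res (Suc (q + k)) (gen (Suc (q + k)) i r))) i s False False \<gamma> \<delta>"
        by (simp only: eq)
      also have "\<dots> = (\<Sum>t\<le>q + k. res_coord (q + k) (d_res (Suc (q + k)) (gen (Suc (q + k)) i r)) i t False False \<gamma> \<delta>
           * res_coord k (L k (gen (q + k) i t)) i s False False False False)"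
        by (rule res_hom_coord[OF Lh _ _ that(2)]) (use True r in \<open>simp_all add: gen_closed\<close>)
      finally show ?thesis .
    qed
    show ?case
    \<comment> \<open>With nothing on the left, the boundary coordinate at (1, 0) in summand s is
      the trivial coordinate of the same summand, which covers r' up to k. The additional summand k
      + 1 of the higher term is reached only through (0, 1), where s = k stands for s + 1.\<close>
    proof (cases "r' \<le> k")
      case r': True
      have "res_coord (Suc k) (L (Suc k) ?x) i r' False False False False
        = diff_coord (Suc k) (res_coord (Suc k) (L (Suc k) ?x)) i r' False False True False"
        by (simp only: diff_coord_def if_True if_False add_0_right)
      also have "\<dots> = (\<Sum>t\<le>q + k. res_coord (q + k) (d_res (Suc (q + k)) (gen (Suc (q + k)) i r)) i t False False True False
           * res_coord k (L k (gen (q + k) i t)) i r' False False False False)"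
        by (rule step[OF r']) simp
      also have "\<dots> = (\<Sum>t\<le>q + k. if t = r then res_coord k (L k (gen (q + k) i r)) i r' False False False False else 0)"
        by (intro sum.cong refl) (simp add: boundary_coord[OF _ r])
      also have "\<dots> = (if r \<le> q + k then res_coord k (L k (gen (q + k) i r)) i r' False False False False else 0)"
        by simp
      also have "\<dots> = (if r' \<le> r \<and> r - r' \<le> q then gen_val q g (r - r') i False False else 0)"
        using Suc.IH[OF _ r', of r] r r' by auto
      finally show ?thesis .
    next
      case False
      then have r': "r' = Suc k" using Suc.prems by simp
      have "(-1) ^ Suc k * res_coord (Suc k) (L (Suc k) ?x) i r' False False False False
        = diff_coord (Suc k) (res_coord (Suc k) (L (Suc k) ?x)) i k False False False True"
        by (simp only: r' diff_coord_def if_True if_False add_0_left)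
      also have "\<dots> = (\<Sum>t\<le>q + k. res_coord (q + k) (d_res (Suc (q + k)) (gen (Suc (q + k)) i r)) i t False False False True
           * res_coord k (L k (gen (q + k) i t)) i k False False False False)"
        by (rule step) simp_all
      also have "\<dots> = (\<Sum>t\<le>q + k. if Suc t = r then (-1) ^ Suc k * res_coord k (L k (gen (q + k) i t)) i k False False False False else 0)"
        by (intro sum.cong refl) (use True in \<open>auto simp: boundary_coord[OF _ r] power_add\<close>)
      also have "\<dots> = (-1) ^ Suc k * (if r' \<le> r \<and> r - r' \<le> q then gen_val q g (r - r') i False False else 0)"
      proof (cases r)
        case 0
        then show ?thesis using r' by simp
      next
        case (Suc r1)
        have "(\<Sum>t\<le>q + k. if Suc t = r then (-1) ^ Suc k * res_coord k (L k (gen (q + k) i t)) i k False False False False else 0)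
          = (\<Sum>t\<le>q + k. if t = r1 then (-1) ^ Suc k * res_coord k (L k (gen (q + k) i r1)) i k False False False False else 0)"
          using Suc by (intro sum.cong) auto
        also have "\<dots> = (-1) ^ Suc k * res_coord k (L k (gen (q + k) i r1)) i k False False False False"
          using r Suc by simp
        finally show ?thesis using Suc.IH[of r1 k] r Suc r' by simp
      qed
      finally show ?thesis by simp
    qed
  qed
qed

text \<open>Vertex 0 is enough: for a cocycle, \<open>cocycle_val\<close> gives the coefficients at
  vertex 1.\<close>

definition val_poly :: "nat \<Rightarrow> ('k::field res \<Rightarrow> 'k lam) \<Rightarrow> 'k poly" where
  "val_poly n f = (\<Sum>r\<le>n. monom (gen_val n f r False False False) r)"

lemma coeff_val_poly: "coeff (val_poly n f) r = (if r \<le> n then gen_val n f r False False False else 0)"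
  by (simp add: val_poly_def coeff_sum)

text \<open>At a trivial path \<open>hom_term\<close> has one product only, the trivial coordinate
  of the lifting times the trivial coefficient of f. By \<open>lifting_coord\<close> the former is
  the coefficient of g at the difference of the indices, and the sum is a convolution.\<close>

lemma val_poly_compose_lifting:
  fixes f g :: "'k::field res \<Rightarrow> 'k lam"
  assumes f: "f \<in> E.Z p" and g: "g \<in> E.Z q" and L: "L \<in> liftings (Lam 2 1) (Res 2 1) (res_aug 2 1) d_res q g"
  shows "val_poly (q + p) (compose (carrier (RP (q + p))) f (L p)) = val_poly p f * val_poly q g"
proof (rule poly_eqI)
  fix t
  let ?c = "\<lambda>s. gen_val p f s False False False * gen_val q g (t - s) False False False"
  have Lh: "L p \<in> E.Hom (q + p) p" using L by (simp add: E.liftings_iff[OF E.Z_hom[OF g]])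
  have rhs: "coeff (val_poly p f * val_poly q g) t = (\<Sum>s | s \<le> p \<and> s \<le> t \<and> t - s \<le> q. ?c s)"
    unfolding coeff_mult coeff_val_poly
    by (rule sum.mono_neutral_cong_right) auto
  show "coeff (val_poly (q + p) (compose (carrier (RP (q + p))) f (L p))) t = coeff (val_poly p f * val_poly q g) t"
  proof (cases "t \<le> q + p")
    case True
    let ?x = "gen (q + p) False t :: 'k res"
    have x: "?x \<in> carrier (RP (q + p))" by (rule gen_closed[OF True])
    have "coeff (val_poly (q + p) (compose (carrier (RP (q + p))) f (L p))) t = lam_coord (f (L p ?x)) False False False"
      using True x by (simp add: coeff_val_poly gen_val_def compose_eq)
    also have "\<dots> = (\<Sum>s\<le>p. res_coord p (L p ?x) False s False False False False * gen_val p f s False False False)"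
      by (subst hom_coord[OF E.Z_hom[OF f] bimodule_homD(2)[OF Lh x]]) (simp add: hom_term_def)
    also have "\<dots> = (\<Sum>s | s \<le> p \<and> s \<le> t \<and> t - s \<le> q. ?c s)"
      by (rule sum.mono_neutral_cong_right) (auto simp: lifting_coord[OF g L True])
    finally show ?thesis by (simp only: rhs)
  next
    case False
    then have empty: "{s. s \<le> p \<and> s \<le> t \<and> t - s \<le> q} = {}" by auto
    show ?thesis using False unfolding rhs empty by (simp add: coeff_val_poly)
  qed
qed

section \<open>The polynomial of a cohomology class\<close>

context graded_ring
begin

definition single :: "nat \<Rightarrow> 'c \<Rightarrow> nat \<Rightarrow> 'c" where
  "single n x = (\<lambda>k. if k = n then x else \<zero>\<^bsub>H k\<^esub>)"

lemma single_closed: "x \<in> carrier (H n) \<Longrightarrow> single n x \<in> sum_carrier"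
  by (rule sum_carrierI[of _ n]) (auto simp: single_def)

lemma conv_single:
  assumes x: "x \<in> carrier (H p)" and y: "y \<in> carrier (H q)"
  shows "conv (single p x) (single q y) = single (p + q) (\<mu> p q x y)"
proof
  fix k
  have xy: "\<mu> p q x y \<in> carrier (H (p + q))" by (rule \<mu>_closed[OF x y])
  have t: "\<mu> i (k - i) (single p x i) (single q y (k - i)) = (if i = p \<and> k = p + q then \<mu> p q x y else \<zero>\<^bsub>H k\<^esub>)"
    if "i \<le> k" for i
    using that \<mu>_zero_left[of "single q y (k - i)" "k - i" i] \<mu>_zero_right[of "single p x i" i "k - i"] x y
    by (auto simp: single_def)
  show "conv (single p x) (single q y) k = single (p + q) (\<mu> p q x y) k"
  proof (cases "k = p + q")
    case True
    have "conv (single p x) (single q y) k = (\<Oplus>\<^bsub>H k\<^esub>i\<in>{..k}. if p = i then \<mu> p q x y else \<zero>\<^bsub>H k\<^esub>)"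
      unfolding conv_def using True xy t by (intro H.finsum_cong' refl) auto
    also have "\<dots> = \<mu> p q x y"
      using True xy by (subst H.finsum_singleton) auto
    finally show ?thesis using True by (simp add: single_def)
  next
    case False
    have "conv (single p x) (single q y) k = (\<Oplus>\<^bsub>H k\<^esub>i\<in>{..k}. \<zero>\<^bsub>H k\<^esub>)"
      unfolding conv_def using False t by (intro H.finsum_cong' refl) auto
    then show ?thesis using False by (simp add: single_def)
  qed
qed

end

locale graded_hom = graded_ring H \<mu> u
  for H :: "nat \<Rightarrow> ('c, 'm) ring_scheme" and \<mu> and u +
  fixes \<phi> :: "nat \<Rightarrow> 'c \<Rightarrow> 'r::comm_ring_1"
  assumes \<phi>_add: "\<lbrakk>x \<in> carrier (H n); y \<in> carrier (H n)\<rbrakk> \<Longrightarrow> \<phi> n (x \<oplus>\<^bsub>H n\<^esub> y) = \<phi> n x + \<phi> n y"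
    and \<phi>_mult: "\<lbrakk>x \<in> carrier (H p); y \<in> carrier (H q)\<rbrakk> \<Longrightarrow> \<phi> (p + q) (\<mu> p q x y) = \<phi> p x * \<phi> q y"
    and \<phi>_unit: "\<phi> 0 u = 1"
begin

lemma \<phi>_zero: "\<phi> n \<zero>\<^bsub>H n\<^esub> = 0"
  using \<phi>_add[of "\<zero>\<^bsub>H n\<^esub>" n "\<zero>\<^bsub>H n\<^esub>"] by simp

lemma \<phi>_finsum: "finite S \<Longrightarrow> f \<in> S \<rightarrow> carrier (H n) \<Longrightarrow> \<phi> n (\<Oplus>\<^bsub>H n\<^esub>i\<in>S. f i) = (\<Sum>i\<in>S. \<phi> n (f i))"
  by (induction S rule: finite_induct) (simp_all add: \<phi>_zero \<phi>_add Pi_iff)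

text \<open>The maps of the separate degrees land in one ring; the new variable records the degree
  and makes them a single ring homomorphism on the direct sum.\<close>

definition to_poly :: "(nat \<Rightarrow> 'c) \<Rightarrow> 'r poly" where
  "to_poly z = Abs_poly (\<lambda>n. \<phi> n (z n))"

lemma coeff_to_poly:
  assumes "z \<in> sum_carrier"
  shows "coeff (to_poly z) n = \<phi> n (z n)"
proof -
  have "finite {n. z n \<noteq> \<zero>\<^bsub>H n\<^esub>}" using assms by (simp add: sum_carrier_def)
  then obtain N where N: "{n. z n \<noteq> \<zero>\<^bsub>H n\<^esub>} \<subseteq> {..N}" using finite_nat_iff_bounded_le by blast
  have "\<phi> n (z n) = 0" if "n > N" for n
  proof -
    have "z n = \<zero>\<^bsub>H n\<^esub>" using N that by (auto simp: subset_iff)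
    then show ?thesis by (simp only: \<phi>_zero)
  qed
  then show ?thesis unfolding to_poly_def by (subst coeff_Abs_poly[of N]) auto
qed

lemma to_poly_add:
  assumes "z \<in> sum_carrier" "w \<in> sum_carrier"
  shows "to_poly (\<lambda>n. z n \<oplus>\<^bsub>H n\<^esub> w n) = to_poly z + to_poly w"
proof (rule poly_eqI)
  have "(\<lambda>n. z n \<oplus>\<^bsub>H n\<^esub> w n) \<in> sum_carrier"
  proof -
    have "{n. z n \<oplus>\<^bsub>H n\<^esub> w n \<noteq> \<zero>\<^bsub>H n\<^esub>} \<subseteq> {n. z n \<noteq> \<zero>\<^bsub>H n\<^esub>} \<union> {n. w n \<noteq> \<zero>\<^bsub>H n\<^esub>}" by auto
    then show ?thesis using assms by (auto simp: sum_carrier_def intro: finite_subset)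
  qed
  then show "coeff (to_poly (\<lambda>n. z n \<oplus>\<^bsub>H n\<^esub> w n)) n = coeff (to_poly z + to_poly w) n" for n
    using assms sum_carrierD by (simp add: coeff_to_poly \<phi>_add)
qed

lemma to_poly_conv:
  assumes z: "z \<in> sum_carrier" "w \<in> sum_carrier"
  shows "to_poly (conv z w) = to_poly z * to_poly w"
proof (rule poly_eqI)
  fix n
  have c: "\<And>n. z n \<in> carrier (H n)" "\<And>n. w n \<in> carrier (H n)" using assms sum_carrierD by auto
  have "\<phi> n (conv z w n) = (\<Sum>p\<le>n. \<phi> n (\<mu> p (n - p) (z p) (w (n - p))))"
    unfolding conv_def by (rule \<phi>_finsum) (auto intro: term_closed c)
  also have "\<dots> = (\<Sum>p\<le>n. \<phi> p (z p) * \<phi> (n - p) (w (n - p)))"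
    using \<phi>_mult[OF c(1) c(2)] by (intro sum.cong refl) (metis atMost_iff le_add_diff_inverse)
  finally show "coeff (to_poly (conv z w)) n = coeff (to_poly z * to_poly w) n"
    by (simp add: coeff_to_poly z conv_closed[OF z] coeff_mult)
qed

lemma unit_single: "unit = single 0 u"
  by (simp add: unit_def single_def fun_eq_iff)

lemma to_poly_unit: "to_poly unit = 1"
  by (rule poly_eqI) (auto simp: unit_single coeff_to_poly single_closed u_closed coeff_1, auto simp: single_def \<phi>_unit \<phi>_zero)

end

lemma lam_coord_diff:
  assumes "x \<in> carrier LA" "y \<in> carrier LA"
  shows "lam_coord (x \<ominus>\<^bsub>LA\<^esub> y) v \<alpha> \<beta> = lam_coord x v \<alpha> \<beta> - (lam_coord y v \<alpha> \<beta> :: 'k::field)"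
proof -
  have "x = (x \<ominus>\<^bsub>LA\<^esub> y) \<oplus>\<^bsub>LA\<^esub> y" using assms by (simp add: LA.minus_eq LA.a_assoc LA.l_neg)
  then have "lam_coord x v \<alpha> \<beta> = lam_coord ((x \<ominus>\<^bsub>LA\<^esub> y) \<oplus>\<^bsub>LA\<^esub> y) v \<alpha> \<beta>" by (rule arg_cong)
  also have "\<dots> = lam_coord (x \<ominus>\<^bsub>LA\<^esub> y) v \<alpha> \<beta> + lam_coord y v \<alpha> \<beta>" using assms by (simp add: lam_coord_add)
  finally show ?thesis by simp
qed

definition cls_poly :: "nat \<Rightarrow> ('k::field res \<Rightarrow> 'k lam) set \<Rightarrow> 'k poly" where
  "cls_poly n F = val_poly n (SOME f. f \<in> F)"

text \<open>Two representatives differ by a coboundary, whose trivial coefficients vanish.\<close>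

lemma cls_poly:
  fixes f :: "'k::field res \<Rightarrow> 'k lam"
  assumes f: "f \<in> E.Z n"
  shows "cls_poly n (E.cls n f) = val_poly n f"
proof -
  note f' = E.Z_hom[OF f]
  let ?g = "SOME g. g \<in> E.cls n f"
  have "?g \<in> E.cls n f" by (rule someI[of "\<lambda>g. g \<in> E.cls n f", OF E.cls_self[OF f']])
  note g = E.cls_memD[OF f' this]
  have "gen_val n ?g r i False False = gen_val n f r i False False" if r: "r \<le> n" for r i
  proof -
    have "(0 :: 'k) = gen_val n (hom_diff (RP n) (regular_bimodule LA) ?g f) r i False False"
      by (rule coboundary_val[OF g(2) r, symmetric])
    also have "\<dots> = gen_val n ?g r i False False - gen_val n f r i False False"
      unfolding gen_val_def E.hom_diff_apply[OF gen_closed[OF r]] E.R_diff[OF E.homA_closed[OF f' gen_closed[OF r]]]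
      by (rule lam_coord_diff[OF E.homA_closed[OF g(1) gen_closed[OF r]] E.homA_closed[OF f' gen_closed[OF r]]])
    finally show ?thesis by simp
  qed
  then show ?thesis unfolding cls_poly_def val_poly_def by (intro sum.cong) auto
qed

lemma cls_poly_hom:
  "graded_hom (cohomology (Lam 2 1 :: ('k::field, 'k lam) module) (Res 2 1) d_res)
     (yoneda (Lam 2 1) (Res 2 1) (res_aug 2 1) d_res) (E.cls 0 (res_aug 2 1)) cls_poly"
proof (intro graded_hom.intro E.Ext_graded_ring graded_hom_axioms.intro)
  fix n and F G :: "('k res \<Rightarrow> 'k lam) set"
  assume "F \<in> carrier (cohomology (Lam 2 1) (Res 2 1) d_res n)" "G \<in> carrier (cohomology (Lam 2 1) (Res 2 1) d_res n)"
  then obtain f g where fg: "f \<in> E.Z n" "g \<in> E.Z n" "F = E.cls n f" "G = E.cls n g"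
    by (auto simp: E.H_simps)
  have s: "F \<oplus>\<^bsub>cohomology (Lam 2 1) (Res 2 1) d_res n\<^esub> G = E.cls n (f \<oplus>\<^bsub>E.C n\<^esub> g)"
    unfolding fg E.H_simps by (rule E.cls_add[OF E.Z_hom E.Z_hom]) (use fg in auto)
  have v: "gen_val n (f \<oplus>\<^bsub>E.C n\<^esub> g) r False False False = gen_val n f r False False False + gen_val n g r False False False"
    if r: "r \<le> n" for r
  proof -
    have "(f \<oplus>\<^bsub>E.C n\<^esub> g) (gen n False r) = f (gen n False r) \<oplus>\<^bsub>LA\<^esub> g (gen n False r)"
      by (simp add: gen_closed[OF r])
    then show ?thesis
      using E.homA_closed[OF E.Z_hom[OF fg(1)] gen_closed[OF r]] E.homA_closed[OF E.Z_hom[OF fg(2)] gen_closed[OF r]]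
      by (simp only: gen_val_def lam_coord_add)
  qed
  show "cls_poly n (F \<oplus>\<^bsub>cohomology (Lam 2 1) (Res 2 1) d_res n\<^esub> G) = cls_poly n F + cls_poly n G"
    unfolding s unfolding fg(3,4) cls_poly[OF fg(1)] cls_poly[OF fg(2)] cls_poly[OF E.Z_add[OF fg(1,2)]]
    by (rule poly_eqI) (simp add: coeff_val_poly v del: E.C_simps)
next
  fix p q and F G :: "('k res \<Rightarrow> 'k lam) set"
  assume "F \<in> carrier (cohomology (Lam 2 1) (Res 2 1) d_res p)" "G \<in> carrier (cohomology (Lam 2 1) (Res 2 1) d_res q)"
  then obtain f g where fg: "f \<in> E.Z p" "g \<in> E.Z q" "F = E.cls p f" "G = E.cls q g"
    by (auto simp: E.H_simps)
  obtain L where L: "L \<in> liftings (Lam 2 1) (Res 2 1) (res_aug 2 1) d_res q g"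
    using E.lifting_exists[OF fg(2)] by blast
  show "cls_poly (p + q) (yoneda (Lam 2 1) (Res 2 1) (res_aug 2 1) d_res p q F G) = cls_poly p F * cls_poly q G"
    unfolding fg(3,4) E.yoneda_cls[OF fg(1,2) L] cls_poly[OF fg(1)] cls_poly[OF fg(2)] add.commute[of p q]
      cls_poly[OF E.compose_lifting_cocycle[OF fg(1,2) L]]
    by (rule val_poly_compose_lifting[OF fg(1,2) L])
next
  show "cls_poly 0 (E.cls 0 (res_aug 2 1) :: ('k res \<Rightarrow> 'k lam) set) = 1"
    unfolding cls_poly[OF E.aug_cocycle]
    by (rule poly_eqI) (simp add: coeff_val_poly gen_val_def res_aug_eq aug_map_gen lam_coord_gens coeff_1)
qed

interpretation G: graded_hom "cohomology (Lam 2 1) (Res 2 1) d_res"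
  "yoneda (Lam 2 1) (Res 2 1) (res_aug 2 1) d_res" "cohomology_class (Lam 2 1) (Res 2 1) d_res 0 (res_aug 2 1)" cls_poly
  by (rule cls_poly_hom)

text \<open>For \<open>i = i0\<close> the trivial coordinate is a trivial coefficient of g by
  \<open>lifting_coord\<close>; for the other vertex it is excluded by the end points.\<close>

lemma lifting_radical:
  fixes g :: "'k::field res \<Rightarrow> 'k lam"
  assumes g: "g \<in> E.Z q" and val: "\<And>r i. r \<le> q \<Longrightarrow> gen_val q g r i False False = 0"
    and L: "L \<in> liftings (Lam 2 1) (Res 2 1) (res_aug 2 1) d_res q g"
    and r: "r \<le> q + k" "r' \<le> k"
  shows "res_coord k (L k (gen (q + k) i0 r)) i r' False False False False = 0"
proof (cases "i = i0")
  case True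
  then show ?thesis using lifting_coord[OF g L r, of i] val[of "r - r'" i] by simp
next
  case False
  have "L k \<in> E.Hom (q + k) k" using L by (simp add: E.liftings_iff[OF E.Z_hom[OF g]])
  then show ?thesis by (rule hom_gen_coord[OF _ r(1)]) (use False in simp)
qed

text \<open>If \<open>f\<close> takes values in the radical, then so do its liftings, hence \<open>f \<circ> L\<close> takes values in the socle and
  \<open>f \<circ> L \<circ> L\<close> vanishes.\<close>

lemma cube_zero:
  fixes f :: "'k::field res \<Rightarrow> 'k lam"
  assumes f: "f \<in> E.Z n" and val: "\<And>r. r \<le> n \<Longrightarrow> gen_val n f r False False False = 0"
  shows "yoneda (Lam 2 1) (Res 2 1) (res_aug 2 1) d_res (n + n) n
     (yoneda (Lam 2 1) (Res 2 1) (res_aug 2 1) d_res n n (E.cls n f) (E.cls n f)) (E.cls n f)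
     = \<zero>\<^bsub>cohomology (Lam 2 1) (Res 2 1) d_res (n + n + n)\<^esub>"
proof -
  have val': "gen_val n f r i False False = 0" if "r \<le> n" for r i
    using val[OF that] cocycle_val[OF f that] by (cases i) simp_all
  obtain L where L: "L \<in> liftings (Lam 2 1) (Res 2 1) (res_aug 2 1) d_res n f"
    using E.lifting_exists[OF f] by blast
  have Lh: "L k \<in> E.Hom (n + k) k" for k using L by (simp add: E.liftings_iff[OF E.Z_hom[OF f]])
  let ?f2 = "compose (carrier (RP (n + n))) f (L n)"
  let ?f3 = "compose (carrier (RP (n + (n + n)))) ?f2 (L (n + n))"
  have f2: "?f2 \<in> E.Z (n + n)" by (rule E.compose_lifting_cocycle[OF f f L])
  have f3: "?f3 \<in> E.Z (n + (n + n))" by (rule E.compose_lifting_cocycle[OF f2 f L])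
  have val2: "gen_val (n + n) ?f2 r i \<alpha> \<beta> = 0" if r: "r \<le> n + n" and ab: "\<not> (\<alpha> \<and> \<beta>)" for r i \<alpha> \<beta>
  proof -
    note x = gen_closed[OF r]
    have "gen_val (n + n) ?f2 r i \<alpha> \<beta> = lam_coord (f (L n (gen (n + n) i r))) i \<alpha> \<beta>"
      by (simp add: gen_val_def compose_eq x)
    also have "\<dots> = (\<Sum>s\<le>n. hom_term (gen_val n f s) (\<lambda>j. res_coord n (L n (gen (n + n) i r)) j s) i \<alpha> \<beta>)"
      by (rule hom_coord[OF E.Z_hom[OF f] bimodule_homD(2)[OF Lh x]])
    also have "\<dots> = 0"
      by (intro sum.neutral ballI) (use ab in \<open>auto simp: hom_term_def val' lifting_radical[OF f val' L r]\<close>)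
    finally show ?thesis .
  qed
  have "?f3 = \<zero>\<^bsub>E.C (n + (n + n))\<^esub>"
  proof (rule Res_hom_ext[OF E.Z_hom[OF f3] _ LA.regular_bimodule])
    show "\<zero>\<^bsub>E.C (n + (n + n))\<^esub> \<in> E.HomA (n + (n + n))"
      using E.Z_hom[OF E.B_sub_Z[OF E.B_zero]] .
    fix s assume "s \<in> Res_index (n + (n + n))"
    then obtain i r where s: "s = (vert i, int r)" "r \<le> n + (n + n)" by (rule Res_indexE)
    note x = gen_closed[OF s(2)]
    let ?u = "L (n + n) (gen (n + (n + n)) i r)"
    have u: "?u \<in> carrier (RP (n + n))" by (rule bimodule_homD(2)[OF Lh x])
    have "?f2 ?u = \<zero>\<^bsub>LA\<^esub>"
    proof (rule lam_coord_inj)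
      show "?f2 ?u \<in> carrier LA" by (rule E.homA_closed[OF E.Z_hom[OF f2] u])
      fix v \<alpha> \<beta>
      have "lam_coord (?f2 ?u) v \<alpha> \<beta> = (\<Sum>s\<le>n + n. hom_term (gen_val (n + n) ?f2 s) (\<lambda>j. res_coord (n + n) ?u j s) v \<alpha> \<beta>)"
        by (rule hom_coord[OF E.Z_hom[OF f2] u])
      also have "\<dots> = 0"
        by (intro sum.neutral ballI)
          (auto simp: hom_term_def val2 lifting_radical[OF f val' L s(2)])
      finally show "lam_coord (?f2 ?u) v \<alpha> \<beta> = lam_coord \<zero>\<^bsub>LA\<^esub> v \<alpha> \<beta>" by (simp add: lam_coord_zero)
    qed simp
    then show "?f3 (single_gen (n + (n + n)) s) = \<zero>\<^bsub>E.C (n + (n + n))\<^esub> (single_gen (n + (n + n)) s)"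
      by (simp only: s compose_eq[OF x] E.C_simps restrict_apply' x)
  qed
  then have "E.cls (n + (n + n)) ?f3 = E.B (n + (n + n))" by (simp only: E.cls_zero)
  then show ?thesis
    unfolding E.yoneda_cls[OF f f L] E.yoneda_cls[OF f2 f L] E.H_simps by (simp only: add.assoc)
qed

section \<open>Quotients by kernels and prime chains\<close>

text \<open>The first isomorphism theorem for algebras, in a form that records where each coset
  goes. The scalar laws are hypotheses, so that it applies to \<open>HH\<close> and to the
  polynomial algebra alike; the further conclusions are what inverting the isomorphism and
  transporting structure along it ask for.\<close>

lemma quotient_iso:
  fixes A :: "('k::field, 'a) module" and B :: "('k, 'b) module"
  assumes A: "ring A" and B: "ring B" and h: "h \<in> ring_hom A B" and surj: "h ` carrier A = carrier B"
    and smult: "\<And>c x. x \<in> carrier A \<Longrightarrow> c \<odot>\<^bsub>A\<^esub> x \<in> carrier A"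
      "\<And>c x y. \<lbrakk>x \<in> carrier A; y \<in> carrier A\<rbrakk> \<Longrightarrow> c \<odot>\<^bsub>A\<^esub> (x \<oplus>\<^bsub>A\<^esub> y) = c \<odot>\<^bsub>A\<^esub> x \<oplus>\<^bsub>A\<^esub> c \<odot>\<^bsub>A\<^esub> y"
      "\<And>c x. x \<in> carrier A \<Longrightarrow> h (c \<odot>\<^bsub>A\<^esub> x) = c \<odot>\<^bsub>B\<^esub> h x"
      "\<And>c. c \<odot>\<^bsub>B\<^esub> \<zero>\<^bsub>B\<^esub> = \<zero>\<^bsub>B\<^esub>"
    and I: "I = {x \<in> carrier A. h x = \<zero>\<^bsub>B\<^esub>}"
  shows "ring (quotient_algebra A I)"
    and "\<exists>\<Phi>\<in>algebra_iso (quotient_algebra A I) B. \<forall>x\<in>carrier A. \<Phi> (I +>\<^bsub>A\<^esub> x) = h x"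
    and "\<And>c Y. Y \<in> carrier (quotient_algebra A I) \<Longrightarrow> c \<odot>\<^bsub>quotient_algebra A I\<^esub> Y \<in> carrier (quotient_algebra A I)"
    and "carrier (quotient_algebra A I) = (\<lambda>x. I +>\<^bsub>A\<^esub> x) ` carrier A"
proof -
  have hr: "ring_hom_ring A B h" by (rule ring_hom_ringI2[OF A B h])
  have Ik: "I = a_kernel A B h" unfolding I a_kernel_def' by (rule refl)
  have idl: "ideal I A" unfolding Ik by (rule ring_hom_ring.kernel_is_ideal[OF hr])
  have h0: "h (c \<odot>\<^bsub>A\<^esub> x) = \<zero>\<^bsub>B\<^esub>" if "x \<in> carrier A" "h x = \<zero>\<^bsub>B\<^esub>" for c x
    unfolding smult(3)[OF that(1)] that(2) by (rule smult(4))
  have "quotient_of_ring I A"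
  proof (intro quotient_of_ring.intro quotient_of_ring_axioms.intro idl)
    show "c \<odot>\<^bsub>A\<^esub> x \<in> I" if "x \<in> I" for c x
      using that h0 smult(1) unfolding I by blast
  qed (rule smult; assumption)+
  then interpret Q: quotient_of_ring I A .
  interpret B: ring B by (rule B)
  show "ring (quotient_algebra A I)" by (rule Q.quotient_ring)
  show car: "carrier (quotient_algebra A I) = (\<lambda>x. I +>\<^bsub>A\<^esub> x) ` carrier A" by (rule Q.carrier_quotient)
  show "c \<odot>\<^bsub>quotient_algebra A I\<^esub> Y \<in> carrier (quotient_algebra A I)" if "Y \<in> carrier (quotient_algebra A I)" for c Y
    using that unfolding car by (auto simp: Q.quotient_smult smult(1))
  have diff: "x \<ominus>\<^bsub>A\<^esub> y \<in> I \<longleftrightarrow> h x = h y" if "x \<in> carrier A" "y \<in> carrier A" for x y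
  proof -
    have xy: "x \<ominus>\<^bsub>A\<^esub> y \<in> carrier A" using that by simp
    have e: "x = y \<oplus>\<^bsub>A\<^esub> (x \<ominus>\<^bsub>A\<^esub> y)" using that by (simp add: Q.minus_eq Q.a_comm Q.r_neg1 Q.r_neg2 Q.a_assoc Q.a_lcomm Q.r_neg Q.l_neg)
    have "h x = h (y \<oplus>\<^bsub>A\<^esub> (x \<ominus>\<^bsub>A\<^esub> y))" by (rule arg_cong[OF e])
    also have "\<dots> = h y \<oplus>\<^bsub>B\<^esub> h (x \<ominus>\<^bsub>A\<^esub> y)" by (rule ring_hom_add[OF h that(2) xy])
    finally have eq: "h x = h y \<oplus>\<^bsub>B\<^esub> h (x \<ominus>\<^bsub>A\<^esub> y)" .
    have c: "h y \<in> carrier B" "h (x \<ominus>\<^bsub>A\<^esub> y) \<in> carrier B"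
      using ring_hom_closed[OF h that(2)] ring_hom_closed[OF h xy] .
    have "h (x \<ominus>\<^bsub>A\<^esub> y) = \<zero>\<^bsub>B\<^esub>" if "h x = h y"
    proof (rule B.add.l_cancel)
      show "h y \<oplus>\<^bsub>B\<^esub> h (x \<ominus>\<^bsub>A\<^esub> y) = h y \<oplus>\<^bsub>B\<^esub> \<zero>\<^bsub>B\<^esub>" using eq that c by simp
    qed (use c in simp_all)
    moreover have "h x = h y" if "h (x \<ominus>\<^bsub>A\<^esub> y) = \<zero>\<^bsub>B\<^esub>"
      unfolding eq that using c by simp
    ultimately show ?thesis unfolding I using xy by blast
  qed
  \<comment> \<open>A representative is chosen for each coset; \<open>diff\<close> shows that h does
    not depend on the choice.\<close>
  define \<Phi> where "\<Phi> C = h (SOME x. x \<in> carrier A \<and> I +>\<^bsub>A\<^esub> x = C)" for C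
  have \<Phi>: "\<Phi> (I +>\<^bsub>A\<^esub> x) = h x" if x: "x \<in> carrier A" for x
  proof -
    have "\<exists>y. y \<in> carrier A \<and> I +>\<^bsub>A\<^esub> y = I +>\<^bsub>A\<^esub> x" using x by blast
    from someI_ex[OF this]
    have y: "(SOME y. y \<in> carrier A \<and> I +>\<^bsub>A\<^esub> y = I +>\<^bsub>A\<^esub> x) \<in> carrier A"
      "I +>\<^bsub>A\<^esub> (SOME y. y \<in> carrier A \<and> I +>\<^bsub>A\<^esub> y = I +>\<^bsub>A\<^esub> x) = I +>\<^bsub>A\<^esub> x"
      by (rule conjunct1, rule conjunct2)
    then show ?thesis unfolding \<Phi>_def using Q.coset_eq_iff[OF y(1) x] diff[OF y(1) x] by blast
  qed
  have "\<Phi> \<in> ring_iso (quotient_algebra A I) B"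
  proof (rule ring_iso_memI)
    show "bij_betw \<Phi> (carrier (quotient_algebra A I)) (carrier B)"
      unfolding bij_betw_def
    proof
      show "inj_on \<Phi> (carrier (quotient_algebra A I))"
      proof (rule inj_onI)
        fix C D assume "C \<in> carrier (quotient_algebra A I)" "D \<in> carrier (quotient_algebra A I)" and eq: "\<Phi> C = \<Phi> D"
        then obtain x y where xy: "x \<in> carrier A" "y \<in> carrier A" "C = I +>\<^bsub>A\<^esub> x" "D = I +>\<^bsub>A\<^esub> y"
          unfolding car by blast
        then show "C = D" using eq by (simp add: \<Phi> Q.coset_eq_iff diff)
      qed
      have "\<Phi> ` carrier (quotient_algebra A I) = h ` carrier A"
        unfolding car image_image by (intro image_cong refl \<Phi>)
      then show "\<Phi> ` carrier (quotient_algebra A I) = carrier B" by (simp only: surj)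
    qed
  next
    fix C D assume "C \<in> carrier (quotient_algebra A I)" "D \<in> carrier (quotient_algebra A I)"
    then obtain x y where xy: "x \<in> carrier A" "y \<in> carrier A" "C = I +>\<^bsub>A\<^esub> x" "D = I +>\<^bsub>A\<^esub> y"
      unfolding car by blast
    then show "\<Phi> C \<in> carrier B" "\<Phi> (C \<otimes>\<^bsub>quotient_algebra A I\<^esub> D) = \<Phi> C \<otimes>\<^bsub>B\<^esub> \<Phi> D"
      "\<Phi> (C \<oplus>\<^bsub>quotient_algebra A I\<^esub> D) = \<Phi> C \<oplus>\<^bsub>B\<^esub> \<Phi> D"
      by (simp_all add: \<Phi> Q.quotient_mult Q.quotient_add ring_hom_closed[OF h] ring_hom_mult[OF h] ring_hom_add[OF h])
  qed (simp add: Q.quotient_one \<Phi> ring_hom_one[OF h])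
  moreover have "\<Phi> (c \<odot>\<^bsub>quotient_algebra A I\<^esub> C) = c \<odot>\<^bsub>B\<^esub> \<Phi> C" if "C \<in> carrier (quotient_algebra A I)" for c C
    using that unfolding car by (auto simp: Q.quotient_smult \<Phi> smult(1,3))
  ultimately show "\<exists>\<Phi>\<in>algebra_iso (quotient_algebra A I) B. \<forall>x\<in>carrier A. \<Phi> (I +>\<^bsub>A\<^esub> x) = h x"
    using \<Phi> by (auto simp: algebra_iso_def)
qed

text \<open>Each law is an equation in A and can be checked after applying the injective h.
  Commutativity of A is obtained in the same way, and this is how the quotient of \<open>HH\<close>
  is seen to be commutative.\<close>

lemma algebra_iso_transport:
  fixes A :: "('k::field, 'a) module" and B :: "('k, 'b) module"
  assumes h: "h \<in> algebra_iso A B" and A: "ring A" and R: "R = (ring_of_type_algebra :: 'k ring)"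
    and smult: "\<And>c x. x \<in> carrier A \<Longrightarrow> c \<odot>\<^bsub>A\<^esub> x \<in> carrier A"
    and B: "algebra R B"
  shows "algebra R A"
proof -
  interpret A: ring A by fact
  interpret B: algebra R B by fact
  have iso: "h \<in> ring_iso A B" and hs: "\<And>c x. x \<in> carrier A \<Longrightarrow> h (c \<odot>\<^bsub>A\<^esub> x) = c \<odot>\<^bsub>B\<^esub> h x"
    using h by (auto simp: algebra_iso_def)
  have hh: "h \<in> ring_hom A B" and inj: "inj_on h (carrier A)"
    using iso by (auto simp: ring_iso_def bij_betw_def)
  note [simp] = ring_hom_closed[OF hh] ring_hom_mult[OF hh] ring_hom_add[OF hh] hs smult
  have R1: "carrier R = UNIV" "\<one>\<^bsub>R\<^esub> = 1" by (simp_all add: R ring_of_type_algebra_def)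
  show ?thesis
  proof (rule algebraI)
    show "cring R" by (rule B.R.is_cring)
    show "cring A"
    proof (intro cring.intro comm_monoid.intro comm_monoid_axioms.intro A A.is_monoid)
      fix x y assume "x \<in> carrier A" "y \<in> carrier A"
      then show "x \<otimes>\<^bsub>A\<^esub> y = y \<otimes>\<^bsub>A\<^esub> x" by (intro inj_onD[OF inj]) (simp_all add: B.m_comm)
    qed
  next
    fix a b x y assume ab: "a \<in> carrier R" "b \<in> carrier R" and x: "x \<in> carrier A" and y: "y \<in> carrier A"
    show "a \<odot>\<^bsub>A\<^esub> x \<in> carrier A" using x by simp
    show "(a \<oplus>\<^bsub>R\<^esub> b) \<odot>\<^bsub>A\<^esub> x = a \<odot>\<^bsub>A\<^esub> x \<oplus>\<^bsub>A\<^esub> b \<odot>\<^bsub>A\<^esub> x"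
      using x ab by (intro inj_onD[OF inj]) (simp_all add: B.smult_l_distr)
    show "a \<odot>\<^bsub>A\<^esub> (x \<oplus>\<^bsub>A\<^esub> y) = a \<odot>\<^bsub>A\<^esub> x \<oplus>\<^bsub>A\<^esub> a \<odot>\<^bsub>A\<^esub> y"
      using x y ab by (intro inj_onD[OF inj]) (simp_all add: B.smult_r_distr)
    show "(a \<otimes>\<^bsub>R\<^esub> b) \<odot>\<^bsub>A\<^esub> x = a \<odot>\<^bsub>A\<^esub> (b \<odot>\<^bsub>A\<^esub> x)"
      using x ab by (intro inj_onD[OF inj]) (simp_all add: B.smult_assoc1)
    show "(a \<odot>\<^bsub>A\<^esub> x) \<otimes>\<^bsub>A\<^esub> y = a \<odot>\<^bsub>A\<^esub> (x \<otimes>\<^bsub>A\<^esub> y)"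
      using x y ab by (intro inj_onD[OF inj]) (simp_all add: B.smult_assoc2)
  next
    fix x assume "x \<in> carrier A"
    then show "\<one>\<^bsub>R\<^esub> \<odot>\<^bsub>A\<^esub> x = x" by (intro inj_onD[OF inj]) simp_all
  qed
qed

text \<open>Preimages of primes are prime, and surjectivity keeps the inclusions strict. Applied to
  an isomorphism in both directions it gives equality.\<close>

lemma krull_dim_surj:
  fixes R :: "('a, 'm) ring_scheme" and S :: "('b, 'n) ring_scheme"
  assumes h: "h \<in> ring_hom R S" and R: "cring R" and S: "cring S" and surj: "h ` carrier R = carrier S"
  shows "krull_dim S \<le> krull_dim R"
  unfolding krull_dim_def
proof (intro Sup_subset_mono image_mono subsetI CollectI)
  fix n assume "n \<in> {n. \<exists>p :: nat \<Rightarrow> 'b set. (\<forall>i\<le>n. primeideal (p i) S) \<and> (\<forall>i<n. p i \<subset> p (Suc i))}"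
  then obtain p :: "nat \<Rightarrow> 'b set" where p: "\<And>i. i \<le> n \<Longrightarrow> primeideal (p i) S" "\<And>i. i < n \<Longrightarrow> p i \<subset> p (Suc i)"
    by blast
  have hr: "ring_hom_ring R S h"
    by (rule ring_hom_ringI2[OF cring.axioms(1)[OF R] cring.axioms(1)[OF S] h])
  let ?q = "\<lambda>i. {r \<in> carrier R. h r \<in> p i}"
  have "primeideal (?q i) R" if "i \<le> n" for i
    by (rule ring_hom_ring.primeideal_vimage[OF hr R p(1)[OF that]])
  moreover have "?q i \<subset> ?q (Suc i)" if i: "i < n" for i
  proof -
    have "p i \<subseteq> p (Suc i)" using p(2)[OF i] by blast
    obtain x where x: "x \<in> p (Suc i)" "x \<notin> p i" using p(2)[OF i] by blast
    have "primeideal (p (Suc i)) S" using p(1) i by simp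
    then have "p (Suc i) \<subseteq> carrier S" by (rule additive_subgroup.a_subset[OF ideal.axioms(1)[OF primeideal.axioms(1)]])
    then have "x \<in> h ` carrier R" using x(1) surj by blast
    then obtain r where r: "r \<in> carrier R" "h r = x" by blast
    have "r \<in> ?q (Suc i)" "r \<notin> ?q i" using r x by simp_all
    moreover have "?q i \<subseteq> ?q (Suc i)" using \<open>p i \<subseteq> p (Suc i)\<close> by blast
    ultimately show ?thesis by (metis psubsetI)
  qed
  ultimately have "(\<forall>i\<le>n. primeideal (?q i) R) \<and> (\<forall>i<n. ?q i \<subset> ?q (Suc i))" by (intro conjI allI impI)
  then show "\<exists>q :: nat \<Rightarrow> 'a set. (\<forall>i\<le>n. primeideal (q i) R) \<and> (\<forall>i<n. q i \<subset> q (Suc i))"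
    by (rule exI[of _ ?q])
qed

section \<open>The second Veronese ring in two variables\<close>

text \<open>The outer variable is \<open>S\<close>, the inner one is \<open>U\<close>; with \<open>S = x\<close> and \<open>S U = y\<close> this is the even part of
  \<open>K[x, y]\<close>.\<close>

definition veronese :: "('k::field, 'k poly poly) module" where
  "veronese = \<lparr>carrier = {p. \<forall>n. degree (coeff p n) \<le> n \<and> (odd n \<longrightarrow> coeff p n = 0)},
     monoid.mult = (*), one = 1, zero = 0, add = (+), module.smult = (\<lambda>c p. smult [:c:] p)\<rparr>"

lemma veronese_simps [simp]:
  "p \<in> carrier veronese \<longleftrightarrow> (\<forall>n. degree (coeff p n) \<le> n \<and> (odd n \<longrightarrow> coeff p n = 0))"
  "monoid.mult veronese = (*)" "\<one>\<^bsub>veronese\<^esub> = 1" "\<zero>\<^bsub>veronese\<^esub> = 0" "add veronese = (+)"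
  "module.smult veronese = (\<lambda>c p. smult [:c:] p)"
  by (simp_all add: veronese_def)

lemma veronese_mult:
  fixes p q :: "'k::field poly poly"
  assumes "p \<in> carrier veronese" "q \<in> carrier veronese"
  shows "p * q \<in> carrier veronese"
proof -
  have "degree (coeff (p * q) n) \<le> n" for n
    unfolding coeff_mult
  proof (rule degree_sum_le)
    fix i assume "i \<in> {..n}"
    then have "degree (coeff p i) + degree (coeff q (n - i)) \<le> i + (n - i)" using assms by (intro add_mono) auto
    then show "degree (coeff p i * coeff q (n - i)) \<le> n"
      using degree_mult_le[of "coeff p i" "coeff q (n - i)"] \<open>i \<in> {..n}\<close> by simp
  qed simp
  moreover have "coeff (p * q) n = 0" if "odd n" for n
    unfolding coeff_mult
  proof (rule sum.neutral, rule ballI)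
    fix i assume "i \<in> {..n}"
    then have "odd i \<or> odd (n - i)" using that by auto
    then have "coeff p i = 0 \<or> coeff q (n - i) = 0" using assms unfolding veronese_simps by blast
    then show "coeff p i * coeff q (n - i) = 0" by (simp only: mult_eq_0_iff)
  qed
  ultimately show ?thesis by simp
qed

lemma veronese_closed:
  "0 \<in> carrier veronese" "1 \<in> carrier veronese"
  "\<lbrakk>p \<in> carrier veronese; q \<in> carrier veronese\<rbrakk> \<Longrightarrow> p + q \<in> carrier veronese"
  "p \<in> carrier veronese \<Longrightarrow> - p \<in> carrier veronese"
  "p \<in> carrier veronese \<Longrightarrow> smult [:c:] p \<in> carrier veronese"
  by (auto simp: coeff_1 intro: degree_add_le order_trans[OF degree_smult_le] split: if_splits)

lemma veronese_power: "p \<in> carrier veronese \<Longrightarrow> p ^ n \<in> carrier veronese"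
  by (induction n) (simp_all add: veronese_closed(2) veronese_mult del: veronese_simps(1))

lemma veronese_sum: "(\<And>i. i \<in> S \<Longrightarrow> f i \<in> carrier veronese) \<Longrightarrow> sum f S \<in> carrier veronese"
  by (induction S rule: infinite_finite_induct) (simp_all add: veronese_closed(1,3) del: veronese_simps(1))

lemmas veronese_intros = veronese_closed veronese_mult veronese_power veronese_sum

lemma veronese_cring: "cring (veronese :: ('k::field, 'k poly poly) module)"
proof (rule cringI)
  show "abelian_group (veronese :: ('k, 'k poly poly) module)"
  proof (rule abelian_groupI)
    fix p :: "'k poly poly" assume "p \<in> carrier veronese"
    then show "\<exists>q\<in>carrier veronese. q \<oplus>\<^bsub>veronese\<^esub> p = \<zero>\<^bsub>veronese\<^esub>"
      by (intro bexI[of _ "- p"] veronese_closed) (simp_all del: veronese_simps(1))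
  qed (simp_all add: veronese_closed algebra_simps del: veronese_simps(1))
  show "Group.comm_monoid (veronese :: ('k, 'k poly poly) module)"
    by (rule Group.comm_monoidI) (simp_all add: veronese_closed veronese_mult algebra_simps del: veronese_simps(1))
qed (simp add: algebra_simps)

lemma veronese_algebra: "algebra (ring_of_type_algebra :: 'k::field ring) (veronese :: ('k, 'k poly poly) module)"
  by (rule algebraI[OF _ veronese_cring])
    (auto simp: ring_of_type_algebra_def veronese_closed smult_add_left[symmetric] smult_add_right one_pCons[symmetric] algebra_simps simp del: veronese_simps(1)
      intro: cring_from_type_algebra[unfolded ring_of_type_algebra_def])

section \<open>Algebraic dependence of any three elements\<close>

lemma homogeneous_system:
  fixes A :: "'s \<Rightarrow> 't \<Rightarrow> 'k::field"
  assumes "finite T" "finite S" "card T < card S"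
  shows "\<exists>c. (\<exists>s\<in>S. c s \<noteq> 0) \<and> (\<forall>t\<in>T. (\<Sum>s\<in>S. c s * A s t) = 0)"
  using assms
proof (induction T arbitrary: S A rule: finite_induct)
  case empty
  then have "\<exists>s. s \<in> S" by (metis card.empty less_irrefl ex_in_conv)
  then show ?case by (intro exI[of _ "\<lambda>_. 1"]) auto
next
  case (insert t T)
  show ?case
  proof (cases "\<forall>s\<in>S. A s t = 0")
    case True
    have "card T < card S" using insert by simp
    then obtain c where "\<exists>s\<in>S. c s \<noteq> 0" "\<forall>t\<in>T. (\<Sum>s\<in>S. c s * A s t) = 0"
      using insert.IH[OF insert.prems(1), of A] by blast
    then show ?thesis using True by (intro exI[of _ c]) auto
  next
    case False
    \<comment> \<open>Gaussian elimination: s0 is the pivot of equation t, the other equations are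
      reduced by it, and c' s0 is then chosen so that equation t holds.\<close>
    then obtain s0 where s0: "s0 \<in> S" "A s0 t \<noteq> 0" by blast
    define S' where "S' = S - {s0}"
    have S': "finite S'" "card T < card S'" "S = insert s0 S'" "s0 \<notin> S'"
      using insert s0 by (auto simp: S'_def)
    obtain c where c: "\<exists>s\<in>S'. c s \<noteq> 0"
      "\<forall>u\<in>T. (\<Sum>s\<in>S'. c s * (A s u - A s t / A s0 t * A s0 u)) = 0"
      using insert.IH[OF S'(1,2), of "\<lambda>s u. A s u - A s t / A s0 t * A s0 u"] by blast
    define c' where "c' s = (if s = s0 then - (\<Sum>s\<in>S'. c s * (A s t / A s0 t)) else c s)" for s
    have "(\<Sum>s\<in>S. c' s * A s u) = (\<Sum>s\<in>S'. c s * (A s u - A s t / A s0 t * A s0 u))" for u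
    proof -
      have "(\<Sum>s\<in>S. c' s * A s u) = c' s0 * A s0 u + (\<Sum>s\<in>S'. c' s * A s u)" using S' by simp
      also have "(\<Sum>s\<in>S'. c' s * A s u) = (\<Sum>s\<in>S'. c s * A s u)"
        using S'(4) by (intro sum.cong) (auto simp: c'_def)
      also have "c' s0 * A s0 u = - (\<Sum>s\<in>S'. c s * (A s t / A s0 t * A s0 u))"
      proof -
        have c0: "c' s0 = - (\<Sum>s\<in>S'. c s * (A s t / A s0 t))" by (simp add: c'_def)
        show ?thesis unfolding c0 by (simp only: minus_mult_left[symmetric] sum_distrib_right mult.assoc)
      qed
      finally show ?thesis
        by (simp only: right_diff_distrib sum_subtractf) simp
    qed
    moreover have "(\<Sum>s\<in>S'. c s * (A s t - A s t / A s0 t * A s0 t)) = 0" using s0 by simp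
    moreover have "\<exists>s\<in>S. c' s \<noteq> 0" using c(1) S' by (auto simp: c'_def)
    ultimately show ?thesis using c(2) by (intro exI[of _ c']) auto
  qed
qed

text \<open>A dimension count. The products x^i y^j z^l with exponents below M have degree at most K
  = 3 M D in S; in the Veronese ring the coefficient of S^n has degree at most n in U, so K bounds
  both degrees. A relation is a solution of (K + 1)^2 linear equations in M^3 unknowns.\<close>

lemma veronese_dependence:
  fixes x y z :: "'k::field poly poly"
  assumes xyz: "x \<in> carrier veronese" "y \<in> carrier veronese" "z \<in> carrier veronese"
  shows "\<exists>M c. (\<exists>i<M. \<exists>j<M. \<exists>l<M. c i j l \<noteq> 0) \<and>
    (\<Sum>i<M. \<Sum>j<M. \<Sum>l<M. smult [:c i j l:] (x ^ i * y ^ j * z ^ l)) = 0"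
proof -
  define D where "D = max (degree x) (max (degree y) (degree z))"
  have D: "degree x \<le> D" "degree y \<le> D" "degree z \<le> D" by (auto simp: D_def)
  \<comment> \<open>Since K + 1 is at most M (3 D + 1), there are at most M^2 (3 D + 1)^2 equations;
    this M exceeds (3 D + 1)^2, which leaves fewer equations than unknowns.\<close>
  define M where "M = (3 * D + 1)\<^sup>2 + 1"
  let ?K = "3 * M * D"
  let ?S = "{..<M} \<times> {..<M} \<times> {..<M}" and ?T = "{..?K} \<times> {..?K}"
  let ?v = "\<lambda>i j l. x ^ i * y ^ j * z ^ l"
  let ?A = "\<lambda>s t. case s of (i, j, l) \<Rightarrow> coeff (coeff (?v i j l) (fst t)) (snd t)"
  have "M * (3 * D + 1) = ?K + M" by (simp only: distrib_left mult_1_right ac_simps)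
  moreover have "1 \<le> M" by (simp add: M_def)
  ultimately have K: "?K + 1 \<le> M * (3 * D + 1)" by (simp only: add_le_cancel_left)
  have "(?K + 1) * (?K + 1) \<le> (M * (3 * D + 1)) * (M * (3 * D + 1))" by (rule mult_le_mono[OF K K])
  also have "\<dots> = M * M * (3 * D + 1)\<^sup>2" by (simp only: power2_eq_square ac_simps)
  also have "\<dots> < M * M * M"
  proof -
    have "(3 * D + 1)\<^sup>2 < M" "0 < M * M" by (simp_all add: M_def)
    then show ?thesis by (simp only: mult_less_cancel1 simp_thms)
  qed
  finally have "card ?T < card ?S" by (simp only: card_cartesian_product card_atMost card_lessThan mult.assoc Suc_eq_plus1)
  then obtain c where c: "\<exists>s\<in>?S. c s \<noteq> 0" "\<forall>t\<in>?T. (\<Sum>s\<in>?S. c s * ?A s t) = 0"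
    using homogeneous_system[of ?T ?S ?A] by auto
  have deg: "degree (?v i j l) \<le> ?K" if ij: "i < M" "j < M" "l < M" for i j l
  proof -
    have "degree (x ^ i) \<le> D * i" "degree (y ^ j) \<le> D * j" "degree (z ^ l) \<le> D * l"
      using D by (meson degree_power_le mult_le_mono1 order_trans)+
    moreover have "D * i \<le> D * M" "D * j \<le> D * M" "D * l \<le> D * M" by (rule mult_le_mono2[OF less_imp_le[OF ij(1)]] mult_le_mono2[OF less_imp_le[OF ij(2)]] mult_le_mono2[OF less_imp_le[OF ij(3)]])+
    moreover have "degree (?v i j l) \<le> degree (x ^ i) + degree (y ^ j) + degree (z ^ l)"
      by (meson degree_mult_le add_mono order_trans order_refl)
    ultimately have "degree (?v i j l) \<le> D * M + D * M + D * M" by linarith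
    also have "\<dots> = ?K" by (simp add: mult.commute)
    finally show ?thesis .
  qed
  have v: "?v i j l \<in> carrier veronese" for i j l by (intro veronese_intros xyz)
  have "(\<Sum>i<M. \<Sum>j<M. \<Sum>l<M. smult [:c (i, j, l):] (?v i j l)) = (\<Sum>(i, j, l)\<in>?S. smult [:c (i, j, l):] (?v i j l))"
    by (simp add: sum.cartesian_product)
  also have "\<dots> = 0"
  proof (intro poly_eqI)
    fix a b
    have "coeff (coeff (\<Sum>(i, j, l)\<in>?S. smult [:c (i, j, l):] (?v i j l)) a) b = (\<Sum>s\<in>?S. c s * ?A s (a, b))"
      by (simp add: coeff_sum case_prod_beta)
    also have "\<dots> = 0"
    proof (cases "a \<le> ?K \<and> b \<le> ?K")
      case True
      then have "(a, b) \<in> ?T" by simp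
      then show ?thesis using c(2) by blast
    next
      case False
      show ?thesis
      proof (intro sum.neutral ballI)
        fix s assume "s \<in> ?S"
        then obtain i j l where s: "s = (i, j, l)" "i < M" "j < M" "l < M" by auto
        have "coeff (coeff (?v i j l) a) b = 0"
        proof (cases "a \<le> ?K")
          case True
          moreover have "degree (coeff (?v i j l) a) \<le> a" using v[of i j l] unfolding veronese_simps by blast
          ultimately have "degree (coeff (?v i j l) a) < b" using False by linarith
          then show ?thesis by (rule coeff_eq_0)
        next
          case False
          then have "coeff (?v i j l) a = 0" using deg[OF s(2,3,4)] by (intro coeff_eq_0) simp
          then show ?thesis by simp
        qed
        then show "c s * ?A s (a, b) = 0" by (simp add: s(1))
      qed
    qed
    finally show "coeff (coeff (\<Sum>(i, j, l)\<in>?S. smult [:c (i, j, l):] (?v i j l)) a) b = coeff (coeff 0 a) b" by simp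
  qed
  finally show ?thesis using c(1) by (intro exI[of _ M] exI[of _ "\<lambda>i j l. c (i, j, l)"]) auto
qed

text \<open>Splitting off the lowest power writes the sum as x^m (s m + x t). As x is not in the
  prime P, the second factor is in P and so in Q; as x is in Q, the coefficient s m is in Q.\<close>

lemma prime_chain_step:
  fixes x :: "'k::field poly poly"
  assumes P: "primeideal P veronese" and Q: "primeideal Q veronese" and PQ: "P \<subseteq> Q"
    and x: "x \<in> Q" "x \<notin> P" and s: "\<And>i. s i \<in> carrier veronese"
    and sum: "(\<Sum>i<M. s i * x ^ i) \<in> P" and m: "\<And>i. i < m \<Longrightarrow> s i = 0" "m < M"
  shows "s m \<in> Q"
proof -
  interpret P: primeideal P veronese by fact
  interpret Q: primeideal Q veronese by fact
  have xc: "x \<in> carrier veronese" using Q.a_subset x(1) by blast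
  define t where "t = (\<Sum>i\<in>{Suc m..<M}. s i * x ^ (i - Suc m))"
  have t: "t \<in> carrier veronese" unfolding t_def by (intro veronese_intros s xc)
  have "(\<Sum>i<M. s i * x ^ i) = (\<Sum>i\<in>{m..<M}. s i * x ^ i)"
    by (rule sum.mono_neutral_right) (auto simp: m(1) not_le)
  also have "\<dots> = s m * x ^ m + (\<Sum>i\<in>{Suc m..<M}. s i * x ^ i)"
    by (rule sum.atLeast_Suc_lessThan[OF m(2)])
  also have "(\<Sum>i\<in>{Suc m..<M}. s i * x ^ i) = x ^ m * (x * t)"
    unfolding t_def sum_distrib_left
  proof (intro sum.cong refl)
    fix i assume "i \<in> {Suc m..<M}"
    then have "i = Suc m + (i - Suc m)" by simp
    then have "x ^ i = x ^ m * x * x ^ (i - Suc m)" by (metis power_add power_Suc2)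
    then show "s i * x ^ i = x ^ m * (x * (s i * x ^ (i - Suc m)))" by (simp only: ac_simps)
  qed
  finally have e: "x ^ m * (s m + x * t) \<in> P" using sum by (simp add: algebra_simps)
  have w: "s m + x * t \<in> carrier veronese" by (intro veronese_intros s xc t)
  have "x ^ k * (s m + x * t) \<in> P \<Longrightarrow> s m + x * t \<in> P" for k
  proof (induction k)
    case (Suc k)
    have "x ^ k * (s m + x * t) \<in> carrier veronese" by (intro veronese_mult veronese_power xc w)
    then show ?case
      using Suc P.I_prime[OF xc, of "x ^ k * (s m + x * t)"] x(2) by (simp add: mult.assoc)
  qed simp
  then have "s m + x * t \<in> Q" using e PQ by blast
  moreover have "x * (- t) \<in> Q" using Q.I_r_closed[OF x(1), of "- t"] veronese_closed(4)[OF t] by simp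
  ultimately have "(s m + x * t) + x * (- t) \<in> Q" using Q.a_closed by fastforce
  then show ?thesis by simp
qed

text \<open>Elements x, y, z that witness the three strict inclusions satisfy a nontrivial relation.
  Each use of \<open>prime_chain_step\<close> moves one prime up and removes one variable, until a
  nonzero scalar lies in the last prime.\<close>

lemma no_prime_chain:
  fixes p :: "nat \<Rightarrow> 'k::field poly poly set"
  assumes p: "\<And>i. i \<le> 3 \<Longrightarrow> primeideal (p i) veronese" and ps: "\<And>i. i < 3 \<Longrightarrow> p i \<subset> p (Suc i)"
  shows False
proof -
  have sub: "p i \<subseteq> carrier veronese" if "i \<le> 3" for i
    using p[OF that] by (meson additive_subgroup.a_subset ideal.axioms(1) primeideal.axioms(1))
  have "p 0 \<subset> p 1" "p 1 \<subset> p 2" "p 2 \<subset> p 3" using ps[of 0] ps[of 1] ps[of 2] by (simp_all add: eval_nat_numeral One_nat_def)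
  then obtain x y z where x: "x \<in> p 1" "x \<notin> p 0" and y: "y \<in> p 2" "y \<notin> p 1" and z: "z \<in> p 3" "z \<notin> p 2"
    and le: "p 0 \<subseteq> p 1" "p 1 \<subseteq> p 2" "p 2 \<subseteq> p 3" by blast
  have c: "x \<in> carrier veronese" "y \<in> carrier veronese" "z \<in> carrier veronese"
    using sub[of 1] sub[of 2] sub[of 3] x y z by (auto simp del: veronese_simps)
  from veronese_dependence[OF c] obtain M where "\<exists>c. (\<exists>i<M. \<exists>j<M. \<exists>l<M. c i j l \<noteq> 0) \<and>
    (\<Sum>i<M. \<Sum>j<M. \<Sum>l<M. smult [:c i j l:] (x ^ i * y ^ j * z ^ l)) = 0" by (rule exE)
  then obtain c where cc: "(\<exists>i<M. \<exists>j<M. \<exists>l<M. c i j l \<noteq> 0) \<and>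
    (\<Sum>i<M. \<Sum>j<M. \<Sum>l<M. smult [:c i j l:] (x ^ i * y ^ j * z ^ l)) = 0" by (rule exE)
  note nz = conjunct1[OF cc] and dep = conjunct2[OF cc]
  \<comment> \<open>(i0, j0, l0) will be the lexicographically least exponent with nonzero
    coefficient: i0 is the lowest power of x, j0 the lowest power of y in its coefficient, and l0
    the lowest power of z in the coefficient of that.\<close>
  define i0 where "i0 = (LEAST i. i < M \<and> (\<exists>j<M. \<exists>l<M. c i j l \<noteq> 0))"
  have i0: "i0 < M \<and> (\<exists>j<M. \<exists>l<M. c i0 j l \<noteq> 0)"
    unfolding i0_def by (rule LeastI_ex) (use nz in blast)
  have i0': "c i j l = 0" if a: "i < i0" "j < M" "l < M" for i j l
  proof -
    have "\<not> (i < M \<and> (\<exists>j<M. \<exists>l<M. c i j l \<noteq> 0))" by (rule not_less_Least[OF a(1)[unfolded i0_def]])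
    moreover have "i < M" using a(1) i0 by linarith
    ultimately show ?thesis using a(2,3) by simp
  qed
  define j0 where "j0 = (LEAST j. j < M \<and> (\<exists>l<M. c i0 j l \<noteq> 0))"
  have j0: "j0 < M \<and> (\<exists>l<M. c i0 j0 l \<noteq> 0)"
    unfolding j0_def by (rule LeastI_ex) (use i0 in blast)
  have j0': "c i0 j l = 0" if a: "j < j0" "l < M" for j l
  proof -
    have "\<not> (j < M \<and> (\<exists>l<M. c i0 j l \<noteq> 0))" by (rule not_less_Least[OF a(1)[unfolded j0_def]])
    moreover have "j < M" using a(1) j0 by linarith
    ultimately show ?thesis using a(2) by simp
  qed
  define l0 where "l0 = (LEAST l. l < M \<and> c i0 j0 l \<noteq> 0)"
  have l0: "l0 < M \<and> c i0 j0 l0 \<noteq> 0"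
    unfolding l0_def by (rule LeastI_ex) (use j0 in blast)
  have l0': "c i0 j0 l = 0" if a: "l < l0" for l
  proof -
    have "\<not> (l < M \<and> c i0 j0 l \<noteq> 0)" by (rule not_less_Least[OF a(1)[unfolded l0_def]])
    then show ?thesis using a l0 by simp
  qed
  let ?s0 = "\<lambda>i. \<Sum>j<M. \<Sum>l<M. smult [:c i j l:] (y ^ j * z ^ l)"
  let ?s1 = "\<lambda>j. \<Sum>l<M. smult [:c i0 j l:] (z ^ l)"
  let ?s2 = "\<lambda>l. smult [:c i0 j0 l:] 1"
  interpret p0: primeideal "p 0" veronese by (rule p) simp
  have "(\<Sum>i<M. ?s0 i * x ^ i) = 0"
    unfolding dep[symmetric] by (simp only: sum_distrib_right mult_smult_left) (simp only: ac_simps)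
  moreover have "0 \<in> p 0" using additive_subgroup.zero_closed[OF p0.is_additive_subgroup] by simp
  ultimately have "(\<Sum>i<M. ?s0 i * x ^ i) \<in> p 0" by simp
  then have "?s0 i0 \<in> p 1"
    by (rule prime_chain_step[where s = ?s0, OF p p le(1) x, rotated 3])
      (auto simp: i0' i0 intro!: veronese_intros c simp del: veronese_simps(1))
  then have "(\<Sum>j<M. ?s1 j * y ^ j) \<in> p 1"
    by (simp only: sum_distrib_right mult_smult_left) (simp only: ac_simps)
  then have "?s1 j0 \<in> p 2"
    by (rule prime_chain_step[where s = ?s1, OF p p le(2) y, rotated 3])
      (auto simp: j0' j0 intro!: veronese_intros c simp del: veronese_simps(1))
  then have s2: "(\<Sum>l<M. ?s2 l * z ^ l) \<in> p 2" by simp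
  have k: "[:[:a:]:] \<in> carrier veronese" for a :: 'k
    using veronese_closed(5)[OF veronese_closed(2), of a] by (simp del: veronese_simps(1))
  from s2 have "?s2 l0 \<in> p 3"
    by (rule prime_chain_step[where s = ?s2, OF p p le(3) z, rotated 3])
      (auto simp: l0' l0 k intro!: veronese_intros c simp del: veronese_simps(1))
  interpret p3: primeideal "p 3" veronese by (rule p) simp
  have inv: "smult [:inverse (c i0 j0 l0):] 1 \<in> carrier veronese" by (intro veronese_intros)
  have "?s2 l0 * smult [:inverse (c i0 j0 l0):] 1 = 1"
    using l0 by (simp add: one_pCons)
  then have "1 \<in> p 3" using p3.I_r_closed[OF \<open>?s2 l0 \<in> p 3\<close> inv] by simp
  then have "p 3 = carrier veronese" using p3.one_imp_carrier by simp
  then show False using p3.I_notcarr by simp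
qed

text \<open>The kernel of a homomorphism to an integral domain; the value at 1 makes it proper. It
  provides all members of the chain that bounds the dimension from below.\<close>

lemma veronese_kernel_prime:
  fixes g :: "'k::field poly poly \<Rightarrow> 'r::idom"
  assumes mult: "\<And>p q. g (p * q) = g p * g q" and add: "\<And>p q. g (p + q) = g p + g q" and one: "g 1 \<noteq> 0"
  shows "primeideal {p \<in> carrier veronese. g p = 0} veronese"
proof (rule primeidealI[OF _ veronese_cring])
  interpret V: cring "veronese :: ('k, 'k poly poly) module" by (rule veronese_cring)
  have "g 0 + g 0 = g 0 + 0" using add[of 0 0] by (simp only: add_0_right)
  then have g0: "g 0 = 0" by (simp only: add_left_cancel)
  have gm: "g (- p) = - g p" for p using add[of p "- p"] g0 by (simp add: add_eq_0_iff)
  show "ideal {p \<in> carrier veronese. g p = 0} veronese"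
  proof (rule idealI[OF V.ring_axioms])
    show "subgroup {p \<in> carrier veronese. g p = 0} (add_monoid (veronese :: ('k, 'k poly poly) module))"
    proof (rule V.add.subgroupI)
      fix p :: "'k poly poly" assume a: "p \<in> {p \<in> carrier veronese. g p = 0}"
      have "\<ominus>\<^bsub>veronese\<^esub> p = - p"
        by (rule V.minus_equality) (use a in \<open>auto intro: veronese_closed(4) simp del: veronese_simps(1)\<close>)
      then show "\<ominus>\<^bsub>veronese\<^esub> p \<in> {p \<in> carrier veronese. g p = 0}"
        using a by (auto simp: gm intro: veronese_closed(4) simp del: veronese_simps(1))
    qed (auto simp: add g0 veronese_closed simp del: veronese_simps(1) intro!: exI[of _ 0])
  qed (auto simp: mult veronese_mult simp del: veronese_simps(1))
  show "carrier veronese \<noteq> {p \<in> carrier veronese. g p = 0}"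
  proof
    assume eq: "carrier veronese = {p \<in> carrier veronese. g p = 0}"
    have "1 \<in> {p \<in> carrier veronese. g p = 0}" by (subst eq[symmetric]) (rule veronese_closed(2))
    then show False using one by (simp only: mem_Collect_eq simp_thms)
  qed
qed (auto simp: mult simp del: veronese_simps(1))

lemma krull_dim_veronese: "krull_dim (veronese :: ('k::field, 'k poly poly) module) = 2"
proof (rule antisym)
  show "krull_dim (veronese :: ('k, 'k poly poly) module) \<le> 2"
    unfolding krull_dim_def
  proof (intro Sup_least, elim imageE CollectE exE conjE)
    fix e n and p :: "nat \<Rightarrow> 'k poly poly set"
    assume p: "\<forall>i\<le>n. primeideal (p i) veronese" "\<forall>i<n. p i \<subset> p (Suc i)" and e: "e = enat n"
    have "n \<le> 2"
    proof (rule ccontr)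
      assume "\<not> n \<le> 2"
      then have n: "3 \<le> n" by simp
      have "primeideal (p i) veronese" if "i \<le> 3" for i using p(1) order_trans[OF that n] by blast
      moreover have "p i \<subset> p (Suc i)" if "i < 3" for i using p(2) less_le_trans[OF that n] by blast
      ultimately show False by (rule no_prime_chain)
    qed
    then show "e \<le> 2" unfolding e by (metis enat_ord_simps(1) numeral_eq_enat)
  qed
next
  \<comment> \<open>This sets U = 0. With x = S and y = S U, the chain consists of the even parts of
    the ideals (0), (y) and (x, y).\<close>
  let ?c0 = "map_poly (\<lambda>q. coeff q 0) :: 'k poly poly \<Rightarrow> 'k poly"
  have c0: "coeff (?c0 p) n = coeff (coeff p n) 0" for p n by (simp add: coeff_map_poly)
  have c0_mult: "?c0 (p * q) = ?c0 p * ?c0 q" for p q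
    by (rule poly_eqI) (simp only: c0 coeff_mult coeff_sum, simp add: coeff_mult_0)
  have c0_add: "?c0 (p + q) = ?c0 p + ?c0 q" for p q by (rule poly_eqI) (simp add: c0)
  define P0 :: "'k poly poly set" where "P0 = {p \<in> carrier veronese. p = 0}"
  define P1 where "P1 = {p \<in> carrier veronese. ?c0 p = 0}"
  define P2 where "P2 = {p \<in> carrier veronese. coeff (?c0 p) 0 = 0}"
  have c1: "coeff (?c0 1) 0 = 1" by (simp only: c0) simp
  have prime: "primeideal P0 veronese" "primeideal P1 veronese" "primeideal P2 veronese"
  proof -
    show "primeideal P0 veronese" unfolding P0_def by (rule veronese_kernel_prime[where g = "\<lambda>p. p"]) simp_all
    have "?c0 1 \<noteq> 0" using c1 by (metis coeff_0 zero_neq_one)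
    then show "primeideal P1 veronese" unfolding P1_def by (intro veronese_kernel_prime c0_mult c0_add)
    show "primeideal P2 veronese" unfolding P2_def
      by (rule veronese_kernel_prime[where g = "\<lambda>p. coeff (?c0 p) 0"]) (simp_all only: c0_mult c0_add coeff_mult_0 coeff_add c1, simp)
  qed
  have le: "P0 \<subset> P1" "P1 \<subset> P2"
  proof -
    \<comment> \<open>S^2 U vanishes at U = 0 without being zero; S^2 vanishes only after S is set
      to 0 as well.\<close>
    let ?u = "monom (monom 1 1) 2 :: 'k poly poly" and ?v = "monom 1 2 :: 'k poly poly"
    have "?c0 ?u = 0" by (rule poly_eqI) (simp only: c0, simp add: coeff_monom)
    moreover have "?u \<in> carrier veronese" by (auto simp: coeff_monom degree_monom_eq)
    ultimately have "?u \<in> P1" "?u \<notin> P0" by (simp_all only: P1_def P0_def mem_Collect_eq simp_thms) simp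
    moreover have "P0 \<subseteq> P1" by (auto simp: P0_def P1_def)
    ultimately show "P0 \<subset> P1" by (metis psubsetI)
    have "coeff (?c0 ?v) 2 = 1" "coeff (?c0 ?v) 0 = 0" by (simp_all only: c0) simp_all
    moreover from this(1) have "?c0 ?v \<noteq> 0" by (metis coeff_0 zero_neq_one)
    moreover have "?v \<in> carrier veronese" by (auto simp: coeff_monom)
    ultimately have "?v \<in> P2" "?v \<notin> P1" by (simp_all only: P1_def P2_def mem_Collect_eq simp_thms)
    moreover have "P1 \<subseteq> P2" unfolding P1_def P2_def by (intro Collect_mono impI conjI) (elim conjE, simp only: coeff_0)+
    ultimately show "P1 \<subset> P2" by (metis psubsetI)
  qed
  let ?p = "\<lambda>i::nat. if i = 0 then P0 else if i = 1 then P1 else P2"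
  have "primeideal (?p i) veronese" for i by (simp add: prime)
  moreover have "?p i \<subset> ?p (Suc i)" if "i < 2" for i
  proof -
    have "i = 0 \<or> i = 1" using that by arith
    then show ?thesis by (elim disjE) (simp_all only: One_nat_def, simp_all add: le[unfolded One_nat_def])
  qed
  ultimately have "(\<forall>i\<le>2. primeideal (?p i) veronese) \<and> (\<forall>i<2. ?p i \<subset> ?p (Suc i))" by (intro conjI allI impI)
  then have "\<exists>p :: nat \<Rightarrow> 'k poly poly set. (\<forall>i\<le>2. primeideal (p i) veronese) \<and> (\<forall>i<2. p i \<subset> p (Suc i))" by (rule exI[of _ ?p])
  then have "enat 2 \<le> krull_dim (veronese :: ('k, 'k poly poly) module)"
    unfolding krull_dim_def by (intro Sup_upper imageI CollectI)
  then show "2 \<le> krull_dim (veronese :: ('k, 'k poly poly) module)" by (simp add: numeral_eq_enat)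
qed

section \<open>The polynomial side\<close>

lemma poly_algebra_simps [simp]:
  "carrier poly_algebra = UNIV" "monoid.mult poly_algebra = (*)" "\<one>\<^bsub>poly_algebra\<^esub> = 1"
  "\<zero>\<^bsub>poly_algebra\<^esub> = 0" "add poly_algebra = (+)"
  "module.smult poly_algebra = (\<lambda>c p. Poly_Mapping.single 0 c * p)"
  by (simp_all add: poly_algebra_def)

lemma poly_algebra_cring: "cring (poly_algebra :: ('k::field, 'k chi_poly) module)"
proof (rule cringI)
  show "abelian_group (poly_algebra :: ('k, 'k chi_poly) module)"
  proof (rule abelian_groupI)
    fix p :: "'k chi_poly"
    show "\<exists>q\<in>carrier poly_algebra. q \<oplus>\<^bsub>poly_algebra\<^esub> p = \<zero>\<^bsub>poly_algebra\<^esub>"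
      by (intro bexI[of _ "- p"]) simp_all
  qed (simp_all add: algebra_simps)
  show "Group.comm_monoid (poly_algebra :: ('k, 'k chi_poly) module)"
    by (rule Group.comm_monoidI) (simp_all add: algebra_simps)
qed (simp add: algebra_simps)

definition chi_mono :: "nat \<Rightarrow> nat \<Rightarrow> nat \<Rightarrow> chi_var \<Rightarrow>\<^sub>0 nat" where
  "chi_mono a b c = Poly_Mapping.single X0 a + Poly_Mapping.single X1 b + Poly_Mapping.single Xm1 c"

lemma lookup_chi_mono:
  "Poly_Mapping.lookup (chi_mono a b c) X0 = a" "Poly_Mapping.lookup (chi_mono a b c) X1 = b"
  "Poly_Mapping.lookup (chi_mono a b c) Xm1 = c"
  by (simp_all add: chi_mono_def lookup_add lookup_single)

lemma mono_lookup: "chi_mono (Poly_Mapping.lookup t X0) (Poly_Mapping.lookup t X1) (Poly_Mapping.lookup t Xm1) = t"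
proof (rule poly_mapping_eqI)
  show "Poly_Mapping.lookup (chi_mono (Poly_Mapping.lookup t X0) (Poly_Mapping.lookup t X1) (Poly_Mapping.lookup t Xm1)) x
    = Poly_Mapping.lookup t x" for x
    by (cases x) (simp_all only: lookup_chi_mono)
qed

lemma mono_add: "chi_mono a b c + chi_mono a' b' c' = chi_mono (a + a') (b + b') (c + c')"
  by (simp add: chi_mono_def single_add ac_simps)

text \<open>The exponent of U after the substitution of S^2 U, S^2 and S^2 U^2 for X0, X1 and Xm1.
  Each variable brings a factor S^2, so the exponent of S is twice \<open>mon_deg\<close>.\<close>

definition mon_r :: "(chi_var \<Rightarrow>\<^sub>0 nat) \<Rightarrow> nat" where
  "mon_r t = Poly_Mapping.lookup t X0 + 2 * Poly_Mapping.lookup t Xm1"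

definition mon_deg :: "(chi_var \<Rightarrow>\<^sub>0 nat) \<Rightarrow> nat" where
  "mon_deg t = Poly_Mapping.lookup t X0 + Poly_Mapping.lookup t X1 + Poly_Mapping.lookup t Xm1"

lemma mon_deg_eq: "(\<Sum>x\<in>Poly_Mapping.keys t. Poly_Mapping.lookup t x) = mon_deg t"
proof -
  have U: "(UNIV :: chi_var set) = {X0, X1, Xm1}" by (auto intro: chi_var.exhaust)
  then have "finite (UNIV :: chi_var set)" by (metis finite.emptyI finite.insertI)
  then have "(\<Sum>x\<in>Poly_Mapping.keys t. Poly_Mapping.lookup t x) = (\<Sum>x\<in>UNIV. Poly_Mapping.lookup t x)"
    by (rule sum.mono_neutral_left) (auto simp: in_keys_iff)
  then show ?thesis by (simp add: U mon_deg_def)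
qed

lemma mon_le: "mon_r t \<le> 2 * mon_deg t"
  by (simp add: mon_r_def mon_deg_def)

lemma mon_add: "mon_r (s + t) = mon_r s + mon_r t" "mon_deg (s + t) = mon_deg s + mon_deg t"
  by (simp_all add: mon_r_def mon_deg_def lookup_add)

definition bimonom :: "(chi_var \<Rightarrow>\<^sub>0 nat) \<Rightarrow> 'k::field poly poly" where
  "bimonom t = monom (monom 1 (mon_r t)) (2 * mon_deg t)"

lemma bimonom_add: "bimonom (s + t) = bimonom s * bimonom t"
  by (simp add: bimonom_def mon_add mult_monom distrib_left)

definition to_veronese :: "'k::field chi_poly \<Rightarrow> 'k poly poly" where
  "to_veronese p = (\<Sum>t\<in>Poly_Mapping.keys p. smult [:Poly_Mapping.lookup p t:] (bimonom t))"

lemma to_veronese_superset: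
  assumes "finite S" "Poly_Mapping.keys p \<subseteq> S"
  shows "to_veronese p = (\<Sum>t\<in>S. smult [:Poly_Mapping.lookup p t:] (bimonom t))"
  unfolding to_veronese_def
  by (rule sum.mono_neutral_left[OF assms]) (auto simp: in_keys_iff)

lemma to_veronese_add: "to_veronese (p + q) = to_veronese p + to_veronese q"
proof -
  let ?S = "Poly_Mapping.keys p \<union> Poly_Mapping.keys q"
  have "to_veronese (p + q) = (\<Sum>t\<in>?S. smult [:Poly_Mapping.lookup (p + q) t:] (bimonom t))"
    by (rule to_veronese_superset) (simp_all add: keys_add)
  also have "\<dots> = (\<Sum>t\<in>?S. smult [:Poly_Mapping.lookup p t:] (bimonom t)) + (\<Sum>t\<in>?S. smult [:Poly_Mapping.lookup q t:] (bimonom t))"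
    unfolding sum.distrib[symmetric] by (intro sum.cong refl) (simp add: lookup_add smult_add_left[symmetric])
  also have "\<dots> = to_veronese p + to_veronese q"
    by (simp add: to_veronese_superset[of ?S p] to_veronese_superset[of ?S q])
  finally show ?thesis .
qed

lemma to_veronese_zero: "to_veronese 0 = 0"
  by (simp add: to_veronese_def)

lemma to_veronese_sum: "to_veronese (sum f S) = (\<Sum>i\<in>S. to_veronese (f i))"
  by (induction S rule: infinite_finite_induct) (simp_all add: to_veronese_zero to_veronese_add)

lemma to_veronese_single: "to_veronese (Poly_Mapping.single t c) = smult [:c:] (bimonom t)"
  by (subst to_veronese_superset[of "{t}"]) simp_all

lemma poly_sum_single:
  fixes p :: "'a \<Rightarrow>\<^sub>0 'b::comm_monoid_add"
  shows "p = (\<Sum>t\<in>Poly_Mapping.keys p. Poly_Mapping.single t (Poly_Mapping.lookup p t))"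
proof (rule poly_mapping_eqI)
  fix s
  have "(\<Sum>t\<in>Poly_Mapping.keys p. Poly_Mapping.lookup (Poly_Mapping.single t (Poly_Mapping.lookup p t)) s)
    = (\<Sum>t\<in>Poly_Mapping.keys p. if s = t then Poly_Mapping.lookup p s else 0)"
    by (intro sum.cong refl) (auto simp: lookup_single when_def)
  then show "Poly_Mapping.lookup p s = Poly_Mapping.lookup (\<Sum>t\<in>Poly_Mapping.keys p. Poly_Mapping.single t (Poly_Mapping.lookup p t)) s"
    by (simp add: lookup_sum in_keys_iff)
qed

lemma to_veronese_mult:
  fixes p q :: "'k::field chi_poly"
  shows "to_veronese (p * q) = to_veronese p * to_veronese q"
proof -
  have pq: "p * q = (\<Sum>s\<in>Poly_Mapping.keys p. \<Sum>t\<in>Poly_Mapping.keys q. Poly_Mapping.single (s + t) (Poly_Mapping.lookup p s * Poly_Mapping.lookup q t))"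
  proof -
    have "p * q = (\<Sum>s\<in>Poly_Mapping.keys p. Poly_Mapping.single s (Poly_Mapping.lookup p s)) * (\<Sum>t\<in>Poly_Mapping.keys q. Poly_Mapping.single t (Poly_Mapping.lookup q t))"
      by (simp only: poly_sum_single[symmetric])
    then show ?thesis by (simp only: sum_product mult_single)
  qed
  have "to_veronese (p * q) = (\<Sum>s\<in>Poly_Mapping.keys p. \<Sum>t\<in>Poly_Mapping.keys q. smult [:Poly_Mapping.lookup p s * Poly_Mapping.lookup q t:] (bimonom (s + t)))"
    unfolding pq by (simp only: to_veronese_sum to_veronese_single)
  also have "\<dots> = to_veronese p * to_veronese q"
    unfolding to_veronese_def sum_product by (intro sum.cong refl) (simp add: bimonom_add mult.commute)
  finally show ?thesis .
qed

lemma bimonom_closed: "bimonom t \<in> carrier veronese"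
  using mon_le[of t] by (auto simp: bimonom_def coeff_monom degree_monom_eq)

lemma to_veronese_closed: "to_veronese p \<in> carrier veronese"
  unfolding to_veronese_def by (intro veronese_intros bimonom_closed)

lemma to_veronese_smult: "to_veronese (Poly_Mapping.single 0 c * p) = smult [:c:] (to_veronese p)"
proof -
  have "bimonom 0 = (1 :: 'a poly poly)" by (simp add: bimonom_def mon_r_def mon_deg_def one_pCons monom_0)
  then show ?thesis by (simp add: to_veronese_mult to_veronese_single)
qed

lemma to_veronese_hom: "to_veronese \<in> ring_hom poly_algebra veronese"
proof (rule ring_hom_memI)
  show "to_veronese p \<in> carrier veronese" for p :: "'a chi_poly" by (rule to_veronese_closed)
  have "to_veronese (Poly_Mapping.single 0 1 * 1) = (1 :: 'a poly poly)"
    by (simp only: mult_1_right to_veronese_single) (simp add: bimonom_def mon_r_def mon_deg_def one_pCons monom_0)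
  then show "to_veronese \<one>\<^bsub>poly_algebra\<^esub> = (\<one>\<^bsub>veronese\<^esub> :: 'a poly poly)" by simp
qed (simp_all add: to_veronese_add to_veronese_mult)

text \<open>The monomial with at most one factor X0 that is sent to S^(2 n) U^r. The exponent of X1
  fills up the total degree; its subtraction is not truncated as long as r is at most 2 n.\<close>

definition normal_mono :: "nat \<Rightarrow> nat \<Rightarrow> chi_var \<Rightarrow>\<^sub>0 nat" where
  "normal_mono r n = chi_mono (r mod 2) (n - r mod 2 - r div 2) (r div 2)"

lemma normal_mono:
  assumes "r \<le> 2 * n"
  shows "mon_r (normal_mono r n) = r" "mon_deg (normal_mono r n) = n"
proof -
  have "r mod 2 + r div 2 \<le> n" using assms by presburger
  then show "mon_r (normal_mono r n) = r" "mon_deg (normal_mono r n) = n"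
    by (simp_all add: mon_r_def mon_deg_def normal_mono_def lookup_chi_mono)
qed

lemma coeff_bimonom: "coeff (coeff (bimonom t) n) r = of_bool (n = 2 * mon_deg t \<and> r = mon_r t)"
  by (auto simp: bimonom_def coeff_monom)

text \<open>The preimage of a homogeneous element is built from monomials of the matching degree.
  Surjectivity needs only its existence; the condition on monomials is for the comparison of
  gradings.\<close>

lemma veronese_preimage:
  fixes q :: "'k::field poly poly"
  assumes q: "q \<in> carrier veronese" and n: "\<And>k. k \<noteq> n \<Longrightarrow> coeff q k = 0"
  shows "\<exists>p. to_veronese p = q \<and> (\<forall>t\<in>Poly_Mapping.keys p. 2 * mon_deg t = n)"
proof (cases "even n")
  case True
  then obtain m where m: "n = 2 * m" by blast
  let ?p = "\<Sum>r\<le>n. Poly_Mapping.single (normal_mono r m) (coeff (coeff q n) r)"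
  have A: "to_veronese ?p = q"
  proof (intro poly_eqI)
    fix k s
    have "coeff (coeff (to_veronese ?p) k) s = (\<Sum>r\<le>n. coeff (coeff q n) r * of_bool (k = n \<and> s = r))"
      unfolding to_veronese_sum to_veronese_single coeff_sum
      by (intro sum.cong refl) (simp add: coeff_bimonom normal_mono m)
    also have "\<dots> = (\<Sum>r\<le>n. if r = s then (if k = n then coeff (coeff q n) s else 0) else 0)"
      by (intro sum.cong refl) auto
    also have "\<dots> = (if s \<le> n \<and> k = n then coeff (coeff q n) s else 0)" by simp
    also have "\<dots> = coeff (coeff q k) s"
    proof (cases "k = n")
      case True
      have "degree (coeff q n) \<le> n" using q unfolding veronese_simps by blast
      then have "coeff (coeff q n) s = 0" if "\<not> s \<le> n" using that by (intro coeff_eq_0) linarith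
      then show ?thesis using True by simp
    qed (simp add: n)
    finally show "coeff (coeff (to_veronese ?p) k) s = coeff (coeff q k) s" .
  qed
  have B: "2 * mon_deg t = n" if "t \<in> Poly_Mapping.keys ?p" for t
  proof -
    have "t \<in> (\<Union>r\<in>{..n}. Poly_Mapping.keys (Poly_Mapping.single (normal_mono r m) (coeff (coeff q n) r)))"
      using that keys_sum by (rule subsetD[rotated])
    then obtain r where "r \<le> n" "t = normal_mono r m" by (auto split: if_splits)
    then show ?thesis using normal_mono(2)[of r m] m by simp
  qed
  show ?thesis by (rule exI[of _ ?p], intro conjI ballI A B)
next
  case False
  have "q = 0"
  proof (rule poly_eqI)
    show "coeff q k = coeff 0 k" for k using q False n[of k] unfolding veronese_simps by (cases "k = n") auto
  qed
  then show ?thesis by (intro exI[of _ 0]) (simp add: to_veronese_zero)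
qed

lemma veronese_component:
  assumes "q \<in> carrier veronese"
  shows "monom (coeff q n) n \<in> carrier veronese"
  using assms by (auto simp: coeff_monom)

lemma to_veronese_surj: "to_veronese ` carrier poly_algebra = carrier veronese"
proof (intro equalityI image_subsetI subsetI)
  show "to_veronese p \<in> carrier veronese" for p :: "'a chi_poly" by (rule to_veronese_closed)
  fix q :: "'a poly poly" assume q: "q \<in> carrier veronese"
  have "\<exists>p. to_veronese p = monom (coeff q n) n" for n
    using veronese_preimage[OF veronese_component[OF q], of n n] by (auto simp: coeff_monom)
  then obtain p where p: "\<And>n. to_veronese (p n) = monom (coeff q n) n" by metis
  have "to_veronese (\<Sum>n\<le>degree q. p n) = q"
    by (simp only: to_veronese_sum p poly_as_sum_of_monoms)
  then show "q \<in> to_veronese ` carrier poly_algebra" by (metis poly_algebra_simps(1) rangeI)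
qed

section \<open>The defining ideal as the kernel of the substitution\<close>

lemma chi_ideal: "ideal chi_ideal (poly_algebra :: ('k::field, 'k chi_poly) module)"
  unfolding chi_ideal_def by (rule ring.genideal_ideal[OF cring.axioms(1)[OF poly_algebra_cring]]) simp

lemma chi_ideal_intros:
  fixes p q :: "'k::field chi_poly"
  shows "Var X0 ^ 2 - Var X1 * Var Xm1 \<in> (chi_ideal :: 'k chi_poly set)"
    and "0 \<in> (chi_ideal :: 'k chi_poly set)"
    and "p \<in> chi_ideal \<Longrightarrow> q \<in> chi_ideal \<Longrightarrow> p + q \<in> chi_ideal"
    and "p \<in> chi_ideal \<Longrightarrow> q * p \<in> chi_ideal"
proof -
  interpret ideal "chi_ideal :: 'k chi_poly set" poly_algebra by (rule chi_ideal)
  show "Var X0 ^ 2 - Var X1 * Var Xm1 \<in> (chi_ideal :: 'k chi_poly set)"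
    unfolding chi_ideal_def using genideal_self[of "{Var X0 ^ 2 - Var X1 * Var Xm1 :: 'k chi_poly}"] by simp
  show "0 \<in> (chi_ideal :: 'k chi_poly set)"
    using additive_subgroup.zero_closed[OF is_additive_subgroup] by simp
  show "p \<in> chi_ideal \<Longrightarrow> q \<in> chi_ideal \<Longrightarrow> p + q \<in> chi_ideal" using additive_subgroup.a_closed[OF is_additive_subgroup, of p q] by simp
  show "p \<in> chi_ideal \<Longrightarrow> q * p \<in> chi_ideal" using I_l_closed[of p q] by simp
qed

lemma chi_ideal_sum: "(\<And>i. i \<in> S \<Longrightarrow> f i \<in> chi_ideal) \<Longrightarrow> sum f S \<in> chi_ideal"
  by (induction S rule: infinite_finite_induct) (simp_all add: chi_ideal_intros)

lemma chi_generator: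
  "Var X0 ^ 2 - Var X1 * Var Xm1 = (Poly_Mapping.single (chi_mono 2 0 0) 1 - Poly_Mapping.single (chi_mono 0 1 1) 1 :: 'k::field chi_poly)"
  by (simp add: Var_def power2_eq_square mult_single chi_mono_def single_add[symmetric])

text \<open>Replacing X0^2 by X1 Xm1 lowers the exponent of X0 by two and keeps both a + 2 c and a +
  b + c, so repeated replacement ends at the normal monomial for these two numbers.\<close>

lemma normal_mono_cong:
  "Poly_Mapping.single (chi_mono a b c) 1 - Poly_Mapping.single (normal_mono (a + 2 * c) (a + b + c)) 1 \<in> (chi_ideal :: 'k::field chi_poly set)"
proof (induction a arbitrary: b c rule: less_induct)
  case (less a)
  show ?case
  proof (cases "a < 2")
    case True
    have "(a + 2 * c) mod 2 = a" "(a + 2 * c) div 2 = c" using True by auto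
    then have "normal_mono (a + 2 * c) (a + b + c) = chi_mono a b c" by (simp add: normal_mono_def)
    then show ?thesis by (simp add: chi_ideal_intros(2))
  next
    case False
    then have a: "a = (a - 2) + 2" by simp
    then obtain a' where a: "a = a' + 2" by (rule that)
    let ?s = "\<lambda>t. Poly_Mapping.single t 1 :: 'k chi_poly"
    have e: "a' + 2 * Suc c = a + 2 * c" "a' + Suc b + Suc c = a + b + c" by (simp_all add: a)
    have IH: "?s (chi_mono a' (Suc b) (Suc c)) - ?s (normal_mono (a + 2 * c) (a + b + c)) \<in> chi_ideal"
    proof -
      have "a' < a" by (simp add: a)
      from less.IH[OF this, of "Suc b" "Suc c"] show ?thesis unfolding e .
    qed
    have "?s (chi_mono a' b c) * (Var X0 ^ 2 - Var X1 * Var Xm1) \<in> chi_ideal"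
      by (rule chi_ideal_intros(4)[OF chi_ideal_intros(1)])
    also have "?s (chi_mono a' b c) * (Var X0 ^ 2 - Var X1 * Var Xm1) = ?s (chi_mono a b c) - ?s (chi_mono a' (Suc b) (Suc c))"
      unfolding chi_generator by (simp add: right_diff_distrib mult_single mono_add a Suc_eq_plus1)
    finally have "(?s (chi_mono a b c) - ?s (chi_mono a' (Suc b) (Suc c)))
      + (?s (chi_mono a' (Suc b) (Suc c)) - ?s (normal_mono (a + 2 * c) (a + b + c))) \<in> chi_ideal"
      using IH by (rule chi_ideal_intros(3))
    then show ?thesis by simp
  qed
qed

text \<open>For the harder inclusion, replace every monomial of p by its normal one, giving q
  congruent to p modulo the ideal. Distinct normal monomials have distinct images, so every
  coefficient of q is zero or a coefficient of the image of p; if that image is zero, so is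
  q.\<close>

lemma chi_ideal_kernel: "(chi_ideal :: 'k::field chi_poly set) = {p \<in> carrier poly_algebra. to_veronese p = \<zero>\<^bsub>veronese\<^esub>}"
proof (intro equalityI)
  have hr: "ring_hom_ring poly_algebra veronese (to_veronese :: 'k chi_poly \<Rightarrow> _)"
    by (rule ring_hom_ringI2[OF cring.axioms(1)[OF poly_algebra_cring] cring.axioms(1)[OF veronese_cring] to_veronese_hom])
  have id: "ideal {p \<in> carrier poly_algebra. to_veronese p = \<zero>\<^bsub>veronese\<^esub>} (poly_algebra :: ('k, 'k chi_poly) module)"
    using ring_hom_ring.kernel_is_ideal[OF hr] by (simp only: a_kernel_def')
  show "(chi_ideal :: 'k chi_poly set) \<subseteq> {p \<in> carrier poly_algebra. to_veronese p = \<zero>\<^bsub>veronese\<^esub>}"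
    unfolding chi_ideal_def
  proof (rule ring.genideal_minimal[OF cring.axioms(1)[OF poly_algebra_cring] id])
    have m: "chi_mono 2 0 0 + chi_mono 0 0 0 = chi_mono 2 0 0" by (simp add: mono_add)
    have "to_veronese (Var X0 ^ 2) = to_veronese (Var X1 * Var Xm1 :: 'k chi_poly)"
      by (simp add: Var_def power2_eq_square mult_single to_veronese_single bimonom_def mon_r_def mon_deg_def lookup_add lookup_single numeral_2_eq_2)
    moreover have "to_veronese (Var X0 ^ 2 - Var X1 * Var Xm1 :: 'k chi_poly) + to_veronese (Var X1 * Var Xm1) = to_veronese (Var X0 ^ 2)"
      unfolding to_veronese_add[symmetric] by simp
    ultimately show "{Var X0 ^ 2 - Var X1 * Var Xm1 :: 'k chi_poly} \<subseteq> {p \<in> carrier poly_algebra. to_veronese p = \<zero>\<^bsub>veronese\<^esub>}"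
      by simp
  qed
  show "{p \<in> carrier poly_algebra. to_veronese p = \<zero>\<^bsub>veronese\<^esub>} \<subseteq> (chi_ideal :: 'k chi_poly set)"
  proof
    fix p :: "'k chi_poly" assume "p \<in> {p \<in> carrier poly_algebra. to_veronese p = \<zero>\<^bsub>veronese\<^esub>}"
    then have p: "to_veronese p = 0" by simp
    let ?K = "Poly_Mapping.keys p" and ?c = "Poly_Mapping.lookup p"
    let ?n = "\<lambda>t. normal_mono (mon_r t) (mon_deg t)"
    let ?q = "\<Sum>t\<in>?K. Poly_Mapping.single (?n t) (?c t)"
    have "?q = 0"
    proof (rule poly_mapping_eqI)
      fix s
      \<comment> \<open>Normal form s is reached from t exactly if s is itself normal and has the
        same two degrees; the factors 2 match the exponents in \<open>coeff_bimonom\<close>.\<close>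
      have inj: "?n t = s \<longleftrightarrow> 2 * mon_deg s = 2 * mon_deg t \<and> mon_r s = mon_r t \<and> ?n s = s" for t
      proof
        assume a: "?n t = s"
        have "mon_r s = mon_r t" "mon_deg s = mon_deg t"
          using normal_mono[OF mon_le[of t]] unfolding a by simp_all
        then show "2 * mon_deg s = 2 * mon_deg t \<and> mon_r s = mon_r t \<and> ?n s = s" using a by simp
      next
        assume b: "2 * mon_deg s = 2 * mon_deg t \<and> mon_r s = mon_r t \<and> ?n s = s"
        then have "mon_deg s = mon_deg t" "mon_r s = mon_r t" by simp_all
        then have "?n t = ?n s" by (simp only:)
        from this conjunct2[OF conjunct2[OF b]] show "?n t = s" by (rule trans)
      qed
      have "Poly_Mapping.lookup ?q s = (\<Sum>t\<in>?K. ?c t * of_bool (?n t = s))"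
        unfolding lookup_sum by (intro sum.cong refl) (auto simp: lookup_single when_def)
      also have "\<dots> = of_bool (?n s = s) * (\<Sum>t\<in>?K. ?c t * of_bool (2 * mon_deg s = 2 * mon_deg t \<and> mon_r s = mon_r t))"
        unfolding sum_distrib_left by (intro sum.cong refl, subst inj, cases "?n s = s") simp_all
      also have "(\<Sum>t\<in>?K. ?c t * of_bool (2 * mon_deg s = 2 * mon_deg t \<and> mon_r s = mon_r t))
        = coeff (coeff (to_veronese p) (2 * mon_deg s)) (mon_r s)"
        unfolding to_veronese_def coeff_sum by (intro sum.cong refl) (simp add: coeff_bimonom)
      finally show "Poly_Mapping.lookup ?q s = Poly_Mapping.lookup 0 s" by (simp add: p)
    qed
    moreover have "p - ?q \<in> chi_ideal"
    proof -
      have "p - ?q = (\<Sum>t\<in>?K. Poly_Mapping.single t (?c t)) - ?q" by (simp only: poly_sum_single[symmetric])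
      also have "\<dots> = (\<Sum>t\<in>?K. Poly_Mapping.single 0 (?c t) * (Poly_Mapping.single t 1 - Poly_Mapping.single (?n t) 1))"
        unfolding sum_subtractf[symmetric] by (intro sum.cong refl) (simp add: right_diff_distrib mult_single)
      also have "\<dots> \<in> chi_ideal"
      proof (intro chi_ideal_sum chi_ideal_intros(4))
        fix t
        show "Poly_Mapping.single t 1 - Poly_Mapping.single (?n t) 1 \<in> (chi_ideal :: 'k chi_poly set)"
          using normal_mono_cong[of "Poly_Mapping.lookup t X0" "Poly_Mapping.lookup t X1" "Poly_Mapping.lookup t Xm1", where 'k='k]
          unfolding mono_lookup mon_r_def mon_deg_def .
      qed
      finally show ?thesis .
    qed
    ultimately show "p \<in> chi_ideal" by simp
  qed
qed

lemma chi_iso: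
  "ring (chi_algebra :: ('k::field, 'k chi_poly set) module)"
  "\<exists>\<Phi>\<in>algebra_iso (chi_algebra :: ('k, 'k chi_poly set) module) veronese.
     \<forall>p. \<Phi> (chi_ideal +>\<^bsub>poly_algebra\<^esub> p) = to_veronese p"
  "carrier (chi_algebra :: ('k, 'k chi_poly set) module) = (\<lambda>p. chi_ideal +>\<^bsub>poly_algebra\<^esub> p) ` UNIV"
proof -
  have A: "ring (poly_algebra :: ('k, 'k chi_poly) module)" and V: "ring (veronese :: ('k, 'k poly poly) module)"
    by (rule cring.axioms(1)[OF poly_algebra_cring], rule cring.axioms(1)[OF veronese_cring])
  have s1: "c \<odot>\<^bsub>poly_algebra\<^esub> p \<in> carrier poly_algebra" for c :: 'k and p by simp
  have s2: "c \<odot>\<^bsub>poly_algebra\<^esub> (p \<oplus>\<^bsub>poly_algebra\<^esub> q) = c \<odot>\<^bsub>poly_algebra\<^esub> p \<oplus>\<^bsub>poly_algebra\<^esub> c \<odot>\<^bsub>poly_algebra\<^esub> q"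
    for c :: 'k and p q by (simp add: distrib_left)
  have s3: "to_veronese (c \<odot>\<^bsub>poly_algebra\<^esub> p) = c \<odot>\<^bsub>veronese\<^esub> to_veronese p" for c :: 'k and p
    by (simp add: to_veronese_smult)
  have s4: "c \<odot>\<^bsub>veronese\<^esub> \<zero>\<^bsub>veronese\<^esub> = \<zero>\<^bsub>veronese\<^esub>" for c :: 'k by simp
  note q = quotient_iso[OF A V to_veronese_hom to_veronese_surj s1 s2 s3 s4 chi_ideal_kernel, folded chi_algebra_def]
  show "ring (chi_algebra :: ('k, 'k chi_poly set) module)" by (rule q(1))
  show "\<exists>\<Phi>\<in>algebra_iso (chi_algebra :: ('k, 'k chi_poly set) module) veronese.
     \<forall>p. \<Phi> (chi_ideal +>\<^bsub>poly_algebra\<^esub> p) = to_veronese p"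
    using q(2) by simp
  show "carrier (chi_algebra :: ('k, 'k chi_poly set) module) = (\<lambda>p. chi_ideal +>\<^bsub>poly_algebra\<^esub> p) ` UNIV"
    using q(4) by simp
qed

text \<open>For the finite generation argument: it reduces a subalgebra containing the images of the
  variables to closure properties of a set of polynomials.\<close>

lemma poly_generated:
  fixes V :: "'k::field chi_poly set"
  assumes one: "1 \<in> V" and add: "\<And>p q. p \<in> V \<Longrightarrow> q \<in> V \<Longrightarrow> p + q \<in> V" and mult: "\<And>p q. p \<in> V \<Longrightarrow> q \<in> V \<Longrightarrow> p * q \<in> V"
    and smult: "\<And>c p. p \<in> V \<Longrightarrow> Poly_Mapping.single 0 c * p \<in> V" and Var: "\<And>x. Var x \<in> V"
  shows "p \<in> V"
proof -
  have pow: "Poly_Mapping.single (Poly_Mapping.single x a) 1 \<in> V" for x a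
  proof (induction a)
    case (Suc a)
    have "Poly_Mapping.single (Poly_Mapping.single x (Suc a)) 1 = Var x * (Poly_Mapping.single (Poly_Mapping.single x a) 1 :: 'k chi_poly)"
      by (simp add: Var_def mult_single single_add[symmetric] Suc_eq_plus1_left)
    then show ?case using mult[OF Var Suc] by simp
  qed (use one in simp)
  have "Poly_Mapping.single (chi_mono a b c) 1 \<in> V" for a b c
  proof -
    have "Poly_Mapping.single (chi_mono a b c) 1 = Poly_Mapping.single (Poly_Mapping.single X0 a) 1
      * Poly_Mapping.single (Poly_Mapping.single X1 b) 1 * (Poly_Mapping.single (Poly_Mapping.single Xm1 c) 1 :: 'k chi_poly)"
      by (simp add: chi_mono_def mult_single)
    then show ?thesis using mult[OF mult[OF pow pow] pow] by simp
  qed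
  then have "Poly_Mapping.single t 1 \<in> V" for t by (metis mono_lookup)
  then have s: "Poly_Mapping.single t c \<in> V" for t c
    using smult[of "Poly_Mapping.single t 1" c] by (simp add: mult_single)
  have "(\<Sum>t\<in>S. Poly_Mapping.single t (f t)) \<in> V" for S f
    using smult[OF one, of 0] by (induction S rule: infinite_finite_induct) (simp_all add: add s)
  then show ?thesis by (subst poly_sum_single)
qed

section \<open>Hochschild cohomology modulo nilpotents\<close>

abbreviation Coh :: "nat \<Rightarrow> ('k::field, ('k res \<Rightarrow> 'k lam) set) module" where
  "Coh \<equiv> cohomology (Lam 2 1) (Res 2 1) d_res"

lemma HH_simps:
  "carrier (HH 2 1 :: ('k::field, 'k hh) module) = E.H.sum_carrier"
  "monoid.mult (HH 2 1 :: ('k, 'k hh) module) = E.H.conv"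
  "\<one>\<^bsub>(HH 2 1 :: ('k, 'k hh) module)\<^esub> = E.H.unit"
  "\<zero>\<^bsub>(HH 2 1 :: ('k, 'k hh) module)\<^esub> = (\<lambda>n. \<zero>\<^bsub>Coh n\<^esub>)"
  "add (HH 2 1 :: ('k, 'k hh) module) = (\<lambda>z w n. z n \<oplus>\<^bsub>Coh n\<^esub> w n)"
  "module.smult (HH 2 1 :: ('k, 'k hh) module) = (\<lambda>c z n. c \<odot>\<^bsub>Coh n\<^esub> z n)"
proof -
  show "carrier (HH 2 1 :: ('k::field, 'k hh) module) = E.H.sum_carrier" unfolding HH_def by (rule E.Ext_algebra_simps)
  show "monoid.mult (HH 2 1 :: ('k, 'k hh) module) = E.H.conv" unfolding HH_def by (rule E.Ext_algebra_simps)
  show "\<one>\<^bsub>(HH 2 1 :: ('k, 'k hh) module)\<^esub> = E.H.unit" unfolding HH_def by (rule E.Ext_algebra_simps)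
  show "\<zero>\<^bsub>(HH 2 1 :: ('k, 'k hh) module)\<^esub> = (\<lambda>n. \<zero>\<^bsub>Coh n\<^esub>)" unfolding HH_def by (rule E.Ext_algebra_simps)
  show "add (HH 2 1 :: ('k, 'k hh) module) = (\<lambda>z w n. z n \<oplus>\<^bsub>Coh n\<^esub> w n)" unfolding HH_def by (rule E.Ext_algebra_simps)
  show "module.smult (HH 2 1 :: ('k, 'k hh) module) = (\<lambda>c z n. c \<odot>\<^bsub>Coh n\<^esub> z n)"
    by (simp add: HH_def Ext_algebra_def Let_def)
qed

lemma HH_ring: "ring (HH 2 1 :: ('k::field, 'k hh) module)"
  unfolding HH_def by (rule E.Ext_algebra_ring)

lemma Coh_cases:
  fixes F :: "('k::field res \<Rightarrow> 'k lam) set"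
  assumes "F \<in> carrier (Coh n)"
  obtains f where "f \<in> E.Z n" "F = E.cls n f"
  using assms unfolding E.H_simps by blast

lemma Coh_clsI: "f \<in> E.Z n \<Longrightarrow> E.cls n f \<in> carrier (Coh n)"
  unfolding E.H_simps by (rule imageI)

lemma cls_poly_degree:
  fixes F :: "('k::field res \<Rightarrow> 'k lam) set"
  assumes "F \<in> carrier (Coh n)"
  shows "degree (cls_poly n F) \<le> n" "odd n \<Longrightarrow> cls_poly n F = 0"
proof -
  obtain f where f: "f \<in> E.Z n" "F = E.cls n f" using assms by (rule Coh_cases)
  show "degree (cls_poly n F) \<le> n"
    unfolding f(2) cls_poly[OF f(1)] by (rule degree_le) (simp add: coeff_val_poly)
  show "cls_poly n F = 0" if "odd n"
    unfolding f(2) cls_poly[OF f(1)] by (rule poly_eqI) (simp add: coeff_val_poly odd_val[OF E.Z_hom[OF f(1)] _ that])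
qed

lemma Coh_smult:
  fixes F :: "('k::field res \<Rightarrow> 'k lam) set"
  assumes "F \<in> carrier (Coh n)"
  shows "c \<odot>\<^bsub>Coh n\<^esub> F \<in> carrier (Coh n)" "cls_poly n (c \<odot>\<^bsub>Coh n\<^esub> F) = smult c (cls_poly n F)"
proof -
  obtain f where f: "f \<in> E.Z n" "F = E.cls n f" using assms by (rule Coh_cases)
  have e: "c \<odot>\<^bsub>Coh n\<^esub> F = E.cls n (c \<odot>\<^bsub>E.C n\<^esub> f)" unfolding f(2) by (rule E.cls_smult[OF f(1)])
  note z = E.Z_smult[OF f(1), of c]
  show "c \<odot>\<^bsub>Coh n\<^esub> F \<in> carrier (Coh n)" unfolding e by (rule Coh_clsI[OF z])
  have "gen_val n (c \<odot>\<^bsub>E.C n\<^esub> f) r False False False = c * gen_val n f r False False False" if r: "r \<le> n" for r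
    unfolding gen_val_def E.homA_smult(2)[OF E.Z_hom[OF f(1)] gen_closed[OF r]]
    by (rule lam_coord_smult[OF E.homA_closed[OF E.Z_hom[OF f(1)] gen_closed[OF r]]])
  then show "cls_poly n (c \<odot>\<^bsub>Coh n\<^esub> F) = smult c (cls_poly n F)"
    unfolding e unfolding f(2) cls_poly[OF z] cls_poly[OF f(1)] by (intro poly_eqI) (simp add: coeff_val_poly)
qed

lemma Coh_smult_add:
  fixes F F' :: "('k::field res \<Rightarrow> 'k lam) set"
  assumes "F \<in> carrier (Coh n)" "F' \<in> carrier (Coh n)"
  shows "c \<odot>\<^bsub>Coh n\<^esub> (F \<oplus>\<^bsub>Coh n\<^esub> F') = c \<odot>\<^bsub>Coh n\<^esub> F \<oplus>\<^bsub>Coh n\<^esub> c \<odot>\<^bsub>Coh n\<^esub> F'"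
proof -
  obtain f where f: "f \<in> E.Z n" "F = E.cls n f" using assms(1) by (rule Coh_cases)
  obtain g where g: "g \<in> E.Z n" "F' = E.cls n g" using assms(2) by (rule Coh_cases)
  note fh = E.Z_hom[OF f(1)] and gh = E.Z_hom[OF g(1)]
  note fg = E.Z_add[OF f(1) g(1)]
  have "c \<odot>\<^bsub>E.C n\<^esub> (f \<oplus>\<^bsub>E.C n\<^esub> g) = c \<odot>\<^bsub>E.C n\<^esub> f \<oplus>\<^bsub>E.C n\<^esub> c \<odot>\<^bsub>E.C n\<^esub> g"
  proof (rule bimodule_hom_eqI[OF E.homA_smult(1)[OF E.Z_hom[OF fg]]
        E.Z_hom[OF E.Z_add[OF E.Z_smult[OF f(1)] E.Z_smult[OF g(1)]]]])
    fix x :: "'k res" assume x: "x \<in> carrier (RP n)"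
    have "(c \<odot>\<^bsub>E.C n\<^esub> (f \<oplus>\<^bsub>E.C n\<^esub> g)) x = c \<odot>\<^bsub>LA\<^esub> (f x \<oplus>\<^bsub>LA\<^esub> g x)"
      unfolding E.homA_smult(2)[OF E.Z_hom[OF fg] x] using x by simp
    also have "\<dots> = c \<odot>\<^bsub>LA\<^esub> f x \<oplus>\<^bsub>LA\<^esub> c \<odot>\<^bsub>LA\<^esub> g x"
      by (rule LA.smult_r_distr[OF E.homA_closed[OF fh x] E.homA_closed[OF gh x]])
    also have "\<dots> = (c \<odot>\<^bsub>E.C n\<^esub> f) x \<oplus>\<^bsub>LA\<^esub> (c \<odot>\<^bsub>E.C n\<^esub> g) x"
      by (simp only: E.homA_smult(2)[OF fh x] E.homA_smult(2)[OF gh x])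
    also have "\<dots> = (c \<odot>\<^bsub>E.C n\<^esub> f \<oplus>\<^bsub>E.C n\<^esub> c \<odot>\<^bsub>E.C n\<^esub> g) x" using x by simp
    finally show "(c \<odot>\<^bsub>E.C n\<^esub> (f \<oplus>\<^bsub>E.C n\<^esub> g)) x = (c \<odot>\<^bsub>E.C n\<^esub> f \<oplus>\<^bsub>E.C n\<^esub> c \<odot>\<^bsub>E.C n\<^esub> g) x" .
  qed
  then show ?thesis
    unfolding f(2) g(2) E.cls_smult[OF f(1)] E.cls_smult[OF g(1)] E.H_simps(3)
      E.cls_add[OF fh gh] E.cls_smult[OF fg] E.cls_add[OF E.homA_smult(1)[OF fh] E.homA_smult(1)[OF gh]]
    by (rule arg_cong)
qed

lemma Coh_smult_zero: "c \<odot>\<^bsub>Coh n\<^esub> \<zero>\<^bsub>Coh n\<^esub> = (\<zero>\<^bsub>Coh n\<^esub> :: ('k::field res \<Rightarrow> 'k lam) set)"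
proof -
  have "c \<odot>\<^bsub>E.C n\<^esub> \<zero>\<^bsub>E.C n\<^esub> = (\<zero>\<^bsub>E.C n\<^esub> :: 'k res \<Rightarrow> 'k lam)"
    by (simp add: cochains_def fun_eq_iff)
  then show ?thesis
    unfolding E.H_simps(2) E.cls_zero[symmetric] E.cls_smult[OF E.B_sub_Z[OF E.B_zero]] by (rule arg_cong)
qed

lemma HH_smult_closed:
  fixes z :: "'k::field hh"
  assumes z: "z \<in> carrier (HH 2 1)"
  shows "c \<odot>\<^bsub>HH 2 1\<^esub> z \<in> carrier (HH 2 1)"
proof -
  have z': "z n \<in> carrier (Coh n)" for n using z unfolding HH_simps by (rule E.H.sum_carrierD)
  have fin: "finite {n. z n \<noteq> \<zero>\<^bsub>Coh n\<^esub>}" using z unfolding HH_simps E.H.sum_carrier_def by (elim CollectE conjE)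
  have "finite {n. c \<odot>\<^bsub>Coh n\<^esub> z n \<noteq> \<zero>\<^bsub>Coh n\<^esub>}"
  proof (rule finite_subset[OF subsetI fin], intro CollectI notI, elim CollectE notE)
    show "c \<odot>\<^bsub>Coh n\<^esub> z n = \<zero>\<^bsub>Coh n\<^esub>" if "z n = \<zero>\<^bsub>Coh n\<^esub>" for n
      unfolding that by (rule Coh_smult_zero)
  qed
  then show ?thesis unfolding HH_simps E.H.sum_carrier_def using Coh_smult(1)[OF z'] by (intro CollectI conjI allI)
qed

section \<open>The homomorphism onto the Veronese ring and its kernel\<close>

definition HH_poly :: "'k::field hh \<Rightarrow> 'k poly poly" where
  "HH_poly = G.to_poly"

lemma coeff_HH_poly: "z \<in> carrier (HH 2 1) \<Longrightarrow> coeff (HH_poly z) n = cls_poly n (z n)"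
  unfolding HH_poly_def HH_simps by (rule G.coeff_to_poly)

lemma HH_poly_hom: "HH_poly \<in> ring_hom (HH 2 1 :: ('k::field, 'k hh) module) veronese"
proof (rule ring_hom_memI)
  fix z w :: "'k hh" assume z: "z \<in> carrier (HH 2 1)"
  have c: "z n \<in> carrier (Coh n)" for n using z unfolding HH_simps by (rule E.H.sum_carrierD)
  show "HH_poly z \<in> carrier veronese"
    unfolding veronese_simps coeff_HH_poly[OF z] using cls_poly_degree[OF c] by (intro allI conjI impI)
  assume w: "w \<in> carrier (HH 2 1)"
  show "HH_poly (z \<otimes>\<^bsub>HH 2 1\<^esub> w) = HH_poly z \<otimes>\<^bsub>veronese\<^esub> HH_poly w"
    using z w unfolding HH_poly_def HH_simps veronese_simps by (rule G.to_poly_conv)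
  show "HH_poly (z \<oplus>\<^bsub>HH 2 1\<^esub> w) = HH_poly z \<oplus>\<^bsub>veronese\<^esub> HH_poly w"
    using z w unfolding HH_poly_def HH_simps veronese_simps by (rule G.to_poly_add)
next
  show "HH_poly \<one>\<^bsub>(HH 2 1 :: ('k, 'k hh) module)\<^esub> = \<one>\<^bsub>veronese\<^esub>"
    unfolding HH_poly_def HH_simps veronese_simps by (rule G.to_poly_unit)
qed

lemma HH_poly_smult:
  fixes z :: "'k::field hh"
  assumes z: "z \<in> carrier (HH 2 1)"
  shows "HH_poly (c \<odot>\<^bsub>HH 2 1\<^esub> z) = c \<odot>\<^bsub>veronese\<^esub> HH_poly z"
proof (rule poly_eqI)
  have z': "z n \<in> carrier (Coh n)" for n using z unfolding HH_simps by (rule E.H.sum_carrierD)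
  show "coeff (HH_poly (c \<odot>\<^bsub>HH 2 1\<^esub> z)) n = coeff (c \<odot>\<^bsub>veronese\<^esub> HH_poly z) n" for n
    unfolding coeff_HH_poly[OF HH_smult_closed[OF z]] veronese_simps coeff_smult coeff_HH_poly[OF z]
    unfolding HH_simps Coh_smult(2)[OF z'] by simp
qed

text \<open>A zero coefficient is lifted to the zero class rather than to an arbitrary class with
  polynomial zero. This makes the support finite, and it makes the preimage of a homogeneous element
  homogeneous.\<close>

lemma HH_poly_preimage:
  fixes p :: "'k::field poly poly"
  assumes p: "p \<in> carrier veronese"
  shows "\<exists>z\<in>carrier (HH 2 1). HH_poly z = p \<and> (\<forall>n. coeff p n = 0 \<longrightarrow> z n = \<zero>\<^bsub>Coh n\<^esub>)"
proof -
  have "\<exists>F. F \<in> carrier (Coh n) \<and> cls_poly n F = coeff p n \<and> (coeff p n = 0 \<longrightarrow> F = \<zero>\<^bsub>Coh n\<^esub>)" for n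
  proof (cases "coeff p n = 0")
    case True
    then show ?thesis using G.\<phi>_zero[of n] E.H.H.zero_closed[of n] by (intro exI[of _ "\<zero>\<^bsub>Coh n\<^esub>"]) simp
  next
    case False
    then have n: "even n" "degree (coeff p n) \<le> n" using spec[OF p[unfolded veronese_simps], of n] False by blast+
    obtain f where f1: "f \<in> E.Z n"
      and f2: "\<forall>i. \<forall>r\<le>n. f (gen n i r) = ((if i then (-1) ^ r else 1) * coeff (coeff p n) r) \<odot>\<^bsub>LA\<^esub> eL (vert i)"
      using cocycle_exists[OF n(1), of "coeff (coeff p n)"] by (rule bexE)
    note f = f1 f2[rule_format]
    have "val_poly n f = coeff p n"
    proof (rule poly_eqI)
      fix r
      have "coeff (coeff p n) r = 0" if "\<not> r \<le> n" using n(2) that by (intro coeff_eq_0) linarith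
      then show "coeff (val_poly n f) r = coeff (coeff p n) r"
        by (simp add: coeff_val_poly gen_val_def f(2) lam_coord_smult lam_gens_closed lam_coord_gens)
    qed
    then show ?thesis using False Coh_clsI[OF f(1)] cls_poly[OF f(1)] by (intro exI[of _ "E.cls n f"]) simp
  qed
  then have "\<exists>z. \<forall>n. z n \<in> carrier (Coh n) \<and> cls_poly n (z n) = coeff p n \<and> (coeff p n = 0 \<longrightarrow> z n = \<zero>\<^bsub>Coh n\<^esub>)"
    by (intro choice allI)
  then obtain z where zz: "\<forall>n. z n \<in> carrier (Coh n) \<and> cls_poly n (z n) = coeff p n \<and> (coeff p n = 0 \<longrightarrow> z n = \<zero>\<^bsub>Coh n\<^esub>)"
    by (rule exE)
  note z = conjunct1[OF spec[OF zz]] conjunct1[OF conjunct2[OF spec[OF zz]]] mp[OF conjunct2[OF conjunct2[OF spec[OF zz]]]]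
  have c: "z \<in> carrier (HH 2 1)"
    unfolding HH_simps by (rule E.H.sum_carrierI[OF z(1), of "degree p"]) (rule z(3)[OF coeff_eq_0])
  have "HH_poly z = p" by (rule poly_eqI) (simp only: coeff_HH_poly[OF c] z(2))
  then show ?thesis using z(3) by (intro bexI[OF _ c] conjI allI impI)
qed

lemma HH_poly_surj: "HH_poly ` carrier (HH 2 1 :: ('k::field, 'k hh) module) = carrier veronese"
proof (intro equalityI image_subsetI subsetI)
  show "HH_poly z \<in> carrier veronese" if "z \<in> carrier (HH 2 1)" for z :: "'k hh"
    by (rule ring_hom_closed[OF HH_poly_hom that])
  show "p \<in> HH_poly ` carrier (HH 2 1 :: ('k, 'k hh) module)" if p: "p \<in> carrier veronese" for p
  proof -
    from HH_poly_preimage[OF p] obtain z where z: "z \<in> carrier (HH 2 1)"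
      and e: "HH_poly z = p \<and> (\<forall>n. coeff p n = 0 \<longrightarrow> z n = \<zero>\<^bsub>Coh n\<^esub>)" by (rule bexE)
    show ?thesis using e z by (intro image_eqI[of p HH_poly z]) simp_all
  qed
qed

lemma single_cube:
  fixes F :: "('k::field res \<Rightarrow> 'k lam) set"
  assumes F: "F \<in> carrier (Coh n)" and F0: "cls_poly n F = 0"
  shows "E.H.single n F [^]\<^bsub>HH 2 1\<^esub> (3::nat) = \<zero>\<^bsub>HH 2 1\<^esub>"
proof -
  interpret HH: ring "HH 2 1 :: ('k, 'k hh) module" by (rule HH_ring)
  let ?y = "yoneda (Lam 2 1) (Res 2 1) (res_aug 2 1) d_res"
  obtain f where f: "f \<in> E.Z n" "F = E.cls n f" using F by (rule Coh_cases)
  have c: "E.H.single n F \<in> carrier (HH 2 1)" unfolding HH_simps by (rule E.H.single_closed[OF F])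
  have "coeff (val_poly n f) r = 0" for r using F0 unfolding f(2) cls_poly[OF f(1)] by simp
  then have v: "gen_val n f r False False False = 0" if "r \<le> n" for r using that unfolding coeff_val_poly by metis
  have "E.H.single n F [^]\<^bsub>HH 2 1\<^esub> (3::nat) = E.H.single n F \<otimes>\<^bsub>HH 2 1\<^esub> E.H.single n F \<otimes>\<^bsub>HH 2 1\<^esub> E.H.single n F"
    using c by (simp add: numeral_3_eq_3)
  also have "\<dots> = E.H.single (n + n + n) (?y (n + n) n (?y n n F F) F)"
    unfolding HH_simps E.H.conv_single[OF F F] by (rule E.H.conv_single[OF E.H.\<mu>_closed[OF F F] F])
  also have "?y (n + n) n (?y n n F F) F = \<zero>\<^bsub>Coh (n + n + n)\<^esub>"
    unfolding f(2) by (rule cube_zero[OF f(1) v])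
  finally show ?thesis unfolding HH_simps by (simp add: E.H.single_def fun_eq_iff)
qed

text \<open>Nilpotents die in the Veronese ring, a subring of an integral domain, and the kernel is
  an ideal, so it contains the ideal they generate. Conversely, an element of the kernel is the
  finite sum of its components, each of which is in the kernel and has cube zero by
  \<open>single_cube\<close>.\<close>

lemma HH_nil_kernel: "(HH_nil 2 1 :: 'k::field hh set) = {z \<in> carrier (HH 2 1). HH_poly z = \<zero>\<^bsub>veronese\<^esub>}"
proof (intro equalityI)
  interpret HH: ring "HH 2 1 :: ('k, 'k hh) module" by (rule HH_ring)
  let ?S = "{z. (\<exists>n. z \<in> HH_homogeneous 2 1 n) \<and> (\<exists>k::nat. z [^]\<^bsub>HH 2 1\<^esub> k = \<zero>\<^bsub>HH 2 1\<^esub>)} :: 'k hh set"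
  have S: "?S \<subseteq> carrier (HH 2 1)" by (auto simp: HH_homogeneous_def)
  have hr: "ring_hom_ring (HH 2 1) veronese (HH_poly :: 'k hh \<Rightarrow> _)"
    by (rule ring_hom_ringI2[OF HH_ring cring.axioms(1)[OF veronese_cring] HH_poly_hom])
  have id: "ideal {z \<in> carrier (HH 2 1). HH_poly z = \<zero>\<^bsub>veronese\<^esub>} (HH 2 1 :: ('k, 'k hh) module)"
    using ring_hom_ring.kernel_is_ideal[OF hr] by (simp only: a_kernel_def')
  have pow: "HH_poly (z [^]\<^bsub>HH 2 1\<^esub> k) = HH_poly z ^ k" if z: "z \<in> carrier (HH 2 1)" for z :: "'k hh" and k :: nat
  proof (induction k)
    case 0
    show ?case using ring_hom_one[OF HH_poly_hom] by simp
  next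
    case (Suc k)
    then show ?case using ring_hom_mult[OF HH_poly_hom HH.nat_pow_closed[OF z] z] by (simp add: mult.commute)
  qed
  have zero: "HH_poly \<zero>\<^bsub>HH 2 1\<^esub> = (0 :: 'k poly poly)"
    using additive_subgroup.zero_closed[OF ideal.axioms(1)[OF id]] by simp
  show "(HH_nil 2 1 :: 'k hh set) \<subseteq> {z \<in> carrier (HH 2 1). HH_poly z = \<zero>\<^bsub>veronese\<^esub>}"
    unfolding HH_nil_def
  proof (rule HH.genideal_minimal[OF id], rule subsetI)
    fix z assume z: "z \<in> ?S"
    then have zc: "z \<in> carrier (HH 2 1)" using S by (rule subsetD[rotated])
    obtain k :: nat where "z [^]\<^bsub>HH 2 1\<^esub> k = \<zero>\<^bsub>HH 2 1\<^esub>" using z by (elim CollectE conjE exE)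
    then have "HH_poly z ^ k = 0" using pow[OF zc, of k] zero by simp
    then have "HH_poly z = 0" by simp
    then show "z \<in> {z \<in> carrier (HH 2 1). HH_poly z = \<zero>\<^bsub>veronese\<^esub>}" using zc by simp
  qed
  have I: "ideal (HH_nil 2 1) (HH 2 1 :: ('k, 'k hh) module)" unfolding HH_nil_def by (rule HH.genideal_ideal[OF S])
  show "{z \<in> carrier (HH 2 1). HH_poly z = \<zero>\<^bsub>veronese\<^esub>} \<subseteq> (HH_nil 2 1 :: 'k hh set)"
  proof
    fix z :: "'k hh" assume a: "z \<in> {z \<in> carrier (HH 2 1). HH_poly z = \<zero>\<^bsub>veronese\<^esub>}"
    then have z: "z \<in> carrier (HH 2 1)" and z0: "HH_poly z = 0" by simp_all
    have zn: "z n \<in> carrier (Coh n)" for n using z unfolding HH_simps by (rule E.H.sum_carrierD)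
    have single: "E.H.single n (z n) \<in> HH_nil 2 1" for n
    proof -
      have "cls_poly n (z n) = 0" using coeff_HH_poly[OF z, of n] z0 by simp
      note cube = single_cube[OF zn this]
      have "E.H.single n (z n) \<in> HH_homogeneous 2 1 n"
        unfolding HH_homogeneous_def HH_simps using E.H.single_closed[OF zn] by (simp add: E.H.single_def)
      then have "E.H.single n (z n) \<in> ?S" using cube by (intro CollectI conjI exI)
      then show ?thesis using HH.genideal_self[OF S] unfolding HH_nil_def by (rule subsetD[rotated])
    qed
    \<comment> \<open>Truncations of z, to add its homogeneous components one at a time; beyond the
      support they equal z.\<close>
    let ?t = "\<lambda>N k. if k < N then z k else \<zero>\<^bsub>Coh k\<^esub>"
    have trunc: "?t N \<in> HH_nil 2 1" for N
    proof (induction N)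
      case 0
      have "?t 0 = \<zero>\<^bsub>HH 2 1\<^esub>" unfolding HH_simps by simp
      then show ?case using additive_subgroup.zero_closed[OF ideal.axioms(1)[OF I]] by (simp only:)
    next
      case (Suc N)
      have "?t (Suc N) = ?t N \<oplus>\<^bsub>HH 2 1\<^esub> E.H.single N (z N)"
        unfolding HH_simps using zn by (auto simp: fun_eq_iff E.H.single_def less_Suc_eq)
      then show ?case using additive_subgroup.a_closed[OF ideal.axioms(1)[OF I] Suc single[of N]] by (simp only:)
    qed
    have "finite {n. z n \<noteq> \<zero>\<^bsub>Coh n\<^esub>}" using z unfolding HH_simps E.H.sum_carrier_def by (elim CollectE conjE)
    from iffD1[OF finite_nat_set_iff_bounded this] obtain N where N: "\<forall>n\<in>{n. z n \<noteq> \<zero>\<^bsub>Coh n\<^esub>}. n < N" by (rule exE)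
    have e: "?t N = z" using N by (auto simp: fun_eq_iff)
    show "z \<in> HH_nil 2 1" using trunc[of N] unfolding e .
  qed
qed

lemma HH_iso:
  "ring (HH_red 2 1 :: ('k::field, 'k hh set) module)"
  "\<exists>\<Phi>\<in>algebra_iso (HH_red 2 1 :: ('k, 'k hh set) module) veronese.
     \<forall>z\<in>carrier (HH 2 1). \<Phi> (HH_nil 2 1 +>\<^bsub>HH 2 1\<^esub> z) = HH_poly z"
  "\<And>c Y. Y \<in> carrier (HH_red 2 1) \<Longrightarrow> c \<odot>\<^bsub>HH_red 2 1\<^esub> Y \<in> carrier (HH_red 2 1 :: ('k, 'k hh set) module)"
  "carrier (HH_red 2 1 :: ('k, 'k hh set) module) = (\<lambda>z. HH_nil 2 1 +>\<^bsub>HH 2 1\<^esub> z) ` carrier (HH 2 1)"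
proof -
  have s2: "c \<odot>\<^bsub>HH 2 1\<^esub> (z \<oplus>\<^bsub>HH 2 1\<^esub> w) = c \<odot>\<^bsub>HH 2 1\<^esub> z \<oplus>\<^bsub>HH 2 1\<^esub> c \<odot>\<^bsub>HH 2 1\<^esub> w"
    if "z \<in> carrier (HH 2 1)" "w \<in> carrier (HH 2 1)" for c :: 'k and z w :: "'k hh"
  proof -
    have "z n \<in> carrier (Coh n)" "w n \<in> carrier (Coh n)" for n
      using that unfolding HH_simps by (simp_all add: E.H.sum_carrierD)
    then show ?thesis unfolding HH_simps by (intro ext Coh_smult_add)
  qed
  have s4: "c \<odot>\<^bsub>veronese\<^esub> \<zero>\<^bsub>veronese\<^esub> = \<zero>\<^bsub>veronese\<^esub>" for c :: 'k by simp
  note q = quotient_iso[OF HH_ring cring.axioms(1)[OF veronese_cring] HH_poly_hom HH_poly_surj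
      HH_smult_closed s2 HH_poly_smult s4 HH_nil_kernel, folded HH_red_def]
  show "ring (HH_red 2 1 :: ('k, 'k hh set) module)" by (rule q(1))
  show "\<exists>\<Phi>\<in>algebra_iso (HH_red 2 1 :: ('k, 'k hh set) module) veronese.
     \<forall>z\<in>carrier (HH 2 1). \<Phi> (HH_nil 2 1 +>\<^bsub>HH 2 1\<^esub> z) = HH_poly z" by (rule q(2))
  show "c \<odot>\<^bsub>HH_red 2 1\<^esub> Y \<in> carrier (HH_red 2 1)" if "Y \<in> carrier (HH_red 2 1)" for c :: 'k and Y
    by (rule q(3)) (assumption | rule that)+
  show "carrier (HH_red 2 1 :: ('k, 'k hh set) module) = (\<lambda>z. HH_nil 2 1 +>\<^bsub>HH 2 1\<^esub> z) ` carrier (HH 2 1)" by (rule q(4))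
qed

text \<open>Resolves the definite description in \<open>HH_red_class\<close>: the cochain is the one
  from \<open>cocycle_exists\<close> supported on the generators with index r. The required sign
  (-1)^r at vertex 1 explains why chi_0, with r = 1, alternates while chi_1 and chi_m1, with r = 0
  and r = 2, are constant.\<close>

lemma HH_red_class_poly:
  fixes c :: "int \<Rightarrow> 'k::field"
  assumes r: "r \<le> 2" and k: "k = 2 - 2 * int r" and c: "\<And>i. c (vert i) = (if i then (-1) ^ r else 1)"
  shows "\<exists>z\<in>carrier (HH 2 1). HH_red_class 2 1 2 k c = HH_nil 2 1 +>\<^bsub>HH 2 1\<^esub> z \<and> HH_poly z = monom (monom 1 r) 2"
proof -
  have "even (2::nat)" by simp
  from cocycle_exists[OF this, of "\<lambda>s. of_bool (s = r)"] obtain f :: "'k res \<Rightarrow> 'k lam" where f1: "f \<in> E.Z 2"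
    and f2: "\<forall>i. \<forall>s\<le>2. f (gen 2 i s) = ((if i then (-1) ^ s else 1) * of_bool (s = r)) \<odot>\<^bsub>LA\<^esub> eL (vert i)"
    by (rule bexE)
  note f = f1 f2[rule_format]
  have val: "(if int 2 - 2 * int s = k then c (vert i) \<odot>\<^bsub>LA\<^esub> eL (vert i) else \<zero>\<^bsub>LA\<^esub>)
    = ((if i then (-1) ^ s else 1) * of_bool (s = r)) \<odot>\<^bsub>LA\<^esub> eL (vert i)" for i s
  proof -
    have "(0 :: 'k) \<odot>\<^bsub>LA\<^esub> eL (vert i) = \<zero>\<^bsub>LA\<^esub>"
      by (rule lam_coord_inj) (simp_all add: lam_gens_closed lam_coord_smult lam_coord_zero)
    then show ?thesis by (cases "s = r") (simp_all add: k c)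
  qed
  have "(THE f. f \<in> carrier (cochains LA (Res 2 1) 2) \<and> (\<forall>i\<in>{0..<2}. \<forall>s\<le>2. f (res_gen 2 1 2 i (int s)) =
     (if int 2 - 2 * int s = k then c i \<odot>\<^bsub>LA\<^esub> eL i else \<zero>\<^bsub>LA\<^esub>))) = f"
  proof (rule the_equality)
    show "f \<in> carrier (cochains LA (Res 2 1) 2) \<and> (\<forall>i\<in>{0..<2}. \<forall>s\<le>2. f (res_gen 2 1 2 i (int s)) =
     (if int 2 - 2 * int s = k then c i \<odot>\<^bsub>LA\<^esub> eL i else \<zero>\<^bsub>LA\<^esub>))"
      unfolding Res_gens_iff val using E.Z_hom[OF f(1)] by (simp add: res_gen_vert f(2))
  next
    fix g assume g: "g \<in> carrier (cochains LA (Res 2 1) 2) \<and> (\<forall>i\<in>{0..<2}. \<forall>s\<le>2. g (res_gen 2 1 2 i (int s)) =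
     (if int 2 - 2 * int s = k then c i \<odot>\<^bsub>LA\<^esub> eL i else \<zero>\<^bsub>LA\<^esub>))"
    show "g = f"
    proof (rule Res_hom_ext[OF _ E.Z_hom[OF f(1)] LA.regular_bimodule])
      show "g \<in> E.HomA 2" using conjunct1[OF g] by simp
      fix s assume "s \<in> Res_index 2"
      then obtain i t where s: "s = (vert i, int t)" "t \<le> 2" by (rule Res_indexE)
      have "g (res_gen 2 1 2 (vert i) (int t)) = ((if i then (-1) ^ t else 1) * of_bool (t = r)) \<odot>\<^bsub>LA\<^esub> eL (vert i)"
        using conjunct2[OF g] s(2) unfolding Res_gens_iff val by (elim allE impE)
      then show "g (single_gen 2 s) = f (single_gen 2 s)" by (simp only: s(1) res_gen_vert[OF s(2)] f(2)[OF s(2)])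
    qed
  qed
  then have e: "HH_red_class 2 1 2 k c = HH_nil 2 1 +>\<^bsub>HH 2 1\<^esub> E.H.single 2 (E.cls 2 f)"
    unfolding HH_red_class_def Let_def HH_simps E.H.single_def by (simp only:)
  have z: "E.H.single 2 (E.cls 2 f) \<in> carrier (HH 2 1)" unfolding HH_simps by (rule E.H.single_closed[OF Coh_clsI[OF f(1)]])
  have v: "val_poly 2 f = monom 1 r"
  proof (rule poly_eqI)
    fix s show "coeff (val_poly 2 f) s = coeff (monom 1 r) s"
      using r by (auto simp: coeff_val_poly gen_val_def f(2) lam_coord_smult lam_gens_closed lam_coord_gens coeff_monom)
  qed
  have "HH_poly (E.H.single 2 (E.cls 2 f)) = monom (monom 1 r) 2"
  proof (rule poly_eqI)
    fix n
    show "coeff (HH_poly (E.H.single 2 (E.cls 2 f))) n = coeff (monom (monom 1 r) 2) n"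
      unfolding coeff_HH_poly[OF z] using cls_poly[OF f(1)] v by (simp add: E.H.single_def coeff_monom G.\<phi>_zero)
  qed
  then show ?thesis by (intro bexI[OF _ z] conjI e)
qed

lemma algebra_iso_inv:
  fixes A :: "('k::field, 'a) module" and B :: "('k, 'b) module"
  assumes h: "h \<in> algebra_iso A B" and A: "ring A"
    and smult: "\<And>c x. x \<in> carrier A \<Longrightarrow> c \<odot>\<^bsub>A\<^esub> x \<in> carrier A"
  shows "inv_into (carrier A) h \<in> algebra_iso B A"
    and "x \<in> carrier A \<Longrightarrow> inv_into (carrier A) h (h x) = x"
proof -
  have iso: "h \<in> ring_iso A B" and hs: "\<And>c x. x \<in> carrier A \<Longrightarrow> h (c \<odot>\<^bsub>A\<^esub> x) = c \<odot>\<^bsub>B\<^esub> h x"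
    using h by (auto simp: algebra_iso_def)
  have inj: "inj_on h (carrier A)" and surj: "h ` carrier A = carrier B"
    using iso by (auto simp: ring_iso_def bij_betw_def)
  show inv: "inv_into (carrier A) h (h x) = x" if "x \<in> carrier A" for x by (rule inv_into_f_f[OF inj that])
  have "inv_into (carrier A) h (c \<odot>\<^bsub>B\<^esub> y) = c \<odot>\<^bsub>A\<^esub> inv_into (carrier A) h y" if y: "y \<in> carrier B" for c y
  proof -
    obtain x where x: "x \<in> carrier A" "y = h x" using y surj by blast
    show ?thesis unfolding x(2) hs[OF x(1), symmetric] inv[OF smult[OF x(1)]] inv[OF x(1)] by (rule refl)
  qed
  then show "inv_into (carrier A) h \<in> algebra_iso B A"
    using ring_iso_set_sym[OF A iso] by (simp add: algebra_iso_def)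
qed

lemma algebra_iso_comp:
  assumes "f \<in> algebra_iso A B" "g \<in> algebra_iso B D"
  shows "g \<circ> f \<in> algebra_iso A D"
proof -
  have f: "f \<in> ring_iso A B" and g: "g \<in> ring_iso B D" using assms by (auto simp: algebra_iso_def)
  have "f x \<in> carrier B" if "x \<in> carrier A" for x
    using f that ring_hom_closed unfolding ring_iso_def by fast
  then show ?thesis using assms ring_iso_set_trans[OF f g] by (simp add: algebra_iso_def)
qed

theorem corollary6p4:
  shows "(\<exists>\<phi> \<in> algebra_iso (chi_algebra :: ('k::field, 'k chi_poly set) module)
                            (HH_red 2 1 :: ('k, 'k hh set) module).
            \<phi> (chi_var_class X0) = chi_0 \<and>
            \<phi> (chi_var_class X1) = chi_1 \<and>
            \<phi> (chi_var_class Xm1) = chi_m1 \<and>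
            (\<forall>n. \<phi> ` chi_degree n = HH_red_degree 2 1 n)) \<and>
         algebra (ring_of_type_algebra :: 'k ring) (HH_red 2 1 :: ('k, 'k hh set) module) \<and>
         finitely_generated_algebra (HH_red 2 1 :: ('k, 'k hh set) module) \<and>
         krull_dim (HH_red 2 1 :: ('k, 'k hh set) module) = 2"
proof -
  let ?R = "HH_red 2 1 :: ('k, 'k hh set) module" and ?V = "veronese :: ('k, 'k poly poly) module"
  let ?cls = "\<lambda>z. HH_nil 2 1 +>\<^bsub>HH 2 1\<^esub> z :: 'k hh set" and ?P = "\<lambda>p. chi_ideal +>\<^bsub>poly_algebra\<^esub> p :: 'k chi_poly set"
  from HH_iso(2) obtain \<Psi> where \<Psi>: "\<Psi> \<in> algebra_iso ?R ?V" and \<Psi>z: "\<forall>z\<in>carrier (HH 2 1). \<Psi> (?cls z) = HH_poly z"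
    by (rule bexE)
  from chi_iso(2) obtain \<Phi> where \<Phi>: "\<Phi> \<in> algebra_iso (chi_algebra :: ('k, 'k chi_poly set) module) ?V"
    and \<Phi>p: "\<forall>p. \<Phi> (?P p) = to_veronese p" by (rule bexE)
  define \<iota> where "\<iota> = inv_into (carrier ?R) \<Psi>"
  have \<iota>: "\<iota> \<in> algebra_iso ?V ?R" unfolding \<iota>_def by (rule algebra_iso_inv(1)[OF \<Psi> HH_iso(1,3)])
  have clsc: "?cls z \<in> carrier ?R" if "z \<in> carrier (HH 2 1)" for z unfolding HH_iso(4) using that by (rule imageI)
  have \<iota>z: "\<iota> (HH_poly z) = ?cls z" if z: "z \<in> carrier (HH 2 1)" for z
    unfolding \<iota>_def bspec[OF \<Psi>z z, symmetric] by (rule algebra_iso_inv(2)[OF \<Psi> HH_iso(1,3) clsc[OF z]])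
  have hom: "\<iota> \<in> ring_hom ?V ?R" and surj: "\<iota> ` carrier ?V = carrier ?R"
    and smult: "\<And>c x. x \<in> carrier ?V \<Longrightarrow> \<iota> (c \<odot>\<^bsub>?V\<^esub> x) = c \<odot>\<^bsub>?R\<^esub> \<iota> x"
    using \<iota> by (auto simp: algebra_iso_def ring_iso_def bij_betw_def simp del: veronese_simps)
  have \<phi>: "\<iota> \<circ> \<Phi> \<in> algebra_iso chi_algebra ?R" by (rule algebra_iso_comp[OF \<Phi> \<iota>])
  have \<phi>p: "(\<iota> \<circ> \<Phi>) (?P p) = \<iota> (to_veronese p)" for p using \<Phi>p by simp
  \<comment> \<open>The variable and the class are both sent to S^2 U^r. The index r is (2 - k)/2,
    hence 1, 0 and 2 for chi_0, chi_1 and chi_m1.\<close>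
  have chi: "(\<iota> \<circ> \<Phi>) (chi_var_class x) = HH_red_class 2 1 2 k c"
    if r: "r \<le> 2" and k: "k = 2 - 2 * int r" and c: "\<And>i. c (vert i) = (if i then (-1) ^ r else 1)"
      and x: "to_veronese (Var x) = (monom (monom 1 r) 2 :: 'k poly poly)" for x k r and c :: "int \<Rightarrow> 'k"
  proof -
    from HH_red_class_poly[OF r k c] obtain z where z: "z \<in> carrier (HH 2 1)"
      and e: "HH_red_class 2 1 2 k c = ?cls z \<and> HH_poly z = monom (monom 1 r) 2" by (rule bexE)
    have "(\<iota> \<circ> \<Phi>) (chi_var_class x) = \<iota> (HH_poly z)"
      unfolding chi_var_class_def \<phi>p conjunct2[OF e] x by (rule refl)
    then show ?thesis unfolding \<iota>z[OF z] conjunct1[OF e] .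
  qed
  have vert: "vert i = (if i then 1 else 0)" for i by (simp add: vert_def)
  have var: "to_veronese (Var x :: 'k chi_poly) = monom (monom 1 (mon_r (Poly_Mapping.single x 1))) (2 * mon_deg (Poly_Mapping.single x 1))" for x
    by (simp add: Var_def to_veronese_single bimonom_def smult_monom)
  have "(\<iota> \<circ> \<Phi>) (chi_var_class X0) = chi_0"
    unfolding chi_0_def by (rule chi[of 1]) (simp_all add: vert var mon_r_def mon_deg_def lookup_single)
  moreover have "(\<iota> \<circ> \<Phi>) (chi_var_class X1) = chi_1"
    unfolding chi_1_def by (rule chi[of 0]) (simp_all add: vert var mon_r_def mon_deg_def lookup_single)
  moreover have "(\<iota> \<circ> \<Phi>) (chi_var_class Xm1) = chi_m1"
    unfolding chi_m1_def by (rule chi[of 2]) (simp_all add: vert var mon_r_def mon_deg_def lookup_single numeral_2_eq_2)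
  \<comment> \<open>A coset does not show the degree of its representatives, so both inclusions
    choose homogeneous ones: \<open>HH_poly_preimage\<close> gives a class that is zero wherever the
    polynomial is, and \<open>veronese_preimage\<close> a polynomial all of whose monomials have the
    right degree.\<close>
  moreover have "(\<iota> \<circ> \<Phi>) ` chi_degree n = HH_red_degree 2 1 n" for n
  proof (intro equalityI subsetI)
    fix w assume "w \<in> (\<iota> \<circ> \<Phi>) ` chi_degree n"
    then obtain p :: "'k chi_poly" where w: "w = (\<iota> \<circ> \<Phi>) (?P p)" and p: "\<forall>t\<in>Poly_Mapping.keys p. 2 * mon_deg t = n"
      unfolding chi_degree_def mon_deg_eq by (elim imageE CollectE) simp
    have "coeff (to_veronese p) k = 0" if k: "k \<noteq> n" for k
      unfolding to_veronese_def coeff_sum by (rule sum.neutral) (use p k in \<open>auto simp: bimonom_def coeff_monom\<close>)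
    moreover from HH_poly_preimage[OF to_veronese_closed[of p]] obtain z where z: "z \<in> carrier (HH 2 1)"
      and e: "HH_poly z = to_veronese p \<and> (\<forall>n. coeff (to_veronese p) n = 0 \<longrightarrow> z n = \<zero>\<^bsub>Coh n\<^esub>)" by (rule bexE)
    ultimately have hz: "z \<in> HH_homogeneous 2 1 n"
      unfolding HH_homogeneous_def HH_simps(4) by (intro CollectI conjI allI impI z) (elim conjE, simp)
    have hw: "w = ?cls z" unfolding w \<phi>p conjunct1[OF e, symmetric] by (rule \<iota>z[OF z])
    show "w \<in> HH_red_degree 2 1 n" unfolding HH_red_degree_def hw by (rule imageI[OF hz])
  next
    fix w :: "'k hh set" assume "w \<in> HH_red_degree 2 1 n"
    then obtain z :: "'k hh" where w: "w = ?cls z" and z: "z \<in> HH_homogeneous 2 1 n"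
      unfolding HH_red_degree_def by (elim imageE)
    have zc: "z \<in> carrier (HH 2 1)" and z0: "\<And>k. k \<noteq> n \<Longrightarrow> z k = \<zero>\<^bsub>Coh k\<^esub>"
      using z unfolding HH_homogeneous_def HH_simps(4) by simp_all
    have c0: "coeff (HH_poly z) k = 0" if k: "k \<noteq> n" for k
      unfolding coeff_HH_poly[OF zc] z0[OF k] by (rule G.\<phi>_zero)
    from veronese_preimage[OF ring_hom_closed[OF HH_poly_hom zc] c0] obtain p
      where p: "to_veronese p = HH_poly z \<and> (\<forall>t\<in>Poly_Mapping.keys p. 2 * mon_deg t = n)" by (rule exE)
    have hp: "?P p \<in> chi_degree n" unfolding chi_degree_def mon_deg_eq by (intro imageI CollectI conjunct2[OF p])
    have hw: "w = (\<iota> \<circ> \<Phi>) (?P p)" unfolding \<phi>p conjunct1[OF p] \<iota>z[OF zc] by (rule w)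
    show "w \<in> (\<iota> \<circ> \<Phi>) ` chi_degree n" unfolding hw by (rule imageI[OF hp])
  qed
  ultimately have iso: "\<exists>\<phi> \<in> algebra_iso (chi_algebra :: ('k, 'k chi_poly set) module) ?R.
            \<phi> (chi_var_class X0) = chi_0 \<and> \<phi> (chi_var_class X1) = chi_1 \<and> \<phi> (chi_var_class Xm1) = chi_m1 \<and>
            (\<forall>n. \<phi> ` chi_degree n = HH_red_degree 2 1 n)"
    by (intro bexI[OF _ \<phi>] conjI allI)
  have alg: "algebra (ring_of_type_algebra :: 'k ring) ?R"
    by (rule algebra_iso_transport[OF \<Psi> HH_iso(1) refl HH_iso(3) veronese_algebra])
  have "finitely_generated_algebra ?R"
    unfolding finitely_generated_algebra_def
  proof (intro exI conjI allI impI)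
    let ?S = "(\<lambda>x. \<iota> (to_veronese (Var x))) ` UNIV"
    have "(UNIV :: chi_var set) = {X0, X1, Xm1}" by (auto intro: chi_var.exhaust)
    then have "finite (UNIV :: chi_var set)" by (metis finite.emptyI finite.insertI)
    then show "finite ?S" by (rule finite_imageI)
    show "?S \<subseteq> carrier ?R" by (intro image_subsetI ring_hom_closed[OF hom] to_veronese_closed)
    fix W assume W: "is_subalgebra ?R W \<and> ?S \<subseteq> W"
    have "\<iota> (to_veronese p) \<in> W" for p
    proof -
      have "p \<in> {p. \<iota> (to_veronese p) \<in> W}"
      proof (rule poly_generated)
        have "to_veronese 1 = (1 :: 'k poly poly)" using ring_hom_one[OF to_veronese_hom] by simp
        then show "1 \<in> {p. \<iota> (to_veronese p) \<in> W}"
          using ring_hom_one[OF hom] W by (simp add: is_subalgebra_def)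
      next
        fix p q :: "'k chi_poly" assume "p \<in> {p. \<iota> (to_veronese p) \<in> W}" "q \<in> {p. \<iota> (to_veronese p) \<in> W}"
        then show "p + q \<in> {p. \<iota> (to_veronese p) \<in> W}" "p * q \<in> {p. \<iota> (to_veronese p) \<in> W}"
          using W ring_hom_add[OF hom to_veronese_closed[of p] to_veronese_closed[of q]]
            ring_hom_mult[OF hom to_veronese_closed[of p] to_veronese_closed[of q]]
          by (simp_all add: is_subalgebra_def to_veronese_add to_veronese_mult)
      next
        fix c :: 'k and p :: "'k chi_poly" assume "p \<in> {p. \<iota> (to_veronese p) \<in> W}"
        then show "Poly_Mapping.single 0 c * p \<in> {p. \<iota> (to_veronese p) \<in> W}"
          using W smult[OF to_veronese_closed[of p], of c] by (simp add: is_subalgebra_def to_veronese_smult)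
      next
        show "Var x \<in> {p. \<iota> (to_veronese p) \<in> W}" for x using W by blast
      qed
      then show ?thesis by simp
    qed
    then have "carrier ?R \<subseteq> W" unfolding surj[symmetric] to_veronese_surj[symmetric] by blast
    then show "W = carrier ?R" using W unfolding is_subalgebra_def by blast
  qed
  moreover have "krull_dim ?R = 2"
  proof -
    have R: "cring ?R" using alg by (rule algebra.axioms(2))
    have "\<Psi> \<in> ring_hom ?R ?V" "\<Psi> ` carrier ?R = carrier ?V"
      using \<Psi> by (auto simp: algebra_iso_def ring_iso_def bij_betw_def simp del: veronese_simps)
    then have "krull_dim ?V \<le> krull_dim ?R" by (rule krull_dim_surj[OF _ R veronese_cring])
    moreover have "krull_dim ?R \<le> krull_dim ?V" by (rule krull_dim_surj[OF hom veronese_cring R surj])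
    ultimately show ?thesis unfolding krull_dim_veronese by (rule antisym[rotated])
  qed
  ultimately show ?thesis using iso alg by (intro conjI)
qed

end
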